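(* Let $I$, its boundary condition, $V$ and $\Xi$ be as in the context (Cases 1, 2-D, 2-R, 3-D, 3-R, 3-M), and let $\hat{\mathcal E}(f,g)=\mathcal E(f,g)+\xi(fg)$ be the random form on $D(\mathcal E)$ defined there. Almost surely, there exists a unique self-adjoint operator $\hat H$ with dense domain $D(\hat H)\subset L^2(I)$ such that (1) $D(\hat H)\subset D(\mathcal E)$; (2) for every $f,g\in D(\hat H)$, one has $\langle f,\hat Hg\rangle=\hat{\mathcal E}(f,g)$; and (3) $\hat H$ has compact resolvent.
   Context: **Domain and boundary conditions.** One of: Case 1: $I=\mathbb R$. Case 2: $I=(0,\infty)$ with $f(0)=0$ (Case 2-D) or $f'(0)+\alpha f(0)=0$ (Case 2-R). Case 3: $I=(0,b)$, $b>0$, with $f(0)=f(b)=0$ (Case 3-D), or $f'(0)+\alpha f(0)=-f'(b)+\beta f(b)=0$ (Case 3-R), or $f'(0)+\alpha f(0)=f(b)=0$ (Case 3-M). Here $\alpha,\beta\in\mathbb R$ are fixed. **Potential.** $V:I\to\mathbb R$ is nonnegative and locally integrable on the closure of $I$; if $I$ is unbounded, $\liminf V(x)/\log|x|=\infty$ as $x\to\pm\infty$ in $I$. **Deterministic form.** $L^2=L^2(I)$ (real-valued functions) with inner product $\langle f,g\rangle=\int_I fg$. $\mathrm H^1_V$ is the set of functions $f$ locally absolutely continuous on the closure of $I$ with $\|f\|_2,\|f'\|_2,\|V^{1/2}f\|_2<\infty$, with norm $\|f\|_*^2=\|f'\|_2^2+\|V^{1/2}f\|_2^2+\|f\|_2^2$.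 The form domain $D(\mathcal E)$ is $\mathrm H^1_V$ in Cases 1, 2-R, 3-R; $\{f\in \mathrm H^1_V:f(0)=0\}$ in Case 2-D; $\{f\in \mathrm H^1_V:f(0)=f(b)=0\}$ in Case 3-D; $\{f\in \mathrm H^1_V:f(b)=0\}$ in Case 3-M. The form is $\mathcal E(f,g)=\tfrac12\langle f',g'\rangle+\langle fg,V\rangle+\mathrm{bdry}$, with $\mathrm{bdry}=0$ in Cases 1, 2-D, 3-D, $\mathrm{bdry}=-\tfrac\alpha2f(0)g(0)$ in Cases 2-R and 3-M, and $\mathrm{bdry}=-\tfrac\alpha2f(0)g(0)-\tfrac\beta2f(b)g(b)$ in Case 3-R. **Noise.** $\Xi:\mathbb R\to\mathbb R$ is a centered Gaussian process such that almost surely $\Xi(0)=0$ and $\Xi$ has continuous sample paths, and $\Xi$ has stationary increments (the joint law of any finite family of increments $\Xi(y_i)-\Xi(x_i)$ is invariant under a common shift of all the $x_i,y_i$). Let $\mathrm C_0^\infty$ be the set of functions that are smooth and compactly supported on the closure of $I$. For $f\in\mathrm C_0^\infty$, $\xi(f):=-\langle f',\Xi\rangle$ in Cases 1 and 2, and $\xi(f):=f(b)\Xi(b)-\langle f',\Xi\rangle$ in Case 3. Almost surely, the quadratic form $f\mapsto\xi(f^2)$ on $\mathrm C_0^\infty$ satisfies $|\xi(f^2)|\le c\|f\|_*^2$ for some finite random $c$ and so extends uniquely to a $\|\cdot\|_*$-continuous quadratic form on $\mathrm H^1_V$; $\xi(fg):=\frac14\big(\xi((f+g)^2)-\xi((f-g)^2)\big)$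 for $f,g\in\mathrm H^1_V$.
   Formalization: Condition (2) is required for every f in D(E) and g in D(Ĥ), not only for f, g in D(Ĥ): as printed, uniqueness fails (e.g. Ξ=0, V=0, Case 3-R with α=β=0: the Dirichlet and Neumann Laplacians both satisfy (1)–(3)). *)

theory Defs
  imports "HOL-Probability.Probability"
begin

section \<open>The real Hilbert space of square-integrable functions\<close>

definition square_integrable :: "(real \<Rightarrow> real) \<Rightarrow> bool" where
  "square_integrable f \<longleftrightarrow>
     f \<in> borel_measurable lebesgue \<and> integrable lebesgue (\<lambda>x. (f x)\<^sup>2)"

lemma square_integrable_mult:
  assumes "square_integrable f" "square_integrable g"
  shows "integrable lebesgue (\<lambda>x. f x * g x)"
proof (rule Bochner_Integration.integrable_bound)
  show "integrable lebesgue (\<lambda>x. (f x)\<^sup>2 + (g x)\<^sup>2)"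
    using assms by (simp add: square_integrable_def)
  show "(\<lambda>x. f x * g x) \<in> borel_measurable lebesgue"
    using assms by (auto simp: square_integrable_def intro: borel_measurable_times)
  have "\<bar>f x * g x\<bar> \<le> (f x)\<^sup>2 + (g x)\<^sup>2" for x
  proof -
    have "2 * \<bar>f x\<bar> * \<bar>g x\<bar> \<le> (f x)\<^sup>2 + (g x)\<^sup>2"
      using sum_squares_bound[of "\<bar>f x\<bar>" "\<bar>g x\<bar>"] by simp
    moreover have "0 \<le> \<bar>f x\<bar> * \<bar>g x\<bar>" by simp
    ultimately show ?thesis unfolding abs_mult mult.assoc by linarith
  qed
  then show "AE x in lebesgue. norm (f x * g x) \<le> norm ((f x)\<^sup>2 + (g x)\<^sup>2)" by simp
qed

lemma square_integrable_add:
  assumes "square_integrable f" "square_integrable g"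
  shows "square_integrable (\<lambda>x. f x + g x)"
proof -
  have "integrable lebesgue (\<lambda>x. (f x)\<^sup>2 + (g x)\<^sup>2 + 2 * (f x * g x))"
    using assms square_integrable_mult[OF assms] by (simp add: square_integrable_def)
  then show ?thesis
    using assms
    by (auto simp: square_integrable_def power2_sum mult.assoc intro: borel_measurable_add)
qed

lemma square_integrable_scale:
  "square_integrable f \<Longrightarrow> square_integrable (\<lambda>x. c * f x)"
  by (auto simp: square_integrable_def power_mult_distrib
      intro: borel_measurable_times borel_measurable_const)

lemma square_integrable_0: "square_integrable (\<lambda>x. 0)"
  by (simp add: square_integrable_def)

quotient_type L2 = "real \<Rightarrow> real" / partial:
  "\<lambda>f g. square_integrable f \<and> square_integrable g \<and> (AE x in lebesgue. f x = g x)"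
proof (rule part_equivpI)
  show "\<exists>f. square_integrable f \<and> square_integrable f \<and> (AE x in lebesgue. f x = f x)"
    using square_integrable_0 by auto
  show "symp (\<lambda>f g. square_integrable f \<and> square_integrable g \<and> (AE x in lebesgue. f x = g x))"
    by (auto simp: symp_def eq_commute)
  show "transp (\<lambda>f g. square_integrable f \<and> square_integrable g \<and> (AE x in lebesgue. f x = g x))"
    by (auto simp: transp_def elim: AE_mp)
qed

instantiation L2 :: real_vector
begin

lift_definition zero_L2 :: L2 is "\<lambda>x. 0" by (simp add: square_integrable_0)

lift_definition plus_L2 :: "L2 \<Rightarrow> L2 \<Rightarrow> L2" is "\<lambda>f g x. f x + g x"
  by (auto intro: square_integrable_add elim!: AE_mp)

lift_definition scaleR_L2 :: "real \<Rightarrow> L2 \<Rightarrow> L2" is "\<lambda>c f x. c * f x"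
  by (auto intro: square_integrable_scale elim!: AE_mp)

definition uminus_L2 :: "L2 \<Rightarrow> L2" where "uminus_L2 u = (-1) *\<^sub>R u"

definition minus_L2 :: "L2 \<Rightarrow> L2 \<Rightarrow> L2" where "minus_L2 u v = u + (-1) *\<^sub>R v"

instance
proof
  fix a b c :: L2 and r s :: real
  show "a + b + c = a + (b + c)"
    by transfer (simp add: square_integrable_add add.assoc)
  show "a + b = b + a"
    by transfer (simp add: square_integrable_add add.commute)
  show "0 + a = a" by transfer simp
  show "- a + a = 0"
    unfolding uminus_L2_def
    by transfer (simp add: square_integrable_0 square_integrable_add
      square_integrable_scale[of _ "-1", simplified])
  show "a - b = a + - b" by (simp add: uminus_L2_def minus_L2_def)
  show "r *\<^sub>R (a + b) = r *\<^sub>R a + r *\<^sub>R b"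
    by transfer (simp add: square_integrable_add square_integrable_scale distrib_left)
  show "(r + s) *\<^sub>R a = r *\<^sub>R a + s *\<^sub>R a"
    by transfer (simp add: square_integrable_add square_integrable_scale distrib_right)
  show "r *\<^sub>R s *\<^sub>R a = (r * s) *\<^sub>R a"
    by transfer (simp add: square_integrable_scale mult.assoc)
  show "1 *\<^sub>R a = a" by transfer simp
qed

end

instantiation L2 :: real_inner
begin

lift_definition inner_L2 :: "L2 \<Rightarrow> L2 \<Rightarrow> real" is
  "\<lambda>f g. integral\<^sup>L lebesgue (\<lambda>x. f x * g x)"
  by (rule integral_cong_AE) (auto simp: square_integrable_def elim!: AE_mp)

definition norm_L2 :: "L2 \<Rightarrow> real" where "norm_L2 u = sqrt (inner u u)"
definition sgn_L2 :: "L2 \<Rightarrow> L2" where "sgn_L2 u = inverse (norm u) *\<^sub>R u"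
definition dist_L2 :: "L2 \<Rightarrow> L2 \<Rightarrow> real" where "dist_L2 u v = norm (u - v)"
definition uniformity_L2 :: "(L2 \<times> L2) filter" where
  "uniformity_L2 = (INF e\<in>{0<..}. principal {(u, v). dist u v < e})"
definition open_L2 :: "L2 set \<Rightarrow> bool" where
  "open_L2 U \<longleftrightarrow> (\<forall>u\<in>U. \<forall>\<^sub>F (u', v) in uniformity. u' = u \<longrightarrow> v \<in> U)"

instance
proof
  fix a b c :: L2 and r :: real and U :: "L2 set"
  show "dist a b = norm (a - b)" by (rule dist_L2_def)
  show "sgn a = a /\<^sub>R norm a" by (rule sgn_L2_def)
  show "uniformity = (INF e\<in>{0<..}. principal {(x::L2, y). dist x y < e})"
    by (rule uniformity_L2_def)
  show "open U = (\<forall>x\<in>U. \<forall>\<^sub>F (x', y) in uniformity. x' = x \<longrightarrow> y \<in> U)"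
    by (rule open_L2_def)
  show "norm a = sqrt (inner a a)" by (rule norm_L2_def)
  show "inner a b = inner b a" by transfer (simp add: mult.commute)
  show "inner (a + b) c = inner a c + inner b c"
    by transfer (simp add: distrib_right square_integrable_mult)
  show "inner (r *\<^sub>R a) b = r * inner a b"
    by transfer (simp add: mult.assoc)
  show "0 \<le> inner a a" by transfer simp
  show "(inner a a = 0) = (a = 0)"
    by transfer (auto simp: square_integrable_0 integral_nonneg_eq_0_iff_AE
        square_integrable_def power2_eq_square)
qed

end

definition L2_function :: "real set \<Rightarrow> (real \<Rightarrow> real) \<Rightarrow> bool" where
  "L2_function I f \<longleftrightarrow>
     set_borel_measurable lebesgue I f \<and> set_integrable lebesgue I (\<lambda>x. (f x)\<^sup>2)"

text \<open>L2(I) is embedded as the closed subspace of classes vanishing almost everywhere outside I: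
  functions on I are extended by zero.\<close>

definition L2_class :: "real set \<Rightarrow> (real \<Rightarrow> real) \<Rightarrow> L2" where
  "L2_class I f = abs_L2 (\<lambda>x. indicator I x * f x)"

definition L2_on :: "real set \<Rightarrow> L2 set" where
  "L2_on I = L2_class I ` {f. L2_function I f}"

section \<open>Unbounded operators, given by their graphs\<close>

text \<open>Here \<open>X\<close> is a closed subspace of the ambient type, playing the role of the Hilbert space.\<close>

definition operator_in :: "'a::real_inner set \<Rightarrow> ('a \<times> 'a) set \<Rightarrow> bool" where
  "operator_in X H \<longleftrightarrow> H \<subseteq> X \<times> X \<and> subspace H \<and> single_valued H"

definition densely_defined_in :: "'a::real_inner set \<Rightarrow> ('a \<times> 'a) set \<Rightarrow> bool" where
  "densely_defined_in X H \<longleftrightarrow> X \<subseteq> closure (Domain H)"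

definition adjoint_in :: "'a::real_inner set \<Rightarrow> ('a \<times> 'a) set \<Rightarrow> ('a \<times> 'a) set" where
  "adjoint_in X H = {(v, w) \<in> X \<times> X. \<forall>(x, y)\<in>H. inner v y = inner w x}"

definition self_adjoint_in :: "'a::real_inner set \<Rightarrow> ('a \<times> 'a) set \<Rightarrow> bool" where
  "self_adjoint_in X H \<longleftrightarrow>
     operator_in X H \<and> densely_defined_in X H \<and> adjoint_in X H = H"

text \<open>The graph of the inverse of \<open>H - \<mu>\<close>.\<close>

definition resolvent :: "('a::real_inner \<times> 'a) set \<Rightarrow> real \<Rightarrow> ('a \<times> 'a) set" where
  "resolvent H \<mu> = {(z, x). (x, z + \<mu> *\<^sub>R x) \<in> H}"

definition resolvent_set_in :: "'a::real_inner set \<Rightarrow> ('a \<times> 'a) set \<Rightarrow> real set" where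
  "resolvent_set_in X H = {\<mu>. (\<forall>z\<in>X. \<exists>!x. (z, x) \<in> resolvent H \<mu>) \<and>
     (\<exists>C. \<forall>(z, x)\<in>resolvent H \<mu>. norm x \<le> C * norm z)}"

text \<open>The space is real, so only real spectral parameters are available. For self-adjoint \<open>H\<close>
  nothing is lost: if the complexification of \<open>H\<close> has compact resolvent, its spectrum is a discrete
  subset of the line, so some real \<open>\<mu>\<close> lies in the resolvent set.\<close>

definition compact_resolvent_in :: "'a::real_inner set \<Rightarrow> ('a \<times> 'a) set \<Rightarrow> bool" where
  "compact_resolvent_in X H \<longleftrightarrow>
     (\<exists>\<mu>\<in>resolvent_set_in X H. compact (closure (resolvent H \<mu> `` (X \<inter> cball 0 1))))"

section \<open>Domains, boundary conditions and potentials\<close>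

text \<open>The arguments of \<open>Case3R\<close> are b, alpha, beta; those of \<open>Case3M\<close> are b, alpha.\<close>

datatype setting =
    Case1
  | Case2D
  | Case2R real
  | Case3D real
  | Case3R real real real
  | Case3M real real

fun valid_setting :: "setting \<Rightarrow> bool" where
  "valid_setting (Case3D b) \<longleftrightarrow> b > 0"
| "valid_setting (Case3R b \<alpha> \<beta>) \<longleftrightarrow> b > 0"
| "valid_setting (Case3M b \<alpha>) \<longleftrightarrow> b > 0"
| "valid_setting _ \<longleftrightarrow> True"

fun interval :: "setting \<Rightarrow> real set" where
  "interval Case1 = UNIV"
| "interval Case2D = {0<..}"
| "interval (Case2R \<alpha>) = {0<..}"
| "interval (Case3D b) = {0<..<b}"
| "interval (Case3R b \<alpha> \<beta>) = {0<..<b}"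
| "interval (Case3M b \<alpha>) = {0<..<b}"

definition locally_integrable_on_closure :: "real set \<Rightarrow> (real \<Rightarrow> real) \<Rightarrow> bool" where
  "locally_integrable_on_closure I V \<longleftrightarrow>
     (\<forall>K. compact K \<and> K \<subseteq> closure I \<longrightarrow> set_integrable lebesgue (K \<inter> I) V)"

text \<open>If \<open>I\<close> is bounded above (below), the filter for the limit at plus (minus) infinity within
  \<open>I\<close> is trivial, and the corresponding condition holds vacuously.\<close>

definition admissible_potential :: "real set \<Rightarrow> (real \<Rightarrow> real) \<Rightarrow> bool" where
  "admissible_potential I V \<longleftrightarrow>
     (\<forall>x\<in>I. V x \<ge> 0) \<and> locally_integrable_on_closure I V \<and>
     Liminf (inf at_top (principal I)) (\<lambda>x. ereal (V x / ln \<bar>x\<bar>)) = \<infinity> \<and>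
     Liminf (inf at_bot (principal I)) (\<lambda>x. ereal (V x / ln \<bar>x\<bar>)) = \<infinity>"

section \<open>The deterministic form\<close>

definition abs_continuous_on :: "real set \<Rightarrow> (real \<Rightarrow> real) \<Rightarrow> bool" where
  "abs_continuous_on S f \<longleftrightarrow>
     (\<forall>\<epsilon>>0. \<exists>\<delta>>0. \<forall>\<D>. \<D> division_of \<Union>\<D> \<and> \<Union>\<D> \<subseteq> S \<and> (\<Sum>k\<in>\<D>. Sup k - Inf k) < \<delta> \<longrightarrow>
        (\<Sum>k\<in>\<D>. \<bar>f (Sup k) - f (Inf k)\<bar>) < \<epsilon>)"

definition locally_abs_continuous_on_closure :: "real set \<Rightarrow> (real \<Rightarrow> real) \<Rightarrow> bool" where
  "locally_abs_continuous_on_closure I f \<longleftrightarrow>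
     (\<forall>c d. {c..d} \<subseteq> closure I \<longrightarrow> abs_continuous_on {c..d} f)"

definition pairing :: "real set \<Rightarrow> (real \<Rightarrow> real) \<Rightarrow> (real \<Rightarrow> real) \<Rightarrow> real" where
  "pairing I f g = set_lebesgue_integral lebesgue I (\<lambda>x. f x * g x)"

text \<open>Functions on the closure of I are represented by functions on the whole line, whose values
  outside the closure are irrelevant. Since I is open, \<open>deriv f\<close> on I is not affected by them;
  it is the derivative of f wherever f is differentiable, hence almost everywhere on I if f is
  locally absolutely continuous.\<close>

definition H1V :: "real set \<Rightarrow> (real \<Rightarrow> real) \<Rightarrow> (real \<Rightarrow> real) set" where
  "H1V I V = {f. locally_abs_continuous_on_closure I f \<and> L2_function I f \<and>
     L2_function I (deriv f) \<and> L2_function I (\<lambda>x. sqrt (V x) * f x)}"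

definition norm_star :: "real set \<Rightarrow> (real \<Rightarrow> real) \<Rightarrow> (real \<Rightarrow> real) \<Rightarrow> real" where
  "norm_star I V f = sqrt (pairing I (deriv f) (deriv f)
     + pairing I (\<lambda>x. sqrt (V x) * f x) (\<lambda>x. sqrt (V x) * f x) + pairing I f f)"

fun form_domain :: "setting \<Rightarrow> (real \<Rightarrow> real) \<Rightarrow> (real \<Rightarrow> real) set" where
  "form_domain Case1 V = H1V (interval Case1) V"
| "form_domain Case2D V = {f \<in> H1V (interval Case2D) V. f 0 = 0}"
| "form_domain (Case2R \<alpha>) V = H1V (interval (Case2R \<alpha>)) V"
| "form_domain (Case3D b) V = {f \<in> H1V (interval (Case3D b)) V. f 0 = 0 \<and> f b = 0}"
| "form_domain (Case3R b \<alpha> \<beta>) V = H1V (interval (Case3R b \<alpha> \<beta>)) V"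
| "form_domain (Case3M b \<alpha>) V = {f \<in> H1V (interval (Case3M b \<alpha>)) V. f b = 0}"

fun bdry :: "setting \<Rightarrow> (real \<Rightarrow> real) \<Rightarrow> (real \<Rightarrow> real) \<Rightarrow> real" where
  "bdry (Case2R \<alpha>) f g = - \<alpha> / 2 * f 0 * g 0"
| "bdry (Case3R b \<alpha> \<beta>) f g = - \<alpha> / 2 * f 0 * g 0 - \<beta> / 2 * f b * g b"
| "bdry (Case3M b \<alpha>) f g = - \<alpha> / 2 * f 0 * g 0"
| "bdry _ f g = 0"

definition form_E ::
  "setting \<Rightarrow> (real \<Rightarrow> real) \<Rightarrow> (real \<Rightarrow> real) \<Rightarrow> (real \<Rightarrow> real) \<Rightarrow> real" where
  "form_E s V f g = 1 / 2 * pairing (interval s) (deriv f) (deriv g)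
     + pairing (interval s) (\<lambda>x. f x * g x) V + bdry s f g"

section \<open>The noise and the random form\<close>

definition centered_gaussian :: "'w measure \<Rightarrow> ('w \<Rightarrow> real) \<Rightarrow> bool" where
  "centered_gaussian M X \<longleftrightarrow> X \<in> borel_measurable M \<and>
     ((AE \<omega> in M. X \<omega> = 0) \<or> (\<exists>\<sigma>>0. distributed M lborel X (\<lambda>x. ennreal (normal_density 0 \<sigma> x))))"

definition centered_gaussian_process :: "'w measure \<Rightarrow> (real \<Rightarrow> 'w \<Rightarrow> real) \<Rightarrow> bool" where
  "centered_gaussian_process M \<Xi> \<longleftrightarrow>
     (\<forall>F c. finite F \<longrightarrow> centered_gaussian M (\<lambda>\<omega>. \<Sum>x\<in>F. c x * \<Xi> x \<omega>))"

definition stationary_increments :: "'w measure \<Rightarrow> (real \<Rightarrow> 'w \<Rightarrow> real) \<Rightarrow> bool" where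
  "stationary_increments M \<Xi> \<longleftrightarrow>
     (\<forall>n::nat. \<forall>x y. \<forall>h::real.
        distr M (\<Pi>\<^sub>M i\<in>{..<n}. borel) (\<lambda>\<omega>. \<lambda>i\<in>{..<n}. \<Xi> (y i + h) \<omega> - \<Xi> (x i + h) \<omega>) =
        distr M (\<Pi>\<^sub>M i\<in>{..<n}. borel) (\<lambda>\<omega>. \<lambda>i\<in>{..<n}. \<Xi> (y i) \<omega> - \<Xi> (x i) \<omega>))"

definition noise_process :: "'w measure \<Rightarrow> (real \<Rightarrow> 'w \<Rightarrow> real) \<Rightarrow> bool" where
  "noise_process M \<Xi> \<longleftrightarrow> centered_gaussian_process M \<Xi> \<and>
     (AE \<omega> in M. \<Xi> 0 \<omega> = 0 \<and> continuous_on UNIV (\<lambda>x. \<Xi> x \<omega>)) \<and>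
     stationary_increments M \<Xi>"

text \<open>Smoothness on the closure of I is smoothness up to the boundary: derivatives of all orders,
  one-sided at the end points.\<close>

definition C0_infinity :: "real set \<Rightarrow> (real \<Rightarrow> real) set" where
  "C0_infinity I = {f.
     (\<exists>F :: nat \<Rightarrow> real \<Rightarrow> real. F 0 = f \<and> (\<forall>n. \<forall>x\<in>closure I.
        (F n has_real_derivative F (Suc n) x) (at x within closure I))) \<and>
     (\<exists>K. compact K \<and> K \<subseteq> closure I \<and> (\<forall>x\<in>closure I - K. f x = 0))}"

text \<open>In the remaining definitions, \<open>w\<close> is a sample path of the noise.\<close>

fun boundary_noise :: "setting \<Rightarrow> (real \<Rightarrow> real) \<Rightarrow> (real \<Rightarrow> real) \<Rightarrow> real" where
  "boundary_noise (Case3D b) w f = f b * w b"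
| "boundary_noise (Case3R b \<alpha> \<beta>) w f = f b * w b"
| "boundary_noise (Case3M b \<alpha>) w f = f b * w b"
| "boundary_noise _ w f = 0"

definition xi :: "setting \<Rightarrow> (real \<Rightarrow> real) \<Rightarrow> (real \<Rightarrow> real) \<Rightarrow> real" where
  "xi s w f = boundary_noise s w f - pairing (interval s) (deriv f) w"

definition quadratic_form_on :: "(real \<Rightarrow> real) set \<Rightarrow> ((real \<Rightarrow> real) \<Rightarrow> real) \<Rightarrow> bool" where
  "quadratic_form_on S Q \<longleftrightarrow> (\<exists>B :: (real \<Rightarrow> real) \<Rightarrow> (real \<Rightarrow> real) \<Rightarrow> real.
     (\<forall>f\<in>S. \<forall>g\<in>S. B f g = B g f) \<and>
     (\<forall>f\<in>S. \<forall>g\<in>S. \<forall>h\<in>S. B (\<lambda>x. f x + g x) h = B f h + B g h) \<and>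
     (\<forall>c. \<forall>f\<in>S. \<forall>g\<in>S. B (\<lambda>x. c * f x) g = c * B f g) \<and>
     (\<forall>f\<in>S. Q f = B f f))"

definition star_continuous :: "real set \<Rightarrow> (real \<Rightarrow> real) \<Rightarrow> ((real \<Rightarrow> real) \<Rightarrow> real) \<Rightarrow> bool" where
  "star_continuous I V Q \<longleftrightarrow>
     (\<forall>f\<in>H1V I V. \<forall>\<epsilon>>0. \<exists>\<delta>>0. \<forall>g\<in>H1V I V.
        norm_star I V (\<lambda>x. g x - f x) < \<delta> \<longrightarrow> \<bar>Q g - Q f\<bar> < \<epsilon>)"

text \<open>The unique continuous extension of \<open>f \<mapsto> \<xi>(f\<^sup>2)\<close>, which exists for almost every path of the
  noise. The extensionality condition merely fixes the value outside \<open>H1V\<close>.\<close>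

definition xi_square :: "setting \<Rightarrow> (real \<Rightarrow> real) \<Rightarrow> (real \<Rightarrow> real) \<Rightarrow> (real \<Rightarrow> real) \<Rightarrow> real" where
  "xi_square s V w = (THE Q.
     Q \<in> extensional (H1V (interval s) V) \<and>
     quadratic_form_on (H1V (interval s) V) Q \<and>
     star_continuous (interval s) V Q \<and>
     (\<forall>f\<in>C0_infinity (interval s). Q f = xi s w (\<lambda>x. (f x)\<^sup>2)))"

definition xi_product ::
  "setting \<Rightarrow> (real \<Rightarrow> real) \<Rightarrow> (real \<Rightarrow> real) \<Rightarrow> (real \<Rightarrow> real) \<Rightarrow> (real \<Rightarrow> real) \<Rightarrow> real" where
  "xi_product s V w f g =
     1 / 4 * (xi_square s V w (\<lambda>x. f x + g x) - xi_square s V w (\<lambda>x. f x - g x))"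

definition form_hat ::
  "setting \<Rightarrow> (real \<Rightarrow> real) \<Rightarrow> (real \<Rightarrow> real) \<Rightarrow> (real \<Rightarrow> real) \<Rightarrow> (real \<Rightarrow> real) \<Rightarrow> real" where
  "form_hat s V w f g = form_E s V f g + xi_product s V w f g"

text \<open>The identity between operator and form, for g in the operator domain and every f in the
  form domain; if \<open>Domain H\<close> lies in the form domain, this includes all f, g in the operator domain.
  With f restricted to the operator domain the operator would not be determined: the form restricted
  to functions vanishing at a fixed interior point of I yields a different self-adjoint operator
  with compact resolvent that satisfies the restricted identity.\<close>

definition represents_form ::
  "setting \<Rightarrow> (real \<Rightarrow> real) \<Rightarrow> (real \<Rightarrow> real) \<Rightarrow> (L2 \<times> L2) set \<Rightarrow> bool" where
  "represents_form s V w H \<longleftrightarrow>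
     (\<forall>f\<in>form_domain s V. \<forall>g\<in>form_domain s V. \<forall>u.
        (L2_class (interval s) g, u) \<in> H \<longrightarrow>
        inner (L2_class (interval s) f) u = form_hat s V w f g)"

end

theory Submission
  imports Defs "HOL-Complex_Analysis.Great_Picard"
begin

text \<open>For a fixed path \<open>w\<close>, write \<open>w = k + L\<close> where \<open>L\<close> is the average of \<open>w\<close> over \<open>{x..x + 1}\<close> up to
  a constant (\<open>L = 0\<close> on bounded intervals). Then \<open>\<xi>(f\<^sup>2) = -2 \<integral>f f' k + \<integral>f\<^sup>2 L'\<close> up to a boundary
  term, so it suffices that \<open>k\<^sup>2\<close> and \<open>L'\<^sup>2\<close> are infinitesimally form bounded with respect to
  \<open>\<E>\<close>. By Young's inequality for entropies this holds for every continuous \<open>\<kappa>\<close> such that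
  \<open>exp (a \<kappa>\<^sup>2) / (1 + x\<^sup>2)\<close> is integrable for some \<open>a > 0\<close>, because \<open>V\<close> dominates the logarithm.
  For Gaussian noise with stationary increments that integral has finite expectation if \<open>a\<close> is
  small. The perturbed form is then closed, bounded below and has compact sublevel sets in \<open>L\<^sup>2\<close>, and
  \<open>H\<close> is the operator that represents it. Any other candidate is contained in \<open>H\<close>, hence equal to it
  since both are self-adjoint.\<close>

section \<open>Absolute continuity\<close>

text \<open>Absolute continuity is the epsilon-delta notion and \<open>deriv\<close> is pointwise,
  so differentiability almost everywhere and the fundamental theorem of calculus must precede any
  Sobolev argument. Limits in the form norm are taken pointwise rather than weakly: the norm
  controls point values, Fatou's lemma bounds the limit, and its derivative is reached through
  difference quotients on a mesh.

  On unbounded intervals, subtracting the average is what makes the noise tractable: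
  \<open>w\<close> itself may grow, but \<open>k\<close> is, up to a constant, an average of
  increments of \<open>w\<close> over distances at most 1, and \<open>L'\<close> is the increment
  over distance 1. By stationarity the laws of such increments do not depend on the place. Their
  exponential square moments need only be finite for some \<open>a\<close>, since V / log |x| tends
  to infinity and absorbs any constant. Asking for an integral over x instead of a bound on the
  supremum confines the probability to single increments and Tonelli's theorem.

  \<open>xi_square\<close> is a definite description, so the test functions must be shown dense in
  the form norm before the extension can be identified.\<close>

definition increment :: "(real \<Rightarrow> real) \<Rightarrow> real set \<Rightarrow> real" where
  "increment f k = (if k = {} then 0 else f (Sup k) - f (Inf k))"

lemma increment_empty [simp]: "increment f {} = 0"
  by (simp add: increment_def)

lemma increment_interval [simp]: "a \<le> b \<Longrightarrow> increment f {a..b} = f b - f a"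
  by (simp add: increment_def)

lemma increment_singleton [simp]: "increment f {a} = 0"
  by (simp add: increment_def)

lemma sum_increment_division:
  assumes "p division_of {a..b}"
  shows "sum (increment f) p = increment f {a..b}"
proof -
  interpret operative_real plus 0 "increment f"
    rewrites "comm_monoid_set.F (+) 0 = sum"
    by standard[1] (auto simp add: sum_def increment_def)
  show ?thesis using division[of p a b] assms by simp
qed

lemma division_of_realD:
  assumes "p division_of S" "k \<in> p"
  obtains u v :: real where "k = {u..v}" "u \<le> v"
  using division_ofD(3,4)[OF assms]
  by (metis atLeastatMost_empty_iff2 box_real(2) not_le_imp_less order_less_imp_le)

text \<open>Two different pairs with the same intersection involve two cells of one division with
  disjoint interiors, so that intersection is empty or a single point and \<open>g\<close> vanishes
  on it. Hence passing from pairs to the set \<open>D\<close> of nonempty intersections changes no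
  sum.\<close>

lemma sum_inter_reindex:
  fixes g :: "real set \<Rightarrow> real"
  assumes p: "p division_of S" and q: "q division_of T" and A: "A \<subseteq> p \<times> q"
    and g0: "g {} = 0" "\<And>a. g {a..a} = 0"
  defines "D \<equiv> (\<lambda>(k, k'). k \<inter> k') ` A - {{}}"
  shows "(\<Sum>(k, k')\<in>A. g (k \<inter> k')) = sum g D" and "D division_of \<Union>D"
proof -
  have fin: "finite A" using A p q by (meson division_of_finite finite_SigmaI finite_subset)
  have "sum g D = sum g ((\<lambda>(k, k'). k \<inter> k') ` A)"
    unfolding D_def by (rule sum.mono_neutral_left) (use fin g0 in auto)
  also have "\<dots> = sum (g \<circ> (\<lambda>(k, k'). k \<inter> k')) A"
  proof (rule sum.reindex_nontrivial[OF fin])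
    fix x y assume xy: "x \<in> A" "y \<in> A" "x \<noteq> y"
      and e: "(case x of (k, k') \<Rightarrow> k \<inter> k') = (case y of (k, k') \<Rightarrow> k \<inter> k')"
    obtain k1 k1' k2 k2' where x: "x = (k1, k1')" "y = (k2, k2')" by (metis surj_pair)
    have m: "k1 \<in> p" "k2 \<in> p" "k1' \<in> q" "k2' \<in> q" using xy A x by auto
    have "interior k1 \<inter> interior k2 = {} \<or> interior k1' \<inter> interior k2' = {}"
      using xy(3) x m division_ofD(5)[OF p] division_ofD(5)[OF q] by blast
    moreover have "interior (k1 \<inter> k1') = interior k1 \<inter> interior k1'" by simp
    moreover have "interior (k1 \<inter> k1') = interior k2 \<inter> interior k2'" using e x by simp
    ultimately have i: "interior (k1 \<inter> k1') = {}" by blast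
    obtain a b c d where "k1 = {a..b}" "k1' = {c..d}"
      using m division_of_realD[OF p] division_of_realD[OF q] by metis
    then have kk: "k1 \<inter> k1' = {max a c..min b d}" by auto
    with i have "max a c \<ge> min b d" by (simp add: interior_atLeastAtMost_real not_less)
    then have "k1 \<inter> k1' = {} \<or> k1 \<inter> k1' = {max a c..max a c}"
      unfolding kk by (metis atLeastatMost_empty_iff order_antisym_conv)
    then show "g (case x of (k, k') \<Rightarrow> k \<inter> k') = 0" using x g0 by auto
  qed
  finally show "(\<Sum>(k, k')\<in>A. g (k \<inter> k')) = sum g D"
    by (simp add: comp_def case_prod_beta)
  show "D division_of \<Union>D"
  proof (rule division_of_subset)
    let ?R = "{k1 \<inter> k2 | k1 k2. k1 \<in> p \<and> k2 \<in> q \<and> k1 \<inter> k2 \<noteq> {}}"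
    show "?R division_of \<Union>?R"
      using division_inter[OF p q] by (metis (no_types, lifting) division_ofD(6))
    show "D \<subseteq> ?R" using A by (auto simp: D_def)
  qed
qed

text \<open>The cells \<open>k \<inter> k'\<close> with \<open>k'\<close> in \<open>C'\<close> and
  \<open>k\<close> outside \<open>C\<close> lie in \<open>U\<close> and do not overlap the cells of
  \<open>C\<close>, so together they fit into \<open>U\<close>. The part of \<open>C'\<close> not
  covered by \<open>C\<close> is therefore at most what \<open>C\<close> leaves of
  \<open>U\<close>.\<close>

lemma measure_cover_division:
  fixes a b :: real
  assumes p: "p division_of {a..b}" and C: "C \<subseteq> p" "C' \<subseteq> p'" and p': "p' division_of {a..b}"
    and U: "U \<in> lmeasurable" "\<Union>C \<subseteq> U" "\<Union>C' \<subseteq> U"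
  shows "(\<Sum>(k, k')\<in>(p - C) \<times> C'. measure lebesgue (k \<inter> k'))
           \<le> measure lebesgue U - (\<Sum>k\<in>C. measure lebesgue k)"
proof -
  let ?g = "measure lebesgue :: real set \<Rightarrow> real"
  \<comment> \<open>Each \<open>k\<close> in \<open>C\<close> is cut along \<open>p'\<close> too, so
    that both kinds of cells are indexed by pairs and one use of \<open>sum_inter_reindex\<close>
    covers them all.\<close>
  let ?A = "(p - C) \<times> C' \<union> (\<Union>k\<in>C. {(k, k')|k'. k' \<in> p'})"
  have fin: "finite p" "finite p'" "finite C" "finite C'" "finite (p - C)"
    using division_of_finite[OF p] division_of_finite[OF p'] C by (blast intro: rev_finite_subset)+
  have Cp: "?g k = (\<Sum>k'\<in>p'. ?g (k \<inter> k'))" if k: "k \<in> C" for k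
  proof -
    have kp: "k \<in> p" using k C by auto
    then have ksub: "k \<subseteq> {a..b}" using division_ofD(2)[OF p] by auto
    obtain u v where uv: "k = {u..v}" using division_of_realD[OF p kp] by metis
    have "?g k = ?g (\<Union>k'\<in>p'. k \<inter> k')"
      using ksub division_ofD(6)[OF p'] by (metis Int_Union inf.absorb1)
    also have "\<dots> = (\<Sum>k'\<in>p'. ?g (k \<inter> k'))"
    proof (rule measure_negligible_finite_Union_image)
      show "k \<inter> k' \<in> lmeasurable" if "k' \<in> p'" for k'
        using division_of_realD[OF p' that] uv by (metis fmeasurable_Int_fmeasurable lmeasurable_cbox box_real(2) fmeasurableD)
      show "pairwise (\<lambda>x y. negligible (k \<inter> x \<inter> (k \<inter> y))) p'"
      proof (rule pairwiseI)
        fix x y assume xy: "x \<in> p'" "y \<in> p'" "x \<noteq> y"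
        obtain c d e f where cd: "x = {c..d}" "y = {e..f}"
          using division_of_realD[OF p'] xy by metis
        then have "interior (cbox (max c e) (min d f)) = {}"
          using division_ofD(5)[OF p' xy] by (auto simp: interior_Int[symmetric])
        then have "negligible (cbox (max c e) (min d f))"
          by (metis negligible_interval(1) interior_cbox)
        then show "negligible (k \<inter> x \<inter> (k \<inter> y))"
          by (rule negligible_subset) (auto simp: cd)
      qed
    qed (use fin in auto)
    finally show ?thesis .
  qed
  have A: "?A \<subseteq> p \<times> p'" using C by auto
  have finA: "finite ?A" using A fin by (meson finite_SigmaI finite_subset)
  note r = sum_inter_reindex[OF p p' A, of "measure lebesgue"]
  have "(\<Sum>(k, k')\<in>(p - C) \<times> C'. ?g (k \<inter> k')) + (\<Sum>k\<in>C. ?g k)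
      = (\<Sum>(k, k')\<in>(p - C) \<times> C'. ?g (k \<inter> k')) + (\<Sum>(k, k')\<in>C \<times> p'. ?g (k \<inter> k'))"
    using Cp by (simp add: sum.cartesian_product[symmetric])
  also have "\<dots> = (\<Sum>(k, k')\<in>(p - C) \<times> C' \<union> C \<times> p'. ?g (k \<inter> k'))"
    by (rule sum.union_disjoint[symmetric]) (use fin in auto)
  also have "(p - C) \<times> C' \<union> C \<times> p' = ?A" by auto
  also have "(\<Sum>(k, k')\<in>?A. ?g (k \<inter> k')) = sum ?g ((\<lambda>(k, k'). k \<inter> k') ` ?A - {{}})"
    by (rule r(1)) auto
  also have "\<dots> = ?g (\<Union>((\<lambda>(k, k'). k \<inter> k') ` ?A - {{}}))"
  proof (rule measure_negligible_finite_Union[symmetric])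
    let ?D = "(\<lambda>(k, k'). k \<inter> k') ` ?A - {{}}"
    have D: "?D division_of \<Union>?D" by (rule r(2)) auto
    show "finite ?D" using finA by auto
    show "S \<in> lmeasurable" if "S \<in> ?D" for S
      using division_of_realD[OF D that] by (metis lmeasurable_cbox box_real(2))
    show "pairwise (\<lambda>S T. negligible (S \<inter> T)) ?D"
    proof (rule pairwiseI)
      fix x y assume xy: "x \<in> ?D" "y \<in> ?D" "x \<noteq> y"
      obtain c d where cd: "x = {c..d}" using division_of_realD[OF D xy(1)] by metis
      obtain e f where ef: "y = {e..f}" using division_of_realD[OF D xy(2)] by metis
      have "interior (cbox (max c e) (min d f)) = {}"
        using division_ofD(5)[OF D xy] by (auto simp: cd ef interior_Int[symmetric])
      then have "negligible (cbox (max c e) (min d f))"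
        by (metis negligible_interval(1) interior_cbox)
      then show "negligible (x \<inter> y)" by (rule negligible_subset) (auto simp: cd ef)
    qed
  qed
  also have "\<dots> \<le> ?g U"
  proof (rule measure_mono_fmeasurable)
    show "\<Union>((\<lambda>(k, k'). k \<inter> k') ` ?A - {{}}) \<subseteq> U" using U C by auto
    have D: "((\<lambda>(k, k'). k \<inter> k') ` ?A - {{}}) division_of \<Union>((\<lambda>(k, k'). k \<inter> k') ` ?A - {{}})"
      by (rule r(2)) auto
    show "\<Union>((\<lambda>(k, k'). k \<inter> k') ` ?A - {{}}) \<in> sets lebesgue"
      by (rule fmeasurableD[OF lmeasurable_division[OF D]])
  qed (use U in auto)
  finally show ?thesis by simp
qed

lemma abs_continuous_on_sum_increment:
  assumes ac: "abs_continuous_on {a..b} f" and e: "\<epsilon> > 0"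
  obtains \<delta> where "\<delta> > 0"
    "\<And>\<D>. \<lbrakk>\<D> division_of \<Union>\<D>; \<Union>\<D> \<subseteq> {a..b}; (\<Sum>k\<in>\<D>. measure lebesgue k) < \<delta>\<rbrakk>
       \<Longrightarrow> (\<Sum>k\<in>\<D>. \<bar>increment f k\<bar>) < \<epsilon>"
proof -
  obtain \<delta> where d: "\<delta> > 0"
    "\<And>\<D>. \<lbrakk>\<D> division_of \<Union>\<D>; \<Union>\<D> \<subseteq> {a..b}; (\<Sum>k\<in>\<D>. Sup k - Inf k) < \<delta>\<rbrakk> \<Longrightarrow>
        (\<Sum>k\<in>\<D>. \<bar>f (Sup k) - f (Inf k)\<bar>) < \<epsilon>"
    using ac[unfolded abs_continuous_on_def, rule_format, OF e] by blast
  show ?thesis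
  proof (rule that[OF d(1)])
    fix \<D> assume D: "\<D> division_of \<Union>\<D>" "\<Union>\<D> \<subseteq> {a..b}" "(\<Sum>k\<in>\<D>. measure lebesgue k) < \<delta>"
    have m: "measure lebesgue k = Sup k - Inf k \<and> increment f k = f (Sup k) - f (Inf k)" if k: "k \<in> \<D>" for k
    proof -
      obtain u v where "k = {u..v}" "u \<le> v" using division_of_realD[OF D(1) k] by metis
      then show ?thesis by (auto simp: increment_def)
    qed
    then show "(\<Sum>k\<in>\<D>. \<bar>increment f k\<bar>) < \<epsilon>" using d(2)[of \<D>] D by (simp cong: sum.cong)
  qed
qed

lemma abs_continuous_on_sum_increment_inter:
  assumes ac: "abs_continuous_on {a..b} f" and e: "\<epsilon> > 0"
  obtains \<delta> where "\<delta> > 0"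
    "\<And>p p' A. \<lbrakk>p division_of {a..b}; p' division_of {a..b}; A \<subseteq> p \<times> p';
        (\<Sum>(k, k')\<in>A. measure lebesgue (k \<inter> k')) < \<delta>\<rbrakk>
       \<Longrightarrow> \<bar>\<Sum>(k, k')\<in>A. increment f (k \<inter> k')\<bar> < \<epsilon>"
proof -
  obtain \<delta> where d: "\<delta> > 0"
    "\<And>\<D>. \<lbrakk>\<D> division_of \<Union>\<D>; \<Union>\<D> \<subseteq> {a..b}; (\<Sum>k\<in>\<D>. measure lebesgue k) < \<delta>\<rbrakk>
       \<Longrightarrow> (\<Sum>k\<in>\<D>. \<bar>increment f k\<bar>) < \<epsilon>"
    using abs_continuous_on_sum_increment[OF ac e] by metis
  show ?thesis
  proof (rule that[OF d(1)])
    fix p p' A assume p: "p division_of {a..b}" and p': "p' division_of {a..b}" and A: "A \<subseteq> p \<times> p'"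
      and s: "(\<Sum>(k, k')\<in>A. measure lebesgue (k \<inter> k')) < \<delta>"
    let ?D = "(\<lambda>(k, k'). k \<inter> k') ` A - {{}}"
    have D: "?D division_of \<Union>?D" by (rule sum_inter_reindex(2)[OF p p' A, of "\<lambda>_. 0"]) auto
    have "(\<Sum>k\<in>?D. measure lebesgue k) < \<delta>"
      using s sum_inter_reindex(1)[OF p p' A, of "measure lebesgue"] by simp
    moreover have "\<Union>?D \<subseteq> {a..b}"
      using A division_ofD(2)[OF p] by fastforce
    ultimately have "(\<Sum>k\<in>?D. \<bar>increment f k\<bar>) < \<epsilon>" using d(2)[OF D] by auto
    moreover have "(\<Sum>(k, k')\<in>A. increment f (k \<inter> k')) = sum (increment f) ?D"
      by (rule sum_inter_reindex(1)[OF p p' A]) auto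
    ultimately show "\<bar>\<Sum>(k, k')\<in>A. increment f (k \<inter> k')\<bar> < \<epsilon>"
      using sum_abs[of "increment f" ?D] by linarith
  qed
qed

text \<open>Extend both families to divisions and refine each along the other. The common cells
  cancel, and the remaining ones have total measure below \<open>\<delta>\<close> by
  \<open>measure_cover_division\<close>. Up to \<open>\<epsilon>\<close>, the total increment of a
  family that nearly fills \<open>U\<close> depends on \<open>U\<close> alone.\<close>

lemma abs_continuous_on_compare:
  assumes ac: "abs_continuous_on {a..b} f" and e: "\<epsilon> > 0"
  obtains \<delta> where "\<delta> > 0"
    "\<And>C C' U. \<lbrakk>C division_of \<Union>C; C' division_of \<Union>C'; \<Union>C \<subseteq> U; \<Union>C' \<subseteq> U; U \<in> lmeasurable; U \<subseteq> {a..b};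
        measure lebesgue U - (\<Sum>k\<in>C. measure lebesgue k) < \<delta>;
        measure lebesgue U - (\<Sum>k\<in>C'. measure lebesgue k) < \<delta>\<rbrakk>
       \<Longrightarrow> \<bar>sum (increment f) C - sum (increment f) C'\<bar> < \<epsilon>"
proof -
  obtain \<delta> where d: "\<delta> > 0"
    "\<And>p p' A. \<lbrakk>p division_of {a..b}; p' division_of {a..b}; A \<subseteq> p \<times> p';
        (\<Sum>(k, k')\<in>A. measure lebesgue (k \<inter> k')) < \<delta>\<rbrakk>
       \<Longrightarrow> \<bar>\<Sum>(k, k')\<in>A. increment f (k \<inter> k')\<bar> < \<epsilon> / 2"
    using abs_continuous_on_sum_increment_inter[OF ac half_gt_zero[OF e]] by metis
  show ?thesis
  proof (rule that[OF d(1)])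
    fix C C' U assume C: "C division_of \<Union>C" "\<Union>C \<subseteq> U" and C': "C' division_of \<Union>C'" "\<Union>C' \<subseteq> U"
      and U: "U \<in> lmeasurable" "U \<subseteq> {a..b}"
      and m: "measure lebesgue U - (\<Sum>k\<in>C. measure lebesgue k) < \<delta>"
        "measure lebesgue U - (\<Sum>k\<in>C'. measure lebesgue k) < \<delta>"
    have "\<Union>C \<subseteq> cbox a b" "\<Union>C' \<subseteq> cbox a b" using C C' U by auto
    then obtain p p' where p: "C \<subseteq> p" "p division_of {a..b}" and p': "C' \<subseteq> p'" "p' division_of {a..b}"
      using partial_division_extend_interval[OF C(1)] partial_division_extend_interval[OF C'(1)]
      by (metis box_real(2))
    have fin: "finite p" "finite p'" "finite C" "finite C'"
      using division_of_finite p(2) p'(2) C(1) C'(1) by blast+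
    have ex: "increment f k = (\<Sum>k'\<in>q'. increment f (k \<inter> k'))"
      if k: "k \<in> q" and q: "q division_of {a..b}" and q': "q' division_of {a..b}" for k q q'
    proof -
      obtain u v where uv: "k = {u..v}" "u \<le> v" using division_of_realD[OF q k] by metis
      have kp: "{k} division_of k" using uv by (metis box_real(2) division_of_self atLeastatMost_empty_iff2)
      have ks: "k \<subseteq> {a..b}" using k division_ofD(2)[OF q] by auto
      have A: "{k} \<times> q' \<subseteq> {k} \<times> q'" by auto
      have "(\<Sum>k'\<in>q'. increment f (k \<inter> k')) = (\<Sum>(k, k')\<in>{k} \<times> q'. increment f (k \<inter> k'))"
        by (simp add: sum.cartesian_product[symmetric])
      also have "\<dots> = sum (increment f) ((\<lambda>(k, k'). k \<inter> k') ` ({k} \<times> q') - {{}})"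
        by (rule sum_inter_reindex(1)[OF kp q' A]) auto
      also have "\<dots> = increment f {u..v}"
      proof (rule sum_increment_division)
        have "((\<lambda>(k, k'). k \<inter> k') ` ({k} \<times> q') - {{}}) division_of \<Union>((\<lambda>(k, k'). k \<inter> k') ` ({k} \<times> q') - {{}})"
          by (rule sum_inter_reindex(2)[OF kp q' A, of "\<lambda>_. 0"]) auto
        moreover have "\<Union>((\<lambda>(k, k'). k \<inter> k') ` ({k} \<times> q') - {{}}) = k \<inter> \<Union>q'"
          by auto
        then have "\<Union>((\<lambda>(k, k'). k \<inter> k') ` ({k} \<times> q') - {{}}) = {u..v}"
          using ks division_ofD(6)[OF q'] uv(1) by auto
        ultimately show "((\<lambda>(k, k'). k \<inter> k') ` ({k} \<times> q') - {{}}) division_of {u..v}" by simp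
      qed
      finally show ?thesis using uv by simp
    qed
    have "sum (increment f) C = (\<Sum>(k, k')\<in>C \<times> p'. increment f (k \<inter> k'))"
      using ex[OF _ p(2) p'(2)] p(1) by (simp add: sum.cartesian_product[symmetric] subset_iff)
    also have "C \<times> p' = C \<times> C' \<union> C \<times> (p' - C')" using p' by auto
    also have "(\<Sum>(k, k')\<in>C \<times> C' \<union> C \<times> (p' - C'). increment f (k \<inter> k'))
       = (\<Sum>(k, k')\<in>C \<times> C'. increment f (k \<inter> k')) + (\<Sum>(k, k')\<in>C \<times> (p' - C'). increment f (k \<inter> k'))"
      by (rule sum.union_disjoint) (use fin in auto)
    finally have 1: "sum (increment f) C = \<dots>" .
    have "sum (increment f) C' = (\<Sum>k'\<in>C'. \<Sum>k\<in>p. increment f (k \<inter> k'))"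
    proof (rule sum.cong[OF refl])
      fix k' assume "k' \<in> C'"
      then have "k' \<in> p'" using p'(1) by auto
      from ex[OF this p'(2) p(2)] show "increment f k' = (\<Sum>k\<in>p. increment f (k \<inter> k'))"
        by (subst Int_commute)
    qed
    also have "\<dots> = (\<Sum>(k, k')\<in>p \<times> C'. increment f (k \<inter> k'))"
      by (subst sum.swap) (simp add: sum.cartesian_product)
    also have "p \<times> C' = C \<times> C' \<union> (p - C) \<times> C'" using p by auto
    also have "(\<Sum>(k, k')\<in>C \<times> C' \<union> (p - C) \<times> C'. increment f (k \<inter> k'))
       = (\<Sum>(k, k')\<in>C \<times> C'. increment f (k \<inter> k')) + (\<Sum>(k, k')\<in>(p - C) \<times> C'. increment f (k \<inter> k'))"
      by (rule sum.union_disjoint) (use fin in auto)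
    finally have 2: "sum (increment f) C' = \<dots>" .
    have "(\<Sum>(k, k')\<in>(p - C) \<times> C'. measure lebesgue (k \<inter> k')) < \<delta>"
      using measure_cover_division[OF p(2,1) p' U(1) C(2) C'(2)] m by linarith
    then have 3: "\<bar>\<Sum>(k, k')\<in>(p - C) \<times> C'. increment f (k \<inter> k')\<bar> < \<epsilon> / 2"
      by (intro d(2)[OF p(2) p'(2)]) (use p p' in auto)
    have "(\<Sum>(k, k')\<in>C \<times> (p' - C'). measure lebesgue (k \<inter> k'))
        = (\<Sum>k\<in>C. \<Sum>k'\<in>p' - C'. measure lebesgue (k' \<inter> k))"
      unfolding sum.cartesian_product[symmetric]
      by (intro sum.cong refl arg_cong[where f = "measure lebesgue"] Int_commute)
    also have "\<dots> = (\<Sum>k'\<in>p' - C'. \<Sum>k\<in>C. measure lebesgue (k' \<inter> k))"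
      by (rule sum.swap)
    also have "\<dots> = (\<Sum>(k', k)\<in>(p' - C') \<times> C. measure lebesgue (k' \<inter> k))"
      by (simp add: sum.cartesian_product)
    also have "\<dots> < \<delta>"
      using measure_cover_division[OF p'(2,1) p U(1) C'(2) C(2)] m by linarith
    finally have 4: "\<bar>\<Sum>(k, k')\<in>C \<times> (p' - C'). increment f (k \<inter> k')\<bar> < \<epsilon> / 2"
      by (intro d(2)[OF p(2) p'(2)]) (use p p' in auto)
    show "\<bar>sum (increment f) C - sum (increment f) C'\<bar> < \<epsilon>"
      unfolding 1 2 using 3 4 by linarith
  qed
qed

section \<open>Vitali coverings and differentiability almost everywhere\<close>

text \<open>\<open>E\<close> may fail to be measurable, so a lower bound \<open>m\<close> on the
  measure of its open neighbourhoods stands in for its measure. A countable disjoint Vitali family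
  covers \<open>E\<close> up to a null set; together with that null set it lies in an open set
  larger by less than \<open>\<epsilon> / 2\<close> in measure, and passing to a finite subfamily
  costs another \<open>\<epsilon> / 2\<close>.\<close>

lemma vitali_family:
  fixes E U :: "real set"
  assumes EU: "E \<subseteq> U" "open U" "U \<in> lmeasurable"
    and cover: "\<And>x \<delta>. \<lbrakk>x \<in> E; \<delta> > 0\<rbrakk> \<Longrightarrow> \<exists>u v. u < v \<and> v - u < \<delta> \<and> x \<in> {u..v} \<and> P u v"
    and outer: "\<And>W. \<lbrakk>open W; E \<subseteq> W; W \<subseteq> U\<rbrakk> \<Longrightarrow> m \<le> measure lebesgue W"
    and e: "\<epsilon> > 0"
  obtains C where "C division_of \<Union>C" "\<Union>C \<subseteq> U" "\<And>k. k \<in> C \<Longrightarrow> \<exists>u v. u < v \<and> k = {u..v} \<and> P u v"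
    "(\<Sum>k\<in>C. measure lebesgue k) > m - \<epsilon>"
proof -
  define K where "K = {(u, v). u < v \<and> P u v \<and> {u..v} \<subseteq> U}"
  let ?a = "\<lambda>(u, v). (u + v) / (2::real)" and ?r = "\<lambda>(u, v). (v - u) / (2::real)"
  have cb: "cball (?a i) (?r i) = {fst i..snd i}" for i
    by (cases i) (auto simp: cball_eq_atLeastAtMost field_simps)
  obtain C0 where C0: "countable C0" "C0 \<subseteq> K"
     "pairwise (\<lambda>i j. disjnt (cball (?a i) (?r i)) (cball (?a j) (?r j))) C0"
     "negligible (E - (\<Union>i \<in> C0. cball (?a i) (?r i)))"
  proof (rule Vitali_covering_theorem_cballs[of K ?r E ?a])
    show "0 < ?r i" if "i \<in> K" for i using that by (auto simp: K_def)
    show "\<exists>i. i \<in> K \<and> x \<in> cball (?a i) (?r i) \<and> ?r i < d" if x: "x \<in> E" and d: "0 < d" for x d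
    proof -
      obtain \<rho> where \<rho>: "\<rho> > 0" "ball x \<rho> \<subseteq> U" using EU x by (meson openE subsetD)
      obtain u v where uv: "u < v" "v - u < min d \<rho>" "x \<in> {u..v}" "P u v"
        using cover[OF x, of "min d \<rho>"] d \<rho> by auto
      have "{u..v} \<subseteq> ball x \<rho>" using uv by (auto simp: dist_real_def)
      then have "(u, v) \<in> K" using uv \<rho> by (auto simp: K_def)
      then show ?thesis using uv cb[of "(u, v)"] by (intro exI[of _ "(u, v)"]) (auto simp: field_simps)
    qed
  qed auto
  define D where "D = (\<lambda>i. {fst i..snd i}) ` C0"
  have D: "countable D" "pairwise disjnt D" "negligible (E - \<Union>D)"
    using C0 by (auto simp: D_def cb pairwise_image pairwise_def)
  have DK: "\<exists>u v. u < v \<and> k = {u..v} \<and> P u v \<and> {u..v} \<subseteq> U" if "k \<in> D" for k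
    using that C0(2) by (force simp: D_def K_def)
  have DU: "\<Union>D \<subseteq> U" using DK by fast
  have Dm: "k \<in> lmeasurable" if "k \<in> D" for k
    using DK[OF that] by (metis lmeasurable_cbox box_real(2))
  have UDs: "\<Union>D \<in> sets lebesgue" using D(1) Dm by (meson fmeasurableD sets.countable_Union subsetI)
  have UDm: "\<Union>D \<in> lmeasurable" using fmeasurableI2[OF EU(3) DU UDs] .
  define A where "A = \<Union>D \<union> (E - \<Union>D)"
  have N: "E - \<Union>D \<in> null_sets lebesgue" using D(3) negligible_iff_null_sets by blast
  have Al: "A \<in> lmeasurable"
    unfolding A_def using UDm N by (metis D(3) fmeasurable.Un negligible_imp_measurable)
  have Am: "A \<in> sets lebesgue" "measure lebesgue A = measure lebesgue (\<Union>D)"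
    using Al measure_Un_null_set[OF UDs N] by (auto simp: A_def fmeasurableD)
  obtain W0 where W0: "open W0" "A \<subseteq> W0" "W0 - A \<in> lmeasurable" "emeasure lebesgue (W0 - A) < ennreal (\<epsilon> / 2)"
    using sets_lebesgue_outer_open[OF Am(1), of "\<epsilon> / 2"] e by auto
  have mW: "measure lebesgue (W0 - A) < \<epsilon> / 2"
    using W0(3,4) e by (simp add: emeasure_eq_measure2 ennreal_less_iff)
  have "m \<le> measure lebesgue (W0 \<inter> U)"
    by (rule outer) (use W0 EU in \<open>auto simp: A_def\<close>)
  also have "\<dots> \<le> measure lebesgue ((W0 - A) \<union> A)"
    by (rule measure_mono_fmeasurable[OF _ _ fmeasurable.Un[OF W0(3) Al]]) (use W0 EU in auto)
  also have "\<dots> \<le> measure lebesgue (W0 - A) + measure lebesgue A"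
    by (rule measure_Un_le) (use W0 Am in \<open>auto simp: fmeasurableD\<close>)
  finally have m: "m \<le> measure lebesgue (\<Union>D) + \<epsilon> / 2" using mW Am by linarith
  have B: "measure lebesgue (\<Union>D') \<le> measure lebesgue U" if D': "D' \<subseteq> D" "finite D'" for D'
  proof (rule measure_mono_fmeasurable[OF _ _ EU(3)])
    show "\<Union>D' \<subseteq> U" using Union_mono[OF D'(1)] DU by (rule order_trans)
    have "D' \<subseteq> sets lebesgue"
    proof
      fix k assume "k \<in> D'"
      then have "k \<in> D" using D'(1) by auto
      then show "k \<in> sets lebesgue" using Dm by (simp add: fmeasurableD)
    qed
    then show "\<Union>D' \<in> sets lebesgue" by (rule sets.finite_Union[OF D'(2)])
  qed
  have e2: "\<epsilon> / 2 > 0" using e by simp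
  obtain C where C: "C \<subseteq> D" "finite C" "measure lebesgue (\<Union>D) - \<epsilon> / 2 < measure lebesgue (\<Union>C)"
    by (rule measure_countable_Union_approachable[where \<D> = D and e = "\<epsilon> / 2" and B = "measure lebesgue U", OF D(1) e2])
      (erule Dm, erule (1) B, erule (2) that)
  show ?thesis
  proof (rule that[of C])
    show "C division_of \<Union>C"
    proof (rule division_ofI)
      show "interior k1 \<inter> interior k2 = {}" if "k1 \<in> C" "k2 \<in> C" "k1 \<noteq> k2" for k1 k2
      proof -
        have "disjnt k1 k2" using pairwiseD[OF D(2), of k1 k2] C(1) that by auto
        then show ?thesis using interior_subset[of k1] interior_subset[of k2] by (auto simp: disjnt_def)
      qed
      show "\<exists>a b. k = cbox a b" if "k \<in> C" for k using DK[of k] that C(1) by (metis box_real(2) subsetD)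
      show "k \<noteq> {}" if "k \<in> C" for k using DK[of k] that C(1) by fastforce
    qed (use C in auto)
    show "\<Union>C \<subseteq> U" using C DU by auto
    show "\<exists>u v. u < v \<and> k = {u..v} \<and> P u v" if "k \<in> C" for k using DK that C by blast
    have "measure lebesgue (\<Union>C) = (\<Sum>k\<in>C. measure lebesgue k)"
      by (rule measure_negligible_finite_Union[OF C(2)])
        (use C(1) Dm D(2) in \<open>auto simp: pairwise_def disjnt_def subset_iff\<close>)
    then show "(\<Sum>k\<in>C. measure lebesgue k) > m - \<epsilon>" using C(3) m by linarith
  qed
qed


text \<open>The number \<open>m\<close> is the outer measure of \<open>E\<close>, as an infimum over
  the open sets between \<open>E\<close> and \<open>U\<close>. Were it zero, open sets of
  arbitrarily small measure would contain \<open>E\<close>, which is negligibility.\<close>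

lemma outer_measure_approx:
  fixes E U :: "real set"
  assumes "E \<subseteq> U" "open U" "U \<in> lmeasurable" "\<not> negligible E"
  obtains m where "m > 0" "\<And>W. \<lbrakk>open W; E \<subseteq> W; W \<subseteq> U\<rbrakk> \<Longrightarrow> m \<le> measure lebesgue W"
    "\<And>\<epsilon>. \<epsilon> > 0 \<Longrightarrow> \<exists>W. open W \<and> E \<subseteq> W \<and> W \<subseteq> U \<and> W \<in> lmeasurable \<and> measure lebesgue W < m + \<epsilon>"
proof -
  define \<W> where "\<W> = {W. open W \<and> E \<subseteq> W \<and> W \<subseteq> U}"
  define m where "m = (INF W\<in>\<W>. measure lebesgue W)"
  have U: "U \<in> \<W>" using assms by (auto simp: \<W>_def)
  have Wm: "W \<in> lmeasurable" if "W \<in> \<W>" for W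
    by (rule fmeasurableI2[OF assms(3)]) (use that in \<open>auto simp: \<W>_def\<close>)
  have bdd: "bdd_below (measure lebesgue ` \<W>)" by (rule bdd_belowI[of _ 0]) auto
  have le: "m \<le> measure lebesgue W" if "W \<in> \<W>" for W
    unfolding m_def using bdd that by (rule cINF_lower)
  have approx: "\<exists>W\<in>\<W>. measure lebesgue W < m + \<epsilon>" if "\<epsilon> > 0" for \<epsilon>
    using cINF_less_iff[OF _ bdd, of "m + \<epsilon>"] U that unfolding m_def[symmetric] by auto
  have "m \<noteq> 0"
  proof
    assume "m = 0"
    then have "negligible E"
      unfolding negligible_outer using approx Wm by (metis (no_types, lifting) \<W>_def add_0 mem_Collect_eq)
    then show False using assms by simp
  qed
  moreover have "m \<ge> 0" unfolding m_def using U by (intro cINF_greatest) auto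
  ultimately have "m > 0" by simp
  then show ?thesis
  proof (rule that)
    show "m \<le> measure lebesgue W" if "open W" "E \<subseteq> W" "W \<subseteq> U" for W
      using le[of W] that by (simp add: \<W>_def)
    show "\<exists>W. open W \<and> E \<subseteq> W \<and> W \<subseteq> U \<and> W \<in> lmeasurable \<and> measure lebesgue W < m + \<epsilon>" if "\<epsilon> > 0" for \<epsilon>
      using approx[OF that] Wm by (auto simp: \<W>_def)
  qed
qed

lemma sum_measure_family_le:
  assumes "C division_of \<Union>C" "\<Union>C \<subseteq> U" "U \<in> lmeasurable"
  shows "(\<Sum>k\<in>C. measure lebesgue k) \<le> measure lebesgue (U :: real set)"
proof -
  have "(\<Sum>k\<in>C. measure lebesgue k) = measure lebesgue (\<Union>C)"
    proof (rule measure_negligible_finite_Union[symmetric])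
    show "finite C" using assms(1) by blast
    show "S \<in> lmeasurable" if "S \<in> C" for S
      using division_of_realD[OF assms(1) that] by (metis lmeasurable_cbox box_real(2))
    show "pairwise (\<lambda>S T. negligible (S \<inter> T)) C"
    proof (rule pairwiseI)
      fix x y assume xy: "x \<in> C" "y \<in> C" "x \<noteq> y"
      obtain c d where cd: "x = {c..d}" using division_of_realD[OF assms(1) xy(1)] by metis
      obtain e f where ef: "y = {e..f}" using division_of_realD[OF assms(1) xy(2)] by metis
      have "interior (cbox (max c e) (min d f)) = {}"
        using division_ofD(5)[OF assms(1) xy] by (auto simp: cd ef interior_Int[symmetric])
      then have "negligible (cbox (max c e) (min d f))"
        by (metis negligible_interval(1) interior_cbox)
      then show "negligible (x \<inter> y)" by (rule negligible_subset) (auto simp: cd ef)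
    qed
  qed
  also have "\<dots> \<le> measure lebesgue U"
    by (rule measure_mono_fmeasurable[OF assms(2) _ assms(3)])
      (rule fmeasurableD[OF lmeasurable_division[OF assms(1)]])
  finally show ?thesis .
qed

lemma sum_increment_le:
  assumes "\<And>k. k \<in> C \<Longrightarrow> \<exists>u v. u < v \<and> k = {u..v} \<and> f v - f u \<le> p * (v - u)"
  shows "sum (increment f) C \<le> p * (\<Sum>k\<in>C. measure lebesgue k)"
  unfolding sum_distrib_left by (rule sum_mono) (use assms in force)

lemma sum_increment_ge:
  assumes "\<And>k. k \<in> C \<Longrightarrow> \<exists>u v. u < v \<and> k = {u..v} \<and> f v - f u \<ge> p * (v - u)"
  shows "sum (increment f) C \<ge> p * (\<Sum>k\<in>C. measure lebesgue k)"
  unfolding sum_distrib_left by (rule sum_mono) (use assms in force)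

text \<open>Take \<open>U\<close> open around \<open>E\<close> with measure close to the outer
  measure \<open>m\<close>. A Vitali family of slopes at most \<open>p\<close> and one of slopes at
  least \<open>q\<close> both nearly fill \<open>U\<close>, so up to small errors their total
  increments are at most \<open>p * m\<close> and at least \<open>q * m\<close>. By
  \<open>abs_continuous_on_compare\<close> the two totals nearly agree, which a positive
  \<open>m\<close> forbids.\<close>

lemma negligible_slope_gap:
  assumes ac: "abs_continuous_on {a..b} f" and E: "E \<subseteq> {a<..<b}" and pq: "p < q"
    and lo: "\<And>x \<delta>. \<lbrakk>x \<in> E; \<delta> > 0\<rbrakk> \<Longrightarrow> \<exists>u v. u < v \<and> v - u < \<delta> \<and> x \<in> {u..v} \<and> f v - f u \<le> p * (v - u)"
    and hi: "\<And>x \<delta>. \<lbrakk>x \<in> E; \<delta> > 0\<rbrakk> \<Longrightarrow> \<exists>u v. u < v \<and> v - u < \<delta> \<and> x \<in> {u..v} \<and> f v - f u \<ge> q * (v - u)"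
  shows "negligible E"
proof (rule ccontr)
  assume "\<not> negligible E"
  then obtain m where m: "m > 0" "\<And>W. \<lbrakk>open W; E \<subseteq> W; W \<subseteq> {a<..<b}\<rbrakk> \<Longrightarrow> m \<le> measure lebesgue W"
    "\<And>\<epsilon>. \<epsilon> > 0 \<Longrightarrow> \<exists>W. open W \<and> E \<subseteq> W \<and> W \<subseteq> {a<..<b} \<and> W \<in> lmeasurable \<and> measure lebesgue W < m + \<epsilon>"
    using outer_measure_approx[OF E open_greaterThanLessThan, of thesis]
    by (metis lmeasurable_box box_real(1))
  \<comment> \<open>Half the discrepancy \<open>(q - p) * m\<close> that the two families would
    produce.\<close>
  define \<epsilon> where "\<epsilon> = (q - p) * m / 2"
  have e: "\<epsilon> > 0" using m pq by (simp add: \<epsilon>_def)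
  obtain \<delta> where d: "\<delta> > 0"
    "\<And>C C' U. \<lbrakk>C division_of \<Union>C; C' division_of \<Union>C'; \<Union>C \<subseteq> U; \<Union>C' \<subseteq> U; U \<in> lmeasurable; U \<subseteq> {a..b};
        measure lebesgue U - (\<Sum>k\<in>C. measure lebesgue k) < \<delta>;
        measure lebesgue U - (\<Sum>k\<in>C'. measure lebesgue k) < \<delta>\<rbrakk>
       \<Longrightarrow> \<bar>sum (increment f) C - sum (increment f) C'\<bar> < \<epsilon>"
    using abs_continuous_on_compare[OF ac e] by metis
  \<comment> \<open>Each family misses less than \<open>2 * \<eta>\<close> of \<open>U\<close>,
    hence \<open>2 * \<eta> \<le> \<delta>\<close>; the other bound keeps the errors
    \<open>\<bar>p\<bar> * \<eta>\<close> and \<open>\<bar>q\<bar> * \<eta>\<close> together below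
    \<open>\<epsilon>\<close>.\<close>
  define \<eta> where "\<eta> = min (\<delta> / 2) (\<epsilon> / (\<bar>p\<bar> + \<bar>q\<bar> + 1))"
  have eta: "\<eta> > 0" "2 * \<eta> \<le> \<delta>" "\<eta> \<le> \<epsilon> / (\<bar>p\<bar> + \<bar>q\<bar> + 1)"
    using d e by (auto simp: \<eta>_def intro!: divide_pos_pos add_nonneg_pos)
  obtain U where U: "open U" "E \<subseteq> U" "U \<subseteq> {a<..<b}" "U \<in> lmeasurable" "measure lebesgue U < m + \<eta>"
    using m(3)[OF eta(1)] by auto
  have mU: "m \<le> measure lebesgue W" if "open W" "E \<subseteq> W" "W \<subseteq> U" for W
    using m(2)[OF that(1,2)] that(3) U(3) by auto
  obtain C where C: "C division_of \<Union>C" "\<Union>C \<subseteq> U"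
    "\<And>k. k \<in> C \<Longrightarrow> \<exists>u v. u < v \<and> k = {u..v} \<and> f v - f u \<le> p * (v - u)"
    "(\<Sum>k\<in>C. measure lebesgue k) > m - \<eta>"
    by (rule vitali_family[OF U(2,1,4) lo mU eta(1)]) auto
  obtain C' where C': "C' division_of \<Union>C'" "\<Union>C' \<subseteq> U"
    "\<And>k. k \<in> C' \<Longrightarrow> \<exists>u v. u < v \<and> k = {u..v} \<and> f v - f u \<ge> q * (v - u)"
    "(\<Sum>k\<in>C'. measure lebesgue k) > m - \<eta>"
    by (rule vitali_family[OF U(2,1,4) hi mU eta(1)]) auto
  let ?s = "\<Sum>k\<in>C. measure lebesgue k" and ?s' = "\<Sum>k\<in>C'. measure lebesgue k"
  have "\<bar>sum (increment f) C - sum (increment f) C'\<bar> < \<epsilon>"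
    by (rule d(2)[OF C(1) C'(1) C(2) C'(2) U(4)]) (use U C(4) C'(4) eta in auto)
  then have 1: "q * ?s' - p * ?s < \<epsilon>"
    using sum_increment_le[of C f p] sum_increment_ge[of C' q f] C(3) C'(3) by force
  have s: "\<bar>?s - m\<bar> \<le> \<eta>" "\<bar>?s' - m\<bar> \<le> \<eta>"
    using C(4) C'(4) U(5) sum_measure_family_le[OF C(1,2) U(4)] sum_measure_family_le[OF C'(1,2) U(4)] by auto
  have "\<bar>q * (?s' - m)\<bar> \<le> \<bar>q\<bar> * \<eta>" "\<bar>p * (?s - m)\<bar> \<le> \<bar>p\<bar> * \<eta>"
    using s by (auto simp: abs_mult intro!: mult_left_mono)
  moreover have "q * ?s' - p * ?s = (q - p) * m + q * (?s' - m) - p * (?s - m)" by algebra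
  ultimately have "(q - p) * m - (\<bar>p\<bar> + \<bar>q\<bar>) * \<eta> < \<epsilon>" using 1 by (auto simp: distrib_right)
  moreover have "(\<bar>p\<bar> + \<bar>q\<bar>) * \<eta> < \<epsilon>"
  proof -
    have "(\<bar>p\<bar> + \<bar>q\<bar> + 1) * \<eta> \<le> \<epsilon>" using eta(3) by (simp add: field_simps)
    then show ?thesis using eta(1) by (simp add: algebra_simps)
  qed
  moreover have "(q - p) * m = 2 * \<epsilon>" by (simp add: \<epsilon>_def)
  ultimately show False by linarith
qed

text \<open>On a stretch of length \<open>\<delta>\<close> the increments of a nonoverlapping family
  add up to less than 1. If \<open>E\<close> had outer measure \<open>m > 0\<close> there, intervals
  of slope at least \<open>2 / m\<close> and total length above \<open>m / 2\<close> would add up to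
  more than 1. Stretches with rational left end cover \<open>E\<close>.\<close>

lemma negligible_infinite_slope:
  assumes ac: "abs_continuous_on {a..b} f" and E: "E \<subseteq> {a<..<b}"
    and hi: "\<And>x \<delta> N. \<lbrakk>x \<in> E; \<delta> > 0\<rbrakk> \<Longrightarrow> \<exists>u v. u < v \<and> v - u < \<delta> \<and> x \<in> {u..v} \<and> f v - f u \<ge> N * (v - u)"
  shows "negligible E"
proof -
  obtain \<delta> where d: "\<delta> > 0"
    "\<And>\<D>. \<lbrakk>\<D> division_of \<Union>\<D>; \<Union>\<D> \<subseteq> {a..b}; (\<Sum>k\<in>\<D>. measure lebesgue k) < \<delta>\<rbrakk>
       \<Longrightarrow> (\<Sum>k\<in>\<D>. \<bar>increment f k\<bar>) < 1"
    using abs_continuous_on_sum_increment[OF ac zero_less_one] by metis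
  have part: "negligible (E \<inter> {c<..<c + \<delta>})" for c
  proof (rule ccontr)
    let ?U = "{max a c<..<min b (c + \<delta>)}"
    assume *: "\<not> negligible (E \<inter> {c<..<c + \<delta>})"
    have EU: "E \<inter> {c<..<c + \<delta>} \<subseteq> ?U" using E by auto
    have Um: "?U \<in> lmeasurable" by (metis lmeasurable_box box_real(1))
    obtain m where m: "m > 0" "\<And>W. \<lbrakk>open W; E \<inter> {c<..<c + \<delta>} \<subseteq> W; W \<subseteq> ?U\<rbrakk> \<Longrightarrow> m \<le> measure lebesgue W"
      using outer_measure_approx[OF EU open_greaterThanLessThan Um *] by metis
    have hi': "\<exists>u v. u < v \<and> v - u < \<delta>' \<and> x \<in> {u..v} \<and> f v - f u \<ge> 2 / m * (v - u)"
      if "x \<in> E \<inter> {c<..<c + \<delta>}" "\<delta>' > 0" for x \<delta>' using hi[of x \<delta>' "2 / m"] that by blast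
    have m2: "m / 2 > 0" using m by simp
    obtain C where C: "C division_of \<Union>C" "\<Union>C \<subseteq> ?U"
      "\<And>k. k \<in> C \<Longrightarrow> \<exists>u v. u < v \<and> k = {u..v} \<and> f v - f u \<ge> 2 / m * (v - u)"
      "(\<Sum>k\<in>C. measure lebesgue k) > m - m / 2"
      by (rule vitali_family[OF EU open_greaterThanLessThan Um hi' m(2) m2]) auto
    have "\<Union>C \<subseteq> {a..b}" using C(2) by force
    have "C \<noteq> {}" using C(4) m(1) by auto
    then obtain k where k: "k \<in> C" by auto
    obtain u v where uv: "{u..v} \<in> C" "u \<le> v" using division_of_realD[OF C(1) k] k by metis
    have fin: "finite C" using C(1) by auto
    have cb: "\<exists>u v. k = {u..v} \<and> u \<le> v \<and> u \<in> ?U \<and> v \<in> ?U" if kC: "k \<in> C" for k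
    proof -
      obtain u v where uv: "k = {u..v}" "u \<le> v" using division_of_realD[OF C(1) kC] by metis
      then have "k \<subseteq> ?U" using C(2) kC by auto
      with uv show ?thesis by (intro exI[of _ u] exI[of _ v]) auto
    qed
    \<comment> \<open>The least and greatest points of the union lie in the open interval
      \<open>?U\<close> of length at most \<open>\<delta>\<close>, which makes the total length
      strictly less than \<open>\<delta>\<close>.\<close>
    have "compact (\<Union>C)" by (rule compact_Union[OF fin]) (use cb in fastforce)
    moreover have "\<Union>C \<noteq> {}" using uv by (metis Union_empty_conv atLeastatMost_empty_iff2)
    ultimately obtain l h where lh: "l \<in> \<Union>C" "h \<in> \<Union>C" "\<And>x. x \<in> \<Union>C \<Longrightarrow> l \<le> x" "\<And>x. x \<in> \<Union>C \<Longrightarrow> x \<le> h"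
      using compact_attains_inf compact_attains_sup by metis
    have lhU: "l \<in> ?U" "h \<in> ?U" "l \<le> h"
      using subsetD[OF C(2) lh(1)] subsetD[OF C(2) lh(2)] lh(4)[OF lh(1)] by blast+
    have lhC: "\<Union>C \<subseteq> {l..h}"
    proof
      fix x assume "x \<in> \<Union>C"
      then show "x \<in> {l..h}" using lh(3,4)[of x] by simp
    qed
    have "(\<Sum>k\<in>C. measure lebesgue k) \<le> measure lebesgue {l..h}"
      by (rule sum_measure_family_le[OF C(1) lhC]) auto
    with lhU have "(\<Sum>k\<in>C. measure lebesgue k) < \<delta>" by auto
    then have "(\<Sum>k\<in>C. \<bar>increment f k\<bar>) < 1" by (intro d(2)[OF C(1)] \<open>\<Union>C \<subseteq> {a..b}\<close>)
    moreover have "2 / m * (\<Sum>k\<in>C. measure lebesgue k) \<le> sum (increment f) C"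
      by (rule sum_increment_ge[OF C(3)])
    moreover have "sum (increment f) C \<le> (\<Sum>k\<in>C. \<bar>increment f k\<bar>)" by (rule sum_mono) auto
    moreover have "2 / m * (\<Sum>k\<in>C. measure lebesgue k) > 1" using C(4) m(1) by (simp add: field_simps)
    ultimately show False by linarith
  qed
  have "E \<subseteq> (\<Union>c\<in>\<rat>. E \<inter> {c<..<c + \<delta>})"
  proof
    fix x assume "x \<in> E"
    moreover obtain c where "c \<in> \<rat>" "x - \<delta> < c" "c < x" using Rats_dense_in_real[of "x - \<delta>" x] d by auto
    ultimately show "x \<in> (\<Union>c\<in>\<rat>. E \<inter> {c<..<c + \<delta>})" by force
  qed
  moreover have "negligible (\<Union>c\<in>\<rat>. E \<inter> {c<..<c + \<delta>})"
    by (intro negligible_countable_Union) (auto simp: countable_rat part)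
  ultimately show ?thesis by (rule negligible_subset[rotated])
qed


lemma abs_continuous_on_uminus:
  "abs_continuous_on S f \<Longrightarrow> abs_continuous_on S (\<lambda>x. - f x)"
  unfolding abs_continuous_on_def by (simp add: abs_minus_commute)

text \<open>Off the exceptional sets, the slopes over all short intervals containing \<open>x\<close>
  accumulate at a single finite value.\<close>

theorem abs_continuous_on_differentiable_AE:
  assumes ac: "abs_continuous_on {a..b} f"
  shows "negligible {x \<in> {a<..<b}. \<not> f differentiable (at x)}"
proof -
  define hi where "hi q = {x \<in> {a<..<b}. \<forall>\<delta>>0. \<exists>u v. u < v \<and> v - u < \<delta> \<and> x \<in> {u..v} \<and> f v - f u \<ge> q * (v - u)}" for q
  define lo where "lo q = {x \<in> {a<..<b}. \<forall>\<delta>>0. \<exists>u v. u < v \<and> v - u < \<delta> \<and> x \<in> {u..v} \<and> f v - f u \<le> q * (v - u)}" for q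
  let ?Q = "{(p, q). p \<in> \<rat> \<and> q \<in> \<rat> \<and> p < (q :: real)}"
  let ?N = "(\<Union>(p, q)\<in>?Q. lo p \<inter> hi q) \<union> (\<Inter>q. hi q) \<union> (\<Inter>q. lo q)"
  have "negligible (lo p \<inter> hi q)" if "p < q" for p q
    by (rule negligible_slope_gap[OF ac _ that]) (auto simp: lo_def hi_def)
  moreover have "countable ?Q"
    by (rule countable_subset[of _ "\<rat> \<times> \<rat>"]) (auto simp: countable_rat)
  ultimately have 1: "negligible (\<Union>(p, q)\<in>?Q. lo p \<inter> hi q)"
    by (intro negligible_countable_Union) auto
  have 2: "negligible (\<Inter>q. hi q)"
    by (rule negligible_infinite_slope[OF ac]) (auto simp: hi_def)
  have 3: "negligible (\<Inter>q. lo q)"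
  proof (rule negligible_infinite_slope[OF abs_continuous_on_uminus[OF ac]])
    fix x \<delta> N :: real assume x: "x \<in> (\<Inter>q. lo q)" and d: "\<delta> > 0"
    then have "x \<in> lo (- N)" by auto
    then obtain u v where "u < v" "v - u < \<delta>" "x \<in> {u..v}" "f v - f u \<le> - N * (v - u)"
      using d unfolding lo_def by blast
    then show "\<exists>u v. u < v \<and> v - u < \<delta> \<and> x \<in> {u..v} \<and> - f v - - f u \<ge> N * (v - u)"
      by (intro exI[of _ u] exI[of _ v]) auto
  qed (auto simp: lo_def)
  have diff: "f differentiable (at x)" if x: "x \<in> {a<..<b}" "x \<notin> ?N" for x
  proof -
    have not_hi: "\<exists>\<delta>>0. \<forall>u v. u < v \<longrightarrow> v - u < \<delta> \<longrightarrow> x \<in> {u..v} \<longrightarrow> f v - f u < q * (v - u)"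
      if nq: "x \<notin> hi q" for q
    proof -
      obtain \<delta> where d: "\<delta> > 0" "\<not> (\<exists>u v. u < v \<and> v - u < \<delta> \<and> x \<in> {u..v} \<and> f v - f u \<ge> q * (v - u))"
        using nq x(1) unfolding hi_def by blast
      show ?thesis
      proof (intro exI[of _ \<delta>] conjI allI impI d(1))
        fix u v assume "u < v" "v - u < \<delta>" "x \<in> {u..v}"
        then have "\<not> (f v - f u \<ge> q * (v - u))" using d(2) by blast
        then show "f v - f u < q * (v - u)" by linarith
      qed
    qed
    have not_lo: "\<exists>\<delta>>0. \<forall>u v. u < v \<longrightarrow> v - u < \<delta> \<longrightarrow> x \<in> {u..v} \<longrightarrow> f v - f u > q * (v - u)"
      if nq: "x \<notin> lo q" for q
    proof -
      obtain \<delta> where d: "\<delta> > 0" "\<not> (\<exists>u v. u < v \<and> v - u < \<delta> \<and> x \<in> {u..v} \<and> f v - f u \<le> q * (v - u))"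
        using nq x(1) unfolding lo_def by blast
      show ?thesis
      proof (intro exI[of _ \<delta>] conjI allI impI d(1))
        fix u v assume "u < v" "v - u < \<delta>" "x \<in> {u..v}"
        then have "\<not> (f v - f u \<le> q * (v - u))" using d(2) by blast
        then show "f v - f u > q * (v - u)" by linarith
      qed
    qed
    have hi_mono: "x \<in> hi p" if "x \<in> hi q" "p \<le> q" for p q
    proof -
      have "p * (v - u) \<le> f v - f u" if "u < v" "q * (v - u) \<le> f v - f u" for u v
        using that \<open>p \<le> q\<close> by (meson diff_ge_0_iff_ge less_imp_le mult_right_mono order_trans)
      then show ?thesis using that(1) unfolding hi_def by blast
    qed
    have lo_or_hi: "x \<in> lo q \<or> x \<in> hi q" for q
    proof (rule ccontr)
      assume "\<not> (x \<in> lo q \<or> x \<in> hi q)"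
      then obtain d1 d2 where "d1 > 0" "d2 > 0"
        "\<And>u v. u < v \<Longrightarrow> v - u < d1 \<Longrightarrow> x \<in> {u..v} \<Longrightarrow> f v - f u < q * (v - u)"
        "\<And>u v. u < v \<Longrightarrow> v - u < d2 \<Longrightarrow> x \<in> {u..v} \<Longrightarrow> f v - f u > q * (v - u)"
        using not_hi[of q] not_lo[of q] by blast
      note d12 = this
      have m: "0 < min d1 d2 / 2" "min d1 d2 / 2 < d1" "min d1 d2 / 2 < d2" using d12(1,2) by auto
      show False using m d12(3)[of x "x + min d1 d2 / 2"] d12(4)[of x "x + min d1 d2 / 2"] by auto
    qed
    obtain q1 q2 where q: "x \<notin> hi q1" "x \<notin> lo q2" using x by auto
    \<comment> \<open>Membership in \<open>hi q\<close> passes to smaller \<open>q\<close>, so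
      \<open>A\<close> is a half-line of slopes, and its endpoint \<open>D\<close> is the
      derivative.\<close>
    define A where "A = {q. x \<in> hi q}"
    have A: "A \<noteq> {}" "bdd_above A"
      using q lo_or_hi hi_mono by (auto simp: A_def bdd_above_def) (meson linear)
    define D where "D = Sup A"
    have up: "x \<notin> hi q" if "q > D" for q
      using that cSup_upper[OF _ A(2), of q] by (auto simp: D_def A_def)
    have dn: "x \<notin> lo p" if pD: "p < D" for p
    proof
      assume lp: "x \<in> lo p"
      obtain r where r: "r \<in> A" "p < r" using pD less_cSup_iff[OF A] by (auto simp: D_def)
      \<comment> \<open>Two rationals between \<open>p\<close> and \<open>r\<close> put
        \<open>x\<close> into \<open>lo p' \<inter> hi q'\<close> with \<open>p' < q'\<close>, which
        is one of the countably many excluded sets.\<close>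
      obtain p' where p': "p' \<in> \<rat>" "p < p'" "p' < r" using Rats_dense_in_real[OF r(2)] by auto
      obtain q' where q': "q' \<in> \<rat>" "p' < q'" "q' < r" using Rats_dense_in_real[OF p'(3)] by auto
      have "x \<in> hi q'" using hi_mono[of r q'] r q' by (auto simp: A_def)
      moreover have "x \<in> lo p'"
      proof -
        have "f v - f u \<le> p' * (v - u)" if "u < v" "f v - f u \<le> p * (v - u)" for u v
          using that p'(2) by (meson diff_ge_0_iff_ge less_imp_le mult_right_mono order_trans)
        then show ?thesis using lp unfolding lo_def by blast
      qed
      ultimately show False using x(2) p' q' by auto
    qed
    have "(f has_real_derivative D) (at x)"
      unfolding has_field_derivative_def has_derivative_at_alt
    proof (intro conjI allI impI bounded_linear_mult_right)
      fix e :: real assume e: "e > 0"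
      obtain d1 where d1: "d1 > 0" "\<And>u v. u < v \<Longrightarrow> v - u < d1 \<Longrightarrow> x \<in> {u..v} \<Longrightarrow> f v - f u < (D + e) * (v - u)"
        using not_hi[OF up, of "D + e"] e by auto
      obtain d2 where d2: "d2 > 0" "\<And>u v. u < v \<Longrightarrow> v - u < d2 \<Longrightarrow> x \<in> {u..v} \<Longrightarrow> f v - f u > (D - e) * (v - u)"
        using not_lo[OF dn, of "D - e"] e by auto
      have "norm (f y - f x - D * (y - x)) \<le> e * norm (y - x)" if y: "norm (y - x) < min d1 d2" for y
      proof (cases y x rule: linorder_cases)
        case less
        then have "f x - f y < (D + e) * (x - y)" "f x - f y > (D - e) * (x - y)"
          using d1(2)[of y x] d2(2)[of y x] y by auto
        then show ?thesis using less by (simp add: algebra_simps abs_le_iff)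
      next
        case greater
        then have "f y - f x < (D + e) * (y - x)" "f y - f x > (D - e) * (y - x)"
          using d1(2)[of x y] d2(2)[of x y] y by auto
        then show ?thesis using greater by (simp add: algebra_simps abs_le_iff)
      qed auto
      then show "\<exists>d>0. \<forall>y. norm (y - x) < d \<longrightarrow> norm (f y - f x - D * (y - x)) \<le> e * norm (y - x)"
        using d1(1) d2(1) by (intro exI[of _ "min d1 d2"]) auto
    qed
    then show ?thesis by (auto simp: real_differentiable_def)
  qed
  have "negligible ?N" using 1 2 3 by auto
  then show ?thesis by (rule negligible_subset) (use diff in blast)
qed

section \<open>Continuity and the fundamental theorem of calculus\<close>

lemma abs_continuous_on_imp_continuous_on:
  assumes ac: "abs_continuous_on {a..b} f"
  shows "continuous_on {a..b} f"
  unfolding continuous_on_iff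
proof (intro ballI allI impI)
  fix x e :: real assume x: "x \<in> {a..b}" and e: "e > 0"
  obtain \<delta> where d: "\<delta> > 0"
    "\<And>\<D>. \<lbrakk>\<D> division_of \<Union>\<D>; \<Union>\<D> \<subseteq> {a..b}; (\<Sum>k\<in>\<D>. measure lebesgue k) < \<delta>\<rbrakk>
       \<Longrightarrow> (\<Sum>k\<in>\<D>. \<bar>increment f k\<bar>) < e"
    using abs_continuous_on_sum_increment[OF ac e] by metis
  have *: "\<bar>f v - f u\<bar> < e" if "u \<le> v" "v - u < \<delta>" "u \<in> {a..b}" "v \<in> {a..b}" for u v
  proof -
    have "{{u..v}} division_of \<Union>{{u..v}}"
      using that(1) by (metis box_real(2) division_of_self atLeastatMost_empty_iff2 ccpo_Sup_singleton)
    from d(2)[OF this] that show ?thesis by auto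
  qed
  show "\<exists>d>0. \<forall>x'\<in>{a..b}. dist x' x < d \<longrightarrow> dist (f x') (f x) < e"
  proof (intro exI[of _ \<delta>] conjI ballI impI d(1))
    fix y assume "y \<in> {a..b}" "dist y x < \<delta>"
    then show "dist (f y) (f x) < e"
      using *[of x y] *[of y x] x by (cases "x \<le> y") (auto simp: dist_real_def abs_minus_commute)
  qed
qed

text \<open>The gauge integral asks for no prior integrability of \<open>f'\<close>. Cells tagged in
  the null set stay inside an open set of measure below \<open>\<delta>\<close>, so absolute
  continuity makes their increments small; on the other cells the derivative at the tag predicts the
  increment up to \<open>e'\<close> times the length.\<close>

theorem abs_continuous_on_has_integral:
  assumes ac: "abs_continuous_on {a..b} f" and ab: "a \<le> b" and N: "negligible N"
    and der: "\<And>x. x \<in> {a<..<b} - N \<Longrightarrow> (f has_real_derivative f' x) (at x)"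
  shows "(f' has_integral f b - f a) {a..b}"
proof -
  \<comment> \<open>The endpoints join the null set because the derivative is given only in the open
    interval; tags in \<open>M\<close> get the value 0.\<close>
  define M where "M = N \<union> {a, b}"
  define g where "g x = (if x \<in> M then 0 else f' x)" for x
  have M: "negligible M" using N by (auto simp: M_def)
  have "(g has_integral f b - f a) (cbox a b)"
    unfolding has_integral
  proof (intro allI impI)
    fix e :: real assume e: "e > 0"
    define e' where "e' = e / (2 * (b - a + 1))"
    have e': "e' > 0" "e' * (b - a) < e / 2" using e ab by (auto simp: e'_def field_simps)
    have e2: "e / 2 > 0" using e by simp
    obtain \<delta> where d: "\<delta> > 0"
      "\<And>\<D>. \<lbrakk>\<D> division_of \<Union>\<D>; \<Union>\<D> \<subseteq> {a..b}; (\<Sum>k\<in>\<D>. measure lebesgue k) < \<delta>\<rbrakk>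
         \<Longrightarrow> (\<Sum>k\<in>\<D>. \<bar>increment f k\<bar>) < e / 2"
      using abs_continuous_on_sum_increment[OF ac e2] by metis
    have Ms: "M \<in> null_sets lebesgue" using M by (simp add: negligible_iff_null_sets)
    obtain T where T: "open T" "M \<subseteq> T" "T - M \<in> lmeasurable" "emeasure lebesgue (T - M) < ennreal \<delta>"
      using sets_lebesgue_outer_open[OF null_setsD2[OF Ms] d(1)] by auto
    have TM: "T = (T - M) \<union> M" using T by auto
    have Tm: "T \<in> lmeasurable"
      by (subst TM) (intro fmeasurable.Un T(3) negligible_imp_measurable M)
    have "measure lebesgue T = measure lebesgue (T - M)"
      by (subst TM) (rule measure_Un_null_set[OF fmeasurableD[OF T(3)] Ms])
    also have "\<dots> < \<delta>" using T(3,4) d by (simp add: emeasure_eq_measure2 ennreal_less_iff)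
    finally have mT: "measure lebesgue T < \<delta>" .
    have "\<exists>r>0. \<forall>y. \<bar>y - x\<bar> < r \<longrightarrow> (if x \<in> M then y \<in> T else x \<in> {a<..<b} \<longrightarrow> \<bar>f y - f x - f' x * (y - x)\<bar> \<le> e' * \<bar>y - x\<bar>)" for x
    proof (cases "x \<in> M")
      case True
      have "x \<in> T" using True T(2) by auto
      then obtain d where "d > 0" "\<forall>y. \<bar>y - x\<bar> < d \<longrightarrow> y \<in> T"
        using T(1) unfolding open_real by blast
      then show ?thesis using True by auto
    next
      case False
      show ?thesis
      proof (cases "x \<in> {a<..<b}")
        case x: True
        then have "(f has_real_derivative f' x) (at x)" using der False by (auto simp: M_def)
        then show ?thesis using e'(1) x False
          unfolding has_field_derivative_def has_derivative_at_alt by auto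
      qed (use False in \<open>auto intro: exI[of _ 1]\<close>)
    qed
    then obtain r where r: "\<And>x. r x > 0" "\<And>x y. \<bar>y - x\<bar> < r x \<Longrightarrow>
      (if x \<in> M then y \<in> T else x \<in> {a<..<b} \<longrightarrow> \<bar>f y - f x - f' x * (y - x)\<bar> \<le> e' * \<bar>y - x\<bar>)" by metis
    show "\<exists>\<gamma>. gauge \<gamma> \<and> (\<forall>\<D>. \<D> tagged_division_of cbox a b \<and> \<gamma> fine \<D> \<longrightarrow>
            norm ((\<Sum>(x, k)\<in>\<D>. measure lborel k *\<^sub>R g x) - (f b - f a)) < e)"
    proof (intro exI[of _ "\<lambda>x. ball x (r x)"] conjI allI impI gauge_ball_dependent ballI r(1), elim conjE)
      fix \<D> assume D: "\<D> tagged_division_of cbox a b" and fine: "(\<lambda>x. ball x (r x)) fine \<D>"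
      note tD = tagged_division_ofD[OF D]
      have incr: "f b - f a = (\<Sum>(x, k)\<in>\<D>. f (Sup k) - f (Inf k))"
        using additive_tagged_division_1[OF ab, of \<D> f] D by simp
      let ?h = "\<lambda>(x, k). measure lborel k * g x - (f (Sup k) - f (Inf k))"
      let ?A = "{(x, k) \<in> \<D>. x \<in> M}" and ?B = "{(x, k) \<in> \<D>. x \<notin> M}"
      have finA: "finite ?A" "finite ?B" by (auto intro: finite_subset[OF _ tD(1)])
      have "(\<Sum>(x, k)\<in>\<D>. measure lborel k *\<^sub>R g x) - (f b - f a) = sum ?h \<D>"
        unfolding incr by (simp add: sum_subtractf[symmetric] case_prod_beta)
      also have "sum ?h \<D> = sum ?h (?A \<union> ?B)" by (rule arg_cong[where f = "sum ?h"]) auto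
      also have "\<dots> = sum ?h ?A + sum ?h ?B"
        by (rule sum.union_disjoint) (use finA in auto)
      finally have eq: "(\<Sum>(x, k)\<in>\<D>. measure lborel k *\<^sub>R g x) - (f b - f a) = sum ?h ?A + sum ?h ?B" .
      have kk: "\<exists>u v. k = {u..v} \<and> u \<le> v \<and> x \<in> {u..v} \<and> a \<le> u \<and> v \<le> b \<and> {u..v} \<subseteq> ball x (r x)" if xk: "(x, k) \<in> \<D>" for x k
      proof -
        obtain u v where "k = cbox u v" using tD(4)[OF xk] by auto
        then show ?thesis using tD(2,3)[OF xk] fineD[OF fine xk] by (intro exI[of _ u] exI[of _ v]) auto
      qed
      have "\<bar>sum ?h ?A\<bar> < e / 2"
      proof -
        have A: "?A tagged_partial_division_of cbox a b"
          by (rule tagged_partial_division_subset[of \<D>]) (use D in \<open>auto simp: tagged_division_of_def\<close>)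
        have "\<bar>sum ?h ?A\<bar> \<le> (\<Sum>(x, k)\<in>?A. \<bar>increment f k\<bar>)"
          by (rule order_trans[OF sum_abs sum_mono]) (use kk in \<open>force simp: g_def\<close>)
        also have "\<dots> = (\<Sum>k\<in>snd ` ?A. \<bar>increment f k\<bar>)"
          by (rule sum.over_tagged_division_lemma[OF tagged_partial_division_of_Union_self[OF A]])
            (auto simp: increment_def)
        also have "\<dots> < e / 2"
        proof (rule d(2)[OF partial_division_of_tagged_division[OF A]])
          show "\<Union>(snd ` ?A) \<subseteq> {a..b}" using kk by force
          have "\<Union>(snd ` ?A) \<subseteq> T"
          proof clarsimp
            fix y x k assume k: "(x, k) \<in> \<D>" "x \<in> M" "y \<in> k"
            then have "y \<in> ball x (r x)" using kk[OF k(1)] by auto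
            then show "y \<in> T" using r(2)[of y x] k(2) by (auto simp: dist_real_def abs_minus_commute)
          qed
          then show "(\<Sum>k\<in>snd ` ?A. measure lebesgue k) < \<delta>"
            using sum_measure_family_le[OF partial_division_of_tagged_division[OF A] _ Tm] mT by linarith
        qed
        finally show ?thesis .
      qed
      moreover have "\<bar>sum ?h ?B\<bar> < e / 2"
      proof -
        have "\<bar>sum ?h ?B\<bar> \<le> (\<Sum>(x, k)\<in>?B. e' * measure lborel k)"
        proof (rule order_trans[OF sum_abs sum_mono], clarify)
          fix x k assume xk: "(x, k) \<in> \<D>" "x \<notin> M"
          obtain u v where uv: "k = {u..v}" "u \<le> v" "x \<in> {u..v}" "a \<le> u" "v \<le> b" "{u..v} \<subseteq> ball x (r x)"
            using kk[OF xk(1)] by auto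
          have xab: "x \<in> {a<..<b}" using uv xk(2) by (auto simp: M_def less_le)
          have "u \<in> ball x (r x)" "v \<in> ball x (r x)" by (rule subsetD[OF uv(6)], use uv in simp)+
          then have "\<bar>u - x\<bar> < r x" "\<bar>v - x\<bar> < r x" by (auto simp: dist_real_def)
          then have "\<bar>f u - f x - f' x * (u - x)\<bar> \<le> e' * (x - u)" "\<bar>f v - f x - f' x * (v - x)\<bar> \<le> e' * (v - x)"
            using r(2)[of u x] r(2)[of v x] xab xk(2) uv(3) by auto
          moreover have "f' x * (v - x) - f' x * (u - x) = f' x * (v - u)" "e' * (x - u) + e' * (v - x) = e' * (v - u)"
            by (auto simp: algebra_simps)
          ultimately have "\<bar>f' x * (v - u) - (f v - f u)\<bar> \<le> e' * (v - u)" by linarith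
          then show "\<bar>measure lborel k * g x - (f (Sup k) - f (Inf k))\<bar> \<le> e' * measure lborel k"
            using uv xk(2) by (simp add: g_def mult.commute)
        qed
        also have "\<dots> \<le> (\<Sum>(x, k)\<in>\<D>. e' * measure lborel k)"
          by (rule sum_mono2[OF tD(1)]) (use e' in \<open>auto intro!: mult_nonneg_nonneg\<close>)
        also have "\<dots> = e' * (b - a)"
          using additive_content_tagged_division[OF D] ab
          by (simp add: sum_distrib_left[symmetric] case_prod_beta)
        finally show ?thesis using e' by simp
      qed
      ultimately show "norm ((\<Sum>(x, k)\<in>\<D>. measure lborel k *\<^sub>R g x) - (f b - f a)) < e"
        unfolding eq by simp
    qed
  qed
  moreover have "(g has_integral f b - f a) (cbox a b) \<longleftrightarrow> (f' has_integral f b - f a) (cbox a b)"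
    by (rule has_integral_spike_eq[OF M]) (auto simp: g_def)
  ultimately show ?thesis by simp
qed

section \<open>Closed forms with compact sublevel sets\<close>

text \<open>Replace each point of the closure by a point of \<open>S\<close> within
  \<open>1 / (n + 1)\<close>; along the subsequence both have the same limit, which may lie outside
  \<open>S\<close>.\<close>

lemma compact_closure_sequentially:
  fixes S :: "'a::metric_space set"
  assumes "\<And>U. (\<And>n. U n \<in> S) \<Longrightarrow> \<exists>l r. strict_mono (r :: nat \<Rightarrow> nat) \<and> (U \<circ> r) \<longlonglongrightarrow> l"
  shows "compact (closure S)"
  unfolding compact_eq_seq_compact_metric seq_compact_def
proof (intro allI impI)
  fix V :: "nat \<Rightarrow> 'a" assume V: "\<forall>n. V n \<in> closure S"
  then have "\<forall>n. \<exists>u\<in>S. dist u (V n) < inverse (real (Suc n))"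
    by (simp add: closure_approachable)
  then obtain U where U: "\<And>n. U n \<in> S" "\<And>n. dist (U n) (V n) < inverse (real (Suc n))" by metis
  obtain l r where r: "strict_mono r" "(U \<circ> r) \<longlonglongrightarrow> l" using assms[of U] U(1) by blast
  have "(\<lambda>n. dist ((U \<circ> r) n) ((V \<circ> r) n)) \<longlonglongrightarrow> 0"
  proof (rule Lim_null_comparison)
    show "\<forall>\<^sub>F n in sequentially. norm (dist ((U \<circ> r) n) ((V \<circ> r) n)) \<le> inverse (real (Suc (r n)))"
    proof (intro always_eventually allI)
      fix n show "norm (dist ((U \<circ> r) n) ((V \<circ> r) n)) \<le> inverse (real (Suc (r n)))"
        using U(2)[of "r n"] by simp
    qed
    show "(\<lambda>n. inverse (real (Suc (r n)))) \<longlonglongrightarrow> 0"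
      using LIMSEQ_subseq_LIMSEQ[OF LIMSEQ_inverse_real_of_nat r(1)] by (simp add: comp_def)
  qed
  from tendsto_add[OF this tendsto_dist_iff[THEN iffD1, OF r(2)]]
  have s: "(\<lambda>n. dist ((U \<circ> r) n) ((V \<circ> r) n) + dist ((U \<circ> r) n) l) \<longlonglongrightarrow> 0" by simp
  have "(\<lambda>n. dist ((V \<circ> r) n) l) \<longlonglongrightarrow> 0"
  proof (rule Lim_null_comparison[OF _ s], intro always_eventually allI)
    fix n show "norm (dist ((V \<circ> r) n) l) \<le> dist ((U \<circ> r) n) ((V \<circ> r) n) + dist ((U \<circ> r) n) l"
      using dist_triangle3[of "(V \<circ> r) n" l "(U \<circ> r) n"] by simp
  qed
  then have "(V \<circ> r) \<longlonglongrightarrow> l" by (rule tendsto_dist_iff[THEN iffD2])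
  moreover have "l \<in> closure S"
  proof (rule closed_sequentially[OF closed_closure _ r(2)])
    show "(U \<circ> r) n \<in> closure S" for n using U(1)[of "r n"] closure_subset[of S] by auto
  qed
  ultimately show "\<exists>l\<in>closure S. \<exists>r. strict_mono r \<and> (V \<circ> r) \<longlonglongrightarrow> l" using r(1) by blast
qed

lemma eq_0_if_orthogonal_to_dense:
  fixes w :: "'a::real_inner"
  assumes "w \<in> closure D" "\<And>f. f \<in> D \<Longrightarrow> inner f w = 0"
  shows "w = 0"
proof -
  have "closure D \<subseteq> {x. inner w x = 0}"
    by (rule closure_minimal[OF _ closed_hyperplane]) (use assms(2) in \<open>auto simp: inner_commute\<close>)
  then show ?thesis using assms(1) by auto
qed

text \<open>Taking adjoints reverses inclusions, and both operators are their own adjoints.\<close>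

lemma self_adjoint_in_maximal:
  assumes "self_adjoint_in X H" "self_adjoint_in X H'" "H' \<subseteq> H"
  shows "H' = H"
proof -
  have "adjoint_in X H \<subseteq> adjoint_in X H'" using assms(3) by (auto simp: adjoint_in_def)
  then show ?thesis using assms by (auto simp: self_adjoint_in_def)
qed

section \<open>Closed coercive forms\<close>

text \<open>Completeness is required of \<open>D\<close> in the form norm rather than of the ambient
  type; this is what the minimization in \<open>representer\<close> uses. \<open>p\<close> is
  thought of as already shifted, so that it dominates the inner product.\<close>

locale closed_form =
  fixes D :: "'a::real_inner set" and p :: "'a \<Rightarrow> 'a \<Rightarrow> real"
  assumes D: "subspace D"
    and sym: "\<lbrakk>u \<in> D; v \<in> D\<rbrakk> \<Longrightarrow> p u v = p v u"
    and add: "\<lbrakk>u \<in> D; v \<in> D; w \<in> D\<rbrakk> \<Longrightarrow> p (u + v) w = p u w + p v w"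
    and scale: "\<lbrakk>u \<in> D; v \<in> D\<rbrakk> \<Longrightarrow> p (c *\<^sub>R u) v = c * p u v"
    and coercive: "u \<in> D \<Longrightarrow> inner u u \<le> p u u"
    and closed: "\<lbrakk>\<And>n. U n \<in> D; \<And>e. e > 0 \<Longrightarrow> \<exists>N. \<forall>m\<ge>N. \<forall>n\<ge>N. p (U m - U n) (U m - U n) < e\<rbrakk>
      \<Longrightarrow> \<exists>u\<in>D. (\<lambda>n. p (U n - u) (U n - u)) \<longlonglongrightarrow> 0"
begin

lemma add_right: "\<lbrakk>u \<in> D; v \<in> D; w \<in> D\<rbrakk> \<Longrightarrow> p w (u + v) = p w u + p w v"
  using add sym subspace_add[OF D] by metis

lemma scale_right: "\<lbrakk>u \<in> D; v \<in> D\<rbrakk> \<Longrightarrow> p v (c *\<^sub>R u) = c * p v u"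
  using scale sym subspace_scale[OF D] by metis

lemma nonneg: "u \<in> D \<Longrightarrow> p u u \<ge> 0"
  using coercive inner_ge_zero order_trans by blast

lemma expand:
  assumes "u \<in> D" "v \<in> D"
  shows "p (u + c *\<^sub>R v) (u + c *\<^sub>R v) = p u u + 2 * c * p u v + c\<^sup>2 * p v v"
proof -
  have "c *\<^sub>R v \<in> D" "u + c *\<^sub>R v \<in> D" using assms D by (auto intro: subspace_add subspace_scale)
  then show ?thesis using assms
    by (simp add: add add_right scale scale_right sym[of v u] power2_eq_square algebra_simps)
qed

lemma diff_expand:
  assumes "u \<in> D" "v \<in> D"
  shows "p (u - v) (u - v) = p u u - 2 * p u v + p v v"
  using expand[OF assms, of "-1"] by simp

lemma Cauchy_Schwarz:
  assumes u: "u \<in> D" and v: "v \<in> D"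
  shows "(p u v)\<^sup>2 \<le> p u u * p v v"
proof (cases "p v v = 0")
  case True
  have "p u v = 0"
  proof (rule ccontr)
    assume nz: "p u v \<noteq> 0"
    \<comment> \<open>As \<open>p v v = 0\<close>, the value of the form at this vector is exactly
      -1.\<close>
    have "u + (- (p u u + 1) / (2 * p u v)) *\<^sub>R v \<in> D" using u v D by (auto intro: subspace_add subspace_scale)
    from nonneg[OF this] show False
      unfolding expand[OF u v] using True nz by (simp add: field_simps)
  qed
  then show ?thesis using True by simp
next
  case False
  then have pos: "p v v > 0" using nonneg[OF v] by simp
  have "u + (- p u v / p v v) *\<^sub>R v \<in> D" using u v D by (auto intro: subspace_diff subspace_scale)
  from nonneg[OF this] have "0 \<le> p u u - (p u v)\<^sup>2 / p v v"
    unfolding expand[OF u v] using pos by (simp add: field_simps power2_eq_square)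
  then show ?thesis using pos by (simp add: field_simps)
qed

text \<open>The minimizer of \<open>p u u - 2 * inner u z\<close>; minimizing sequences are Cauchy by the
  parallelogram law.\<close>

lemma representer: "\<exists>u\<in>D. \<forall>f\<in>D. p f u = inner f z"
proof -
  define F where "F u = p u u - 2 * inner u z" for u
  have lower: "F u \<ge> - inner z z" if "u \<in> D" for u
  proof -
    have "0 \<le> inner (u - z) (u - z)" by simp
    then have "2 * inner u z \<le> inner u u + inner z z"
      by (simp add: inner_diff_left inner_diff_right inner_commute)
    then show ?thesis using coercive[OF that] by (simp add: F_def)
  qed
  have D0: "0 \<in> D" using D by (rule subspace_0)
  have bdd: "bdd_below (F ` D)" using lower by (auto intro: bdd_belowI[of _ "- inner z z"])
  define m where "m = Inf (F ` D)"
  have mle: "m \<le> F u" if "u \<in> D" for u unfolding m_def using that bdd by (intro cINF_lower)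
  have "\<exists>u\<in>D. F u < m + inverse (real (Suc n))" for n
  proof -
    have "F ` D \<noteq> {}" using D0 by auto
    from cInf_less_iff[OF this bdd, of "m + inverse (real (Suc n))"] show ?thesis
      by (simp add: m_def)
  qed
  then obtain U where U: "\<And>n. U n \<in> D" "\<And>n. F (U n) < m + inverse (real (Suc n))" by metis
  have par: "p (U i - U j) (U i - U j) < 2 * inverse (real (Suc i)) + 2 * inverse (real (Suc j))" for i j
  proof -
    let ?w = "(1/2) *\<^sub>R (U i + (1::real) *\<^sub>R U j)"
    have w: "?w \<in> D" "U i + 1 *\<^sub>R U j \<in> D" using U D by (auto intro!: subspace_add subspace_scale)
    have P: "p ?w ?w = (p (U i) (U i) + 2 * p (U i) (U j) + p (U j) (U j)) / 4"
      using expand[OF U(1) U(1), of i 1 j] w by (simp add: scale scale_right)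
    have I: "inner ?w z = (inner (U i) z + inner (U j) z) / 2" by (simp add: inner_add_left)
    have "4 * F ?w = p (U i) (U i) + 2 * p (U i) (U j) + p (U j) (U j) - 4 * (inner (U i) z + inner (U j) z)"
      unfolding F_def P I by (simp add: field_simps)
    then have "p (U i - U j) (U i - U j) = 2 * F (U i) + 2 * F (U j) - 4 * F ?w"
      using diff_expand[OF U(1) U(1), of i j] by (simp add: F_def)
    then show ?thesis using mle[OF w(1)] U(2)[of i] U(2)[of j] by linarith
  qed
  have "\<exists>N. \<forall>m\<ge>N. \<forall>n\<ge>N. p (U m - U n) (U m - U n) < e" if e: "e > 0" for e
  proof -
    obtain N where N: "inverse (real (Suc N)) < e / 4" using reals_Archimedean[of "e / 4"] e by auto
    have *: "inverse (real (Suc m)) < e / 4" if "m \<ge> N" for m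
      using N that by (smt (verit) le_imp_inverse_le of_nat_0_less_iff of_nat_le_iff Suc_le_mono zero_less_Suc)
    show ?thesis
    proof (intro exI[of _ N] allI impI)
      fix m n assume "m \<ge> N" "n \<ge> N"
      then show "p (U m - U n) (U m - U n) < e" using *[of m] *[of n] par[of m n] by linarith
    qed
  qed
  from closed[OF U(1) this] obtain u where u: "u \<in> D" "(\<lambda>n. p (U n - u) (U n - u)) \<longlonglongrightarrow> 0" by blast
  have dU: "U n - u \<in> D" for n using U(1) u(1) D by (auto intro: subspace_diff)
  have F_lim: "(\<lambda>n. F (U n)) \<longlonglongrightarrow> F u"
  proof -
    have sq: "(\<lambda>n. sqrt (p u u * p (U n - u) (U n - u))) \<longlonglongrightarrow> 0"
      using tendsto_real_sqrt[OF tendsto_mult_right_zero[OF u(2)], of "p u u"] by simp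
    have "(\<lambda>n. p u (U n - u)) \<longlonglongrightarrow> 0"
    proof (rule Lim_null_comparison[OF _ sq], rule always_eventually, rule allI)
      fix n show "norm (p u (U n - u)) \<le> sqrt (p u u * p (U n - u) (U n - u))"
        using Cauchy_Schwarz[OF u(1) dU, of n] real_le_rsqrt[of "\<bar>p u (U n - u)\<bar>"] by simp
    qed
    moreover have "(\<lambda>n. inner (U n - u) z) \<longlonglongrightarrow> 0"
    proof -
      have sq: "(\<lambda>n. sqrt (p (U n - u) (U n - u)) * norm z) \<longlonglongrightarrow> 0"
        using tendsto_mult[OF tendsto_real_sqrt[OF u(2)] tendsto_const[of "norm z"]] by simp
      show ?thesis
      proof (rule Lim_null_comparison[OF _ sq], rule always_eventually, rule allI)
        fix n
        have "norm (inner (U n - u) z) \<le> norm (U n - u) * norm z" using Cauchy_Schwarz_ineq2[of "U n - u" z] by simp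
        also have "\<dots> \<le> sqrt (p (U n - u) (U n - u)) * norm z"
          using coercive[OF dU, of n] by (intro mult_right_mono) (auto simp: norm_eq_sqrt_inner)
        finally show "norm (inner (U n - u) z) \<le> sqrt (p (U n - u) (U n - u)) * norm z" .
      qed
    qed
    ultimately have "(\<lambda>n. F u + p (U n - u) (U n - u) + 2 * p u (U n - u) - 2 * inner (U n - u) z) \<longlonglongrightarrow> F u + 0 + 2 * 0 - 2 * 0"
      using u(2) by (intro tendsto_intros)
    moreover have "F (U n) = F u + p (U n - u) (U n - u) + 2 * p u (U n - u) - 2 * inner (U n - u) z" for n
      using expand[OF u(1) dU, of 1 n] by (simp add: F_def inner_diff_left)
    ultimately show ?thesis by simp
  qed
  have Fu: "F u \<le> m"
  proof (rule LIMSEQ_le[OF F_lim])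
    show "(\<lambda>n. m + inverse (real (Suc n))) \<longlonglongrightarrow> m" using LIMSEQ_inverse_real_of_nat_add .
    show "\<exists>N. \<forall>n\<ge>N. F (U n) \<le> m + inverse (real (Suc n))" using U(2) less_imp_le by blast
  qed
  show ?thesis
  proof (rule bexI[OF _ u(1)], rule ballI)
    fix f assume f: "f \<in> D"
    define d where "d = p u f - inner f z"
    have "F u \<le> F (u + t *\<^sub>R f)" for t
    proof -
      have "u + t *\<^sub>R f \<in> D" using u(1) f D by (auto intro: subspace_add subspace_scale)
      then show ?thesis using Fu mle by (meson order_trans)
    qed
    then have q: "0 \<le> 2 * t * d + t\<^sup>2 * p f f" for t
      unfolding F_def expand[OF u(1) f] by (simp add: d_def inner_add_left algebra_simps)
    have "d = 0"
    proof (rule ccontr)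
      assume nz: "d \<noteq> 0"
      \<comment> \<open>Any number above half of \<open>p f f\<close> and positive would do: at
        \<open>t = - d / r\<close> the quadratic in \<open>q\<close> takes the value
        \<open>(d / r)^2 * (p f f - 2 * r)\<close>, which is then negative.\<close>
      define r where "r = p f f + 1"
      have r: "r > 0" "p f f - 2 * r < 0" using nonneg[OF f] by (auto simp: r_def)
      have "2 * (- d / r) * d + (- d / r)\<^sup>2 * p f f = (d / r)\<^sup>2 * (p f f - 2 * r)"
        using r(1) by (simp add: field_simps power2_eq_square)
      moreover have "(d / r)\<^sup>2 > 0" using nz r(1) by simp
      ultimately have "2 * (- d / r) * d + (- d / r)\<^sup>2 * p f f < 0" using r(2) by (simp add: mult_pos_neg)
      then show False using q[of "- d / r"] by simp
    qed
    then show "p f u = inner f z" using sym[OF f u(1)] by (simp add: d_def)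
  qed
qed

text \<open>Solving for the shifted form gives the resolvent further to the left, which approximates
  the identity in the proof that the operator domain is dense. By coercivity \<open>p\<close>
  dominates the added term, so convergence in the form norm keeps its meaning.\<close>

lemma shifted: "k \<ge> 0 \<Longrightarrow> closed_form D (\<lambda>u v. p u v + k * inner u v)"
proof
  fix U :: "nat \<Rightarrow> 'a" assume k: "k \<ge> 0" and U: "\<And>n. U n \<in> D"
    and C: "\<And>e. e > 0 \<Longrightarrow> \<exists>N. \<forall>m\<ge>N. \<forall>n\<ge>N. p (U m - U n) (U m - U n) + k * inner (U m - U n) (U m - U n) < e"
  have "\<exists>N. \<forall>m\<ge>N. \<forall>n\<ge>N. p (U m - U n) (U m - U n) < e" if "e > 0" for e
    using C[OF that] k by (smt (verit) inner_ge_zero mult_nonneg_nonneg)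
  from closed[OF U this] obtain u where u: "u \<in> D" "(\<lambda>n. p (U n - u) (U n - u)) \<longlonglongrightarrow> 0" by blast
  have dU: "U n - u \<in> D" for n using U u(1) D by (auto intro: subspace_diff)
  have "(\<lambda>n. inner (U n - u) (U n - u)) \<longlonglongrightarrow> 0"
    by (rule Lim_null_comparison[OF _ u(2)]) (use coercive[OF dU] in auto)
  from tendsto_add[OF u(2) tendsto_mult_right_zero[OF this, of k]] u(1)
  show "\<exists>u\<in>D. (\<lambda>n. p (U n - u) (U n - u) + k * inner (U n - u) (U n - u)) \<longlonglongrightarrow> 0" by auto
next
  fix u assume "k \<ge> 0" "u \<in> D"
  then show "inner u u \<le> p u u + k * inner u u" using coercive[of u] by (simp add: add_increasing2)
qed (use D in \<open>auto simp: sym add scale inner_commute inner_add_left algebra_simps\<close>)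

end

section \<open>The operator of a form with compact sublevel sets\<close>

text \<open>The relation of the first representation theorem: \<open>u\<close> is in the domain if
  \<open>q f u\<close>, as a functional of \<open>f\<close>, is given by a vector \<open>v\<close>.
  Restricting \<open>v\<close> to \<open>X\<close> makes it unique once \<open>D\<close> is dense in
  \<open>X\<close>.\<close>

definition form_operator :: "'a::real_inner set \<Rightarrow> 'a set \<Rightarrow> ('a \<Rightarrow> 'a \<Rightarrow> real) \<Rightarrow> ('a \<times> 'a) set" where
  "form_operator X D q = {(u, v). u \<in> D \<and> v \<in> X \<and> (\<forall>f\<in>D. inner f v = q f u)}"

text \<open>\<open>q\<close> itself is only bounded below; the form with \<open>c\<close> times the
  inner product added is the coercive one. \<open>relatively_compact\<close> says that the unit ball
  of the form norm is relatively compact in the ambient norm.\<close>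

locale compact_form = closed_form D "\<lambda>u v. q u v + c * inner u v"
  for D :: "'a::real_inner set" and q :: "'a \<Rightarrow> 'a \<Rightarrow> real" and c :: real +
  fixes X :: "'a set"
  assumes X: "subspace X" and DX: "D \<subseteq> X" and dense: "X \<subseteq> closure D"
    and relatively_compact: "\<lbrakk>\<And>n. U n \<in> D; \<And>n. q (U n) (U n) + c * inner (U n) (U n) \<le> 1\<rbrakk>
      \<Longrightarrow> \<exists>l r. strict_mono (r :: nat \<Rightarrow> nat) \<and> (U \<circ> r) \<longlonglongrightarrow> l"
begin

abbreviation "H \<equiv> form_operator X D q"

lemma q_sym: "\<lbrakk>u \<in> D; v \<in> D\<rbrakk> \<Longrightarrow> q u v = q v u"
  using sym[of u v] by (simp add: inner_commute)

text \<open>Writing \<open>z\<close> for \<open>(H + c) u\<close> turns the defining identity into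
  one for the coercive form, which \<open>representer\<close> solves for every
  \<open>z\<close>.\<close>

lemma mem_H_iff:
  "(u, z - c *\<^sub>R u) \<in> H \<longleftrightarrow> u \<in> D \<and> z \<in> X \<and> (\<forall>f\<in>D. q f u + c * inner f u = inner f z)"
proof -
  have "z - c *\<^sub>R u \<in> X \<longleftrightarrow> z \<in> X" if "u \<in> D"
  proof -
    have "c *\<^sub>R u \<in> X" using that DX X by (auto intro: subspace_scale)
    then show ?thesis using X by (metis diff_add_cancel subspace_add subspace_diff)
  qed
  then show ?thesis by (auto simp: form_operator_def inner_diff_right algebra_simps)
qed

lemma ex_H: "z \<in> X \<Longrightarrow> \<exists>u. (u, z - c *\<^sub>R u) \<in> H"
  using representer[of z] by (auto simp: mem_H_iff)

lemma orthogonal_X: "\<lbrakk>w \<in> X; \<And>f. f \<in> D \<Longrightarrow> inner f w = 0\<rbrakk> \<Longrightarrow> w = 0"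
  using eq_0_if_orthogonal_to_dense[of w D] dense by auto

lemma operator_in_H: "operator_in X H"
  unfolding operator_in_def
proof (intro conjI)
  show "H \<subseteq> X \<times> X" using DX by (auto simp: form_operator_def)
  show "subspace H"
  proof (rule subspaceI)
    have q0: "q f 0 = 0" if "f \<in> D" for f
      using scale_right[OF subspace_0[OF D] that, of 0] by simp
    show "0 \<in> H" using D X q0 by (auto simp: form_operator_def zero_prod_def subspace_0)
  next
    fix a b assume ab: "a \<in> H" "b \<in> H"
    have "q f (u + v) = q f u + q f v" if "f \<in> D" "u \<in> D" "v \<in> D" for f u v
      using add_right[of u v f] that by (simp add: inner_add_right algebra_simps)
    then show "a + b \<in> H" using ab D X
      by (auto simp: form_operator_def inner_add_right subspace_add)
  next
    fix k a assume a: "a \<in> H"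
    have "q f (k *\<^sub>R u) = k * q f u" if "f \<in> D" "u \<in> D" for f u
      using scale_right[of u f k] that by (simp add: algebra_simps)
    then show "k *\<^sub>R a \<in> H" using a D X
      by (auto simp: form_operator_def subspace_scale)
  qed
  show "single_valued H"
  proof (rule single_valuedI)
    fix u v w assume "(u, v) \<in> H" "(u, w) \<in> H"
    then have "v - w \<in> X" "\<And>f. f \<in> D \<Longrightarrow> inner f (v - w) = 0"
      using X by (auto simp: form_operator_def inner_diff_right subspace_diff)
    then have "v - w = 0" by (rule orthogonal_X)
    then show "v = w" by simp
  qed
qed

text \<open>An element \<open>u\<close> of the form domain is approximated by \<open>k * (H + c + k)\<^sup>-\<^sup>1 u\<close>.\<close>

lemma densely_defined_H: "densely_defined_in X H"
proof -
  have "D \<subseteq> closure (Domain H)"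
  proof
    fix u assume u: "u \<in> D"
    let ?p = "\<lambda>u v. q u v + c * inner u v"
    show "u \<in> closure (Domain H)"
      unfolding closure_approachable
    proof (intro allI impI)
      fix e :: real assume e: "e > 0"
      \<comment> \<open>The estimate below reads \<open>k * (norm (u - w))^2 \<le> ?p u u\<close>,
        so this \<open>k\<close> gives a distance below \<open>e\<close>; the added 1 makes the
        inequality strict and \<open>k\<close> positive.\<close>
      define k where "k = (?p u u + 1) / e\<^sup>2"
      have k: "k > 0" using nonneg[OF u] e by (simp add: k_def)
      interpret k: closed_form D "\<lambda>u v. ?p u v + k * inner u v" using shifted[of k] k by simp
      obtain w where w: "w \<in> D" "\<And>f. f \<in> D \<Longrightarrow> ?p f w + k * inner f w = inner f (k *\<^sub>R u)"
        using k.representer by blast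
      have pw: "?p f w = k * inner f (u - w)" if "f \<in> D" for f
        using w(2)[OF that] by (simp add: inner_diff_right algebra_simps)
      have "k *\<^sub>R (u - w) \<in> X"
        using u w(1) DX X by (meson subsetD subspace_diff subspace_scale)
      then have "(w, k *\<^sub>R (u - w) - c *\<^sub>R w) \<in> H"
        unfolding mem_H_iff using w(1) pw by simp
      then have wH: "w \<in> Domain H" by auto
      have d: "u - w \<in> D" using u w D by (auto intro: subspace_diff)
      have "?p u w = ?p (u - w) w + ?p w w" using add[OF d w(1) w(1)] by simp
      then have "k * inner (u - w) (u - w) = ?p u w - ?p w w" using pw[OF d] by simp
      also have "\<dots> \<le> ?p u u"
      proof -
        \<comment> \<open>Nonnegativity of the form at \<open>u - 2 w\<close> says that
          \<open>?p u w - ?p w w\<close> is at most a quarter of \<open>?p u u\<close>.\<close>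
        have "u + (-2) *\<^sub>R w \<in> D" by (intro subspace_add[OF D] subspace_scale[OF D] u w(1))
        from nonneg[OF this] have "0 \<le> ?p u u + 2 * (-2) * ?p u w + (-2)\<^sup>2 * ?p w w"
          by (simp only: expand[OF u w(1)])
        moreover have "b - d \<le> a" if "0 \<le> a + 2 * (-2) * b + (-2)\<^sup>2 * d" "0 \<le> a" for a b d :: real
          using that by simp
        ultimately show ?thesis using nonneg[OF u] by blast
      qed
      finally have "(norm (u - w))\<^sup>2 * k < e\<^sup>2 * k"
        using e nonneg[OF u] by (simp add: k_def power2_norm_eq_inner mult.commute)
      then have "norm (u - w) < e" using k e by (simp add: power2_less_imp_less)
      then show "\<exists>y\<in>Domain H. dist y u < e" using wH by (auto simp: dist_norm norm_minus_commute)
    qed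
  qed
  then have "closure D \<subseteq> closure (Domain H)" by (simp add: closure_minimal)
  then show ?thesis using dense by (auto simp: densely_defined_in_def)
qed

text \<open>Symmetry together with surjectivity of \<open>H + c\<close>. For \<open>(v, w)\<close>
  in the adjoint, solve \<open>(H + c) u = w + c v\<close>; testing against the solutions of
  \<open>(H + c) x = h\<close> shows that \<open>v - u\<close> is orthogonal to every
  \<open>h\<close> in \<open>X\<close>, hence zero.\<close>

lemma self_adjoint_H: "self_adjoint_in X H"
  unfolding self_adjoint_in_def
proof (intro conjI operator_in_H densely_defined_H equalityI subsetI)
  fix a assume a: "a \<in> H"
  obtain v w where vw: "a = (v, w)" by (cases a)
  show "a \<in> adjoint_in X H"
    unfolding vw adjoint_in_def
    using a DX q_sym by (auto simp: form_operator_def vw inner_commute)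
next
  fix a assume a: "a \<in> adjoint_in X H"
  obtain v w where vw: "a = (v, w)" by (cases a)
  have vX: "v \<in> X" "w \<in> X" and adj: "\<And>x y. (x, y) \<in> H \<Longrightarrow> inner v y = inner w x"
    using a by (auto simp: vw adjoint_in_def)
  define z where "z = w + c *\<^sub>R v"
  have "z \<in> X" using vX X by (auto simp: z_def intro: subspace_add subspace_scale)
  then obtain u where u: "(u, z - c *\<^sub>R u) \<in> H" using ex_H by blast
  have uD: "u \<in> D" and pu: "\<And>f. f \<in> D \<Longrightarrow> q f u + c * inner f u = inner f z" using u unfolding mem_H_iff by auto
  have orth: "inner h (v - u) = 0" if h: "h \<in> X" for h
  proof -
    obtain x where x: "(x, h - c *\<^sub>R x) \<in> H" using ex_H[OF h] by blast
    have xD: "x \<in> D" and px: "\<And>f. f \<in> D \<Longrightarrow> q f x + c * inner f x = inner f h" using x unfolding mem_H_iff by auto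
    have "inner v h = inner x z"
      using adj[OF x] by (simp add: z_def inner_diff_right inner_add_right inner_commute algebra_simps)
    also have "\<dots> = inner u h" using pu[OF xD] px[OF uD] sym[OF xD uD] by simp
    finally show ?thesis by (simp add: inner_diff_right inner_commute)
  qed
  have "v - u \<in> X" using vX uD DX X by (auto intro: subspace_diff)
  then have "v - u = 0" using orth[of "v - u"] by simp
  then show "a \<in> H" using u by (simp add: vw z_def)
qed

text \<open>If \<open>(H + c) x = z\<close>, the coercive form at \<open>x\<close> equals
  \<open>inner x z \<le> norm x * norm z\<close>, and coercivity gives
  \<open>norm x \<le> norm z\<close>. So the resolvent at \<open>- c\<close> maps the unit ball into
  the unit ball of the form norm, which is relatively compact.\<close>

lemma compact_resolvent_H: "compact_resolvent_in X H"
proof -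
  have res: "(z, x) \<in> resolvent H (- c) \<longleftrightarrow> (x, z - c *\<^sub>R x) \<in> H" for z x by (simp add: resolvent_def)
  have bound: "q x x + c * inner x x \<le> norm x * norm z" "norm x \<le> norm z" if "(z, x) \<in> resolvent H (- c)" for z x
  proof -
    have x: "x \<in> D" "q x x + c * inner x x = inner x z" using that unfolding res mem_H_iff by auto
    show 1: "q x x + c * inner x x \<le> norm x * norm z" using x(2) norm_cauchy_schwarz[of x z] by simp
    have "norm x * norm x \<le> norm x * norm z"
      using coercive[OF x(1)] 1 by (simp add: power2_norm_eq_inner[symmetric] power2_eq_square)
    then show "norm x \<le> norm z" by (cases "norm x = 0") auto
  qed
  show ?thesis
    unfolding compact_resolvent_in_def
  proof (rule bexI[of _ "- c"])
    show "- c \<in> resolvent_set_in X H"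
      unfolding resolvent_set_in_def
    proof (intro CollectI conjI ballI)
      fix z assume z: "z \<in> X"
      then obtain x where x: "(z, x) \<in> resolvent H (- c)" using ex_H res by blast
      show "\<exists>!x. (z, x) \<in> resolvent H (- c)"
      proof (rule ex1I)
        show "(z, x) \<in> resolvent H (- c)" by (rule x)
        fix y assume y: "(z, y) \<in> resolvent H (- c)"
        have "(0 :: 'a, y - x) \<in> resolvent H (- c)"
          using x y operator_in_H
          unfolding res operator_in_def using subspace_diff[of H "(y, z - c *\<^sub>R y)" "(x, z - c *\<^sub>R x)"]
          by (simp add: algebra_simps)
        from bound(2)[OF this] show "y = x" by simp
      qed
    next
      show "\<exists>C. \<forall>(z, x)\<in>resolvent H (- c). norm x \<le> C * norm z"
        by (rule exI[of _ 1]) (use bound(2) in auto)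
    qed
    show "compact (closure (resolvent H (- c) `` (X \<inter> cball 0 1)))"
    proof (rule compact_closure_sequentially)
      fix U assume "\<And>n :: nat. U n \<in> resolvent H (- c) `` (X \<inter> cball 0 1)"
      then obtain z where z: "\<And>n. (z n, U n) \<in> resolvent H (- c)" "\<And>n. norm (z n) \<le> 1"
        unfolding Image_iff by (metis IntE mem_cball_0)
      show "\<exists>l r. strict_mono r \<and> (U \<circ> r) \<longlonglongrightarrow> l"
      proof (rule relatively_compact)
        show "U n \<in> D" for n using z(1)[of n] unfolding res mem_H_iff by auto
        show "q (U n) (U n) + c * inner (U n) (U n) \<le> 1" for n
        proof -
          have "norm (U n) \<le> 1" using bound(2)[OF z(1)[of n]] z(2)[of n] by simp
          then have "norm (U n) * norm (z n) \<le> 1" using z(2)[of n] by (simp add: mult_le_one)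
          then show ?thesis using bound(1)[OF z(1)[of n]] by simp
        qed
      qed
    qed
  qed
qed

end

section \<open>Square-integrable functions on an interval\<close>

lemma L2_function_iff: "L2_function I f \<longleftrightarrow> square_integrable (\<lambda>x. indicator I x * f x)"
proof -
  have "(\<lambda>x. indicator I x *\<^sub>R (f x)\<^sup>2) = (\<lambda>x. (indicator I x * f x)\<^sup>2)"
    by (auto simp: indicator_def)
  then show ?thesis
    by (simp add: L2_function_def square_integrable_def set_borel_measurable_def set_integrable_def)
qed

lemma pairing_eq: "pairing I f g = (LINT x|lebesgue. (indicator I x * f x) * (indicator I x * g x))"
  unfolding pairing_def set_lebesgue_integral_def
  by (rule Bochner_Integration.integral_cong) (auto simp: indicator_def)

lemma pairing_integrable:
  assumes "L2_function I f" "L2_function I g"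
  shows "integrable lebesgue (\<lambda>x. indicator I x * (f x * g x))"
proof -
  have "integrable lebesgue (\<lambda>x. (indicator I x * f x) * (indicator I x * g x))"
    using assms by (auto simp: L2_function_iff intro: square_integrable_mult)
  also have "(\<lambda>x. (indicator I x * f x) * (indicator I x * g x)) = (\<lambda>x. indicator I x * (f x * g x))"
    by (auto simp: indicator_def)
  finally show ?thesis .
qed

lemma L2_function_measurable: "L2_function I f \<Longrightarrow> (\<lambda>x. indicator I x * f x) \<in> borel_measurable lebesgue"
  by (simp add: L2_function_iff square_integrable_def)

lemma L2_function_add:
  "\<lbrakk>L2_function I f; L2_function I g\<rbrakk> \<Longrightarrow> L2_function I (\<lambda>x. f x + g x)"
  unfolding L2_function_iff distrib_left by (rule square_integrable_add)

lemma L2_function_scale: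
  assumes "L2_function I f"
  shows "L2_function I (\<lambda>x. c * f x)"
  using square_integrable_scale[of "\<lambda>x. indicator I x * f x" c] assms
  by (simp add: L2_function_iff mult.left_commute)

lemma L2_function_diff:
  "\<lbrakk>L2_function I f; L2_function I g\<rbrakk> \<Longrightarrow> L2_function I (\<lambda>x. f x - g x)"
  using L2_function_add[of I f "\<lambda>x. (-1) * g x"] L2_function_scale[of I g "-1"] by simp

lemma L2_function_cong_AE:
  assumes f: "L2_function I f" and ae: "AE x in lebesgue. x \<in> I \<longrightarrow> f x = g x"
  shows "L2_function I g" "L2_class I g = L2_class I f"
proof -
  have ae': "AE x in lebesgue. indicator I x * f x = indicator I x * g x"
    using ae by eventually_elim (auto simp: indicator_def)
  have sf: "square_integrable (\<lambda>x. indicator I x * f x)" using f by (simp add: L2_function_iff)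
  have m: "(\<lambda>x. indicator I x * g x) \<in> borel_measurable lebesgue"
    using borel_measurable_AE[OF L2_function_measurable[OF f] ae'] .
  have "integrable lebesgue (\<lambda>x. (indicator I x * g x)\<^sup>2)"
  proof (rule integrable_cong_AE_imp)
    show "integrable lebesgue (\<lambda>x. (indicator I x * f x)\<^sup>2)" using sf by (simp add: square_integrable_def)
    show "AE x in lebesgue. (indicator I x * f x)\<^sup>2 = (indicator I x * g x)\<^sup>2"
      using ae' by eventually_elim (simp only:)
  qed (use m in measurable)
  then have sg: "square_integrable (\<lambda>x. indicator I x * g x)" using m by (simp add: square_integrable_def)
  then show "L2_function I g" by (simp add: L2_function_iff)
  show "L2_class I g = L2_class I f"
    unfolding L2_class_def
    by (rule Quotient_rel_abs[OF Quotient_L2]) (use sf sg ae' in \<open>auto elim: eventually_mono\<close>)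
qed

lemma L2_class_add:
  assumes "L2_function I f" "L2_function I g"
  shows "L2_class I (\<lambda>x. f x + g x) = L2_class I f + L2_class I g"
  unfolding L2_class_def distrib_left
  by (rule plus_L2.abs_eq[symmetric]) (use assms in \<open>simp_all add: L2_function_iff\<close>)

lemma L2_class_scale:
  assumes "L2_function I f"
  shows "L2_class I (\<lambda>x. c * f x) = c *\<^sub>R L2_class I f"
  unfolding L2_class_def mult.left_commute[of _ c]
  by (rule scaleR_L2.abs_eq[symmetric]) (use assms in \<open>simp_all add: L2_function_iff\<close>)

lemma L2_class_diff:
  assumes "L2_function I f" "L2_function I g"
  shows "L2_class I (\<lambda>x. f x - g x) = L2_class I f - L2_class I g"
proof -
  have "L2_class I (\<lambda>x. f x + (-1) * g x) = L2_class I f + (-1) *\<^sub>R L2_class I g"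
    using L2_class_add[OF assms(1) L2_function_scale[OF assms(2)], of "-1"] L2_class_scale[OF assms(2), of "-1"] by simp
  then show ?thesis by simp
qed

lemma pairing_inner:
  assumes "L2_function I f" "L2_function I g"
  shows "pairing I f g = inner (L2_class I f) (L2_class I g)"
  unfolding L2_class_def pairing_eq
  by (rule inner_L2.abs_eq[symmetric]) (use assms in \<open>simp_all add: L2_function_iff\<close>)

lemma pairing_norm: "L2_function I f \<Longrightarrow> pairing I f f = (norm (L2_class I f))\<^sup>2"
  by (simp add: pairing_inner power2_norm_eq_inner)

lemma pairing_nonneg: "pairing I f f \<ge> 0"
  unfolding pairing_eq by (rule Bochner_Integration.integral_nonneg) simp

lemma pairing_Cauchy_Schwarz:
  assumes "L2_function I f" "L2_function I g"
  shows "(pairing I f g)\<^sup>2 \<le> pairing I f f * pairing I g g"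
  using Cauchy_Schwarz_ineq assms by (simp add: pairing_inner)

lemma pairing_nn:
  assumes "L2_function I f"
  shows "(\<integral>\<^sup>+x. ennreal ((indicator I x * f x)\<^sup>2) \<partial>lebesgue) = ennreal (pairing I f f)"
  unfolding pairing_eq power2_eq_square[symmetric]
  by (rule nn_integral_eq_integral) (use assms in \<open>auto simp: L2_function_iff square_integrable_def\<close>)

text \<open>Integrability and the bound become one inequality between nonnegative integrals, the
  shape in which Fatou's lemma and the later pointwise estimates deliver it.\<close>

lemma L2_bound_iff:
  assumes "K \<ge> 0"
  shows "L2_function I f \<and> pairing I f f \<le> K \<longleftrightarrow>
    (\<lambda>x. indicator I x * f x) \<in> borel_measurable lebesgue \<and>
    (\<integral>\<^sup>+x. ennreal ((indicator I x * f x)\<^sup>2) \<partial>lebesgue) \<le> ennreal K" (is "?L \<longleftrightarrow> ?R")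
proof
  assume ?L then show ?R using pairing_nn[of I f] by (simp add: L2_function_measurable ennreal_leI)
next
  assume R: ?R
  have "integrable lebesgue (\<lambda>x. (indicator I x * f x)\<^sup>2)"
  proof (rule integrableI_nonneg)
    show "(\<lambda>x. (indicator I x * f x)\<^sup>2) \<in> borel_measurable lebesgue"
      by (rule borel_measurable_power[OF conjunct1[OF R]])
    show "(\<integral>\<^sup>+x. ennreal ((indicator I x * f x)\<^sup>2) \<partial>lebesgue) < \<infinity>"
      using R by (auto intro: le_less_trans)
  qed simp
  then have "L2_function I f" using R by (simp add: L2_function_iff square_integrable_def)
  moreover have "ennreal (pairing I f f) \<le> ennreal K" using R pairing_nn[OF \<open>L2_function I f\<close>] by simp
  ultimately show ?L using assms by (simp add: ennreal_le_iff)
qed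

text \<open>Fatou's lemma for the squares. Square integrability of the limit comes together with the
  bound, so that bounded norms and convergence almost everywhere replace weak compactness.\<close>

lemma L2_fatou:
  assumes g: "\<And>n. L2_function I (g n)" "\<And>n. pairing I (g n) (g n) \<le> K" and K: "K \<ge> 0"
    and lim: "AE x in lebesgue. x \<in> I \<longrightarrow> (\<lambda>n. g n x) \<longlonglongrightarrow> f x"
  shows "L2_function I f" "pairing I f f \<le> K"
proof -
  let ?G = "\<lambda>n x. indicator I x * g n x"
  have G: "?G n \<in> borel_measurable lebesgue" for n using L2_function_measurable[OF g(1)] .
  have lim': "AE x in lebesgue. (\<lambda>n. ?G n x) \<longlonglongrightarrow> indicator I x * f x"
    using lim by eventually_elim (auto simp: indicator_def)
  have m: "(\<lambda>x. indicator I x * f x) \<in> borel_measurable lebesgue"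
  proof (rule borel_measurable_AE)
    show "(\<lambda>x. lim (\<lambda>n. ?G n x)) \<in> borel_measurable lebesgue" using G by (rule borel_measurable_lim_metric)
    show "AE x in lebesgue. lim (\<lambda>n. ?G n x) = indicator I x * f x"
      using lim' by eventually_elim (rule limI)
  qed
  have "(\<integral>\<^sup>+x. ennreal ((indicator I x * f x)\<^sup>2) \<partial>lebesgue)
      = (\<integral>\<^sup>+x. liminf (\<lambda>n. ennreal ((?G n x)\<^sup>2)) \<partial>lebesgue)"
  proof (rule nn_integral_cong_AE)
    show "AE x in lebesgue. ennreal ((indicator I x * f x)\<^sup>2) = liminf (\<lambda>n. ennreal ((?G n x)\<^sup>2))"
      using lim'
    proof eventually_elim
      case (elim x)
      then have "(\<lambda>n. ennreal ((?G n x)\<^sup>2)) \<longlonglongrightarrow> ennreal ((indicator I x * f x)\<^sup>2)"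
        by (intro tendsto_ennrealI tendsto_power)
      then show ?case by (rule lim_imp_Liminf[OF trivial_limit_sequentially, symmetric])
    qed
  qed
  also have "\<dots> \<le> liminf (\<lambda>n. \<integral>\<^sup>+x. ennreal ((?G n x)\<^sup>2) \<partial>lebesgue)"
    by (rule nn_integral_liminf) (use G in measurable)
  also have "\<dots> \<le> ennreal K"
  proof (rule Liminf_le)
    show "\<forall>\<^sub>F n in sequentially. (\<integral>\<^sup>+x. ennreal ((?G n x)\<^sup>2) \<partial>lebesgue) \<le> ennreal K"
      using g L2_bound_iff[OF K] by (intro always_eventually allI) blast
  qed simp
  finally show "L2_function I f" "pairing I f f \<le> K" using m L2_bound_iff[OF K, of I f] by auto
qed

lemma L2_function_subset:
  assumes f: "L2_function I f" and B: "B \<in> sets lebesgue" "B \<subseteq> I"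
  shows "L2_function B f" "pairing B f f \<le> pairing I f f"
proof -
  have eq: "(\<lambda>x. indicator B x * f x) = (\<lambda>x. indicator B x * (indicator I x * f x))"
  proof
    fix x show "indicator B x * f x = indicator B x * (indicator I x * f x)"
      using B(2) by (cases "x \<in> B") auto
  qed
  have m: "(\<lambda>x. indicator B x * f x) \<in> borel_measurable lebesgue"
    unfolding eq by (intro borel_measurable_times borel_measurable_indicator B L2_function_measurable f)
  have "(\<integral>\<^sup>+x. ennreal ((indicator B x * f x)\<^sup>2) \<partial>lebesgue) \<le> (\<integral>\<^sup>+x. ennreal ((indicator I x * f x)\<^sup>2) \<partial>lebesgue)"
    by (rule nn_integral_mono) (use B(2) in \<open>auto simp: indicator_def\<close>)
  then show "L2_function B f" "pairing B f f \<le> pairing I f f"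
    using m L2_bound_iff[OF pairing_nonneg[of I f], of B f] pairing_nn[OF f] by auto
qed

lemma L2_function_bounded_interval:
  assumes "\<And>x. x \<in> {c<..<d} \<Longrightarrow> \<bar>f x\<bar> \<le> B" "set_borel_measurable lebesgue {c<..<d} f"
  shows "L2_function {c<..<d} (f :: real \<Rightarrow> real)"
proof -
  have "integrable lebesgue (\<lambda>x. (indicator {c<..<d} x * f x)\<^sup>2)"
  proof (rule Bochner_Integration.integrable_bound[of _ "\<lambda>x. B\<^sup>2 * indicator {c<..<d} x"])
    show "integrable lebesgue (\<lambda>x. B\<^sup>2 * indicator {c<..<d} x)"
      by (metis integrable_mult_right lmeasurable_box box_real(1) lmeasurable_iff_integrable)
    show "(\<lambda>x. (indicator {c<..<d} x * f x)\<^sup>2) \<in> borel_measurable lebesgue"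
      using assms(2) by (auto simp: set_borel_measurable_def)
    have "(f x)\<^sup>2 \<le> B\<^sup>2" if "x \<in> {c<..<d}" for x using assms(1)[OF that] by (rule power2_le_iff_abs_le[THEN iffD2, rotated]) (use assms(1)[OF that] in linarith)
    then show "AE x in lebesgue. norm ((indicator {c<..<d} x * f x)\<^sup>2) \<le> norm (B\<^sup>2 * indicator {c<..<d} x)"
      by (auto simp: indicator_def)
  qed
  then show ?thesis using assms(2) by (simp add: L2_function_iff square_integrable_def set_borel_measurable_def)
qed

lemma L2_function_const_interval: "L2_function {c<..<d} (\<lambda>x::real. k)"
  by (rule L2_function_bounded_interval[of _ _ _ "\<bar>k\<bar>"])
    (auto simp: set_borel_measurable_def intro!: borel_measurable_times borel_measurable_indicator)

lemma pairing_const_interval: "c \<le> d \<Longrightarrow> pairing {c<..<d} (\<lambda>x. k) (\<lambda>x. k) = k\<^sup>2 * (d - c)"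
  by (simp add: pairing_def set_lebesgue_integral_def power2_eq_square)

section \<open>The interval and its closure\<close>

lemma interval_cases:
  assumes "valid_setting s"
  obtains "interval s = UNIV" "closure (interval s) = UNIV"
    | "interval s = {0<..}" "closure (interval s) = {0..}"
    | b where "b > 0" "interval s = {0<..<b}" "closure (interval s) = {0..b}"
  using assms by (cases s) (auto simp: closure_greaterThanLessThan)

lemma open_interval [simp]: "open (interval s)"
  by (cases s) auto

lemma interval_measurable [measurable, simp]: "interval s \<in> sets lebesgue"
  using open_interval[of s] by auto

lemma interval_interior:
  assumes "valid_setting s" "{c..d} \<subseteq> closure (interval s)"
  shows "{c<..<d} \<subseteq> interval s"
proof (cases "c < d")
  case True
  then have "c \<in> closure (interval s)" "d \<in> closure (interval s)" using assms(2) by auto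
  then show ?thesis
    by - (rule interval_cases[OF assms(1)]; simp add: subset_iff)
qed auto

lemma interval_convex:
  assumes "valid_setting s" "c \<in> closure (interval s)" "d \<in> closure (interval s)"
  shows "{c..d} \<subseteq> closure (interval s)"
  using assms(2,3)
  by - (rule interval_cases[OF assms(1)]; simp add: subset_iff)

lemma interval_segment:
  assumes "valid_setting s"
  obtains r0 where "r0 > 0" "r0 \<le> 1"
    "\<And>x r. \<lbrakk>x \<in> closure (interval s); 0 < r; r \<le> r0\<rbrakk> \<Longrightarrow> \<exists>c. {c..c + r} \<subseteq> closure (interval s) \<and> x \<in> {c..c + r}"
proof (cases rule: interval_cases[OF assms])
  case (3 b)
  show thesis
  \<comment> \<open>If \<open>x + r > b\<close> then \<open>x > b / 2 \<ge> r\<close>, so the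
    segment to the left of \<open>x\<close> stays inside.\<close>
  proof (rule that[of "min 1 (b / 2)"])
    fix x r assume x: "x \<in> closure (interval s)" and r: "0 < r" "r \<le> min 1 (b / 2)"
    show "\<exists>c. {c..c + r} \<subseteq> closure (interval s) \<and> x \<in> {c..c + r}"
      by (rule exI[of _ "if x + r \<le> b then x else x - r"]) (use x r 3 in auto)
  qed (use 3 in auto)
next
  case 1
  show thesis by (rule that[of 1]) (use 1 in \<open>auto intro: exI[of _ "_ :: real"]\<close>)
next
  case 2
  show thesis
  proof (rule that[of 1])
    fix x r :: real assume "x \<in> closure (interval s)" "0 < r"
    then show "\<exists>c. {c..c + r} \<subseteq> closure (interval s) \<and> x \<in> {c..c + r}"
      by (intro exI[of _ x]) (use 2 in auto)
  qed auto
qed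

lemma AE_negligible: "negligible {x. \<not> P x} \<longleftrightarrow> (AE x in lebesgue. P x)"
  by (simp add: negligible_iff_null_sets completion.AE_iff_null_sets AE_iff_null_sets) 

section \<open>Functions with square-integrable derivative\<close>

lemma locally_abs_continuous_differentiable_AE:
  assumes I: "open I" and f: "locally_abs_continuous_on_closure I f"
  shows "AE x in lebesgue. x \<in> I \<longrightarrow> f differentiable (at x)"
proof -
  let ?Q = "{(c, d). c \<in> \<rat> \<and> d \<in> \<rat> \<and> {c..d} \<subseteq> closure I}"
  let ?N = "\<Union>(c, d)\<in>?Q. {x \<in> {c<..<d}. \<not> f differentiable (at x)}"
  have "countable ?Q" by (rule countable_subset[of _ "\<rat> \<times> \<rat>"]) (auto simp: countable_rat)
  moreover have "negligible {x \<in> {c<..<d}. \<not> f differentiable (at x)}" if "(c, d) \<in> ?Q" for c d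
    by (rule abs_continuous_on_differentiable_AE)
      (use f that in \<open>auto simp: locally_abs_continuous_on_closure_def\<close>)
  ultimately have N: "negligible ?N" by (intro negligible_countable_Union) auto
  have "{x. \<not> (x \<in> I \<longrightarrow> f differentiable (at x))} \<subseteq> ?N"
  proof
    fix x assume x: "x \<in> {x. \<not> (x \<in> I \<longrightarrow> f differentiable (at x))}"
    then obtain e where e: "e > 0" "ball x e \<subseteq> I" using I by (auto simp: open_contains_ball)
    obtain c where c: "c \<in> \<rat>" "x - e < c" "c < x" using Rats_dense_in_real[of "x - e" x] e by auto
    obtain d where d: "d \<in> \<rat>" "x < d" "d < x + e" using Rats_dense_in_real[of x "x + e"] e by auto
    have "{c..d} \<subseteq> ball x e" using c d by (auto simp: dist_real_def)
    then have "{c..d} \<subseteq> closure I" using e closure_subset[of I] by auto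
    then show "x \<in> ?N" using x c d by auto
  qed
  then have "negligible {x. \<not> (x \<in> I \<longrightarrow> f differentiable (at x))}"
    by (rule negligible_subset[OF N])
  then show ?thesis by (simp only: AE_negligible)
qed

lemma L2_function_integrable_Ioo:
  assumes "L2_function {c<..<d} (g :: real \<Rightarrow> real)"
  shows "set_integrable lebesgue {c<..<d} g"
  using pairing_integrable[OF assms L2_function_const_interval[of c d 1]]
  by (simp add: set_integrable_def)

text \<open>Since \<open>g\<close> is integrable here, the gauge integral supplied by
  \<open>abs_continuous_on_has_integral\<close> coincides with the Lebesgue integral.\<close>

lemma abs_continuous_on_integral:
  assumes ac: "abs_continuous_on {c..d} f" and cd: "c \<le> d"
    and der: "AE x in lebesgue. x \<in> {c<..<d} \<longrightarrow> (f has_real_derivative g x) (at x)"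
    and g: "set_integrable lebesgue {c<..<d} g"
  shows "f d - f c = (LINT x:{c<..<d}|lebesgue. g x)"
proof -
  have N: "negligible {x. \<not> (x \<in> {c<..<d} \<longrightarrow> (f has_real_derivative g x) (at x))}"
    using der by (simp only: AE_negligible)
  have "(g has_integral f d - f c) {c..d}"
    by (rule abs_continuous_on_has_integral[OF ac cd N]) auto
  then have "(g has_integral f d - f c) {c<..<d}" by (simp add: has_integral_Icc_iff_Ioo)
  then show ?thesis using has_integral_set_lebesgue[OF g] by (rule has_integral_unique)
qed

text \<open>The part of membership in \<open>H1V\<close> that does not involve \<open>V\<close> or
  the size of \<open>f\<close>; it is the part whose stability under limits takes work.\<close>

locale H1_function =
  fixes s :: setting and f :: "real \<Rightarrow> real"
  assumes valid: "valid_setting s"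
    and ac: "locally_abs_continuous_on_closure (interval s) f"
    and L2d: "L2_function (interval s) (deriv f)"
begin

lemma has_deriv_AE: "AE x in lebesgue. x \<in> interval s \<longrightarrow> (f has_real_derivative deriv f x) (at x)"
  using locally_abs_continuous_differentiable_AE[OF open_interval ac]
  by eventually_elim (auto simp: field_differentiable_derivI DERIV_deriv_iff_real_differentiable)

lemma L2d_sub: "{c..d} \<subseteq> closure (interval s) \<Longrightarrow> L2_function {c<..<d} (deriv f)"
  by (rule L2_function_subset(1)[OF L2d]) (auto dest: interval_interior[OF valid])

lemma increment_integral:
  assumes "c \<le> d" "{c..d} \<subseteq> closure (interval s)"
  shows "f d - f c = (LINT x:{c<..<d}|lebesgue. deriv f x)"
proof (rule abs_continuous_on_integral[OF _ assms(1)])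
  show "abs_continuous_on {c..d} f" using ac assms(2) by (simp add: locally_abs_continuous_on_closure_def)
  show "AE x in lebesgue. x \<in> {c<..<d} \<longrightarrow> (f has_real_derivative deriv f x) (at x)"
    using has_deriv_AE
  proof eventually_elim
    case (elim x)
    then show ?case using interval_interior[OF valid assms(2)] by blast
  qed
  show "set_integrable lebesgue {c<..<d} (deriv f)"
    by (rule L2_function_integrable_Ioo[OF L2d_sub[OF assms(2)]])
qed

lemma increment_bound:
  assumes "c \<le> d" "{c..d} \<subseteq> closure (interval s)"
  shows "(f d - f c)\<^sup>2 \<le> (d - c) * pairing {c<..<d} (deriv f) (deriv f)"
proof -
  have "f d - f c = pairing {c<..<d} (\<lambda>x. 1) (deriv f)"
    using increment_integral[OF assms] by (simp add: pairing_def)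
  then show ?thesis
    using pairing_Cauchy_Schwarz[OF L2_function_const_interval L2d_sub[OF assms(2)], of 1]
      pairing_const_interval[OF assms(1), of 1] by simp
qed

lemma continuous: "{c..d} \<subseteq> closure (interval s) \<Longrightarrow> continuous_on {c..d} f"
  using ac abs_continuous_on_imp_continuous_on by (simp add: locally_abs_continuous_on_closure_def)

text \<open>Average \<open>(f x)\<^sup>2 \<le> 2 * (f y)\<^sup>2 + 2 * (f x - f y)\<^sup>2\<close> over \<open>y\<close>.\<close>

lemma pointwise_bound:
  assumes r: "r > 0" and sub: "{c..c + r} \<subseteq> closure (interval s)" and x: "x \<in> {c..c + r}"
    and f2: "L2_function {c<..<c + r} f"
  shows "(f x)\<^sup>2 \<le> 2 / r * pairing {c<..<c + r} f f + 2 * r * pairing {c<..<c + r} (deriv f) (deriv f)"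
proof -
  let ?A = "pairing {c<..<c + r} f f" and ?B = "pairing {c<..<c + r} (deriv f) (deriv f)"
  have pt: "(f x)\<^sup>2 \<le> 2 * (f y)\<^sup>2 + 2 * r * ?B" if y: "y \<in> {c<..<c + r}" for y
  proof -
    have inc: "(f v - f u)\<^sup>2 \<le> r * ?B" if uv: "u \<le> v" "u \<in> {c..c + r}" "v \<in> {c..c + r}" for u v
    proof -
      have s: "{u..v} \<subseteq> closure (interval s)" using uv sub by (auto simp: subset_iff)
      have "(f v - f u)\<^sup>2 \<le> (v - u) * pairing {u<..<v} (deriv f) (deriv f)" by (rule increment_bound[OF uv(1) s])
      also have "\<dots> \<le> r * ?B"
      proof (rule mult_mono)
        show "pairing {u<..<v} (deriv f) (deriv f) \<le> ?B"
          by (rule L2_function_subset(2)[OF L2d_sub[OF sub]]) (use uv in auto)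
      qed (use uv r pairing_nonneg in auto)
      finally show ?thesis .
    qed
    have "(f x - f y)\<^sup>2 \<le> r * ?B"
      using inc[of x y] inc[of y x] x y by (cases "x \<le> y") (auto simp: power2_commute)
    moreover have "(f x)\<^sup>2 \<le> 2 * (f y)\<^sup>2 + 2 * (f x - f y)\<^sup>2"
    proof -
      have "2 * (f y)\<^sup>2 + 2 * (f x - f y)\<^sup>2 - (f x)\<^sup>2 = (2 * f y - f x)\<^sup>2" by (simp add: power2_eq_square algebra_simps)
      then show ?thesis using zero_le_power2[of "2 * f y - f x"] by linarith
    qed
    ultimately show ?thesis by linarith
  qed
  have fi: "set_integrable lebesgue {c<..<c + r} (\<lambda>y. 2 * (f y)\<^sup>2)"
    using pairing_integrable[OF f2 f2] by (simp add: set_integrable_def power2_eq_square mult.left_commute[of _ 2])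
  have ci: "set_integrable lebesgue {c<..<c + r} (\<lambda>y. k)" for k :: real
    by (rule L2_function_integrable_Ioo[OF L2_function_const_interval])
  have cv: "(LINT y:{c<..<c + r}|lebesgue. k) = r * k" for k :: real
    using r by (simp add: set_lebesgue_integral_def)
  have "r * (f x)\<^sup>2 = (LINT y:{c<..<c + r}|lebesgue. (f x)\<^sup>2)" by (simp only: cv)
  also have "\<dots> \<le> (LINT y:{c<..<c + r}|lebesgue. 2 * (f y)\<^sup>2 + 2 * r * ?B)"
    by (rule set_integral_mono[OF ci set_integral_add(1)[OF fi ci]]) (rule pt)
  also have "\<dots> = (LINT y:{c<..<c + r}|lebesgue. 2 * (f y)\<^sup>2) + (LINT y:{c<..<c + r}|lebesgue. 2 * r * ?B)"
    by (rule set_integral_add(2)[OF fi ci])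
  also have "\<dots> = 2 * ?A + r * (2 * r * ?B)"
    unfolding cv by (simp add: pairing_def power2_eq_square set_lebesgue_integral_def mult.left_commute[of _ 2])
  finally have "r * (f x)\<^sup>2 \<le> r * (2 / r * ?A + 2 * r * ?B)" using r by (simp add: algebra_simps)
  then show ?thesis using r by simp
qed

end

section \<open>Difference quotients and pointwise limits\<close>

text \<open>The deviations from the tangent line at the two endpoints are at most
  \<open>e / 2\<close> times their distances from \<open>x\<close>, and these distances add up to
  the length of the interval because \<open>x\<close> lies in it.\<close>

lemma straddle_tendsto:
  fixes f :: "real \<Rightarrow> real"
  assumes der: "(f has_real_derivative D) (at x)"
    and u: "u \<longlonglongrightarrow> x" and v: "v \<longlonglongrightarrow> x" and uv: "\<And>n. u n \<le> x" "\<And>n. x \<le> v n" "\<And>n. u n < v n"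
  shows "(\<lambda>n. (f (v n) - f (u n)) / (v n - u n)) \<longlonglongrightarrow> D"
proof (rule tendstoI)
  fix e :: real assume e: "e > 0"
  obtain d where d: "d > 0" "\<And>y. \<bar>y - x\<bar> < d \<Longrightarrow> \<bar>f y - f x - D * (y - x)\<bar> \<le> e / 2 * \<bar>y - x\<bar>"
    using der half_gt_zero[OF e] unfolding has_field_derivative_def has_derivative_at_alt real_norm_def by blast
  have "\<forall>\<^sub>F n in sequentially. dist (u n) x < d" "\<forall>\<^sub>F n in sequentially. dist (v n) x < d"
    using tendstoD[OF u d(1)] tendstoD[OF v d(1)] by auto
  then show "\<forall>\<^sub>F n in sequentially. dist ((f (v n) - f (u n)) / (v n - u n)) D < e"
  proof eventually_elim
    case (elim n)
    have 1: "\<bar>f (u n) - f x - D * (u n - x)\<bar> \<le> e / 2 * (x - u n)" "\<bar>f (v n) - f x - D * (v n - x)\<bar> \<le> e / 2 * (v n - x)"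
      using d(2)[of "u n"] d(2)[of "v n"] elim uv(1,2)[of n] by (auto simp: dist_real_def)
    have "\<bar>f (v n) - f (u n) - D * (v n - u n)\<bar> \<le> e / 2 * (v n - u n)"
    proof -
      have "f (v n) - f (u n) - D * (v n - u n) = (f (v n) - f x - D * (v n - x)) - (f (u n) - f x - D * (u n - x))"
        "e / 2 * (v n - u n) = e / 2 * (v n - x) + e / 2 * (x - u n)"
        by (simp_all add: algebra_simps add_divide_distrib diff_divide_distrib)
      then show ?thesis using 1 by linarith
    qed
    then have "\<bar>(f (v n) - f (u n)) / (v n - u n) - D\<bar> \<le> e / 2"
      using uv(3)[of n] by (simp add: field_simps abs_le_iff)
    then show ?case using e by (simp add: dist_real_def)
  qed
qed

lemma nn_integral_cells_mono:
  fixes F G :: "real \<Rightarrow> ennreal"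
  assumes N: "N > 0" and F: "F \<in> borel_measurable lebesgue" and G: "G \<in> borel_measurable lebesgue"
    and le: "\<And>j :: int. (\<integral>\<^sup>+x. F x * indicator {real_of_int j / N..<(real_of_int j + 1) / N} x \<partial>lebesgue)
      \<le> (\<integral>\<^sup>+x. G x * indicator {real_of_int j / N..<(real_of_int j + 1) / N} x \<partial>lebesgue)"
  shows "(\<integral>\<^sup>+x. F x \<partial>lebesgue) \<le> (\<integral>\<^sup>+x. G x \<partial>lebesgue)"
proof -
  define B where "B n = {real_of_int (int_decode n) / N..<(real_of_int (int_decode n) + 1) / N}" for n
  have mem: "x \<in> B n \<longleftrightarrow> int_decode n = \<lfloor>x * N\<rfloor>" for x n
  proof -
    have "int_decode n = \<lfloor>x * N\<rfloor> \<longleftrightarrow> real_of_int (int_decode n) \<le> x * N \<and> x * N < real_of_int (int_decode n) + 1"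
      by (metis floor_eq_iff)
    then show ?thesis using N by (simp add: B_def pos_divide_le_eq pos_less_divide_eq)
  qed
  have B: "B n \<in> sets lebesgue" for n by (simp add: B_def)
  have dis: "disjoint_family B" unfolding disjoint_family_on_def using mem by (metis disjoint_iff inj_eq inj_int_decode)
  have un: "(\<Union>n. B n) = UNIV"
  proof -
    have "x \<in> B (int_encode \<lfloor>x * N\<rfloor>)" for x by (simp add: mem)
    then show ?thesis by blast
  qed
  have "(\<integral>\<^sup>+x. F x \<partial>lebesgue) = (\<Sum>n. \<integral>\<^sup>+x\<in>B n. F x \<partial>lebesgue)"
    using nn_integral_disjoint_family[OF F B dis] by (simp add: un)
  also have "\<dots> \<le> (\<Sum>n. \<integral>\<^sup>+x\<in>B n. G x \<partial>lebesgue)"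
    by (rule suminf_le) (use le in \<open>auto simp: B_def\<close>)
  also have "\<dots> = (\<integral>\<^sup>+x. G x \<partial>lebesgue)"
    using nn_integral_disjoint_family[OF G B dis] by (simp add: un)
  finally show ?thesis .
qed


text \<open>Unlike the epsilon-delta condition, the energy inequality with a fixed \<open>K\<close>
  survives pointwise limits; absolute continuity of a limit is obtained through it.\<close>

lemma abs_continuous_onI_energy:
  assumes K: "K \<ge> 0"
    and le: "\<And>\<D>. \<lbrakk>\<D> division_of \<Union>\<D>; \<Union>\<D> \<subseteq> S\<rbrakk> \<Longrightarrow>
      (\<Sum>k\<in>\<D>. \<bar>f (Sup k) - f (Inf k)\<bar>) \<le> sqrt K * sqrt (\<Sum>k\<in>\<D>. Sup k - Inf k)"
  shows "abs_continuous_on S f"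
  unfolding abs_continuous_on_def
proof (intro allI impI)
  fix e :: real assume e: "e > 0"
  define d where "d = (e / (sqrt K + 1))\<^sup>2"
  have sK: "sqrt K + 1 > 0" using K by (simp add: add_nonneg_pos)
  show "\<exists>\<delta>>0. \<forall>\<D>. \<D> division_of \<Union>\<D> \<and> \<Union>\<D> \<subseteq> S \<and> (\<Sum>k\<in>\<D>. Sup k - Inf k) < \<delta> \<longrightarrow>
      (\<Sum>k\<in>\<D>. \<bar>f (Sup k) - f (Inf k)\<bar>) < e"
  proof (intro exI[of _ d] conjI allI impI)
    show "d > 0" using e sK by (simp add: d_def)
    fix \<D> assume A: "\<D> division_of \<Union>\<D> \<and> \<Union>\<D> \<subseteq> S \<and> (\<Sum>k\<in>\<D>. Sup k - Inf k) < d"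
    then have D: "\<D> division_of \<Union>\<D>" "\<Union>\<D> \<subseteq> S" "(\<Sum>k\<in>\<D>. Sup k - Inf k) < d" by blast+
    have "sqrt (\<Sum>k\<in>\<D>. Sup k - Inf k) < e / (sqrt K + 1)"
      using real_sqrt_less_mono[OF D(3)] e sK by (simp add: d_def)
    then have "sqrt K * sqrt (\<Sum>k\<in>\<D>. Sup k - Inf k) \<le> sqrt K * (e / (sqrt K + 1))"
      using K by (intro mult_left_mono) auto
    also have "\<dots> < e" using e sK by (simp add: field_simps)
    finally show "(\<Sum>k\<in>\<D>. \<bar>f (Sup k) - f (Inf k)\<bar>) < e" using le[OF D(1,2)] by linarith
  qed
qed

lemma sum_mult_le_sqrt:
  fixes a b :: "'i \<Rightarrow> real"
  shows "(\<Sum>i\<in>A. \<bar>a i * b i\<bar>) \<le> sqrt (\<Sum>i\<in>A. (a i)\<^sup>2) * sqrt (\<Sum>i\<in>A. (b i)\<^sup>2)"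
  using L2_set_mult_ineq[of a b A] by (simp add: L2_set_def abs_mult)

context H1_function
begin

text \<open>Cauchy-Schwarz twice: for the increment over each cell, and for the sum over the cells.
  The cells do not overlap, so their energies add up to at most the energy on the interval.\<close>

lemma energy_bound:
  assumes D: "\<D> division_of \<Union>\<D>" "\<Union>\<D> \<subseteq> {c..d}" and cd: "{c..d} \<subseteq> closure (interval s)"
  shows "(\<Sum>k\<in>\<D>. \<bar>f (Sup k) - f (Inf k)\<bar>)
    \<le> sqrt (pairing (interval s) (deriv f) (deriv f)) * sqrt (\<Sum>k\<in>\<D>. Sup k - Inf k)"
proof -
  let ?P = "\<lambda>k. pairing {Inf k<..<Sup k} (deriv f) (deriv f)"
  have fin: "finite \<D>" using D(1) by blast
  have kk: "k = {Inf k..Sup k}" "Inf k \<le> Sup k" "{Inf k..Sup k} \<subseteq> closure (interval s)"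
    "{Inf k<..<Sup k} = interior k" if k: "k \<in> \<D>" for k
  proof -
    obtain u v where uv: "k = {u..v}" "u \<le> v" using division_of_realD[OF D(1) k] by metis
    then have e: "Inf k = u" "Sup k = v" by auto
    show "k = {Inf k..Sup k}" "Inf k \<le> Sup k" using uv e by auto
    show "{Inf k..Sup k} \<subseteq> closure (interval s)" unfolding e using uv k D(2) cd by blast
    show "{Inf k<..<Sup k} = interior k" unfolding e by (simp add: uv(1) interior_atLeastAtMost_real)
  qed
  have inc: "\<bar>f (Sup k) - f (Inf k)\<bar> \<le> \<bar>sqrt (?P k) * sqrt (Sup k - Inf k)\<bar>" if k: "k \<in> \<D>" for k
  proof -
    have "(f (Sup k) - f (Inf k))\<^sup>2 \<le> ?P k * (Sup k - Inf k)"
      using increment_bound[OF kk(2,3)[OF k]] by (simp add: mult.commute)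
    then have "\<bar>f (Sup k) - f (Inf k)\<bar> \<le> sqrt (?P k * (Sup k - Inf k))"
      using real_sqrt_le_mono by fastforce
    then show ?thesis using kk(2)[OF k] pairing_nonneg by (simp add: real_sqrt_mult)
  qed
  have "(\<Sum>k\<in>\<D>. \<bar>f (Sup k) - f (Inf k)\<bar>) \<le> (\<Sum>k\<in>\<D>. \<bar>sqrt (?P k) * sqrt (Sup k - Inf k)\<bar>)"
    by (rule sum_mono) (rule inc)
  also have "\<dots> \<le> sqrt (\<Sum>k\<in>\<D>. (sqrt (?P k))\<^sup>2) * sqrt (\<Sum>k\<in>\<D>. (sqrt (Sup k - Inf k))\<^sup>2)"
    by (rule sum_mult_le_sqrt)
  also have "\<dots> = sqrt (\<Sum>k\<in>\<D>. ?P k) * sqrt (\<Sum>k\<in>\<D>. Sup k - Inf k)"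
    using kk(2) pairing_nonneg by (simp cong: sum.cong)
  also have "\<dots> \<le> sqrt (pairing (interval s) (deriv f) (deriv f)) * sqrt (\<Sum>k\<in>\<D>. Sup k - Inf k)"
  proof (rule mult_right_mono)
    have sub: "interior k \<subseteq> interval s" if "k \<in> \<D>" for k
      using interval_interior[OF valid kk(3)[OF that]] kk(4)[OF that] by simp
    have dis: "(\<Sum>k\<in>\<D>. indicator (interior k) x :: real) \<le> indicator (interval s) x" for x
    proof (cases "\<exists>k\<in>\<D>. x \<in> interior k")
      case True
      then obtain k where k: "k \<in> \<D>" "x \<in> interior k" by auto
      have "indicator (interior k') x = (0 :: real)" if "k' \<in> \<D> - {k}" for k'
        using that k division_ofD(5)[OF D(1), of k k'] by (auto simp: indicator_def)
      then have "(\<Sum>k\<in>\<D>. indicator (interior k) x :: real) = indicator (interior k) x"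
        using sum.remove[OF fin k(1), of "\<lambda>k. indicator (interior k) x :: real"] by simp
      then show ?thesis using sub[OF k(1)] k(2) by auto
    next
      case False
      then show ?thesis by (auto simp: indicator_def intro!: sum.neutral)
    qed
    have Lk: "L2_function (interior k) (deriv f)" if "k \<in> \<D>" for k
      by (rule L2_function_subset(1)[OF L2d _ sub[OF that]]) auto
    have ik: "integrable lebesgue (\<lambda>x. indicator (interior k) x * (deriv f x * deriv f x))" if "k \<in> \<D>" for k
      by (rule pairing_integrable[OF Lk[OF that] Lk[OF that]])
    have "(\<Sum>k\<in>\<D>. ?P k) = (\<Sum>k\<in>\<D>. LINT x|lebesgue. indicator (interior k) x * (deriv f x * deriv f x))"
      using kk(4) by (auto simp: pairing_def set_lebesgue_integral_def intro!: sum.cong)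
    also have "\<dots> = (LINT x|lebesgue. (\<Sum>k\<in>\<D>. indicator (interior k) x * (deriv f x * deriv f x)))"
      by (rule Bochner_Integration.integral_sum[symmetric]) (rule ik)
    also have "\<dots> \<le> (LINT x|lebesgue. indicator (interval s) x * (deriv f x * deriv f x))"
    proof (rule integral_mono)
      show "integrable lebesgue (\<lambda>x. \<Sum>k\<in>\<D>. indicator (interior k) x * (deriv f x * deriv f x))"
        by (rule Bochner_Integration.integrable_sum) (rule ik)
      show "integrable lebesgue (\<lambda>x. indicator (interval s) x * (deriv f x * deriv f x))"
        by (rule pairing_integrable[OF L2d L2d])
      show "(\<Sum>k\<in>\<D>. indicator (interior k) x * (deriv f x * deriv f x)) \<le> indicator (interval s) x * (deriv f x * deriv f x)" for x
        unfolding sum_distrib_right[symmetric] by (rule mult_right_mono[OF dis]) simp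
    qed
    also have "\<dots> = pairing (interval s) (deriv f) (deriv f)"
      by (simp add: pairing_def set_lebesgue_integral_def)
    finally show "sqrt (\<Sum>k\<in>\<D>. ?P k) \<le> sqrt (pairing (interval s) (deriv f) (deriv f))" by simp
    show "0 \<le> sqrt (\<Sum>k\<in>\<D>. Sup k - Inf k)" using kk(2) by (auto intro!: sum_nonneg)
  qed
  finally show ?thesis .
qed

end

text \<open>A difference quotient that is constant on the cells of a mesh of width
  \<open>1 / N\<close>. It reads only countably many values of \<open>f\<close>, hence is measurable
  for every \<open>f\<close> and inherits pointwise limits, and Cauchy-Schwarz on each cell bounds
  its norm by that of the derivative. On cells that stick out of the closure, where values of
  \<open>f\<close> mean nothing, it is 0.\<close>

definition mesh_quotient :: "setting \<Rightarrow> real \<Rightarrow> (real \<Rightarrow> real) \<Rightarrow> real \<Rightarrow> real" where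
  "mesh_quotient s N f x =
     (let j = real_of_int \<lfloor>x * N\<rfloor> in
      if {j / N..(j + 1) / N} \<subseteq> closure (interval s) then N * (f ((j + 1) / N) - f (j / N)) else 0)"

lemma mesh_quotient_measurable: "mesh_quotient s N f \<in> borel_measurable lebesgue"
proof -
  have "(\<lambda>x::real. \<lfloor>x * N\<rfloor>) \<in> measurable borel (count_space UNIV)"
    by measurable
  then have "mesh_quotient s N f \<in> borel_measurable borel"
    unfolding mesh_quotient_def Let_def by (rule measurable_compose) simp
  then show ?thesis by (simp add: measurable_completion)
qed

lemma (in H1_function) mesh_quotient_bound:
  assumes N: "N > 0"
  shows "(\<integral>\<^sup>+x. ennreal ((mesh_quotient s N f x)\<^sup>2) \<partial>lebesgue)
    \<le> ennreal (pairing (interval s) (deriv f) (deriv f))"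
proof -
  have "(\<integral>\<^sup>+x. ennreal ((mesh_quotient s N f x)\<^sup>2) \<partial>lebesgue)
      \<le> (\<integral>\<^sup>+x. ennreal ((indicator (interval s) x * deriv f x)\<^sup>2) \<partial>lebesgue)"
  proof (rule nn_integral_cells_mono[OF N])
    show "(\<lambda>x. ennreal ((mesh_quotient s N f x)\<^sup>2)) \<in> borel_measurable lebesgue"
      by (intro measurable_compose[OF _ measurable_ennreal] borel_measurable_power mesh_quotient_measurable)
    show "(\<lambda>x. ennreal ((indicator (interval s) x * deriv f x)\<^sup>2)) \<in> borel_measurable lebesgue"
      by (intro measurable_compose[OF _ measurable_ennreal] borel_measurable_power L2_function_measurable L2d)
    fix j :: int
    let ?u = "real_of_int j / N" and ?v = "(real_of_int j + 1) / N"
    have fl: "\<lfloor>x * N\<rfloor> = j" if "x \<in> {?u..<?v}" for x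
      using that N by (simp add: floor_eq_iff pos_divide_le_eq pos_less_divide_eq)
    have uv: "?u \<le> ?v" using N by (simp add: divide_right_mono)
    show "(\<integral>\<^sup>+x. ennreal ((mesh_quotient s N f x)\<^sup>2) * indicator {?u..<?v} x \<partial>lebesgue)
       \<le> (\<integral>\<^sup>+x. ennreal ((indicator (interval s) x * deriv f x)\<^sup>2) * indicator {?u..<?v} x \<partial>lebesgue)"
    proof (cases "{?u..?v} \<subseteq> closure (interval s)")
      case False
      then have z: "mesh_quotient s N f x = 0" if "x \<in> {?u..<?v}" for x
        using fl[OF that] by (simp add: mesh_quotient_def Let_def)
      have "(\<lambda>x. ennreal ((mesh_quotient s N f x)\<^sup>2) * indicator {?u..<?v} x) = (\<lambda>x. 0)"
      proof
        fix x show "ennreal ((mesh_quotient s N f x)\<^sup>2) * indicator {?u..<?v} x = 0"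
          using z[of x] by (cases "x \<in> {?u..<?v}") auto
      qed
      then show ?thesis by simp
    next
      case True
      let ?P = "pairing {?u<..<?v} (deriv f) (deriv f)"
      have "mesh_quotient s N f x = N * (f ?v - f ?u)" if "x \<in> {?u..<?v}" for x
        using fl[OF that] True by (simp add: mesh_quotient_def Let_def)
      then have "(\<lambda>x. ennreal ((mesh_quotient s N f x)\<^sup>2) * indicator {?u..<?v} x)
          = (\<lambda>x. ennreal ((N * (f ?v - f ?u))\<^sup>2) * indicator {?u..<?v} x)"
        by (auto simp: indicator_def)
      then have "(\<integral>\<^sup>+x. ennreal ((mesh_quotient s N f x)\<^sup>2) * indicator {?u..<?v} x \<partial>lebesgue)
          = ennreal ((N * (f ?v - f ?u))\<^sup>2) * emeasure lebesgue {?u..<?v}"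
        by (simp add: nn_integral_cmult_indicator)
      also have "\<dots> = ennreal ((N * (f ?v - f ?u))\<^sup>2 * (1 / N))"
      proof -
        have "?v - ?u = 1 / N" by (simp add: add_divide_distrib)
        then have "emeasure lebesgue {?u..<?v} = ennreal (1 / N)"
          using emeasure_lborel_Ico[OF uv] by simp
        then show ?thesis using N by (simp add: ennreal_mult[symmetric])
      qed
      also have "\<dots> \<le> ennreal ?P"
      proof (rule ennreal_leI)
        have "(f ?v - f ?u)\<^sup>2 \<le> (1 / N) * ?P"
          using increment_bound[OF uv True] by (simp add: add_divide_distrib)
        then have "N * (f ?v - f ?u)\<^sup>2 \<le> N * ((1 / N) * ?P)" using N by (intro mult_left_mono) auto
        moreover have "(N * d)\<^sup>2 * (1 / N) = N * d\<^sup>2" for d using N by (simp add: power2_eq_square)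
        ultimately show "(N * (f ?v - f ?u))\<^sup>2 * (1 / N) \<le> ?P" using N by simp
      qed
      also have "\<dots> = (\<integral>\<^sup>+x. ennreal ((indicator {?u<..<?v} x * deriv f x)\<^sup>2) \<partial>lebesgue)"
        by (rule pairing_nn[OF L2d_sub[OF True], symmetric])
      also have "\<dots> \<le> (\<integral>\<^sup>+x. ennreal ((indicator (interval s) x * deriv f x)\<^sup>2) * indicator {?u..<?v} x \<partial>lebesgue)"
      proof (rule nn_integral_mono)
        fix x
        show "ennreal ((indicator {?u<..<?v} x * deriv f x)\<^sup>2)
          \<le> ennreal ((indicator (interval s) x * deriv f x)\<^sup>2) * indicator {?u..<?v} x"
        proof (cases "x \<in> {?u<..<?v}")
          case x: True
          then have "x \<in> interval s" using interval_interior[OF valid True] by blast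
          then show ?thesis using x by auto
        qed auto
      qed
      finally show ?thesis .
    qed
  qed
  also have "\<dots> = ennreal (pairing (interval s) (deriv f) (deriv f))" by (rule pairing_nn[OF L2d])
  finally show ?thesis .
qed

lemma mesh_quotient_tendsto:
  assumes der: "(f has_real_derivative D) (at x)" and x: "x \<in> interval s"
  shows "(\<lambda>n. mesh_quotient s (real (Suc n)) f x) \<longlonglongrightarrow> D"
proof -
  let ?u = "\<lambda>n. real_of_int \<lfloor>x * real (Suc n)\<rfloor> / real (Suc n)"
  let ?v = "\<lambda>n. (real_of_int \<lfloor>x * real (Suc n)\<rfloor> + 1) / real (Suc n)"
  have u: "?u n \<le> x" and v: "x \<le> ?v n" and uv: "?u n < ?v n" and d: "?v n - ?u n = inverse (real (Suc n))" for n
  proof -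
    show "?u n \<le> x" by (simp only: pos_divide_le_eq of_nat_0_less_iff zero_less_Suc) (rule of_int_floor_le)
    show "x \<le> ?v n" by (simp only: pos_le_divide_eq of_nat_0_less_iff zero_less_Suc) linarith
    show "?v n - ?u n = inverse (real (Suc n))" by (simp add: add_divide_distrib inverse_eq_divide)
    then show "?u n < ?v n" by (smt (verit) inverse_positive_iff_positive of_nat_0_less_iff zero_less_Suc)
  qed
  have lu: "?u \<longlonglongrightarrow> x"
  proof (rule tendsto_sandwich[OF _ _ _ tendsto_const])
    show "(\<lambda>n. x - inverse (real (Suc n))) \<longlonglongrightarrow> x" using LIMSEQ_inverse_real_of_nat_add_minus by simp
    show "\<forall>\<^sub>F n in sequentially. x - inverse (real (Suc n)) \<le> ?u n"
      using v d by (intro always_eventually allI) (smt (verit))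
    show "\<forall>\<^sub>F n in sequentially. ?u n \<le> x" using u by (intro always_eventually allI)
  qed
  have lv: "?v \<longlonglongrightarrow> x"
  proof (rule tendsto_sandwich[OF _ _ tendsto_const])
    show "(\<lambda>n. x + inverse (real (Suc n))) \<longlonglongrightarrow> x" using LIMSEQ_inverse_real_of_nat_add by simp
    show "\<forall>\<^sub>F n in sequentially. ?v n \<le> x + inverse (real (Suc n))"
      using u d by (intro always_eventually allI) (smt (verit))
    show "\<forall>\<^sub>F n in sequentially. x \<le> ?v n" using v by (intro always_eventually allI)
  qed
  have quot: "(\<lambda>n. (f (?v n) - f (?u n)) / (?v n - ?u n)) \<longlonglongrightarrow> D"
    by (rule straddle_tendsto[OF der lu lv u v uv])
  obtain e where e: "e > 0" "ball x e \<subseteq> interval s" using x open_interval[of s] openE by blast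
  have "\<forall>\<^sub>F n in sequentially. dist (?u n) x < e" "\<forall>\<^sub>F n in sequentially. dist (?v n) x < e"
    using tendstoD[OF lu e(1)] tendstoD[OF lv e(1)] by auto
  then have "\<forall>\<^sub>F n in sequentially. (f (?v n) - f (?u n)) / (?v n - ?u n) = mesh_quotient s (real (Suc n)) f x"
  proof eventually_elim
    case (elim n)
    have "{?u n..?v n} \<subseteq> ball x e"
      using elim u[of n] v[of n] by (auto simp: dist_real_def simp del: of_nat_Suc)
    then have "{?u n..?v n} \<subseteq> closure (interval s)" using e(2) closure_subset by blast
    then show ?case unfolding d mesh_quotient_def Let_def by (simp add: divide_inverse mult.commute del: of_nat_Suc)
  qed
  then show ?thesis using quot by (rule Lim_transform_eventually[rotated])
qed

text \<open>The derivatives themselves need not converge. On a fixed mesh the quotients of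
  \<open>U n\<close> converge to those of \<open>f\<close>, so Fatou's lemma bounds the latter by
  \<open>K\<close>; as the mesh is refined they converge almost everywhere to
  \<open>deriv f\<close>, and Fatou's lemma applies again.\<close>

theorem H1_limit:
  assumes valid: "valid_setting s" and U: "\<And>n. H1_function s (U n)"
    and K: "K \<ge> 0" "\<And>n. pairing (interval s) (deriv (U n)) (deriv (U n)) \<le> K"
    and lim: "\<And>x. x \<in> closure (interval s) \<Longrightarrow> (\<lambda>n. U n x) \<longlonglongrightarrow> f x"
  shows "H1_function s f" "pairing (interval s) (deriv f) (deriv f) \<le> K"
proof -
  have ac: "locally_abs_continuous_on_closure (interval s) f"
    unfolding locally_abs_continuous_on_closure_def
  proof (intro allI impI)
    fix c d assume cd: "{c..d} \<subseteq> closure (interval s)"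
    show "abs_continuous_on {c..d} f"
    proof (rule abs_continuous_onI_energy[OF K(1)])
      fix \<D> assume D: "\<D> division_of \<Union>\<D>" "\<Union>\<D> \<subseteq> {c..d}"
      have fin: "finite \<D>" using D(1) by blast
      have mem: "Sup k \<in> closure (interval s)" "Inf k \<in> closure (interval s)" "Inf k \<le> Sup k" if k: "k \<in> \<D>" for k
      proof -
        obtain u v where uv: "k = {u..v}" "u \<le> v" using division_of_realD[OF D(1) k] by metis
        then have "u \<in> k" "v \<in> k" by auto
        then have "u \<in> closure (interval s)" "v \<in> closure (interval s)" using k D(2) cd by blast+
        then show "Sup k \<in> closure (interval s)" "Inf k \<in> closure (interval s)" "Inf k \<le> Sup k" using uv by auto
      qed
      show "(\<Sum>k\<in>\<D>. \<bar>f (Sup k) - f (Inf k)\<bar>) \<le> sqrt K * sqrt (\<Sum>k\<in>\<D>. Sup k - Inf k)"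
      proof (rule tendsto_upperbound)
        show "(\<lambda>n. \<Sum>k\<in>\<D>. \<bar>U n (Sup k) - U n (Inf k)\<bar>) \<longlonglongrightarrow> (\<Sum>k\<in>\<D>. \<bar>f (Sup k) - f (Inf k)\<bar>)"
          by (intro tendsto_sum tendsto_rabs tendsto_diff lim mem)
        show "\<forall>\<^sub>F n in sequentially. (\<Sum>k\<in>\<D>. \<bar>U n (Sup k) - U n (Inf k)\<bar>) \<le> sqrt K * sqrt (\<Sum>k\<in>\<D>. Sup k - Inf k)"
        proof (intro always_eventually allI)
          fix n
          have "(\<Sum>k\<in>\<D>. \<bar>U n (Sup k) - U n (Inf k)\<bar>)
            \<le> sqrt (pairing (interval s) (deriv (U n)) (deriv (U n))) * sqrt (\<Sum>k\<in>\<D>. Sup k - Inf k)"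
            by (rule H1_function.energy_bound[OF U D cd])
          also have "\<dots> \<le> sqrt K * sqrt (\<Sum>k\<in>\<D>. Sup k - Inf k)"
            by (rule mult_right_mono) (use K(2)[of n] mem in \<open>auto intro!: sum_nonneg\<close>)
          finally show "(\<Sum>k\<in>\<D>. \<bar>U n (Sup k) - U n (Inf k)\<bar>) \<le> sqrt K * sqrt (\<Sum>k\<in>\<D>. Sup k - Inf k)" .
        qed
      qed simp
    qed
  qed
  have der: "AE x in lebesgue. x \<in> interval s \<longrightarrow> (f has_real_derivative deriv f x) (at x)"
    using locally_abs_continuous_differentiable_AE[OF open_interval ac]
    by eventually_elim (auto simp: field_differentiable_derivI DERIV_deriv_iff_real_differentiable)
  have mq: "(\<integral>\<^sup>+x. ennreal ((mesh_quotient s N f x)\<^sup>2) \<partial>lebesgue) \<le> ennreal K" if N: "N > 0" for N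
  proof -
    have "(\<lambda>n. mesh_quotient s N (U n) x) \<longlonglongrightarrow> mesh_quotient s N f x" for x
    proof (cases "{real_of_int \<lfloor>x * N\<rfloor> / N..(real_of_int \<lfloor>x * N\<rfloor> + 1) / N} \<subseteq> closure (interval s)")
      case True
      moreover have "real_of_int \<lfloor>x * N\<rfloor> / N \<le> (real_of_int \<lfloor>x * N\<rfloor> + 1) / N" using N by (simp add: divide_right_mono)
      ultimately have "real_of_int \<lfloor>x * N\<rfloor> / N \<in> closure (interval s)" "(real_of_int \<lfloor>x * N\<rfloor> + 1) / N \<in> closure (interval s)"
        by auto
      then show ?thesis using True unfolding mesh_quotient_def Let_def by (simp add: lim tendsto_diff tendsto_mult_left)
    qed (simp add: mesh_quotient_def Let_def)
    then have l: "(\<lambda>n. ennreal ((mesh_quotient s N (U n) x)\<^sup>2)) \<longlonglongrightarrow> ennreal ((mesh_quotient s N f x)\<^sup>2)" for x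
      by (intro tendsto_ennrealI tendsto_power)
    have "(\<integral>\<^sup>+x. ennreal ((mesh_quotient s N f x)\<^sup>2) \<partial>lebesgue)
        = (\<integral>\<^sup>+x. liminf (\<lambda>n. ennreal ((mesh_quotient s N (U n) x)\<^sup>2)) \<partial>lebesgue)"
      by (rule nn_integral_cong) (rule lim_imp_Liminf[OF trivial_limit_sequentially l, symmetric])
    also have "\<dots> \<le> liminf (\<lambda>n. \<integral>\<^sup>+x. ennreal ((mesh_quotient s N (U n) x)\<^sup>2) \<partial>lebesgue)"
      by (rule nn_integral_liminf)
        (intro measurable_compose[OF _ measurable_ennreal] borel_measurable_power mesh_quotient_measurable)
    also have "\<dots> \<le> ennreal K"
    proof (rule Liminf_le)
      show "\<forall>\<^sub>F n in sequentially. (\<integral>\<^sup>+x. ennreal ((mesh_quotient s N (U n) x)\<^sup>2) \<partial>lebesgue) \<le> ennreal K"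
        using H1_function.mesh_quotient_bound[OF U N] K(2)
        by (intro always_eventually allI) (meson ennreal_leI order_trans)
    qed simp
    finally show ?thesis .
  qed
  have L: "L2_function UNIV (mesh_quotient s (real (Suc n)) f) \<and> pairing UNIV (mesh_quotient s (real (Suc n)) f) (mesh_quotient s (real (Suc n)) f) \<le> K" for n
    unfolding L2_bound_iff[OF K(1)] using mq[of "real (Suc n)"] mesh_quotient_measurable by simp
  have sub: "L2_function (interval s) (mesh_quotient s (real (Suc n)) f)"
    "pairing (interval s) (mesh_quotient s (real (Suc n)) f) (mesh_quotient s (real (Suc n)) f) \<le> K" for n
    using L2_function_subset[OF conjunct1[OF L[of n]] interval_measurable[of s]] L[of n] by auto
  have l: "AE x in lebesgue. x \<in> interval s \<longrightarrow> (\<lambda>n. mesh_quotient s (real (Suc n)) f x) \<longlonglongrightarrow> deriv f x"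
    using der
  proof eventually_elim
    case (elim x)
    then show ?case using mesh_quotient_tendsto[of f "deriv f x" x s] by blast
  qed
  have "L2_function (interval s) (deriv f)" and le: "pairing (interval s) (deriv f) (deriv f) \<le> K"
    using L2_fatou[OF sub K(1) l] by auto
  then show "H1_function s f" using valid ac by unfold_locales
  show "pairing (interval s) (deriv f) (deriv f) \<le> K" by (rule le)
qed

section \<open>The form domain\<close>

lemma abs_continuous_on_add:
  assumes "abs_continuous_on S f" "abs_continuous_on S g"
  shows "abs_continuous_on S (\<lambda>x. f x + g x)"
  unfolding abs_continuous_on_def
proof (intro allI impI)
  fix e :: real assume "e > 0"
  then have e2: "e / 2 > 0" by simp
  obtain d1 where d1: "d1 > 0" "\<And>\<D>. \<D> division_of \<Union>\<D> \<and> \<Union>\<D> \<subseteq> S \<and> (\<Sum>k\<in>\<D>. Sup k - Inf k) < d1 \<Longrightarrow>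
        (\<Sum>k\<in>\<D>. \<bar>f (Sup k) - f (Inf k)\<bar>) < e / 2"
    using assms(1)[unfolded abs_continuous_on_def, rule_format, OF e2] by blast
  obtain d2 where d2: "d2 > 0" "\<And>\<D>. \<D> division_of \<Union>\<D> \<and> \<Union>\<D> \<subseteq> S \<and> (\<Sum>k\<in>\<D>. Sup k - Inf k) < d2 \<Longrightarrow>
        (\<Sum>k\<in>\<D>. \<bar>g (Sup k) - g (Inf k)\<bar>) < e / 2"
    using assms(2)[unfolded abs_continuous_on_def, rule_format, OF e2] by blast
  show "\<exists>\<delta>>0. \<forall>\<D>. \<D> division_of \<Union>\<D> \<and> \<Union>\<D> \<subseteq> S \<and> (\<Sum>k\<in>\<D>. Sup k - Inf k) < \<delta> \<longrightarrow>
        (\<Sum>k\<in>\<D>. \<bar>f (Sup k) + g (Sup k) - (f (Inf k) + g (Inf k))\<bar>) < e"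
  proof (intro exI[of _ "min d1 d2"] conjI allI impI)
    show "min d1 d2 > 0" using d1 d2 by simp
    fix \<D> assume D: "\<D> division_of \<Union>\<D> \<and> \<Union>\<D> \<subseteq> S \<and> (\<Sum>k\<in>\<D>. Sup k - Inf k) < min d1 d2"
    have "(\<Sum>k\<in>\<D>. \<bar>f (Sup k) + g (Sup k) - (f (Inf k) + g (Inf k))\<bar>)
        \<le> (\<Sum>k\<in>\<D>. \<bar>f (Sup k) - f (Inf k)\<bar> + \<bar>g (Sup k) - g (Inf k)\<bar>)"
      by (rule sum_mono) arith
    also have "\<dots> < e" using d1(2)[of \<D>] d2(2)[of \<D>] D by (simp add: sum.distrib)
    finally show "(\<Sum>k\<in>\<D>. \<bar>f (Sup k) + g (Sup k) - (f (Inf k) + g (Inf k))\<bar>) < e" .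
  qed
qed

lemma abs_continuous_on_scale:
  assumes "abs_continuous_on S f"
  shows "abs_continuous_on S (\<lambda>x. c * f x)"
  unfolding abs_continuous_on_def
proof (intro allI impI)
  fix e :: real assume e: "e > 0"
  have c: "\<bar>c\<bar> + 1 > 0" by simp
  have e2: "e / (\<bar>c\<bar> + 1) > 0" using e c by simp
  obtain d1 where d1: "d1 > 0" "\<And>\<D>. \<D> division_of \<Union>\<D> \<and> \<Union>\<D> \<subseteq> S \<and> (\<Sum>k\<in>\<D>. Sup k - Inf k) < d1 \<Longrightarrow>
        (\<Sum>k\<in>\<D>. \<bar>f (Sup k) - f (Inf k)\<bar>) < e / (\<bar>c\<bar> + 1)"
    using assms[unfolded abs_continuous_on_def, rule_format, OF e2] by blast
  show "\<exists>\<delta>>0. \<forall>\<D>. \<D> division_of \<Union>\<D> \<and> \<Union>\<D> \<subseteq> S \<and> (\<Sum>k\<in>\<D>. Sup k - Inf k) < \<delta> \<longrightarrow>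
        (\<Sum>k\<in>\<D>. \<bar>c * f (Sup k) - c * f (Inf k)\<bar>) < e"
  proof (intro exI[of _ d1] conjI allI impI d1(1))
    fix \<D> assume D: "\<D> division_of \<Union>\<D> \<and> \<Union>\<D> \<subseteq> S \<and> (\<Sum>k\<in>\<D>. Sup k - Inf k) < d1"
    let ?s = "\<Sum>k\<in>\<D>. \<bar>f (Sup k) - f (Inf k)\<bar>"
    have "(\<Sum>k\<in>\<D>. \<bar>c * f (Sup k) - c * f (Inf k)\<bar>) = \<bar>c\<bar> * ?s"
      by (simp add: sum_distrib_left right_diff_distrib[symmetric] abs_mult)
    also have "\<dots> \<le> (\<bar>c\<bar> + 1) * ?s" by (rule mult_right_mono) (auto intro: sum_nonneg)
    also have "\<dots> < e" using d1(2)[OF D] c by (simp add: pos_less_divide_eq mult.commute)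
    finally show "(\<Sum>k\<in>\<D>. \<bar>c * f (Sup k) - c * f (Inf k)\<bar>) < e" .
  qed
qed

lemma H1_function_add:
  assumes f: "H1_function s f" and g: "H1_function s g"
  shows "H1_function s (\<lambda>x. f x + g x)"
    "L2_class (interval s) (deriv (\<lambda>x. f x + g x)) = L2_class (interval s) (deriv f) + L2_class (interval s) (deriv g)"
proof -
  have ae: "AE x in lebesgue. x \<in> interval s \<longrightarrow> deriv f x + deriv g x = deriv (\<lambda>x. f x + g x) x"
    using H1_function.has_deriv_AE[OF f] H1_function.has_deriv_AE[OF g]
    by eventually_elim (auto intro!: DERIV_imp_deriv[symmetric] DERIV_add)
  have L: "L2_function (interval s) (\<lambda>x. deriv f x + deriv g x)"
    by (intro L2_function_add H1_function.L2d f g)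
  show "H1_function s (\<lambda>x. f x + g x)"
  proof
    show "valid_setting s" using f by (rule H1_function.valid)
    show "locally_abs_continuous_on_closure (interval s) (\<lambda>x. f x + g x)"
      using H1_function.ac[OF f] H1_function.ac[OF g]
      by (simp add: locally_abs_continuous_on_closure_def abs_continuous_on_add)
    show "L2_function (interval s) (deriv (\<lambda>x. f x + g x))" by (rule L2_function_cong_AE(1)[OF L ae])
  qed
  show "L2_class (interval s) (deriv (\<lambda>x. f x + g x)) = L2_class (interval s) (deriv f) + L2_class (interval s) (deriv g)"
    unfolding L2_function_cong_AE(2)[OF L ae]
    by (intro L2_class_add H1_function.L2d f g)
qed

lemma H1_function_scale:
  assumes f: "H1_function s f"
  shows "H1_function s (\<lambda>x. c * f x)"
    "L2_class (interval s) (deriv (\<lambda>x. c * f x)) = c *\<^sub>R L2_class (interval s) (deriv f)"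
proof -
  have ae: "AE x in lebesgue. x \<in> interval s \<longrightarrow> c * deriv f x = deriv (\<lambda>x. c * f x) x"
    using H1_function.has_deriv_AE[OF f]
    by eventually_elim (auto intro!: DERIV_imp_deriv[symmetric] DERIV_cmult)
  have L: "L2_function (interval s) (\<lambda>x. c * deriv f x)"
    by (intro L2_function_scale H1_function.L2d f)
  show "H1_function s (\<lambda>x. c * f x)"
  proof
    show "valid_setting s" using f by (rule H1_function.valid)
    show "locally_abs_continuous_on_closure (interval s) (\<lambda>x. c * f x)"
      using H1_function.ac[OF f]
      by (simp add: locally_abs_continuous_on_closure_def abs_continuous_on_scale)
    show "L2_function (interval s) (deriv (\<lambda>x. c * f x))" by (rule L2_function_cong_AE(1)[OF L ae])
  qed
  show "L2_class (interval s) (deriv (\<lambda>x. c * f x)) = c *\<^sub>R L2_class (interval s) (deriv f)"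
    unfolding L2_function_cong_AE(2)[OF L ae]
    by (intro L2_class_scale H1_function.L2d f)
qed

section \<open>The weighted Sobolev space: point evaluation, completeness, compactness\<close>

locale potential_setting =
  fixes s :: setting and V :: "real \<Rightarrow> real"
  assumes valid: "valid_setting s" and pot: "admissible_potential (interval s) V"
begin

abbreviation "I \<equiv> interval s"
abbreviation "J \<equiv> closure (interval s)"
abbreviation "H1 \<equiv> H1V (interval s) V"
text \<open>The classes of the function, of its derivative and of its product with the square root
  of \<open>V\<close> carry the three parts of the form norm, so that linearity and the
  parallelogram law come from \<open>L2\<close>. On \<open>H1\<close>, \<open>star\<close> is the
  square of \<open>norm_star\<close>.\<close>

definition "c0 f = L2_class I f"
definition "c1 f = L2_class I (deriv f)"
definition "cV f = L2_class I (\<lambda>x. sqrt (V x) * f x)"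

definition "star f = (norm (c1 f))\<^sup>2 + (norm (cV f))\<^sup>2 + (norm (c0 f))\<^sup>2"

lemma V_nonneg: "x \<in> I \<Longrightarrow> V x \<ge> 0"
  using pot by (simp add: admissible_potential_def)

lemma H1V_iff: "f \<in> H1 \<longleftrightarrow> H1_function s f \<and> L2_function I f \<and> L2_function I (\<lambda>x. sqrt (V x) * f x)"
  using valid by (auto simp: H1V_def H1_function_def)

lemma H1V_D:
  assumes "f \<in> H1"
  shows "H1_function s f" "L2_function I f" "L2_function I (deriv f)" "L2_function I (\<lambda>x. sqrt (V x) * f x)"
  using assms H1_function.L2d by (auto simp: H1V_iff)

lemma pairing_c:
  assumes "f \<in> H1" "g \<in> H1"
  shows "pairing I f g = inner (c0 f) (c0 g)" "pairing I (deriv f) (deriv g) = inner (c1 f) (c1 g)"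
    "pairing I (\<lambda>x. sqrt (V x) * f x) (\<lambda>x. sqrt (V x) * g x) = inner (cV f) (cV g)"
    "pairing I (\<lambda>x. f x * g x) V = inner (cV f) (cV g)"
proof -
  show "pairing I f g = inner (c0 f) (c0 g)" "pairing I (deriv f) (deriv g) = inner (c1 f) (c1 g)"
    unfolding c0_def c1_def by (intro pairing_inner H1V_D assms)+
  show 3: "pairing I (\<lambda>x. sqrt (V x) * f x) (\<lambda>x. sqrt (V x) * g x) = inner (cV f) (cV g)"
    unfolding cV_def by (intro pairing_inner H1V_D assms)
  have "pairing I (\<lambda>x. f x * g x) V = pairing I (\<lambda>x. sqrt (V x) * f x) (\<lambda>x. sqrt (V x) * g x)"
    unfolding pairing_def set_lebesgue_integral_def
  proof (rule Bochner_Integration.integral_cong[OF refl])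
    fix x
    have "sqrt (V x) * f x * (sqrt (V x) * g x) = (sqrt (V x) * sqrt (V x)) * (f x * g x)" by (simp only: ac_simps)
    then show "indicator I x *\<^sub>R (f x * g x * V x) = indicator I x *\<^sub>R (sqrt (V x) * f x * (sqrt (V x) * g x))"
      using V_nonneg[of x] by (cases "x \<in> I") simp_all
  qed
  then show "pairing I (\<lambda>x. f x * g x) V = inner (cV f) (cV g)" using 3 by simp
qed

lemma star_norm: "f \<in> H1 \<Longrightarrow> norm_star I V f = sqrt (star f)"
  by (simp add: norm_star_def star_def pairing_c power2_norm_eq_inner)

lemma star_nonneg: "star f \<ge> 0"
  by (simp add: star_def)

lemma H1V_add:
  assumes "f \<in> H1" "g \<in> H1"
  shows "(\<lambda>x. f x + g x) \<in> H1" "c0 (\<lambda>x. f x + g x) = c0 f + c0 g"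
    "c1 (\<lambda>x. f x + g x) = c1 f + c1 g" "cV (\<lambda>x. f x + g x) = cV f + cV g"
proof -
  note D = H1V_D[OF assms(1)] H1V_D[OF assms(2)]
  show "(\<lambda>x. f x + g x) \<in> H1"
    unfolding H1V_iff distrib_left using D by (intro conjI H1_function_add(1) L2_function_add)
  show "c0 (\<lambda>x. f x + g x) = c0 f + c0 g" unfolding c0_def using D by (intro L2_class_add)
  show "c1 (\<lambda>x. f x + g x) = c1 f + c1 g" unfolding c1_def using D by (intro H1_function_add(2))
  show "cV (\<lambda>x. f x + g x) = cV f + cV g" unfolding cV_def distrib_left using D by (intro L2_class_add)
qed

lemma H1V_scale:
  assumes "f \<in> H1"
  shows "(\<lambda>x. c * f x) \<in> H1" "c0 (\<lambda>x. c * f x) = c *\<^sub>R c0 f"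
    "c1 (\<lambda>x. c * f x) = c *\<^sub>R c1 f" "cV (\<lambda>x. c * f x) = c *\<^sub>R cV f"
proof -
  note D = H1V_D[OF assms(1)]
  show "(\<lambda>x. c * f x) \<in> H1"
    unfolding H1V_iff mult.left_commute[of _ c] using D by (intro conjI H1_function_scale(1) L2_function_scale)
  show "c0 (\<lambda>x. c * f x) = c *\<^sub>R c0 f" unfolding c0_def using D by (intro L2_class_scale)
  show "c1 (\<lambda>x. c * f x) = c *\<^sub>R c1 f" unfolding c1_def using D by (intro H1_function_scale(2))
  show "cV (\<lambda>x. c * f x) = c *\<^sub>R cV f" unfolding cV_def mult.left_commute[of _ c] using D by (intro L2_class_scale)
qed

lemma H1V_diff:
  assumes "f \<in> H1" "g \<in> H1"
  shows "(\<lambda>x. f x - g x) \<in> H1" "c0 (\<lambda>x. f x - g x) = c0 f - c0 g"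
    "c1 (\<lambda>x. f x - g x) = c1 f - c1 g" "cV (\<lambda>x. f x - g x) = cV f - cV g"
  using H1V_add[OF assms(1) H1V_scale(1)[OF assms(2)], of "-1"] H1V_scale[OF assms(2), of "-1"] by simp_all

lemma H1V_zero: "(\<lambda>x. 0) \<in> H1"
proof -
  have "L2_function I (\<lambda>x. 0)" by (simp add: L2_function_iff square_integrable_0)
  moreover have "H1_function s (\<lambda>x. 0)"
    using valid \<open>L2_function I (\<lambda>x. 0)\<close>
    by unfold_locales (auto simp: locally_abs_continuous_on_closure_def abs_continuous_on_def intro: exI[of _ 1])
  ultimately show ?thesis by (simp add: H1V_iff)
qed

text \<open>The length \<open>r\<close> of the segment over which \<open>pointwise_bound\<close>
  averages is free: shrinking it makes the weight of the derivative as small as desired, at the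
  price of \<open>2 / r\<close> on the norm of \<open>f\<close>. Point evaluations are thereby
  infinitesimally form bounded.\<close>

lemma pointwise_le_star:
  obtains r0 where "r0 > 0" "\<And>f x r. \<lbrakk>f \<in> H1; x \<in> J; 0 < r; r \<le> r0\<rbrakk> \<Longrightarrow>
    (f x)\<^sup>2 \<le> 2 * r * (norm (c1 f))\<^sup>2 + 2 / r * (norm (c0 f))\<^sup>2"
proof -
  obtain r0 where r0: "r0 > 0" "r0 \<le> 1"
    "\<And>x r. \<lbrakk>x \<in> J; 0 < r; r \<le> r0\<rbrakk> \<Longrightarrow> \<exists>c. {c..c + r} \<subseteq> J \<and> x \<in> {c..c + r}"
    using interval_segment[OF valid] by metis
  show thesis
  proof (rule that[OF r0(1)])
    fix f x r assume f: "f \<in> H1" and x: "x \<in> J" and r: "0 < r" "r \<le> r0"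
    obtain c where c: "{c..c + r} \<subseteq> J" "x \<in> {c..c + r}" using r0(3)[OF x r] by blast
    interpret f: H1_function s f using f by (rule H1V_D)
    have sub: "{c<..<c + r} \<subseteq> I" by (rule interval_interior[OF valid c(1)])
    have L: "L2_function {c<..<c + r} f" "pairing {c<..<c + r} f f \<le> pairing I f f"
      "pairing {c<..<c + r} (deriv f) (deriv f) \<le> pairing I (deriv f) (deriv f)"
      using L2_function_subset[OF H1V_D(2)[OF f] _ sub] L2_function_subset[OF H1V_D(3)[OF f] _ sub] by auto
    have "(f x)\<^sup>2 \<le> 2 / r * pairing {c<..<c + r} f f + 2 * r * pairing {c<..<c + r} (deriv f) (deriv f)"
      by (rule f.pointwise_bound[OF r(1) c L(1)])
    also have "\<dots> \<le> 2 / r * pairing I f f + 2 * r * pairing I (deriv f) (deriv f)"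
      by (rule add_mono; rule mult_left_mono) (use L r in auto)
    finally show "(f x)\<^sup>2 \<le> 2 * r * (norm (c1 f))\<^sup>2 + 2 / r * (norm (c0 f))\<^sup>2"
      by (simp add: pairing_c f power2_norm_eq_inner)
  qed
qed

lemma pointwise_bound_star:
  obtains B where "B > 0" "\<And>f x. \<lbrakk>f \<in> H1; x \<in> J\<rbrakk> \<Longrightarrow> (f x)\<^sup>2 \<le> B * star f"
proof -
  obtain r0 where r0: "r0 > 0" "\<And>f x r. \<lbrakk>f \<in> H1; x \<in> J; 0 < r; r \<le> r0\<rbrakk> \<Longrightarrow>
    (f x)\<^sup>2 \<le> 2 * r * (norm (c1 f))\<^sup>2 + 2 / r * (norm (c0 f))\<^sup>2"
    using pointwise_le_star by blast
  define B where "B = 2 * r0 + 2 / r0"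
  have "B > 0" using r0(1) by (simp add: B_def add_pos_pos)
  then show thesis
  proof (rule that)
    fix f x assume f: "f \<in> H1" and x: "x \<in> J"
    have "(f x)\<^sup>2 \<le> 2 * r0 * (norm (c1 f))\<^sup>2 + 2 / r0 * (norm (c0 f))\<^sup>2" using r0(2)[OF f x r0(1)] by simp
    also have "\<dots> \<le> B * (norm (c1 f))\<^sup>2 + B * (norm (c0 f))\<^sup>2"
      using r0(1) by (intro add_mono mult_right_mono) (auto simp: B_def)
    also have "\<dots> \<le> B * star f" using \<open>B > 0\<close> by (simp add: star_def distrib_left)
    finally show "(f x)\<^sup>2 \<le> B * star f" .
  qed
qed

lemma V_tail:
  fixes M :: real
  obtains R where "R > 0" "\<And>x. \<lbrakk>x \<in> I; \<bar>x\<bar> \<ge> R\<rbrakk> \<Longrightarrow> V x \<ge> M * ln \<bar>x\<bar>"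
proof -
  have "\<forall>\<^sub>F x in inf at_top (principal I). ereal M < ereal (V x / ln \<bar>x\<bar>)"
    "\<forall>\<^sub>F x in inf at_bot (principal I). ereal M < ereal (V x / ln \<bar>x\<bar>)"
  proof -
    have "\<infinity> \<le> Liminf (inf at_top (principal I)) (\<lambda>x. ereal (V x / ln \<bar>x\<bar>))"
      "\<infinity> \<le> Liminf (inf at_bot (principal I)) (\<lambda>x. ereal (V x / ln \<bar>x\<bar>))"
      using pot by (simp_all add: admissible_potential_def)
    note L = this
    show "\<forall>\<^sub>F x in inf at_top (principal I). ereal M < ereal (V x / ln \<bar>x\<bar>)"
      by (rule le_Liminf_iff[THEN iffD1, OF L(1), rule_format]) simp
    show "\<forall>\<^sub>F x in inf at_bot (principal I). ereal M < ereal (V x / ln \<bar>x\<bar>)"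
      by (rule le_Liminf_iff[THEN iffD1, OF L(2), rule_format]) simp
  qed
  then obtain a b where ab: "\<And>x. \<lbrakk>x \<ge> a; x \<in> I\<rbrakk> \<Longrightarrow> M < V x / ln \<bar>x\<bar>" "\<And>x. \<lbrakk>x \<le> b; x \<in> I\<rbrakk> \<Longrightarrow> M < V x / ln \<bar>x\<bar>"
    unfolding eventually_inf_principal eventually_at_top_linorder eventually_at_bot_linorder by auto
  show thesis
  proof (rule that[of "max 2 (max a (- b))"])
    fix x assume x: "x \<in> I" "max 2 (max a (- b)) \<le> \<bar>x\<bar>"
    then have "x \<ge> a \<or> x \<le> b" by (cases "x \<ge> 0") auto
    then have "M < V x / ln \<bar>x\<bar>" using ab x(1) by blast
    moreover have "ln \<bar>x\<bar> > 0" using x(2) by (intro ln_gt_zero) auto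
    ultimately show "V x \<ge> M * ln \<bar>x\<bar>" by (simp add: pos_less_divide_eq)
  qed auto
qed

text \<open>The shape in which the growth of \<open>V\<close> enters the estimates: an arbitrarily
  small multiple of \<open>V\<close> absorbs the logarithm up to a constant. The shift by 2 keeps
  the logarithm positive near the origin and costs at most 2 where
  \<open>\<bar>x\<bar> \<ge> 1\<close>.\<close>

lemma log_le_V:
  fixes \<theta> :: real
  assumes \<theta>: "\<theta> > 0"
  obtains C where "C \<ge> 0" "\<And>x. x \<in> I \<Longrightarrow> ln (2 + \<bar>x\<bar>) \<le> \<theta> * V x + C"
proof -
  obtain R where R: "R > 0" "\<And>x. \<lbrakk>x \<in> I; \<bar>x\<bar> \<ge> R\<rbrakk> \<Longrightarrow> V x \<ge> 1 / \<theta> * ln \<bar>x\<bar>" using V_tail by blast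
  show thesis
  proof (rule that[of "ln (2 + R) + 2"])
    show "ln (2 + R) + 2 \<ge> 0" using R(1) by (intro add_nonneg_nonneg ln_ge_zero) auto
    fix x assume x: "x \<in> I"
    show "ln (2 + \<bar>x\<bar>) \<le> \<theta> * V x + (ln (2 + R) + 2)"
    proof (cases "\<bar>x\<bar> \<ge> max R 1")
      case True
      have x1: "1 \<le> \<bar>x\<bar>" using True by simp
      then have x0: "0 < \<bar>x\<bar>" by linarith
      have "ln (2 + \<bar>x\<bar>) \<le> ln (3 * \<bar>x\<bar>)" using x1 x0 by (subst ln_le_cancel_iff) linarith+
      also have "\<dots> = ln 3 + ln \<bar>x\<bar>" by (rule ln_mult_pos[OF _ x0]) simp
      also have "ln 3 \<le> (2::real)" using ln_le_minus_one[of "3::real"] by simp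
      finally have "ln (2 + \<bar>x\<bar>) \<le> 2 + ln \<bar>x\<bar>" by simp
      moreover have "ln \<bar>x\<bar> \<le> \<theta> * V x" using R(2)[OF x] True \<theta> by (simp add: pos_divide_le_eq mult.commute)
      moreover have "ln (2 + R) \<ge> 0" using R(1) by simp
      ultimately show ?thesis by linarith
    next
      case False
      have "ln (2 + \<bar>x\<bar>) \<le> ln (2 + R) + 2"
      proof (cases "\<bar>x\<bar> \<le> R")
        case True
        then have "ln (2 + \<bar>x\<bar>) \<le> ln (2 + R)" by (subst ln_le_cancel_iff) auto
        then show ?thesis by simp
      next
        case 2: False
        then have "ln (2 + \<bar>x\<bar>) \<le> ln 3" using False by (subst ln_le_cancel_iff) auto
        also have "ln 3 \<le> (2::real)" using ln_le_minus_one[of "3::real"] by simp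
        moreover have "ln (2 + R) \<ge> 0" using R(1) by simp
        ultimately show ?thesis by linarith
      qed
      moreover have "\<theta> * V x \<ge> 0" using \<theta> V_nonneg[OF x] by simp
      ultimately show ?thesis by linarith
    qed
  qed
qed

text \<open>Point values are Cauchy because the norm controls them. For fixed \<open>m\<close>, the
  bounds on \<open>U n - U m\<close> pass to the limit in \<open>n\<close> separately for the three
  parts of the norm, which accounts for the factor 3 in \<open>key\<close>.\<close>

lemma H1V_complete:
  assumes U: "\<And>n. U n \<in> H1"
    and C: "\<And>e. e > 0 \<Longrightarrow> \<exists>N. \<forall>m\<ge>N. \<forall>n\<ge>N. star (\<lambda>x. U m x - U n x) < e"
  obtains f where "f \<in> H1" "(\<lambda>n. star (\<lambda>x. U n x - f x)) \<longlonglongrightarrow> 0" "\<And>x. x \<in> J \<Longrightarrow> (\<lambda>n. U n x) \<longlonglongrightarrow> f x"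
proof -
  obtain B where B: "B > 0" "\<And>f x. \<lbrakk>f \<in> H1; x \<in> J\<rbrakk> \<Longrightarrow> (f x)\<^sup>2 \<le> B * star f" using pointwise_bound_star by blast
  have "Cauchy (\<lambda>n. U n x)" if x: "x \<in> J" for x
    unfolding Cauchy_def
  proof (intro allI impI)
    fix e :: real assume e: "e > 0"
    then have "e\<^sup>2 / B > 0" using B by simp
    from C[OF this] obtain N where N: "\<And>m n. \<lbrakk>m \<ge> N; n \<ge> N\<rbrakk> \<Longrightarrow> star (\<lambda>x. U m x - U n x) < e\<^sup>2 / B" by blast
    show "\<exists>M. \<forall>m\<ge>M. \<forall>n\<ge>M. dist (U m x) (U n x) < e"
    proof (intro exI[of _ N] allI impI)
      fix m n assume "m \<ge> N" "n \<ge> N"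
      then have "B * star (\<lambda>x. U m x - U n x) < e\<^sup>2" using N[of m n] B(1) by (simp add: pos_less_divide_eq mult.commute)
      then have "(U m x - U n x)\<^sup>2 < e\<^sup>2"
        using B(2)[OF H1V_diff(1)[OF U U] x, of m n] by linarith
      from real_sqrt_less_mono[OF this] show "dist (U m x) (U n x) < e" using e by (simp add: dist_real_def)
    qed
  qed
  then have "\<forall>x. \<exists>l. x \<in> J \<longrightarrow> (\<lambda>n. U n x) \<longlonglongrightarrow> l" using Cauchy_convergent convergent_def by blast
  then obtain f where f: "\<And>x. x \<in> J \<Longrightarrow> (\<lambda>n. U n x) \<longlonglongrightarrow> f x" by metis
  have key: "\<exists>N. \<forall>m\<ge>N. (\<lambda>x. f x - U m x) \<in> H1 \<and> star (\<lambda>x. f x - U m x) \<le> 3 * e" if e: "e > 0" for e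
  proof -
    obtain N where N: "\<And>m n. \<lbrakk>m \<ge> N; n \<ge> N\<rbrakk> \<Longrightarrow> star (\<lambda>x. U m x - U n x) < e" using C[OF e] by blast
    show ?thesis
    proof (intro exI[of _ N] allI impI)
      fix m assume m: "m \<ge> N"
      let ?W = "\<lambda>n x. U (n + N) x - U m x"
      have W: "?W n \<in> H1" for n using H1V_diff(1)[OF U U] .
      have sW: "star (?W n) \<le> e" for n using N[of "n + N" m] m by simp
      have b: "pairing I (?W n) (?W n) \<le> e" "pairing I (deriv (?W n)) (deriv (?W n)) \<le> e"
        "pairing I (\<lambda>x. sqrt (V x) * ?W n x) (\<lambda>x. sqrt (V x) * ?W n x) \<le> e" for n
        using sW[of n] W[of n]
        unfolding pairing_c[OF W W] power2_norm_eq_inner[symmetric] star_def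
        by (auto intro: order_trans[rotated])
      have l: "(\<lambda>n. ?W n x) \<longlonglongrightarrow> f x - U m x" if "x \<in> J" for x
        by (intro tendsto_diff tendsto_const LIMSEQ_ignore_initial_segment f that)
      have lI: "x \<in> I \<longrightarrow> (\<lambda>n. ?W n x) \<longlonglongrightarrow> f x - U m x" for x using l closure_subset[of I] by blast
      have lV: "x \<in> I \<longrightarrow> (\<lambda>n. sqrt (V x) * ?W n x) \<longlonglongrightarrow> sqrt (V x) * (f x - U m x)" for x
        using lI[of x] tendsto_mult_left by blast
      have e0: "0 \<le> e" using e by simp
      have h: "H1_function s (\<lambda>x. f x - U m x)"
        "pairing I (deriv (\<lambda>x. f x - U m x)) (deriv (\<lambda>x. f x - U m x)) \<le> e"
        using H1_limit[OF valid H1V_D(1)[OF W] e0 b(2) l] by auto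
      have h0: "L2_function I (\<lambda>x. f x - U m x)" "pairing I (\<lambda>x. f x - U m x) (\<lambda>x. f x - U m x) \<le> e"
        using L2_fatou[OF H1V_D(2)[OF W] b(1) e0 AE_I2[OF lI]] by auto
      have hV: "L2_function I (\<lambda>x. sqrt (V x) * (f x - U m x))"
        "pairing I (\<lambda>x. sqrt (V x) * (f x - U m x)) (\<lambda>x. sqrt (V x) * (f x - U m x)) \<le> e"
        using L2_fatou[OF H1V_D(4)[OF W] b(3) e0 AE_I2[OF lV]] by auto
      have H: "(\<lambda>x. f x - U m x) \<in> H1" using h h0 hV by (simp add: H1V_iff)
      moreover have "star (\<lambda>x. f x - U m x) \<le> 3 * e"
        using h(2) h0(2) hV(2) unfolding pairing_c[OF H H] by (simp add: star_def power2_norm_eq_inner)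
      ultimately show "(\<lambda>x. f x - U m x) \<in> H1 \<and> star (\<lambda>x. f x - U m x) \<le> 3 * e" by simp
    qed
  qed
  obtain N where "(\<lambda>x. f x - U N x) \<in> H1" using key[of 1] by auto
  from H1V_add(1)[OF this U[of N]] have fH: "f \<in> H1" by simp
  have "(\<lambda>n. star (\<lambda>x. U n x - f x)) \<longlonglongrightarrow> 0"
  proof (rule LIMSEQ_I)
    fix e :: real assume e: "e > 0"
    then have "e / 6 > 0" by simp
    from key[OF this] obtain N where N: "\<And>m. m \<ge> N \<Longrightarrow> star (\<lambda>x. f x - U m x) \<le> 3 * (e / 6)" by blast
    have sw: "star (\<lambda>x. U n x - f x) = star (\<lambda>x. f x - U n x)" for n
      using H1V_diff[OF U fH, of n] H1V_diff[OF fH U, of n] by (simp add: star_def norm_minus_commute)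
    show "\<exists>no. \<forall>n\<ge>no. norm (star (\<lambda>x. U n x - f x) - 0) < e"
    proof (intro exI[of _ N] allI impI)
      fix n assume "n \<ge> N"
      then show "norm (star (\<lambda>x. U n x - f x) - 0) < e" using N[of n] e star_nonneg by (simp add: sw)
    qed
  qed
  with fH show thesis using f by (rule that)
qed

text \<open>Bounded energy makes the sequence uniformly Hoelder continuous of order 1/2, so
  convergence at the rational points along a diagonal subsequence extends to all of
  \<open>J\<close>. In \<open>L2\<close>, bounded regions are settled by dominated convergence, and
  the tails are uniformly small because \<open>V\<close> is large there.\<close>

lemma H1V_compact:
  assumes U: "\<And>n. U n \<in> H1" and C: "\<And>n. star (U n) \<le> C"
  obtains r f where "strict_mono (r :: nat \<Rightarrow> nat)" "(\<lambda>n. c0 (U (r n))) \<longlonglongrightarrow> L2_class I f"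
proof -
  obtain B where B: "B > 0" "\<And>f x. \<lbrakk>f \<in> H1; x \<in> J\<rbrakk> \<Longrightarrow> (f x)\<^sup>2 \<le> B * star f" using pointwise_bound_star by blast
  have C0: "C \<ge> 0" using C[of 0] star_nonneg[of "U 0"] by linarith
  have sq: "(U n x)\<^sup>2 \<le> B * C" if "x \<in> J" for n x
    using B(2)[OF U that, of n] mult_left_mono[OF C[of n], of B] B(1) by linarith
  have bnd: "norm (U n x) \<le> sqrt (B * C)" if "x \<in> J" for n x
    using real_sqrt_le_mono[OF sq[OF that, of n]] by simp
  have inc: "(U n y - U n x)\<^sup>2 \<le> (y - x) * C" if "x \<le> y" "x \<in> J" "y \<in> J" for n x y
  proof -
    interpret u: H1_function s "U n" using U by (rule H1V_D)
    have sub: "{x..y} \<subseteq> J" by (rule interval_convex[OF valid that(2,3)])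
    have "pairing {x<..<y} (deriv (U n)) (deriv (U n)) \<le> pairing I (deriv (U n)) (deriv (U n))"
      by (rule L2_function_subset(2)[OF u.L2d]) (use interval_interior[OF valid sub] in auto)
    also have "\<dots> \<le> star (U n)" using U by (simp add: pairing_c power2_norm_eq_inner[symmetric] star_def)
    also have "\<dots> \<le> C" by (rule C)
    finally have "(y - x) * pairing {x<..<y} (deriv (U n)) (deriv (U n)) \<le> (y - x) * C"
      using that(1) by (intro mult_left_mono) auto
    then show ?thesis using u.increment_bound[OF that(1) sub] by linarith
  qed
  have cQ: "countable (J \<inter> \<rat>)" by (rule countable_subset[of _ \<rat>]) (auto simp: countable_rat)
  obtain r where r: "strict_mono (r :: nat \<Rightarrow> nat)" "\<And>x. x \<in> J \<inter> \<rat> \<Longrightarrow> \<exists>l. (\<lambda>n. U (r n) x) \<longlonglongrightarrow> l"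
    using function_convergent_subsequence[OF cQ, of U "sqrt (B * C)"] bnd by blast
  obtain r0 where r0: "r0 > 0" "r0 \<le> 1"
    "\<And>x r. \<lbrakk>x \<in> J; 0 < r; r \<le> r0\<rbrakk> \<Longrightarrow> \<exists>c. {c..c + r} \<subseteq> J \<and> x \<in> {c..c + r}"
    using interval_segment[OF valid] by metis
  have "Cauchy (\<lambda>n. U (r n) x)" if x: "x \<in> J" for x
    unfolding Cauchy_def
  proof (intro allI impI)
    fix e :: real assume e: "e > 0"
    \<comment> \<open>Within a distance \<open>d\<close> the values of every \<open>U n\<close>
      change by at most \<open>e / 4\<close>.\<close>
    define d where "d = min r0 ((e / 4)\<^sup>2 / (C + 1))"
    have d: "d > 0" "d \<le> r0" using e r0(1) C0 by (auto simp: d_def)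
    have dC: "d * C \<le> (e / 4)\<^sup>2"
    proof -
      have "d * C \<le> (e / 4)\<^sup>2 / (C + 1) * C" using C0 by (intro mult_right_mono) (auto simp: d_def)
      also have "\<dots> \<le> (e / 4)\<^sup>2" using C0 by (simp add: field_simps)
      finally show ?thesis .
    qed
    obtain c where c: "{c..c + d} \<subseteq> J" "x \<in> {c..c + d}" using r0(3)[OF x d] by blast
    obtain y where y: "y \<in> \<rat>" "c < y" "y < c + d" using Rats_dense_in_real[of c "c + d"] d by auto
    have yJ: "y \<in> J" using c(1) y by auto
    have xy: "\<bar>U n x - U n y\<bar> \<le> e / 4" for n
    proof -
      have "(U n x - U n y)\<^sup>2 \<le> \<bar>x - y\<bar> * C"
        using inc[of x y n] inc[of y x n] x yJ by (cases "x \<le> y") (auto simp: power2_commute)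
      also have "\<dots> \<le> d * C" using c(2) y C0 by (intro mult_right_mono) auto
      also have "\<dots> \<le> (e / 4)\<^sup>2" by (rule dC)
      finally show ?thesis using e abs_le_square_iff[of "U n x - U n y" "e / 4"] by simp
    qed
    have "Cauchy (\<lambda>n. U (r n) y)" using r(2)[of y] yJ y(1) LIMSEQ_imp_Cauchy by blast
    then obtain M where M: "\<And>m n. \<lbrakk>m \<ge> M; n \<ge> M\<rbrakk> \<Longrightarrow> dist (U (r m) y) (U (r n) y) < e / 4"
      using e unfolding Cauchy_def by (metis divide_pos_pos zero_less_numeral)
    show "\<exists>M. \<forall>m\<ge>M. \<forall>n\<ge>M. dist (U (r m) x) (U (r n) x) < e"
    proof (intro exI[of _ M] allI impI)
      fix m n assume "m \<ge> M" "n \<ge> M"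
      then have "\<bar>U (r m) y - U (r n) y\<bar> < e / 4" using M[of m n] by (simp add: dist_real_def)
      then show "dist (U (r m) x) (U (r n) x) < e"
        using xy[of "r m"] xy[of "r n"] e unfolding dist_real_def by linarith
    qed
  qed
  then have "\<forall>x. \<exists>l. x \<in> J \<longrightarrow> (\<lambda>n. U (r n) x) \<longlonglongrightarrow> l" using Cauchy_convergent convergent_def by blast
  then obtain f where f: "\<And>x. x \<in> J \<Longrightarrow> (\<lambda>n. U (r n) x) \<longlonglongrightarrow> f x" by metis
  define W where "W n x = U (r n) x - f x" for n x
  have IJ: "x \<in> J" if "x \<in> I" for x using that closure_subset[of I] by blast
  have b: "pairing I (U (r n)) (U (r n)) \<le> C"
    "pairing I (\<lambda>x. sqrt (V x) * U (r n) x) (\<lambda>x. sqrt (V x) * U (r n) x) \<le> C" for n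
    using C[of "r n"] U[of "r n"]
    unfolding pairing_c[OF U U] power2_norm_eq_inner[symmetric] star_def
    by (auto intro: order_trans[rotated])
  have lI: "x \<in> I \<longrightarrow> (\<lambda>n. U (r n) x) \<longlonglongrightarrow> f x" for x using f IJ by blast
  have lV: "x \<in> I \<longrightarrow> (\<lambda>n. sqrt (V x) * U (r n) x) \<longlonglongrightarrow> sqrt (V x) * f x" for x
    using lI[of x] tendsto_mult_left by blast
  have f0: "L2_function I f" by (rule L2_fatou(1)[OF H1V_D(2)[OF U] b(1) C0 AE_I2[OF lI]])
  have fV: "L2_function I (\<lambda>x. sqrt (V x) * f x)" "pairing I (\<lambda>x. sqrt (V x) * f x) (\<lambda>x. sqrt (V x) * f x) \<le> C"
    using L2_fatou[OF H1V_D(4)[OF U] b(2) C0 AE_I2[OF lV]] by auto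
  have W0: "L2_function I (W n)" for n unfolding W_def by (intro L2_function_diff H1V_D U f0)
  have WV: "L2_function I (\<lambda>x. sqrt (V x) * W n x)" for n
    unfolding W_def right_diff_distrib by (intro L2_function_diff H1V_D U fV)
  have WVb: "pairing I (\<lambda>x. sqrt (V x) * W n x) (\<lambda>x. sqrt (V x) * W n x) \<le> 4 * C" for n
  proof -
    let ?a = "L2_class I (\<lambda>x. sqrt (V x) * U (r n) x)" and ?b = "L2_class I (\<lambda>x. sqrt (V x) * f x)"
    have "L2_class I (\<lambda>x. sqrt (V x) * W n x) = ?a - ?b"
      unfolding W_def right_diff_distrib by (intro L2_class_diff H1V_D U fV)
    then have "pairing I (\<lambda>x. sqrt (V x) * W n x) (\<lambda>x. sqrt (V x) * W n x) = (norm (?a - ?b))\<^sup>2"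
      using pairing_norm[OF WV] by simp
    also have "\<dots> \<le> 2 * (norm ?a)\<^sup>2 + 2 * (norm ?b)\<^sup>2"
    proof -
      have "(norm (?a - ?b))\<^sup>2 + (norm (?a + ?b))\<^sup>2 = 2 * (norm ?a)\<^sup>2 + 2 * (norm ?b)\<^sup>2"
        by (simp add: power2_norm_eq_inner inner_add_left inner_add_right inner_diff_left inner_diff_right inner_commute)
      then show ?thesis using zero_le_power2[of "norm (?a + ?b)"] by linarith
    qed
    also have "\<dots> \<le> 4 * C" using b(2)[of n] fV(2) pairing_norm[OF H1V_D(4)[OF U]] pairing_norm[OF fV(1)] by simp
    finally show ?thesis .
  qed
  have lim: "(\<lambda>n. pairing I (W n) (W n)) \<longlonglongrightarrow> 0"
  proof (rule LIMSEQ_I)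
    fix e :: real assume e: "e > 0"
    \<comment> \<open>\<open>4 * C\<close> is the bound of \<open>WVb\<close> on the weighted norm,
      so with this \<open>\<theta>\<close> the tail contributes at most
      \<open>e / 2\<close>.\<close>
    define \<theta> where "\<theta> = e / (8 * (C + 1))"
    have \<theta>: "\<theta> > 0" "\<theta> * (4 * C) \<le> e / 2" using e C0 by (auto simp: \<theta>_def field_simps)
    obtain K where K: "K \<ge> 0" "\<And>x. x \<in> I \<Longrightarrow> ln (2 + \<bar>x\<bar>) \<le> \<theta> * V x + K" using log_le_V[OF \<theta>(1)] by blast
    \<comment> \<open>Outside this radius \<open>ln (2 + \<bar>x\<bar>)\<close> is at least
      \<open>K + 1\<close>, which forces \<open>\<theta> * V x \<ge> 1\<close>.\<close>
    define R where "R = exp (K + 1)"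
    have tail: "1 \<le> \<theta> * V x" if x: "x \<in> I" "x \<notin> {- R<..<R}" for x
    proof -
      have "R \<le> 2 + \<bar>x\<bar>" using x(2) by auto
      then have "ln R \<le> ln (2 + \<bar>x\<bar>)" by (subst ln_le_cancel_iff) (auto simp: R_def)
      then show ?thesis using K(2)[OF x(1)] by (simp add: R_def)
    qed
    let ?F = "\<lambda>n x. indicator (I \<inter> {- R<..<R}) x * (W n x)\<^sup>2"
    have LS: "L2_function (I \<inter> {- R<..<R}) (W n)" for n
      by (rule L2_function_subset(1)[OF W0]) auto
    have Fi: "integrable lebesgue (?F n)" for n
      using pairing_integrable[OF LS LS] by (simp add: power2_eq_square)
    have "(\<lambda>n. LINT x|lebesgue. ?F n x) \<longlonglongrightarrow> (LINT x::real|lebesgue. 0)"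
    proof (rule integral_dominated_convergence[where w = "\<lambda>x. 4 * (B * C) * indicator {- R<..<R} x"])
      show "integrable lebesgue (\<lambda>x. 4 * (B * C) * indicator {- R<..<R} x :: real)"
        by (metis integrable_mult_right lmeasurable_box box_real(1) lmeasurable_iff_integrable)
      show "AE x in lebesgue. (\<lambda>n. ?F n x) \<longlonglongrightarrow> 0"
      proof (intro AE_I2)
        fix x :: real
        show "(\<lambda>n. ?F n x) \<longlonglongrightarrow> 0"
        proof (cases "x \<in> I")
          case True
          have "(\<lambda>n. W n x) \<longlonglongrightarrow> f x - f x" unfolding W_def by (intro tendsto_diff tendsto_const f IJ True)
          then have "(\<lambda>n. ?F n x) \<longlonglongrightarrow> indicator (I \<inter> {- R<..<R}) x * 0\<^sup>2" by (intro tendsto_intros) simp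
          then show ?thesis by simp
        qed simp
      qed
      have "(W n x)\<^sup>2 \<le> 4 * (B * C)" if x: "x \<in> J" for n x
      proof -
        have fx: "(f x)\<^sup>2 \<le> B * C"
          by (rule tendsto_upperbound[OF tendsto_power[OF f[OF x]]]) (use sq[OF x] in auto)
        have "(W n x)\<^sup>2 + (U (r n) x + f x)\<^sup>2 = 2 * (U (r n) x)\<^sup>2 + 2 * (f x)\<^sup>2"
          by (simp add: W_def power2_eq_square algebra_simps)
        then show ?thesis using fx sq[OF x, of "r n"] zero_le_power2[of "U (r n) x + f x"] by linarith
      qed
      then show "AE x in lebesgue. norm (?F n x) \<le> 4 * (B * C) * indicator {- R<..<R} x" for n
        using IJ B(1) C0 by (intro AE_I2) (simp add: indicator_def)
    qed (use Fi in auto)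
    then have "(\<lambda>n. LINT x|lebesgue. ?F n x) \<longlonglongrightarrow> 0" by simp
    from LIMSEQ_D[OF this half_gt_zero[OF e]] obtain M where
      M: "\<And>n. n \<ge> M \<Longrightarrow> norm ((LINT x|lebesgue. ?F n x) - 0) < e / 2" by blast
    show "\<exists>no. \<forall>n\<ge>no. norm (pairing I (W n) (W n) - 0) < e"
    proof (intro exI[of _ M] allI impI)
      fix n assume n: "n \<ge> M"
      have Vi: "integrable lebesgue (\<lambda>x. indicator I x * (sqrt (V x) * W n x * (sqrt (V x) * W n x)))"
        by (rule pairing_integrable[OF WV WV])
      have "pairing I (W n) (W n) \<le> (LINT x|lebesgue. ?F n x + \<theta> * (indicator I x * (sqrt (V x) * W n x * (sqrt (V x) * W n x))))"
        unfolding pairing_def set_lebesgue_integral_def real_scaleR_def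
      proof (rule integral_mono[OF pairing_integrable[OF W0 W0]])
        show "integrable lebesgue (\<lambda>x. ?F n x + \<theta> * (indicator I x * (sqrt (V x) * W n x * (sqrt (V x) * W n x))))"
          by (intro Bochner_Integration.integrable_add integrable_mult_right Fi Vi)
        fix x
        have sV: "sqrt (V x) * W n x * (sqrt (V x) * W n x) = V x * (W n x)\<^sup>2" if "x \<in> I"
        proof -
          have "sqrt (V x) * W n x * (sqrt (V x) * W n x) = (sqrt (V x) * sqrt (V x)) * (W n x)\<^sup>2"
            by (simp only: power2_eq_square ac_simps)
          then show ?thesis using V_nonneg[OF that] by simp
        qed
        have "(W n x)\<^sup>2 \<le> \<theta> * (V x * (W n x)\<^sup>2)" if "x \<in> I" "x \<notin> {- R<..<R}"
          using mult_right_mono[OF tail[OF that], of "(W n x)\<^sup>2"] by (simp add: mult.assoc)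
        moreover have "0 \<le> \<theta> * (V x * (W n x)\<^sup>2)" if "x \<in> I" using V_nonneg[OF that] \<theta>(1) by simp
        ultimately show "indicator I x * (W n x * W n x) \<le> ?F n x + \<theta> * (indicator I x * (sqrt (V x) * W n x * (sqrt (V x) * W n x)))"
          using sV by (cases "x \<in> I"; cases "x \<in> {- R<..<R}") (auto simp: power2_eq_square[symmetric])
      qed
      also have "\<dots> = (LINT x|lebesgue. ?F n x) + \<theta> * pairing I (\<lambda>x. sqrt (V x) * W n x) (\<lambda>x. sqrt (V x) * W n x)"
        using Fi Vi by (simp add: pairing_def set_lebesgue_integral_def)
      also have "\<dots> < e / 2 + e / 2"
      proof (rule add_less_le_mono)
        show "(LINT x|lebesgue. ?F n x) < e / 2" using M[OF n] by simp
        have "\<theta> * pairing I (\<lambda>x. sqrt (V x) * W n x) (\<lambda>x. sqrt (V x) * W n x) \<le> \<theta> * (4 * C)"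
          by (rule mult_left_mono[OF WVb]) (use \<theta> in simp)
        then show "\<theta> * pairing I (\<lambda>x. sqrt (V x) * W n x) (\<lambda>x. sqrt (V x) * W n x) \<le> e / 2" using \<theta>(2) by linarith
      qed
      finally show "norm (pairing I (W n) (W n) - 0) < e" using pairing_nonneg[of I "W n"] by simp
    qed
  qed
  have "(\<lambda>n. (norm (c0 (U (r n)) - L2_class I f))\<^sup>2) \<longlonglongrightarrow> 0"
  proof -
    have "(norm (c0 (U (r n)) - L2_class I f))\<^sup>2 = pairing I (W n) (W n)" for n
      unfolding pairing_norm[OF W0] c0_def W_def by (subst L2_class_diff) (auto intro: H1V_D U f0)
    then show ?thesis using lim by simp
  qed
  from tendsto_real_sqrt[OF this] have "(\<lambda>n. norm (c0 (U (r n)) - L2_class I f)) \<longlonglongrightarrow> 0" by simp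
  then have "(\<lambda>n. c0 (U (r n))) \<longlonglongrightarrow> L2_class I f"
    by (rule LIM_zero_cancel[OF tendsto_norm_zero_cancel])
  with r(1) show thesis by (rule that)
qed

end

section \<open>Test functions\<close>

definition smooth_on :: "real set \<Rightarrow> (real \<Rightarrow> real) \<Rightarrow> bool" where
  "smooth_on S f \<longleftrightarrow> (\<exists>F :: nat \<Rightarrow> real \<Rightarrow> real. F 0 = f \<and> (\<forall>n. \<forall>x\<in>S.
     (F n has_real_derivative F (Suc n) x) (at x within S)))"

text \<open>A class of functions closed under differentiation consists of smooth functions: a choice
  of derivatives within the class can be iterated.\<close>

lemma smooth_onI:
  assumes "f \<in> \<C>" "\<And>g. g \<in> \<C> \<Longrightarrow> \<exists>g'\<in>\<C>. \<forall>x\<in>S. (g has_real_derivative g' x) (at x within S)"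
  shows "smooth_on S f"
proof -
  obtain D where D: "\<And>g. g \<in> \<C> \<Longrightarrow> D g \<in> \<C>"
    "\<And>g x. \<lbrakk>g \<in> \<C>; x \<in> S\<rbrakk> \<Longrightarrow> (g has_real_derivative D g x) (at x within S)" using assms(2) by metis
  have "(D ^^ n) f \<in> \<C>" for n by (induction n) (simp_all add: assms(1) D(1))
  then show ?thesis
    unfolding smooth_on_def using D(2) by (intro exI[of _ "\<lambda>n. (D ^^ n) f"]) simp
qed

lemma smooth_on_deriv:
  assumes "smooth_on S f"
  obtains f' where "smooth_on S f'" "\<And>x. x \<in> S \<Longrightarrow> (f has_real_derivative f' x) (at x within S)"
proof -
  obtain F where F: "F 0 = f" "\<And>n x. x \<in> S \<Longrightarrow> (F n has_real_derivative F (Suc n) x) (at x within S)"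
    using assms unfolding smooth_on_def by blast
  have "smooth_on S (F 1)" unfolding smooth_on_def
    by (intro exI[of _ "\<lambda>n. F (Suc n)"]) (use F in auto)
  moreover have "(f has_real_derivative F 1 x) (at x within S)" if "x \<in> S" for x using F(2)[OF that, of 0] F(1) by simp
  ultimately show ?thesis by (rule that)
qed

lemma smooth_on_subset:
  assumes "smooth_on T f" "S \<subseteq> T"
  shows "smooth_on S f"
proof -
  obtain F where "F 0 = f" "\<And>n x. x \<in> T \<Longrightarrow> (F n has_real_derivative F (Suc n) x) (at x within T)"
    using assms(1) unfolding smooth_on_def by blast
  then show ?thesis unfolding smooth_on_def
    using assms(2) by (intro exI[of _ F] conjI allI ballI) (auto intro: has_field_derivative_subset)
qed

lemma smooth_on_continuous:
  assumes "smooth_on S f"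
  shows "continuous_on S f"
proof -
  obtain f' where "\<And>x. x \<in> S \<Longrightarrow> (f has_real_derivative f' x) (at x within S)"
    using smooth_on_deriv[OF assms] by blast
  then show ?thesis by (rule DERIV_continuous_on)
qed

text \<open>By the sum and product rules this algebra is closed under differentiation, so products
  are smooth without a Leibniz formula for higher derivatives.\<close>

inductive_set smooth_algebra :: "real set \<Rightarrow> (real \<Rightarrow> real) set" for S where
  base: "smooth_on S f \<Longrightarrow> f \<in> smooth_algebra S"
| add: "\<lbrakk>f \<in> smooth_algebra S; g \<in> smooth_algebra S\<rbrakk> \<Longrightarrow> (\<lambda>x. f x + g x) \<in> smooth_algebra S"
| mult: "\<lbrakk>f \<in> smooth_algebra S; g \<in> smooth_algebra S\<rbrakk> \<Longrightarrow> (\<lambda>x. f x * g x) \<in> smooth_algebra S"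

lemma smooth_algebra_smooth: "f \<in> smooth_algebra S \<Longrightarrow> smooth_on S f"
proof (erule smooth_onI)
  fix g assume "g \<in> smooth_algebra S"
  then show "\<exists>g'\<in>smooth_algebra S. \<forall>x\<in>S. (g has_real_derivative g' x) (at x within S)"
  proof induction
    case (base f)
    obtain f' where "smooth_on S f'" "\<And>x. x \<in> S \<Longrightarrow> (f has_real_derivative f' x) (at x within S)"
      using smooth_on_deriv[OF base] by blast
    then show ?case by (intro bexI[of _ f'] smooth_algebra.base) auto
  next
    case (add f g)
    then obtain f' g' where "f' \<in> smooth_algebra S" "g' \<in> smooth_algebra S"
      "\<forall>x\<in>S. (f has_real_derivative f' x) (at x within S)" "\<forall>x\<in>S. (g has_real_derivative g' x) (at x within S)" by blast
    then show ?case
      by (intro bexI[of _ "\<lambda>x. f' x + g' x"] ballI DERIV_add smooth_algebra.add) auto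
  next
    case (mult f g)
    then obtain f' g' where *: "f' \<in> smooth_algebra S" "g' \<in> smooth_algebra S"
      "\<forall>x\<in>S. (f has_real_derivative f' x) (at x within S)" "\<forall>x\<in>S. (g has_real_derivative g' x) (at x within S)" by blast
    show ?case
    proof (rule bexI[of _ "\<lambda>x. f' x * g x + g' x * f x"])
      show "\<forall>x\<in>S. ((\<lambda>x. f x * g x) has_real_derivative f' x * g x + g' x * f x) (at x within S)"
        using * by (auto intro: DERIV_mult)
      show "(\<lambda>x. f' x * g x + g' x * f x) \<in> smooth_algebra S"
        using * mult(1,2) by (intro smooth_algebra.add smooth_algebra.mult)
    qed
  qed
qed

lemma smooth_on_mult: "\<lbrakk>smooth_on S f; smooth_on S g\<rbrakk> \<Longrightarrow> smooth_on S (\<lambda>x. f x * g x)"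
  by (rule smooth_algebra_smooth[OF smooth_algebra.mult[OF smooth_algebra.base smooth_algebra.base]])

lemma smooth_on_affine:
  assumes "smooth_on UNIV f"
  shows "smooth_on UNIV (\<lambda>x. f (a * x + b))"
proof (rule smooth_onI[of _ "{\<lambda>x. c * f (a * x + b) | c f. smooth_on UNIV f}"])
  show "(\<lambda>x. f (a * x + b)) \<in> {\<lambda>x. c * f (a * x + b) | c f. smooth_on UNIV f}"
    using assms by (auto intro!: exI[of _ 1])
  fix g assume "g \<in> {\<lambda>x. c * f (a * x + b) | c f. smooth_on UNIV f}"
  then obtain c f where g: "g = (\<lambda>x. c * f (a * x + b))" "smooth_on UNIV f" by blast
  obtain f' where f': "smooth_on UNIV f'" "\<And>x. (f has_real_derivative f' x) (at x)"
    using smooth_on_deriv[OF g(2)] by auto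
  have "(g has_real_derivative (c * a) * f' (a * x + b)) (at x)" for x
    unfolding g(1) by (rule derivative_eq_intros DERIV_chain2[OF f'(2)] refl | simp)+
  then show "\<exists>g'\<in>{\<lambda>x. c * f (a * x + b) | c f. smooth_on UNIV f}. \<forall>x\<in>UNIV. (g has_real_derivative g' x) (at x)"
    using f'(1) by (intro bexI[of _ "\<lambda>x. (c * a) * f' (a * x + b)"]) auto
qed

lemma smooth_on_real_polynomial_function: "real_polynomial_function p \<Longrightarrow> smooth_on S p"
proof (rule smooth_onI[of _ "{p. real_polynomial_function p}"])
  fix g :: "real \<Rightarrow> real" assume "g \<in> {p. real_polynomial_function p}"
  then obtain g' where "real_polynomial_function g'" "\<And>x. (g has_real_derivative g' x) (at x)"
    using has_real_derivative_polynomial_function by blast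
  then show "\<exists>g'\<in>{p. real_polynomial_function p}. \<forall>x\<in>S. (g has_real_derivative g' x) (at x within S)"
    by (intro bexI[of _ g']) (auto intro: has_field_derivative_at_within)
qed simp

lemma real_polynomial_function_antiderivative:
  fixes p :: "real \<Rightarrow> real"
  assumes "real_polynomial_function p"
  obtains P where "real_polynomial_function P" "\<And>x. (P has_real_derivative p x) (at x)" "P a = b"
proof -
  obtain c n where p: "p = (\<lambda>x. \<Sum>i\<le>n. c i * x ^ i)" using assms real_polynomial_function_iff_sum by blast
  define Q where "Q x = (\<Sum>i\<le>n. c i / real (Suc i) * x ^ Suc i)" for x :: real
  have "real_polynomial_function Q" unfolding Q_def
    unfolding real_polynomial_function_iff_sum
    by (rule exI[of _ "\<lambda>i. if i = 0 then 0 else c (i - 1) / real i"], rule exI[of _ "Suc n"])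
      (simp add: sum.atMost_Suc_shift del: sum.atMost_Suc power_Suc of_nat_Suc)
  then have "real_polynomial_function (\<lambda>x. Q x + (b - Q a))"
    by (intro real_polynomial_function.intros(3)[OF _ real_polynomial_function.intros(2)])
  moreover have "((\<lambda>x. Q x + (b - Q a)) has_real_derivative p x) (at x)" for x
  proof -
    have "(Q has_real_derivative (\<Sum>i\<le>n. c i / real (Suc i) * (real (Suc i) * x ^ i))) (at x)"
    proof -
      have pw: "((\<lambda>x. x ^ Suc i) has_real_derivative real (Suc i) * x ^ i) (at x)" for i
        by (rule DERIV_cong[OF DERIV_pow]) simp
      show ?thesis unfolding Q_def by (intro DERIV_sum DERIV_cmult pw)
    qed
    then show ?thesis unfolding p by (auto intro!: derivative_eq_intros)
  qed
  ultimately show ?thesis by (rule that) simp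
qed

section \<open>A smooth bump function\<close>

text \<open>With \<open>t = 1 / x\<close>, differentiating \<open>P(t) exp (- t)\<close> in
  \<open>x\<close> gives \<open>t^2 (P(t) - P'(t)) exp (- t)\<close>, again of this shape. The
  family is closed under differentiation, also at 0, where exponential decay beats every polynomial;
  \<open>smooth_onI\<close> then applies.\<close>

definition exp_flat :: "real poly \<Rightarrow> real \<Rightarrow> real" where
  "exp_flat P x = (if x > 0 then poly P (1 / x) * exp (- (1 / x)) else 0)"

lemma poly_exp_tendsto_0: "((\<lambda>t. poly P t * exp (- t)) \<longlongrightarrow> (0::real)) at_top"
proof -
  have "((\<lambda>t. \<Sum>i\<le>degree P. coeff P i * (t ^ i / exp t)) \<longlongrightarrow> (\<Sum>i\<le>degree P. coeff P i * (0::real))) at_top"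
    by (intro tendsto_sum tendsto_mult tendsto_const tendsto_power_div_exp_0)
  moreover have "poly P t * exp (- t) = (\<Sum>i\<le>degree P. coeff P i * (t ^ i / exp t))" for t
    by (simp add: poly_altdef sum_distrib_right exp_minus divide_inverse mult.assoc)
  ultimately show ?thesis by simp
qed

lemma exp_flat_DERIV:
  "(exp_flat P has_real_derivative exp_flat ([:0, 0, 1:] * (P - pderiv P)) x) (at x)"
proof (cases x "0::real" rule: linorder_cases)
  case greater
  have "((\<lambda>x. poly P (1 / x) * exp (- (1 / x))) has_real_derivative
      exp_flat ([:0, 0, 1:] * (P - pderiv P)) x) (at x)"
  proof -
    have 1: "((\<lambda>x. 1 / x) has_real_derivative - (1 / x\<^sup>2)) (at x)"
      using DERIV_inverse[of x] greater by (simp add: inverse_eq_divide power2_eq_square)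
    have 2: "((\<lambda>x. poly P (1 / x)) has_real_derivative poly (pderiv P) (1 / x) * (- (1 / x\<^sup>2))) (at x)"
      by (rule DERIV_chain2[OF poly_DERIV 1])
    have 3: "((\<lambda>x. exp (- (1 / x))) has_real_derivative exp (- (1 / x)) * (- (- (1 / x\<^sup>2)))) (at x)"
      by (rule DERIV_chain2[OF DERIV_exp DERIV_minus[OF 1]])
    show ?thesis
      by (rule DERIV_cong[OF DERIV_mult[OF 2 3]])
        (use greater in \<open>simp add: exp_flat_def algebra_simps power2_eq_square\<close>)
  qed
  moreover have ev: "\<forall>\<^sub>F y in nhds x. exp_flat P y = poly P (1 / y) * exp (- (1 / y))"
    using eventually_nhds_in_open[of "{0<..}" x] greater by (auto elim!: eventually_mono simp: exp_flat_def)
  ultimately show ?thesis using DERIV_cong_ev[OF refl ev refl] by simp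
next
  case less
  have ev: "\<forall>\<^sub>F y in nhds x. exp_flat P y = 0"
    using eventually_nhds_in_open[of "{..<0}" x] less by (auto elim!: eventually_mono simp: exp_flat_def)
  have "(exp_flat P has_real_derivative 0) (at x)"
    by (rule DERIV_cong_ev[OF refl ev refl, THEN iffD2]) (rule DERIV_const)
  then show ?thesis using less by (simp add: exp_flat_def)
next
  case equal
  have inv: "filterlim (\<lambda>h::real. 1 / h) at_top (at_right 0)"
    using filterlim_inverse_at_top_right by (simp add: inverse_eq_divide)
  have "((\<lambda>h. exp_flat P h / h) \<longlongrightarrow> 0) (at_right 0)"
  proof (rule Lim_transform_eventually)
    show "((\<lambda>h. poly (pCons 0 P) (1 / h) * exp (- (1 / h))) \<longlongrightarrow> 0) (at_right (0::real))"
      by (rule filterlim_compose[OF poly_exp_tendsto_0 inv])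
    show "\<forall>\<^sub>F h in at_right 0. poly (pCons 0 P) (1 / h) * exp (- (1 / h)) = exp_flat P h / h"
      by (auto simp: exp_flat_def eventually_at_filter)
  qed
  moreover have "((\<lambda>h. exp_flat P h / h) \<longlongrightarrow> 0) (at_left 0)"
  proof (rule Lim_transform_eventually[OF tendsto_const])
    show "\<forall>\<^sub>F h in at_left 0. 0 = exp_flat P h / h" by (auto simp: exp_flat_def eventually_at_filter)
  qed
  ultimately have "((\<lambda>h. exp_flat P h / h) \<longlongrightarrow> 0) (at 0)" by (simp add: filterlim_at_split)
  then show ?thesis using equal by (simp add: DERIV_def exp_flat_def)
qed

lemma smooth_on_exp_flat: "smooth_on UNIV (exp_flat P)"
  by (rule smooth_onI[of _ "range exp_flat"]) (use exp_flat_DERIV in auto)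

text \<open>The factor \<open>exp 2\<close> normalizes the value at 0, where each of the other two
  factors is \<open>exp (- 1)\<close>. On its support the function is
  \<open>exp (2 - 2 / (1 - x^2))\<close>, so it takes values between 0 and 1.\<close>

definition bump :: "real \<Rightarrow> real" where
  "bump x = exp 2 * (exp_flat 1 (1 - x) * exp_flat 1 (1 + x))"

lemma smooth_on_bump: "smooth_on UNIV bump"
proof -
  have "smooth_on UNIV (\<lambda>x. exp_flat 1 ((-1) * x + 1))" "smooth_on UNIV (\<lambda>x. exp_flat 1 (1 * x + 1))"
    by (rule smooth_on_affine[OF smooth_on_exp_flat])+
  then have "smooth_on UNIV (\<lambda>x. exp 2 * (exp_flat 1 ((-1) * x + 1) * exp_flat 1 (1 * x + 1)))"
    by (rule smooth_on_mult[OF smooth_on_real_polynomial_function[OF real_polynomial_function.intros(2)] smooth_on_mult])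
  moreover have "(\<lambda>x. exp 2 * (exp_flat 1 ((-1) * x + 1) * exp_flat 1 (1 * x + 1))) = bump"
    by (rule ext) (simp add: bump_def add.commute)
  ultimately show ?thesis by simp
qed

lemma bump_zero: "\<bar>x\<bar> \<ge> 1 \<Longrightarrow> bump x = 0"
  by (auto simp: bump_def exp_flat_def)

lemma bump_at_0: "bump 0 = 1"
  by (simp add: bump_def exp_flat_def exp_add[symmetric])

lemma bump_bounds: "0 \<le> bump x" "bump x \<le> 1"
proof -
  show "0 \<le> bump x" by (auto simp: bump_def exp_flat_def)
  show "bump x \<le> 1"
  proof (cases "\<bar>x\<bar> < 1")
    case True
    have eq: "bump x = exp (2 - 1 / (1 - x) - 1 / (1 + x))"
      using True by (auto simp: bump_def exp_flat_def exp_add[symmetric] mult_exp_exp)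
    have "1 / (1 - x) + 1 / (1 + x) = 2 / (1 - x\<^sup>2)"
    proof -
      have "1 - x \<noteq> 0" "1 + x \<noteq> 0" using True by auto
      moreover have "(1 - x) * (1 + x) = 1 - x\<^sup>2" by (simp add: algebra_simps power2_eq_square)
      ultimately show ?thesis by (simp add: add_frac_eq)
    qed
    moreover have "2 / (1 - x\<^sup>2) \<ge> 2"
    proof -
      have "x\<^sup>2 < 1" using True by (simp add: abs_square_less_1)
      then show ?thesis by (simp add: pos_le_divide_eq)
    qed
    ultimately show ?thesis unfolding eq by simp
  qed (simp add: bump_zero)
qed

lemma bump_deriv:
  obtains b C where "\<And>x. (bump has_real_derivative b x) (at x)" "continuous_on UNIV b"
    "\<And>x. \<bar>x\<bar> \<ge> 1 \<Longrightarrow> b x = 0" "C \<ge> 0" "\<And>x. \<bar>b x\<bar> \<le> C"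
proof -
  obtain b where b: "smooth_on UNIV b" "\<And>x. (bump has_real_derivative b x) (at x)"
    using smooth_on_deriv[OF smooth_on_bump] by auto
  have c: "continuous_on UNIV b" by (rule smooth_on_continuous[OF b(1)])
  have z: "b x = 0" if "\<bar>x\<bar> \<ge> 1" for x
    \<comment> \<open>A zero of the nonnegative function \<open>bump\<close> is a minimum; this also
      covers the endpoints of the support.\<close>
    by (rule DERIV_local_min[OF b(2) zero_less_one]) (use bump_zero[OF that] bump_bounds in auto)
  have "compact (b ` {-1..1})" by (rule compact_continuous_image[OF continuous_on_subset[OF c]]) auto
  then obtain C where C: "\<And>x. x \<in> {-1..1} \<Longrightarrow> \<bar>b x\<bar> \<le> C"
    using bounded_iff compact_imp_bounded by (metis imageI real_norm_def)
  have C0: "C \<ge> 0" using C[of 0] by (meson abs_ge_zero atLeastAtMost_iff order_trans neg_le_0_iff_le zero_le_one)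
  have "\<bar>b x\<bar> \<le> C" for x
  proof (cases "\<bar>x\<bar> \<ge> 1")
    case False
    then have "x \<in> {-1..1}" by (simp add: abs_le_iff not_le abs_less_iff)
    then show ?thesis by (rule C)
  qed (use z C0 in simp)
  then show ?thesis using that[OF b(2) c z C0] by blast
qed

section \<open>Approximation in \<open>L2\<close> on an interval\<close>

lemma pairing_dominated:
  assumes F: "\<And>n. L2_function A (F n)" and G: "L2_function A G"
    and le: "\<And>n x. x \<in> A \<Longrightarrow> \<bar>F n x\<bar> \<le> \<bar>G x\<bar>" and lim: "AE x in lebesgue. x \<in> A \<longrightarrow> (\<lambda>n. F n x) \<longlonglongrightarrow> 0"
  shows "(\<lambda>n. norm (L2_class A (F n))) \<longlonglongrightarrow> 0"
proof -
  have "(\<lambda>n. LINT x|lebesgue. indicator A x * (F n x * F n x)) \<longlonglongrightarrow> (LINT x::real|lebesgue. 0)"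
  proof (rule integral_dominated_convergence[where w = "\<lambda>x. indicator A x * (G x * G x)"])
    show "integrable lebesgue (\<lambda>x. indicator A x * (G x * G x))" by (rule pairing_integrable[OF G G])
    show "(\<lambda>x. indicator A x * (F n x * F n x)) \<in> borel_measurable lebesgue" for n
      using pairing_integrable[OF F F] by blast
    show "AE x in lebesgue. (\<lambda>n. indicator A x * (F n x * F n x)) \<longlonglongrightarrow> 0"
      using lim
    proof eventually_elim
      case (elim x)
      show ?case
      proof (cases "x \<in> A")
        case True
        then have "(\<lambda>n. F n x * F n x) \<longlonglongrightarrow> 0 * 0" using elim by (intro tendsto_mult) auto
        then show ?thesis using True by simp
      qed simp
    qed
    show "AE x in lebesgue. norm (indicator A x * (F n x * F n x)) \<le> indicator A x * (G x * G x)" for n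
    proof (intro AE_I2)
      fix x show "norm (indicator A x * (F n x * F n x)) \<le> indicator A x * (G x * G x)"
        using abs_le_square_iff[of "F n x" "G x"] le[of x n] by (cases "x \<in> A") (auto simp: power2_eq_square)
    qed
  qed simp
  then have "(\<lambda>n. sqrt (pairing A (F n) (F n))) \<longlonglongrightarrow> sqrt 0"
    by (intro tendsto_real_sqrt) (simp add: pairing_def set_lebesgue_integral_def)
  then show ?thesis by (simp add: pairing_norm[OF F])
qed

lemma L2_small:
  assumes A: "{c<..<d} \<subseteq> B" "c \<le> d" and m: "set_borel_measurable lebesgue {c<..<d} h"
    and le: "\<And>x. x \<in> {c<..<d} \<Longrightarrow> \<bar>h x\<bar> \<le> b" and z: "\<And>x. x \<in> B - {c<..<d} \<Longrightarrow> h x = 0"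
  shows "L2_function B h" "(norm (L2_class B h))\<^sup>2 \<le> b\<^sup>2 * (d - c)"
proof -
  have eq: "(\<lambda>x. indicator B x * h x) = (\<lambda>x. indicator {c<..<d} x * h x)"
  proof
    fix x show "indicator B x * h x = indicator {c<..<d} x * h x"
      using A z[of x] by (cases "x \<in> {c<..<d}"; cases "x \<in> B") auto
  qed
  have L: "L2_function {c<..<d} h" by (rule L2_function_bounded_interval[OF le m])
  then show B: "L2_function B h" by (simp add: L2_function_iff eq)
  have "(norm (L2_class B h))\<^sup>2 = pairing {c<..<d} h h"
    by (simp only: pairing_norm[OF B, symmetric] pairing_eq fun_cong[OF eq])
  also have "\<dots> \<le> pairing {c<..<d} (\<lambda>x. b) (\<lambda>x. b)"
    unfolding pairing_def set_lebesgue_integral_def real_scaleR_def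
  proof (rule integral_mono[OF pairing_integrable[OF L L] pairing_integrable[OF L2_function_const_interval L2_function_const_interval]])
    fix x show "indicator {c<..<d} x * (h x * h x) \<le> indicator {c<..<d} x * (b * b)"
      using abs_le_square_iff[of "h x" b] le[of x] by (cases "x \<in> {c<..<d}") (auto simp: power2_eq_square)
  qed
  also have "\<dots> = b\<^sup>2 * (d - c)" by (rule pairing_const_interval[OF A(2)])
  finally show "(norm (L2_class B h))\<^sup>2 \<le> b\<^sup>2 * (d - c)" .
qed

lemma continuous_set_borel_measurable:
  "continuous_on A h \<Longrightarrow> A \<in> sets borel \<Longrightarrow> set_borel_measurable lebesgue A (h :: real \<Rightarrow> real)"
  using borel_measurable_continuous_on_indicator[of A h]
  by (simp add: set_borel_measurable_def measurable_completion)

definition clip :: "real \<Rightarrow> real \<Rightarrow> real" where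
  "clip M t = max (- M) (min M t)"

lemma clip_le: "M \<ge> 0 \<Longrightarrow> \<bar>clip M t\<bar> \<le> M" "M \<ge> 0 \<Longrightarrow> \<bar>t - clip M t\<bar> \<le> \<bar>t\<bar>" "M \<ge> 0 \<Longrightarrow> \<bar>clip M t\<bar> \<le> \<bar>t\<bar>"
  by (auto simp: clip_def)

lemma continuous_clip: "continuous_on UNIV (clip M)"
  unfolding clip_def by (intro continuous_intros)

text \<open>Truncate, approximate by continuous functions almost everywhere, and apply Weierstrass.\<close>

lemma L2_polynomial_approx:
  fixes g :: "real \<Rightarrow> real"
  assumes g: "L2_function {c<..<d} g" and cd: "c < d" and e: "e > 0"
  obtains p where "real_polynomial_function p" "L2_function {c<..<d} p"
    "norm (L2_class {c<..<d} g - L2_class {c<..<d} p) < e"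
proof -
  let ?A = "{c<..<d}"
  have e3: "e / 3 > 0" using e by simp
  have gm: "(\<lambda>x. indicator ?A x * g x) \<in> borel_measurable lebesgue" by (rule L2_function_measurable[OF g])
  have cm: "(\<lambda>x. indicator ?A x * clip M (g x)) \<in> borel_measurable lebesgue" if "M \<ge> 0" for M
  proof -
    have "(\<lambda>x. clip M (indicator ?A x * g x)) \<in> borel_measurable lebesgue"
      by (rule borel_measurable_continuous_on[OF continuous_clip gm])
    moreover have "(\<lambda>x. clip M (indicator ?A x * g x)) = (\<lambda>x. indicator ?A x * clip M (g x))"
      using that by (auto simp: fun_eq_iff indicator_def clip_def)
    ultimately show ?thesis by simp
  qed
  have Lc: "L2_function ?A (\<lambda>x. clip M (g x))" if "M \<ge> 0" for M
    by (rule L2_function_bounded_interval[OF clip_le(1)[OF that]])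
      (use cm[OF that] in \<open>simp add: set_borel_measurable_def\<close>)
  have "(\<lambda>n. norm (L2_class ?A (\<lambda>x. g x - clip (real n) (g x)))) \<longlonglongrightarrow> 0"
  proof (rule pairing_dominated[OF L2_function_diff[OF g Lc] g])
    show "\<bar>g x - clip (real n) (g x)\<bar> \<le> \<bar>g x\<bar>" for n x by (rule clip_le) simp
    have "(\<lambda>n. g x - clip (real n) (g x)) \<longlonglongrightarrow> 0" for x
    proof (rule tendsto_eventually)
      obtain N where "\<bar>g x\<bar> < real N" using reals_Archimedean2 by blast
      then show "\<forall>\<^sub>F n in sequentially. g x - clip (real n) (g x) = 0"
        by (intro eventually_sequentiallyI[of N]) (auto simp: clip_def)
    qed
    then show "AE x in lebesgue. x \<in> ?A \<longrightarrow> (\<lambda>n. g x - clip (real n) (g x)) \<longlonglongrightarrow> 0" by simp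
  qed simp
  from LIMSEQ_D[OF this e3] obtain n where n: "norm (norm (L2_class ?A (\<lambda>x. g x - clip (real n) (g x))) - 0) < e / 3" by blast
  define M where "M = real n"
  have M: "M \<ge> 0" by (simp add: M_def)
  let ?t = "\<lambda>x. clip M (g x)"
  have 1: "norm (L2_class ?A g - L2_class ?A ?t) < e / 3"
    using n by (simp add: M_def L2_class_diff[OF g Lc[OF M], symmetric, unfolded M_def])
  have "(\<lambda>x. indicator ?A x * g x) measurable_on UNIV"
    by (rule lebesgue_measurable_imp_measurable_on[OF gm]) simp
  then obtain N h where h: "negligible N" "\<And>n. continuous_on UNIV (h n)"
    "\<And>x. x \<notin> N \<Longrightarrow> (\<lambda>n. h n x) \<longlonglongrightarrow> indicator ?A x * g x"
    unfolding measurable_on_def by auto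
  let ?u = "\<lambda>n x. clip M (h n x)"
  have uc: "continuous_on UNIV (?u n)" for n
    by (rule continuous_on_compose2[OF continuous_clip h(2)]) auto
  have Lu: "L2_function ?A (?u n)" for n
    by (rule L2_function_bounded_interval[OF clip_le(1)[OF M]])
      (rule continuous_set_borel_measurable[OF continuous_on_subset[OF uc]], auto)
  have "(\<lambda>n. norm (L2_class ?A (\<lambda>x. ?t x - ?u n x))) \<longlonglongrightarrow> 0"
  proof (rule pairing_dominated[OF L2_function_diff[OF Lc[OF M] Lu] L2_function_const_interval[of c d "2 * M"]])
    show "\<bar>?t x - ?u n x\<bar> \<le> \<bar>2 * M\<bar>" for n x
      using clip_le(1)[OF M, of "g x"] clip_le(1)[OF M, of "h n x"] by linarith
    have "AE x in lebesgue. x \<notin> N" using h(1) by (simp add: AE_negligible[symmetric])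
    then show "AE x in lebesgue. x \<in> ?A \<longrightarrow> (\<lambda>n. ?t x - ?u n x) \<longlonglongrightarrow> 0"
    proof eventually_elim
      case (elim x)
      show ?case
      proof
        assume x: "x \<in> ?A"
        have "(\<lambda>n. h n x) \<longlonglongrightarrow> g x" using h(3)[OF elim] x by simp
        then have "(\<lambda>n. ?u n x) \<longlonglongrightarrow> ?t x"
          by (rule isCont_tendsto_compose[rotated]) (use continuous_clip in \<open>simp add: continuous_on_eq_continuous_at\<close>)
        then have "(\<lambda>n. ?t x - ?u n x) \<longlonglongrightarrow> ?t x - ?t x" by (intro tendsto_diff tendsto_const)
        then show "(\<lambda>n. ?t x - ?u n x) \<longlonglongrightarrow> 0" by simp
      qed
    qed
  qed
  from LIMSEQ_D[OF this e3] obtain k where k: "norm (norm (L2_class ?A (\<lambda>x. ?t x - ?u k x)) - 0) < e / 3" by blast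
  then have 2: "norm (L2_class ?A ?t - L2_class ?A (?u k)) < e / 3"
    by (simp add: L2_class_diff[OF Lc[OF M] Lu, symmetric])
  \<comment> \<open>A uniform error \<open>\<eta>\<close> on the interval costs at most
    \<open>\<eta> * sqrt (d - c) = e / 4\<close> in norm.\<close>
  define \<eta> where "\<eta> = e / (4 * sqrt (d - c))"
  have eta: "\<eta> > 0" using e cd by (simp add: \<eta>_def)
  obtain p where p: "real_polynomial_function p" "\<And>x. x \<in> {c..d} \<Longrightarrow> \<bar>?u k x - p x\<bar> < \<eta>"
    using Stone_Weierstrass_real_polynomial_function[OF compact_Icc continuous_on_subset[OF uc] eta] by blast
  have pc: "continuous_on UNIV p" using smooth_on_continuous[OF smooth_on_real_polynomial_function[OF p(1)]] .
  have sm: "set_borel_measurable lebesgue ?A (\<lambda>x. ?u k x - p x)"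
    by (intro continuous_set_borel_measurable continuous_on_diff continuous_on_subset[OF uc] continuous_on_subset[OF pc]) auto
  have ps: "L2_function ?A (\<lambda>x. ?u k x - p x)" "(norm (L2_class ?A (\<lambda>x. ?u k x - p x)))\<^sup>2 \<le> \<eta>\<^sup>2 * (d - c)"
    by (rule L2_small[of c d ?A _ \<eta>, OF _ _ sm]; use cd p(2) in \<open>force intro: less_imp_le\<close>)+
  have Lp: "L2_function ?A p" using L2_function_diff[OF Lu[of k] ps(1)] by simp
  have "norm (L2_class ?A (\<lambda>x. ?u k x - p x)) \<le> \<eta> * sqrt (d - c)"
    using real_sqrt_le_mono[OF ps(2)] eta by (simp add: real_sqrt_mult)
  also have "\<dots> < e / 3" using e cd by (simp add: \<eta>_def)
  finally have 3: "norm (L2_class ?A (?u k) - L2_class ?A p) < e / 3" by (simp add: L2_class_diff[OF Lu Lp])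
  have "norm (L2_class ?A g - L2_class ?A p) \<le> norm (L2_class ?A g - L2_class ?A ?t)
      + norm (L2_class ?A ?t - L2_class ?A (?u k)) + norm (L2_class ?A (?u k) - L2_class ?A p)"
    using norm_triangle_ineq[of "L2_class ?A g - L2_class ?A ?t" "L2_class ?A ?t - L2_class ?A p"]
      norm_triangle_ineq[of "L2_class ?A ?t - L2_class ?A (?u k)" "L2_class ?A (?u k) - L2_class ?A p"] by simp
  then have "norm (L2_class ?A g - L2_class ?A p) < e" using 1 2 3 by linarith
  then show ?thesis using that p(1) Lp by blast
qed

lemma abs_continuous_on_Lipschitz:
  assumes B: "B \<ge> 0" and le: "\<And>u v. \<lbrakk>u \<in> S; v \<in> S\<rbrakk> \<Longrightarrow> \<bar>f v - f u\<bar> \<le> B * \<bar>v - u\<bar>"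
  shows "abs_continuous_on S f"
  unfolding abs_continuous_on_def
proof (intro allI impI)
  fix e :: real assume e: "e > 0"
  show "\<exists>\<delta>>0. \<forall>\<D>. \<D> division_of \<Union>\<D> \<and> \<Union>\<D> \<subseteq> S \<and> (\<Sum>k\<in>\<D>. Sup k - Inf k) < \<delta> \<longrightarrow>
        (\<Sum>k\<in>\<D>. \<bar>f (Sup k) - f (Inf k)\<bar>) < e"
  proof (intro exI[of _ "e / (B + 1)"] conjI allI impI)
    show "e / (B + 1) > 0" using e B by simp
    fix \<D> assume D: "\<D> division_of \<Union>\<D> \<and> \<Union>\<D> \<subseteq> S \<and> (\<Sum>k\<in>\<D>. Sup k - Inf k) < e / (B + 1)"
    have k: "\<bar>f (Sup k) - f (Inf k)\<bar> \<le> B * (Sup k - Inf k) \<and> Sup k - Inf k \<ge> 0" if k: "k \<in> \<D>" for k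
    proof -
      obtain u v where uv: "k = {u..v}" "u \<le> v" using division_of_realD[OF conjunct1[OF D] k] by metis
      then have "u \<in> k" "v \<in> k" by auto
      then have "u \<in> S" "v \<in> S" using D k by blast+
      then show ?thesis using le[of u v] uv by auto
    qed
    have "(\<Sum>k\<in>\<D>. \<bar>f (Sup k) - f (Inf k)\<bar>) \<le> B * (\<Sum>k\<in>\<D>. Sup k - Inf k)"
      unfolding sum_distrib_left by (rule sum_mono) (use k in blast)
    also have "\<dots> \<le> (B + 1) * (\<Sum>k\<in>\<D>. Sup k - Inf k)"
      by (rule mult_right_mono) (use k in \<open>auto intro: sum_nonneg\<close>)
    also have "\<dots> < e" using D B by (simp add: pos_less_divide_eq mult.commute)
    finally show "(\<Sum>k\<in>\<D>. \<bar>f (Sup k) - f (Inf k)\<bar>) < e" .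
  qed
qed

lemma interval_box:
  assumes "valid_setting s" "R > 0"
  obtains c d where "c < d" "{c..d} = closure (interval s) \<inter> {-R..R}" "{c<..<d} = interval s \<inter> {-R<..<R}"
proof (rule interval_cases[OF assms(1)])
  assume h: "interval s = UNIV" "closure (interval s) = UNIV"
  show thesis by (rule that[of "-R" R]) (simp_all add: h assms(2))
next
  assume h: "interval s = {0<..}" "closure (interval s) = {0..}"
  have "{0..R} = {0..} \<inter> {-R..R}" "{0<..<R} = {0<..} \<inter> {-R<..<R}" using assms(2) by (simp_all add: set_eq_iff) linarith+
  then show thesis by (intro that[of 0 R]) (simp_all only: h h(2)[unfolded h(1)] assms(2))
next
  fix b :: real assume h: "b > 0" "interval s = {0<..<b}" "closure (interval s) = {0..b}"
  have "{0..min b R} = {0..b} \<inter> {-R..R}" "{0<..<min b R} = {0<..<b} \<inter> {-R<..<R}"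
    using assms(2) h(1) by (simp_all add: set_eq_iff)
  moreover have "0 < min b R" using assms(2) h(1) by simp
  ultimately show thesis by (intro that[of 0 "min b R"]) (simp_all only: h h(3)[unfolded h(2)])
qed

lemma L2_function_mult_bounded:
  assumes f: "L2_function A f" and h: "continuous_on UNIV h" and le: "\<And>x. \<bar>h x\<bar> \<le> B"
  shows "L2_function A (\<lambda>x. h x * f x)"
proof -
  have hm: "h \<in> borel_measurable lebesgue"
    using borel_measurable_continuous_onI[OF h] by (simp add: measurable_completion)
  have m: "(\<lambda>x. indicator A x * (h x * f x)) \<in> borel_measurable lebesgue"
    using borel_measurable_times[OF hm L2_function_measurable[OF f]] by (simp add: mult.left_commute)
  have "integrable lebesgue (\<lambda>x. (indicator A x * (h x * f x))\<^sup>2)"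
  proof (rule Bochner_Integration.integrable_bound)
    show "integrable lebesgue (\<lambda>x. B\<^sup>2 * (indicator A x * f x)\<^sup>2)"
      using f by (intro integrable_mult_right) (simp add: L2_function_iff square_integrable_def)
    show "(\<lambda>x. (indicator A x * (h x * f x))\<^sup>2) \<in> borel_measurable lebesgue"
      by (rule borel_measurable_power[OF m])
    have "(indicator A x * (h x * f x))\<^sup>2 \<le> B\<^sup>2 * (indicator A x * f x)\<^sup>2" for x
    proof -
      have "(h x)\<^sup>2 \<le> B\<^sup>2" using abs_le_square_iff[of "h x" B] le[of x] by auto
      then have "(h x)\<^sup>2 * (indicator A x * f x)\<^sup>2 \<le> B\<^sup>2 * (indicator A x * f x)\<^sup>2" by (rule mult_right_mono) simp
      then show ?thesis by (simp add: power_mult_distrib mult.left_commute)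
    qed
    then show "AE x in lebesgue. norm ((indicator A x * (h x * f x))\<^sup>2) \<le> norm (B\<^sup>2 * (indicator A x * f x)\<^sup>2)" by simp
  qed
  then show ?thesis using m by (simp add: L2_function_iff square_integrable_def)
qed

lemma L2_function_mult_extend:
  assumes g: "L2_function A g" and AB: "A \<subseteq> B" and h: "continuous_on UNIV h" and le: "\<And>x. \<bar>h x\<bar> \<le> 1"
    and z: "\<And>x. x \<in> B - A \<Longrightarrow> h x = 0"
  shows "L2_function B (\<lambda>x. h x * g x)" "norm (L2_class B (\<lambda>x. h x * g x)) \<le> norm (L2_class A g)"
proof -
  have L: "L2_function A (\<lambda>x. h x * g x)" by (rule L2_function_mult_bounded[OF g h le])
  have eq: "indicator B x * (h x * g x) = indicator A x * (h x * g x)" for x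
    using AB z[of x] by (cases "x \<in> A"; cases "x \<in> B") auto
  show LB: "L2_function B (\<lambda>x. h x * g x)" using L by (simp only: L2_function_iff eq)
  have "pairing B (\<lambda>x. h x * g x) (\<lambda>x. h x * g x) = pairing A (\<lambda>x. h x * g x) (\<lambda>x. h x * g x)"
    by (simp only: pairing_eq eq)
  also have "\<dots> \<le> pairing A g g"
    unfolding pairing_def set_lebesgue_integral_def real_scaleR_def
  proof (rule integral_mono[OF pairing_integrable[OF L L] pairing_integrable[OF g g]])
    fix x
    have "\<bar>h x * g x\<bar> \<le> \<bar>g x\<bar>" using mult_right_mono[OF le[of x], of "\<bar>g x\<bar>"] by (simp add: abs_mult)
    then show "indicator A x * (h x * g x * (h x * g x)) \<le> indicator A x * (g x * g x)"
      using abs_le_square_iff[of "h x * g x" "g x"] by (cases "x \<in> A") (auto simp: power2_eq_square)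
  qed
  finally show "norm (L2_class B (\<lambda>x. h x * g x)) \<le> norm (L2_class A g)"
    unfolding pairing_norm[OF LB] pairing_norm[OF g] by simp
qed

section \<open>Density of the test functions in the form norm\<close>

context potential_setting
begin

lemma I_subset_J: "I \<subseteq> J"
  by (rule closure_subset)

lemma at_within_J: "x \<in> I \<Longrightarrow> at x within J = at x"
  by (meson I_subset_J at_within_interior interior_maximal open_interval subsetD)

lemma V_integrable:
  assumes "{c..d} \<subseteq> J"
  shows "set_integrable lebesgue {c<..<d} V"
proof -
  have "set_integrable lebesgue ({c..d} \<inter> I) V"
    using pot assms by (auto simp: admissible_potential_def locally_integrable_on_closure_def)
  then show ?thesis by (rule set_integrable_subset) (use interval_interior[OF valid assms] in auto)
qed

text \<open>\<open>V\<close> is only locally integrable, so the weighted norm is controlled by a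
  uniform bound on \<open>h\<close> and by the integral of \<open>V\<close> over the segment that
  carries \<open>h\<close>. This is why approximation in the form norm asks for uniform
  closeness.\<close>

lemma V_weight:
  assumes cd: "{c..d} \<subseteq> J" and m: "set_borel_measurable lebesgue {c<..<d} h"
    and le: "\<And>x. x \<in> {c<..<d} \<Longrightarrow> \<bar>h x\<bar> \<le> b" and z: "\<And>x. x \<in> I - {c<..<d} \<Longrightarrow> h x = 0"
  shows "L2_function I (\<lambda>x. sqrt (V x) * h x)"
    "(norm (L2_class I (\<lambda>x. sqrt (V x) * h x)))\<^sup>2 \<le> b\<^sup>2 * (LINT x:{c<..<d}|lebesgue. V x)"
proof -
  let ?A = "{c<..<d}"
  have AI: "?A \<subseteq> I" by (rule interval_interior[OF valid cd])
  have Vi: "integrable lebesgue (\<lambda>x. indicator ?A x * V x)" using V_integrable[OF cd] by (simp add: set_integrable_def)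
  have eq: "indicator I x * (sqrt (V x) * h x) = sqrt (indicator ?A x * V x) * (indicator ?A x * h x)" for x
    using AI z[of x] by (cases "x \<in> ?A"; cases "x \<in> I") auto
  have m': "(\<lambda>x. indicator I x * (sqrt (V x) * h x)) \<in> borel_measurable lebesgue"
    unfolding eq
    by (rule borel_measurable_times[OF measurable_compose[OF borel_measurable_integrable[OF Vi] borel_measurable_sqrt]
          m[unfolded set_borel_measurable_def real_scaleR_def]])
  have sq: "(indicator I x * (sqrt (V x) * h x))\<^sup>2 \<le> b\<^sup>2 * (indicator ?A x * V x)" for x
  proof (cases "x \<in> ?A")
    case True
    have "(h x)\<^sup>2 \<le> b\<^sup>2" using abs_le_square_iff[of "h x" b] le[OF True] by auto
    then have "V x * (h x)\<^sup>2 \<le> V x * b\<^sup>2" using V_nonneg[of x] True AI by (intro mult_left_mono) auto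
    then show ?thesis unfolding eq using True V_nonneg[of x] AI by (simp add: power_mult_distrib mult.commute subset_iff)
  qed (simp add: eq)
  have i: "integrable lebesgue (\<lambda>x. (indicator I x * (sqrt (V x) * h x))\<^sup>2)"
    by (rule Bochner_Integration.integrable_bound[OF integrable_mult_right[OF Vi, of "b\<^sup>2"] borel_measurable_power[OF m']])
      (use sq in \<open>auto intro!: AE_I2 intro: order_trans[OF _ abs_ge_self]\<close>)
  then show L: "L2_function I (\<lambda>x. sqrt (V x) * h x)" using m' by (simp add: L2_function_iff square_integrable_def)
  have "(norm (L2_class I (\<lambda>x. sqrt (V x) * h x)))\<^sup>2 = (LINT x|lebesgue. (indicator I x * (sqrt (V x) * h x))\<^sup>2)"
    by (simp only: pairing_norm[OF L, symmetric] pairing_eq power2_eq_square[symmetric])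
  also have "\<dots> \<le> (LINT x|lebesgue. b\<^sup>2 * (indicator ?A x * V x))"
    by (rule integral_mono[OF i integrable_mult_right[OF Vi] sq])
  also have "\<dots> = b\<^sup>2 * (LINT x:?A|lebesgue. V x)" by (simp add: set_lebesgue_integral_def)
  finally show "(norm (L2_class I (\<lambda>x. sqrt (V x) * h x)))\<^sup>2 \<le> b\<^sup>2 * (LINT x:?A|lebesgue. V x)" .
qed

lemma C0_infinity_D:
  assumes "f \<in> C0_infinity I"
  obtains f' c d B where "\<And>x. x \<in> J \<Longrightarrow> (f has_real_derivative f' x) (at x within J)"
    "\<And>x. x \<in> I \<Longrightarrow> deriv f x = f' x" "\<And>x. x \<in> I \<Longrightarrow> (f has_real_derivative f' x) (at x)"
    "continuous_on J f" "continuous_on J f'" "c < d" "{c..d} \<subseteq> J" "{c<..<d} \<subseteq> I"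
    "\<And>x. x \<in> J - {c..d} \<Longrightarrow> f x = 0" "\<And>x. x \<in> I - {c<..<d} \<Longrightarrow> f x = 0"
    "\<And>x. x \<in> I - {c<..<d} \<Longrightarrow> f' x = 0"
    "B \<ge> 0" "\<And>x. x \<in> {c..d} \<Longrightarrow> \<bar>f x\<bar> \<le> B \<and> \<bar>f' x\<bar> \<le> B"
proof -
  have sm: "smooth_on J f" using assms by (auto simp: C0_infinity_def smooth_on_def)
  obtain K where K: "compact K" "K \<subseteq> J" "\<And>x. x \<in> J - K \<Longrightarrow> f x = 0" using assms by (auto simp: C0_infinity_def)
  obtain f' where f': "smooth_on J f'" "\<And>x. x \<in> J \<Longrightarrow> (f has_real_derivative f' x) (at x within J)"
    using smooth_on_deriv[OF sm] by blast
  obtain R0 where R0: "\<And>x. x \<in> K \<Longrightarrow> \<bar>x\<bar> \<le> R0" using compact_imp_bounded[OF K(1)] unfolding bounded_iff real_norm_def by blast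
  \<comment> \<open>The added 1 puts \<open>K\<close> into the open box, so points of
    \<open>I\<close> outside \<open>{c<..<d}\<close> are outside \<open>K\<close> and have a
    neighbourhood on which \<open>f\<close> vanishes.\<close>
  define R where "R = max R0 0 + 1"
  have R: "R > 0" "\<And>x. x \<in> K \<Longrightarrow> \<bar>x\<bar> < R" using R0 by (fastforce simp: R_def)+
  obtain c d where cd: "c < d" "{c..d} = J \<inter> {-R..R}" "{c<..<d} = I \<inter> {-R<..<R}"
    by (rule interval_box[OF valid R(1)])
  have at: "(f has_real_derivative f' x) (at x)" if "x \<in> I" for x
    using f'(2)[of x] that I_subset_J at_within_J[OF that] by auto
  have z1: "f x = 0" if "x \<in> J - {c..d}" for x
    using K(3)[of x] R(2)[of x] that cd(2) by fastforce
  have xK: "x \<notin> K" if "x \<in> I - {c<..<d}" for x using R(2)[of x] that cd(3) by fastforce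
  have z2: "f x = 0" if "x \<in> I - {c<..<d}" for x
    using K(3)[of x] xK[OF that] that I_subset_J by auto
  have z3: "f' x = 0" if x: "x \<in> I - {c<..<d}" for x
  proof -
    have "open (I - K)" using K(1) by (intro open_Diff compact_imp_closed) auto
    then have "\<forall>\<^sub>F y in nhds x. y \<in> I - K" using x xK[OF x] by (intro eventually_nhds_in_open) auto
    then have ev: "\<forall>\<^sub>F y in nhds x. f y = 0" by eventually_elim (use K(3) I_subset_J in blast)
    have "(f has_real_derivative 0) (at x)"
      by (rule DERIV_cong_ev[OF refl ev refl, THEN iffD2]) (rule DERIV_const)
    then show ?thesis using at[of x] x DERIV_unique by blast
  qed
  have cf: "continuous_on J f" "continuous_on J f'" using sm f'(1) by (auto intro: smooth_on_continuous)
  have sub: "{c..d} \<subseteq> J" using cd by auto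
  have "compact (f ` {c..d})" "compact (f' ` {c..d})"
    by (rule compact_continuous_image[OF continuous_on_subset[OF cf(1) sub] compact_Icc],
        rule compact_continuous_image[OF continuous_on_subset[OF cf(2) sub] compact_Icc])
  then obtain B1 B2 where "\<And>y. y \<in> f ` {c..d} \<Longrightarrow> \<bar>y\<bar> \<le> B1" "\<And>y. y \<in> f' ` {c..d} \<Longrightarrow> \<bar>y\<bar> \<le> B2"
    by (metis bounded_iff compact_imp_bounded real_norm_def)
  then have B: "\<bar>f x\<bar> \<le> max 0 (max B1 B2) \<and> \<bar>f' x\<bar> \<le> max 0 (max B1 B2)" if "x \<in> {c..d}" for x
    using that by (auto simp: le_max_iff_disj)
  have dv: "deriv f x = f' x" if "x \<in> I" for x using DERIV_imp_deriv[OF at[OF that]] .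
  show thesis
    by (rule that[of f' c d "max 0 (max B1 B2)"]; (fact f'(2) dv at cf cd sub z1 z2 z3 B | simp add: cd(3)))
qed

lemma C0_infinity_H1V:
  assumes "f \<in> C0_infinity I"
  shows "f \<in> H1"
proof (rule C0_infinity_D[OF assms])
  fix f' c d B assume f: "\<And>x. x \<in> J \<Longrightarrow> (f has_real_derivative f' x) (at x within J)"
    "\<And>x. x \<in> I \<Longrightarrow> deriv f x = f' x" "\<And>x. x \<in> I \<Longrightarrow> (f has_real_derivative f' x) (at x)"
    "continuous_on J f" "continuous_on J f'" "c < d" "{c..d} \<subseteq> J" "{c<..<d} \<subseteq> I"
    "\<And>x. x \<in> J - {c..d} \<Longrightarrow> f x = 0" "\<And>x. x \<in> I - {c<..<d} \<Longrightarrow> f x = 0"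
    "\<And>x. x \<in> I - {c<..<d} \<Longrightarrow> f' x = 0"
    "B \<ge> 0" "\<And>x. x \<in> {c..d} \<Longrightarrow> \<bar>f x\<bar> \<le> B \<and> \<bar>f' x\<bar> \<le> B"
  have ms: "set_borel_measurable lebesgue {c<..<d} h" if "continuous_on J h" for h :: "real \<Rightarrow> real"
    using continuous_set_borel_measurable[OF continuous_on_subset[OF that], of "{c<..<d}"] f(8) I_subset_J by auto
  have b: "\<bar>f x\<bar> \<le> B" "\<bar>f' x\<bar> \<le> B" if "x \<in> {c<..<d}" for x using f(13)[of x] that by auto
  have L0: "L2_function I f" by (rule L2_small(1)[OF f(8) less_imp_le[OF f(6)] ms[OF f(4)] b(1) f(10)])
  have L1: "L2_function I f'" by (rule L2_small(1)[OF f(8) less_imp_le[OF f(6)] ms[OF f(5)] b(2) f(11)])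
  have L1': "L2_function I (deriv f)" by (rule L2_function_cong_AE(1)[OF L1]) (simp add: f(2))
  have LV: "L2_function I (\<lambda>x. sqrt (V x) * f x)" by (rule V_weight(1)[OF f(7) ms[OF f(4)] b(1) f(10)])
  have "locally_abs_continuous_on_closure I f"
    unfolding locally_abs_continuous_on_closure_def
  proof (intro allI impI)
    fix u v assume uv: "{u..v} \<subseteq> J"
    have "compact (f' ` {u..v})"
      by (rule compact_continuous_image[OF continuous_on_subset[OF f(5) uv] compact_Icc])
    then obtain B' where B': "\<And>y. y \<in> f' ` {u..v} \<Longrightarrow> \<bar>y\<bar> \<le> B'"
      by (metis bounded_iff compact_imp_bounded real_norm_def)
    show "abs_continuous_on {u..v} f"
    proof (rule abs_continuous_on_Lipschitz[of "max 0 B'"])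
      fix x y assume xy: "x \<in> {u..v}" "y \<in> {u..v}"
      have "norm (f y - f x) \<le> max 0 B' * norm (y - x)"
      proof (rule field_differentiable_bound[of "{u..v}"])
        show "(f has_field_derivative f' z) (at z within {u..v})" if "z \<in> {u..v}" for z
          using f(1)[of z] that uv by (meson has_field_derivative_subset subsetD)
        show "norm (f' z) \<le> max 0 B'" if "z \<in> {u..v}" for z using B'[of "f' z"] that by auto
      qed (use xy in auto)
      then show "\<bar>f y - f x\<bar> \<le> max 0 B' * \<bar>y - x\<bar>" by simp
    qed simp
  qed
  then have "H1_function s f" using valid L1' by unfold_locales
  then show "f \<in> H1" using L0 LV by (simp add: H1V_iff)
qed

lemma bump_polynomial_C0:
  assumes R: "R > 0" and p: "real_polynomial_function p"
  shows "(\<lambda>x. bump (x / R) * p x) \<in> C0_infinity I"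
proof -
  have "smooth_on UNIV (\<lambda>x. bump ((1 / R) * x + 0) * p x)"
    by (intro smooth_on_mult smooth_on_affine smooth_on_bump smooth_on_real_polynomial_function p)
  then have "smooth_on J (\<lambda>x. bump (x / R) * p x)" using smooth_on_subset[of UNIV _ J] by simp
  moreover have "compact (J \<inter> {-R..R})" by (intro closed_Int_compact) auto
  moreover have "bump (x / R) * p x = 0" if "x \<in> J - (J \<inter> {-R..R})" for x
  proof -
    have "\<bar>x / R\<bar> \<ge> 1" using that R by (auto simp: abs_le_iff pos_le_divide_eq)
    then show ?thesis by (simp add: bump_zero)
  qed
  ultimately show ?thesis unfolding C0_infinity_def smooth_on_def by blast
qed

text \<open>Cut off with \<open>\<psi> n\<close>, approximate \<open>f'\<close> on the resulting
  bounded piece by a polynomial \<open>p\<close>, and take \<open>\<psi> n * P\<close> with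
  \<open>P' = p\<close> and \<open>P c = f c\<close>. Test functions are smooth up to the boundary
  and unconstrained there, so the restriction of a polynomial qualifies and no mollifier enters.
  Since \<open>P\<close> is an antiderivative, \<open>f - P\<close> is uniformly small, which also
  controls the part weighted by \<open>V\<close>.\<close>

theorem C0_infinity_dense:
  assumes f: "f \<in> H1" and e: "e > 0"
  obtains g where "g \<in> C0_infinity I" "star (\<lambda>x. f x - g x) < e"
proof -
  obtain b C where b: "\<And>x. (bump has_real_derivative b x) (at x)" "continuous_on UNIV b"
    "\<And>x. \<bar>x\<bar> \<ge> 1 \<Longrightarrow> b x = 0" "C \<ge> 0" "\<And>x. \<bar>b x\<bar> \<le> C"
    using bump_deriv by metis
  have bc: "continuous_on UNIV bump" by (rule smooth_on_continuous[OF smooth_on_bump])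
  define \<psi> where "\<psi> n x = bump (x / real (Suc n))" for n x
  define \<psi>' where "\<psi>' n x = b (x / real (Suc n)) / real (Suc n)" for n x
  have psi: "continuous_on UNIV (\<psi> n)" "0 \<le> \<psi> n x" "\<psi> n x \<le> 1" "(\<psi> n has_real_derivative \<psi>' n x) (at x)"
    "continuous_on UNIV (\<psi>' n)" "\<bar>\<psi>' n x\<bar> \<le> C / real (Suc n)" "\<bar>\<psi>' n x\<bar> \<le> C" for n x
  proof -
    show "continuous_on UNIV (\<psi> n)" unfolding \<psi>_def
      by (rule continuous_on_compose2[OF bc]) (auto intro!: continuous_intros)
    show "continuous_on UNIV (\<psi>' n)" unfolding \<psi>'_def
      by (intro continuous_on_divide continuous_on_compose2[OF b(2)] continuous_intros) auto
    show "0 \<le> \<psi> n x" "\<psi> n x \<le> 1" unfolding \<psi>_def by (rule bump_bounds)+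
    have "((\<lambda>x. x / real (Suc n)) has_real_derivative 1 / real (Suc n)) (at x)"
      by (rule DERIV_cdivide) (rule DERIV_ident)
    from DERIV_chain2[OF b(1) this] show "(\<psi> n has_real_derivative \<psi>' n x) (at x)"
      unfolding \<psi>_def \<psi>'_def by simp
    show 1: "\<bar>\<psi>' n x\<bar> \<le> C / real (Suc n)" unfolding \<psi>'_def using b(5) by (simp add: divide_right_mono del: of_nat_Suc)
    have "C / real (Suc n) \<le> C / 1" by (rule divide_left_mono) (use b(4) in auto)
    then show "\<bar>\<psi>' n x\<bar> \<le> C" using 1 by simp
  qed
  have psi_lim: "(\<lambda>n. 1 - \<psi> n x) \<longlonglongrightarrow> 0" for x
  proof -
    have "(\<lambda>n. x * inverse (real (Suc n))) \<longlonglongrightarrow> x * 0" by (intro tendsto_mult_left LIMSEQ_inverse_real_of_nat)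
    then have "(\<lambda>n. x / real (Suc n)) \<longlonglongrightarrow> 0" by (simp add: divide_inverse)
    then have "(\<lambda>n. \<psi> n x) \<longlonglongrightarrow> bump 0" unfolding \<psi>_def
      by (rule isCont_tendsto_compose[rotated]) (use bc in \<open>simp add: continuous_on_eq_continuous_at\<close>)
    then have "(\<lambda>n. 1 - \<psi> n x) \<longlonglongrightarrow> 1 - 1" unfolding bump_at_0 by (intro tendsto_diff tendsto_const)
    then show ?thesis by simp
  qed
  have psi'_lim: "(\<lambda>n. \<psi>' n x) \<longlonglongrightarrow> 0" for x
  proof (rule Lim_null_comparison)
    show "\<forall>\<^sub>F n in sequentially. norm (\<psi>' n x) \<le> C * inverse (real (Suc n))"
      using psi(6) by (intro always_eventually allI) (simp add: divide_inverse)
    show "(\<lambda>n. C * inverse (real (Suc n))) \<longlonglongrightarrow> 0" using tendsto_mult_left[OF LIMSEQ_inverse_real_of_nat, of C] by simp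
  qed
  have c1m: "continuous_on UNIV (\<lambda>x. 1 - \<psi> n x)" "\<bar>1 - \<psi> n x\<bar> \<le> 1" for n x
    using psi(1,2,3)[of n] by (auto intro!: continuous_intros)
  have cut: "(\<lambda>n. norm (L2_class I (\<lambda>x. (1 - \<psi> n x) * g x))) \<longlonglongrightarrow> 0" if g: "L2_function I g" for g
  proof (rule pairing_dominated[OF L2_function_mult_bounded[OF g c1m] g])
    show "\<bar>(1 - \<psi> n x) * g x\<bar> \<le> \<bar>g x\<bar>" for n x
      using mult_right_mono[OF c1m(2)[of n x], of "\<bar>g x\<bar>"] by (simp add: abs_mult)
    show "AE x in lebesgue. x \<in> I \<longrightarrow> (\<lambda>n. (1 - \<psi> n x) * g x) \<longlonglongrightarrow> 0"
      by (intro AE_I2 impI tendsto_mult_left_zero psi_lim)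
  qed
  note D = H1V_D[OF f]
  have cut': "(\<lambda>n. norm (L2_class I (\<lambda>x. \<psi>' n x * f x))) \<longlonglongrightarrow> 0"
  proof (rule pairing_dominated[OF L2_function_mult_bounded[OF D(2) psi(5,7)] L2_function_scale[OF D(2), of C]])
    show "\<bar>\<psi>' n x * f x\<bar> \<le> \<bar>C * f x\<bar>" for n x
      using mult_right_mono[OF psi(7)[of n x], of "\<bar>f x\<bar>"] b(4) by (simp add: abs_mult)
    show "AE x in lebesgue. x \<in> I \<longrightarrow> (\<lambda>n. \<psi>' n x * f x) \<longlonglongrightarrow> 0"
      by (intro AE_I2 impI tendsto_mult_left_zero psi'_lim)
  qed
  \<comment> \<open>The final estimate is \<open>4 + 4 + 16 = 24\<close> times
    \<open>\<delta>^2\<close>: two errors of size \<open>\<delta>\<close> for the function, two for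
    its weighted version, four for the derivative.\<close>
  define \<delta> where "\<delta> = sqrt e / 5"
  have d: "\<delta> > 0" "24 * \<delta>\<^sup>2 < e" using e by (auto simp: \<delta>_def power_divide)
  have "\<forall>\<^sub>F n in sequentially. norm (L2_class I (\<lambda>x. (1 - \<psi> n x) * f x)) < \<delta>
      \<and> norm (L2_class I (\<lambda>x. (1 - \<psi> n x) * deriv f x)) < \<delta>
      \<and> norm (L2_class I (\<lambda>x. (1 - \<psi> n x) * (sqrt (V x) * f x))) < \<delta>
      \<and> norm (L2_class I (\<lambda>x. \<psi>' n x * f x)) < \<delta>"
    by (intro eventually_conj order_tendstoD(2)[OF cut] order_tendstoD(2)[OF cut'] D d(1))
  then obtain n where n: "norm (L2_class I (\<lambda>x. (1 - \<psi> n x) * f x)) < \<delta>"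
    "norm (L2_class I (\<lambda>x. (1 - \<psi> n x) * deriv f x)) < \<delta>"
    "norm (L2_class I (\<lambda>x. (1 - \<psi> n x) * (sqrt (V x) * f x))) < \<delta>"
    "norm (L2_class I (\<lambda>x. \<psi>' n x * f x)) < \<delta>"
    using eventually_happens'[OF sequentially_bot] by blast
  define R where "R = real (Suc n)"
  have R: "R > 0" by (simp add: R_def)
  obtain c d where cd: "c < d" "{c..d} = J \<inter> {-R..R}" "{c<..<d} = I \<inter> {-R<..<R}"
    by (rule interval_box[OF valid R])
  let ?A = "{c<..<d}"
  have sub: "{c..d} \<subseteq> J" "?A \<subseteq> I" using cd by auto
  have off: "\<bar>x / R\<bar> \<ge> 1" if "x \<in> I - ?A" for x
    using that cd(3) R by (auto simp: abs_le_iff pos_le_divide_eq)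
  have z: "\<psi> n x = 0" "\<psi>' n x = 0" if "x \<in> I - ?A" for x
    using off[OF that] bump_zero b(3) by (simp_all add: \<psi>_def \<psi>'_def R_def del: of_nat_Suc)
  define VA where "VA = (LINT x:?A|lebesgue. V x)"
  have VA: "VA \<ge> 0" unfolding VA_def set_lebesgue_integral_def
  proof (rule Bochner_Integration.integral_nonneg)
    fix x show "0 \<le> indicator ?A x *\<^sub>R V x" using V_nonneg[of x] sub(2) by (cases "x \<in> ?A") auto
  qed
  \<comment> \<open>The four terms of the denominator answer, in this order, for the errors in
    \<open>\<psi> (f' - p)\<close>, \<open>\<psi> (f - P)\<close>,
    \<open>sqrt V \<psi> (f - P)\<close> and \<open>\<psi>' (f - P)\<close>; each of them is then at
    most \<open>\<delta>\<close>.\<close>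
  define \<kappa> where "\<kappa> = \<delta> / (1 + (d - c) + sqrt (d - c) * sqrt VA + C * (d - c))"
  have den: "1 + (d - c) + sqrt (d - c) * sqrt VA + C * (d - c) > 0"
    using cd(1) VA b(4) by (intro add_pos_nonneg) auto
  have k: "\<kappa> > 0" using d(1) den by (simp add: \<kappa>_def)
  have "\<kappa> * (1 + (d - c) + sqrt (d - c) * sqrt VA + C * (d - c)) = \<delta>" using den by (simp add: \<kappa>_def)
  then have keq: "\<kappa> + \<kappa> * (d - c) + \<kappa> * (sqrt (d - c) * sqrt VA) + \<kappa> * (C * (d - c)) = \<delta>" by (simp add: distrib_left)
  have knn: "\<kappa> * (d - c) \<ge> 0" "\<kappa> * (sqrt (d - c) * sqrt VA) \<ge> 0" "\<kappa> * (C * (d - c)) \<ge> 0"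
    using k cd(1) VA b(4) by auto
  have kd: "\<kappa> < \<delta> \<or> \<kappa> = \<delta>" "\<kappa> \<le> \<delta>" "\<kappa> * (d - c) \<le> \<delta>" "\<kappa> * (sqrt (d - c) * sqrt VA) \<le> \<delta>" "\<kappa> * (C * (d - c)) \<le> \<delta>"
    using keq knn k by linarith+
  interpret f: H1_function s f by (rule D(1))
  have LA: "L2_function ?A (deriv f)" by (rule f.L2d_sub[OF sub(1)])
  obtain p where p: "real_polynomial_function p" "L2_function ?A p"
    "norm (L2_class ?A (deriv f) - L2_class ?A p) < \<kappa>"
    using L2_polynomial_approx[OF LA cd(1) k] by metis
  obtain P where P: "real_polynomial_function P" "\<And>x. (P has_real_derivative p x) (at x)" "P c = f c"
    using real_polynomial_function_antiderivative[OF p(1)] by metis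
  have Lfp: "L2_function ?A (\<lambda>x. deriv f x - p x)" by (rule L2_function_diff[OF LA p(2)])
  have nfp: "norm (L2_class ?A (\<lambda>x. deriv f x - p x)) \<le> \<kappa>" using p(3) by (simp add: L2_class_diff[OF LA p(2)])
  have smp: "smooth_on UNIV P" "smooth_on UNIV p" using P(1) p(1) by (auto intro: smooth_on_real_polynomial_function)
  have cP: "continuous_on UNIV P" "continuous_on UNIV p" using smp by (auto intro: smooth_on_continuous)
  define \<eta> where "\<eta> = sqrt (d - c) * \<kappa>"
  have fP: "\<bar>f x - P x\<bar> \<le> \<eta>" if x: "x \<in> {c..d}" for x
  proof -
    have cx: "c \<le> x" "{c..x} \<subseteq> J" "{c<..<x} \<subseteq> ?A" using x sub(1) by auto
    have Lx: "L2_function {c<..<x} (\<lambda>x. deriv f x - p x)" "L2_function {c<..<x} (deriv f)" "L2_function {c<..<x} p"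
      using L2_function_subset(1)[OF Lfp _ cx(3)] L2_function_subset(1)[OF LA _ cx(3)] L2_function_subset(1)[OF p(2) _ cx(3)] by auto
    have "(p has_integral P x - P c) {c..x}"
      by (rule fundamental_theorem_of_calculus[OF cx(1)])
        (use P(2) in \<open>auto simp: has_real_derivative_iff_has_vector_derivative[symmetric] intro: has_field_derivative_at_within\<close>)
    then have "(p has_integral P x - P c) {c<..<x}" by (simp add: has_integral_Icc_iff_Ioo)
    then have "P x - P c = (LINT x:{c<..<x}|lebesgue. p x)"
      using has_integral_set_lebesgue[OF L2_function_integrable_Ioo[OF Lx(3)]] has_integral_unique by blast
    moreover have "f x - f c = (LINT x:{c<..<x}|lebesgue. deriv f x)" by (rule f.increment_integral[OF cx(1,2)])
    ultimately have "f x - P x = (LINT x:{c<..<x}|lebesgue. deriv f x - p x)"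
      using set_integral_diff(2)[OF L2_function_integrable_Ioo[OF Lx(2)] L2_function_integrable_Ioo[OF Lx(3)]] P(3) by simp
    then have eq: "f x - P x = pairing {c<..<x} (\<lambda>x. 1) (\<lambda>x. deriv f x - p x)" by (simp add: pairing_def)
    have "(f x - P x)\<^sup>2 \<le> (x - c) * pairing {c<..<x} (\<lambda>x. deriv f x - p x) (\<lambda>x. deriv f x - p x)"
      unfolding eq using pairing_Cauchy_Schwarz[OF L2_function_const_interval Lx(1), of 1] pairing_const_interval[OF cx(1), of 1] by simp
    also have "\<dots> \<le> (d - c) * (norm (L2_class ?A (\<lambda>x. deriv f x - p x)))\<^sup>2"
    proof (rule mult_mono)
      show "pairing {c<..<x} (\<lambda>x. deriv f x - p x) (\<lambda>x. deriv f x - p x) \<le> (norm (L2_class ?A (\<lambda>x. deriv f x - p x)))\<^sup>2"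
        using L2_function_subset(2)[OF Lfp _ cx(3)] pairing_norm[OF Lfp] by simp
    qed (use x pairing_nonneg in auto)
    also have "\<dots> \<le> (d - c) * \<kappa>\<^sup>2"
      using nfp cd(1) by (intro mult_left_mono power_mono) auto
    also have "\<dots> = \<eta>\<^sup>2" using cd(1) by (simp add: \<eta>_def power_mult_distrib)
    finally show ?thesis using abs_le_square_iff[of "f x - P x" \<eta>] k cd(1) by (simp add: \<eta>_def)
  qed
  define g where "g x = \<psi> n x * P x" for x
  have gC: "g \<in> C0_infinity I"
    using bump_polynomial_C0[OF R P(1)] unfolding g_def \<psi>_def R_def .
  have gH: "g \<in> H1" by (rule C0_infinity_H1V[OF gC])
  have cf: "continuous_on ?A f" using f.continuous[OF sub(1)] by (rule continuous_on_subset) auto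
  have msb: "set_borel_measurable lebesgue ?A (\<lambda>x. h x * (f x - P x))" if "continuous_on UNIV h" for h
    by (intro continuous_set_borel_measurable continuous_on_mult continuous_on_diff cf
        continuous_on_subset[OF that] continuous_on_subset[OF cP(1)]) auto
  have bA: "\<bar>h x * (f x - P x)\<bar> \<le> K * \<eta>" if "\<bar>h x\<bar> \<le> K" "x \<in> ?A" for h K x
  proof -
    have "\<bar>h x\<bar> * \<bar>f x - P x\<bar> \<le> K * \<eta>" using fP[of x] that by (intro mult_mono) (auto intro: order_trans[OF abs_ge_zero])
    then show ?thesis by (simp add: abs_mult)
  qed
  have psi1: "\<bar>\<psi> n x\<bar> \<le> 1" for x using psi(2,3)[of n x] by simp
  have eta0: "\<eta> \<ge> 0" using k cd(1) by (simp add: \<eta>_def)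
  have P0: "L2_function I (\<lambda>x. \<psi> n x * (f x - P x))" "(norm (L2_class I (\<lambda>x. \<psi> n x * (f x - P x))))\<^sup>2 \<le> (1 * \<eta>)\<^sup>2 * (d - c)"
    by (rule L2_small[OF sub(2) less_imp_le[OF cd(1)] msb[OF psi(1)] bA[where h = "\<psi> n" and K = 1, OF psi1]]; simp add: z)+
  have P1: "L2_function I (\<lambda>x. \<psi>' n x * (f x - P x))" "(norm (L2_class I (\<lambda>x. \<psi>' n x * (f x - P x))))\<^sup>2 \<le> (C * \<eta>)\<^sup>2 * (d - c)"
    by (rule L2_small[OF sub(2) less_imp_le[OF cd(1)] msb[OF psi(5)] bA[where h = "\<psi>' n" and K = C, OF psi(7)]]; simp add: z)+
  have PV: "L2_function I (\<lambda>x. sqrt (V x) * (\<psi> n x * (f x - P x)))"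
    "(norm (L2_class I (\<lambda>x. sqrt (V x) * (\<psi> n x * (f x - P x)))))\<^sup>2 \<le> (1 * \<eta>)\<^sup>2 * VA"
    unfolding VA_def by (rule V_weight[OF sub(1) msb[OF psi(1)] bA[where h = "\<psi> n" and K = 1, OF psi1]]; simp add: z)+
  have N0: "norm (L2_class I (\<lambda>x. \<psi> n x * (f x - P x))) \<le> \<delta>"
    using real_sqrt_le_mono[OF P0(2)] eta0 kd(3) cd(1) by (simp add: real_sqrt_mult \<eta>_def ac_simps)
  have N1: "norm (L2_class I (\<lambda>x. \<psi>' n x * (f x - P x))) \<le> \<delta>"
    using real_sqrt_le_mono[OF P1(2)] eta0 kd(5) cd(1) b(4) by (simp add: real_sqrt_mult \<eta>_def ac_simps)
  have NV: "norm (L2_class I (\<lambda>x. sqrt (V x) * (\<psi> n x * (f x - P x)))) \<le> \<delta>"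
    using real_sqrt_le_mono[OF PV(2)] eta0 kd(4) cd(1) by (simp add: real_sqrt_mult \<eta>_def ac_simps)
  have P2: "L2_function I (\<lambda>x. \<psi> n x * (deriv f x - p x))" "norm (L2_class I (\<lambda>x. \<psi> n x * (deriv f x - p x))) \<le> \<delta>"
    using L2_function_mult_extend[OF Lfp sub(2) psi(1) psi1 z(1)] nfp kd(2) by auto
  note L = L2_function_mult_bounded[OF D(2) c1m] L2_function_mult_bounded[OF D(3) c1m] L2_function_mult_bounded[OF D(4) c1m]
    L2_function_mult_bounded[OF D(2) psi(5,7)]
  have "c0 (\<lambda>x. f x - g x) = L2_class I (\<lambda>x. (1 - \<psi> n x) * f x + \<psi> n x * (f x - P x))"
    unfolding c0_def g_def by (simp add: algebra_simps)
  also have "\<dots> = L2_class I (\<lambda>x. (1 - \<psi> n x) * f x) + L2_class I (\<lambda>x. \<psi> n x * (f x - P x))"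
    by (rule L2_class_add[OF L(1) P0(1)])
  finally have "norm (c0 (\<lambda>x. f x - g x)) \<le> 2 * \<delta>"
    using norm_triangle_ineq[of "L2_class I (\<lambda>x. (1 - \<psi> n x) * f x)" "L2_class I (\<lambda>x. \<psi> n x * (f x - P x))"] n(1) N0 by simp
  then have 0: "(norm (c0 (\<lambda>x. f x - g x)))\<^sup>2 \<le> (2 * \<delta>)\<^sup>2" by (intro power_mono) auto
  have "cV (\<lambda>x. f x - g x) = L2_class I (\<lambda>x. (1 - \<psi> n x) * (sqrt (V x) * f x) + sqrt (V x) * (\<psi> n x * (f x - P x)))"
    unfolding cV_def g_def by (simp add: algebra_simps)
  also have "\<dots> = L2_class I (\<lambda>x. (1 - \<psi> n x) * (sqrt (V x) * f x)) + L2_class I (\<lambda>x. sqrt (V x) * (\<psi> n x * (f x - P x)))"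
    by (rule L2_class_add[OF L(3) PV(1)])
  finally have "norm (cV (\<lambda>x. f x - g x)) \<le> 2 * \<delta>"
    using norm_triangle_ineq[of "L2_class I (\<lambda>x. (1 - \<psi> n x) * (sqrt (V x) * f x))" "L2_class I (\<lambda>x. sqrt (V x) * (\<psi> n x * (f x - P x)))"] n(3) NV by simp
  then have V: "(norm (cV (\<lambda>x. f x - g x)))\<^sup>2 \<le> (2 * \<delta>)\<^sup>2" by (intro power_mono) auto
  \<comment> \<open>The derivative of \<open>f - \<psi> P\<close>, grouped into four pieces of norm
    at most \<open>\<delta>\<close> each.\<close>
  let ?h = "\<lambda>x. ((1 - \<psi> n x) * deriv f x - \<psi>' n x * f x) + (\<psi>' n x * (f x - P x) + \<psi> n x * (deriv f x - p x))"
  have Lh1: "L2_function I (\<lambda>x. (1 - \<psi> n x) * deriv f x - \<psi>' n x * f x)" by (rule L2_function_diff[OF L(2,4)])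
  have Lh2: "L2_function I (\<lambda>x. \<psi>' n x * (f x - P x) + \<psi> n x * (deriv f x - p x))" by (rule L2_function_add[OF P1(1) P2(1)])
  have ae: "AE x in lebesgue. x \<in> I \<longrightarrow> ?h x = deriv (\<lambda>x. f x - g x) x"
    using f.has_deriv_AE
  proof eventually_elim
    case (elim x)
    show ?case
    proof
      assume "x \<in> I"
      then have fd: "(f has_real_derivative deriv f x) (at x)" using elim by simp
      have "(g has_real_derivative \<psi>' n x * P x + p x * \<psi> n x) (at x)"
        unfolding g_def by (rule DERIV_mult[OF psi(4) P(2)])
      from DERIV_diff[OF fd this] have "((\<lambda>x. f x - g x) has_real_derivative ?h x) (at x)"
        by (rule DERIV_cong) (simp add: algebra_simps)
      then show "?h x = deriv (\<lambda>x. f x - g x) x" by (rule DERIV_imp_deriv[symmetric])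
    qed
  qed
  have "c1 (\<lambda>x. f x - g x) = L2_class I ?h"
    unfolding c1_def by (rule L2_function_cong_AE(2)[OF L2_function_add[OF Lh1 Lh2] ae])
  also have "\<dots> = (L2_class I (\<lambda>x. (1 - \<psi> n x) * deriv f x) - L2_class I (\<lambda>x. \<psi>' n x * f x))
     + (L2_class I (\<lambda>x. \<psi>' n x * (f x - P x)) + L2_class I (\<lambda>x. \<psi> n x * (deriv f x - p x)))"
    unfolding L2_class_add[OF Lh1 Lh2] L2_class_diff[OF L(2,4)] L2_class_add[OF P1(1) P2(1)] ..
  finally have "norm (c1 (\<lambda>x. f x - g x)) \<le> 4 * \<delta>"
    using norm_triangle_ineq[of "L2_class I (\<lambda>x. (1 - \<psi> n x) * deriv f x) - L2_class I (\<lambda>x. \<psi>' n x * f x)"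
        "L2_class I (\<lambda>x. \<psi>' n x * (f x - P x)) + L2_class I (\<lambda>x. \<psi> n x * (deriv f x - p x))"]
      norm_triangle_ineq4[of "L2_class I (\<lambda>x. (1 - \<psi> n x) * deriv f x)" "L2_class I (\<lambda>x. \<psi>' n x * f x)"]
      norm_triangle_ineq[of "L2_class I (\<lambda>x. \<psi>' n x * (f x - P x))" "L2_class I (\<lambda>x. \<psi> n x * (deriv f x - p x))"]
      n(2,4) N1 P2(2) by simp
  then have 1: "(norm (c1 (\<lambda>x. f x - g x)))\<^sup>2 \<le> (4 * \<delta>)\<^sup>2" by (intro power_mono) auto
  have "star (\<lambda>x. f x - g x) \<le> 24 * \<delta>\<^sup>2" using 0 V 1 by (simp add: star_def power_mult_distrib)
  then have "star (\<lambda>x. f x - g x) < e" using d(2) by linarith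
  with gC show thesis by (rule that)
qed

end

section \<open>The form associated with a path\<close>

text \<open>The constant 1, \<open>x / R\<close> or \<open>(x / b) (1 - x / b)\<close>. As
  \<open>\<rho>\<close> is a polynomial, \<open>1 - (1 - \<rho>)^m\<close> may multiply a test
  function; it vanishes on the boundary and tends to 1 inside the box.\<close>

lemma interval_weight:
  assumes "valid_setting s" "R > 0"
  obtains \<rho> where "real_polynomial_function \<rho>" "\<And>x. x \<in> interval s \<inter> {-R<..<R} \<Longrightarrow> 0 < \<rho> x \<and> \<rho> x \<le> 1"
    "\<And>x. x \<in> closure (interval s) - interval s \<Longrightarrow> \<rho> x = (0::real)"
proof (rule interval_cases[OF assms(1)])
  assume "interval s = UNIV" "closure (interval s) = UNIV"
  then show thesis by (intro that[of "\<lambda>x. 1"] real_polynomial_function.intros(2)) auto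
next
  assume h: "interval s = {0<..}" "closure (interval s) = {0..}"
  have "real_polynomial_function (\<lambda>x. 1 / R * x)"
    by (intro real_polynomial_function.intros(4) real_polynomial_function.intros(2) real_polynomial_function.intros(1) bounded_linear_ident)
  then show thesis
  proof (rule that)
    show "0 < 1 / R * x \<and> 1 / R * x \<le> 1" if "x \<in> interval s \<inter> {-R<..<R}" for x
      using that assms(2) by (simp add: h(1) pos_divide_le_eq)
    show "1 / R * x = 0" if x: "x \<in> closure (interval s) - interval s" for x
    proof -
      have "x \<in> {0..} - {0<..}" using x h by blast
      then show ?thesis by simp
    qed
  qed
next
  fix b :: real assume h: "b > 0" "interval s = {0<..<b}" "closure (interval s) = {0..b}"
  have "real_polynomial_function (\<lambda>x. (1 / b * x) * (1 + (- 1 / b) * x))"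
    by (intro real_polynomial_function.intros(4) real_polynomial_function.intros(3) real_polynomial_function.intros(2) real_polynomial_function.intros(1) bounded_linear_ident)
  then show thesis
  proof (rule that)
    fix x assume "x \<in> interval s \<inter> {-R<..<R}"
    then have "0 < x / b" "x / b < 1" using h by auto
    then have "0 < x / b * (1 - x / b)" "x / b * (1 - x / b) \<le> 1"
      by (intro mult_pos_pos mult_le_one; linarith)+
    then show "0 < (1 / b * x) * (1 + (- 1 / b) * x) \<and> (1 / b * x) * (1 + (- 1 / b) * x) \<le> 1" by simp
  next
    fix x assume "x \<in> closure (interval s) - interval s"
    then have "x \<in> {0..b} - {0<..<b}" using h(2,3) by auto
    then have "x = 0 \<or> x = b" by auto
    then show "(1 / b * x) * (1 + (- 1 / b) * x) = 0" using h(1) by auto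
  qed
qed

text \<open>Together with the next two lemmas this removes the six-fold case distinction: boundary
  terms are combinations of values at points of the closure, with coefficient 0 in the cases that
  have none, and boundary conditions are zeros on a set of boundary points.\<close>

lemma boundary_noise_repr:
  assumes "valid_setting s"
  obtains q \<beta> where "q \<in> closure (interval s)" "\<And>h. boundary_noise s w h = \<beta> * h q"
proof -
  have "interval s \<noteq> {}" using assms by (cases s) (auto simp: greaterThanLessThan_empty_iff)
  then obtain x0 where x0: "x0 \<in> closure (interval s)" using closure_subset[of "interval s"] by blast
  show thesis
  proof (cases s)
    case (Case3D b)
    then show thesis using assms by (intro that[of b "w b"]) (auto simp: closure_greaterThanLessThan)
  next
    case (Case3R b)
    then show thesis using assms by (intro that[of b "w b"]) (auto simp: closure_greaterThanLessThan)
  next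
    case (Case3M b)
    then show thesis using assms by (intro that[of b "w b"]) (auto simp: closure_greaterThanLessThan)
  qed (use x0 in \<open>auto intro: that[of x0 0]\<close>)
qed

lemma bdry_repr:
  assumes "valid_setting s"
  obtains p q \<alpha> \<beta> where "p \<in> closure (interval s)" "q \<in> closure (interval s)"
    "\<And>f g. bdry s f g = \<alpha> * (f p * g p) + \<beta> * (f q * g q)"
proof -
  have "interval s \<noteq> {}" using assms by (cases s) (auto simp: greaterThanLessThan_empty_iff)
  then obtain x0 where x0: "x0 \<in> closure (interval s)" using closure_subset[of "interval s"] by blast
  show thesis
  proof (cases s)
    case (Case2R a)
    then show thesis by (intro that[of 0 0 "- a / 2" 0]) auto
  next
    case (Case3R b a a')
    then show thesis using assms by (intro that[of 0 b "- a / 2" "- a' / 2"]) (auto simp: closure_greaterThanLessThan)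
  next
    case (Case3M b a)
    then show thesis using assms by (intro that[of 0 0 "- a / 2" 0]) (auto simp: closure_greaterThanLessThan)
  qed (use x0 in \<open>auto intro: that[of x0 x0 0 0]\<close>)
qed

lemma form_domain_repr:
  assumes "valid_setting s"
  obtains Z where "Z \<subseteq> closure (interval s) - interval s"
    "form_domain s V = {f \<in> H1V (interval s) V. \<forall>x\<in>Z. f x = 0}"
proof (cases s)
  case Case1
  then show thesis by (intro that[of "{}"]) auto
next
  case Case2D
  then show thesis by (intro that[of "{0}"]) auto
next
  case (Case2R a)
  then show thesis by (intro that[of "{}"]) auto
next
  case (Case3D b)
  then show thesis using assms by (intro that[of "{0, b}"]) (auto simp: closure_greaterThanLessThan)
next
  case (Case3R b)
  then show thesis by (intro that[of "{}"]) auto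
next
  case (Case3M b)
  then show thesis using assms by (intro that[of "{b}"]) (auto simp: closure_greaterThanLessThan)
qed

lemma subspace_L2_on: "subspace (L2_on I)"
proof (rule subspaceI)
  have "L2_function I (\<lambda>x. 0)" by (simp add: L2_function_iff square_integrable_0)
  then show "0 \<in> L2_on I"
    unfolding L2_on_def using L2_class_scale[of I "\<lambda>x. 0" 0] by (intro image_eqI[of _ _ "\<lambda>x. 0"]) auto
  show "x + y \<in> L2_on I" if "x \<in> L2_on I" "y \<in> L2_on I" for x y
    using that L2_class_add L2_function_add unfolding L2_on_def by (force simp: image_iff)
  show "c *\<^sub>R x \<in> L2_on I" if "x \<in> L2_on I" for c x
    using that L2_class_scale L2_function_scale unfolding L2_on_def by (force simp: image_iff)
qed

context potential_setting
begin

abbreviation "FD \<equiv> form_domain s V"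

lemma dom_H1: "f \<in> FD \<Longrightarrow> f \<in> H1"
  using form_domain_repr[OF valid, of V] by blast

lemma dom_closed:
  assumes "\<And>n. U n \<in> FD" "f \<in> H1" "\<And>x. x \<in> J \<Longrightarrow> (\<lambda>n. U n x) \<longlonglongrightarrow> f x"
  shows "f \<in> FD"
proof -
  obtain Z where Z: "Z \<subseteq> J - I" "FD = {f \<in> H1. \<forall>x\<in>Z. f x = 0}" by (rule form_domain_repr[OF valid])
  have "f x = 0" if "x \<in> Z" for x
  proof -
    have "(\<lambda>n. U n x) \<longlonglongrightarrow> f x" using assms(3) Z(1) that by blast
    moreover have "U n x = 0" for n using assms(1)[of n] Z(2) that by blast
    ultimately show ?thesis using LIMSEQ_unique[OF _ tendsto_const] by simp
  qed
  then show ?thesis using Z(2) assms(2) by blast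
qed

lemma dom_add:
  assumes "f \<in> FD" "g \<in> FD"
  shows "(\<lambda>x. f x + g x) \<in> FD"
proof -
  obtain Z where Z: "Z \<subseteq> J - I" "FD = {f \<in> H1. \<forall>x\<in>Z. f x = 0}" by (rule form_domain_repr[OF valid])
  have "(\<lambda>x. f x + g x) \<in> H1" by (rule H1V_add(1)[OF dom_H1[OF assms(1)] dom_H1[OF assms(2)]])
  moreover have "\<forall>x\<in>Z. f x = 0" "\<forall>x\<in>Z. g x = 0" using Z(2) assms by blast+
  ultimately show ?thesis unfolding Z(2) by simp
qed

lemma dom_scale:
  assumes "f \<in> FD"
  shows "(\<lambda>x. c * f x) \<in> FD"
proof -
  obtain Z where Z: "Z \<subseteq> J - I" "FD = {f \<in> H1. \<forall>x\<in>Z. f x = 0}" by (rule form_domain_repr[OF valid])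
  have "(\<lambda>x. c * f x) \<in> H1" by (rule H1V_scale(1)[OF dom_H1[OF assms]])
  moreover have "\<forall>x\<in>Z. f x = 0" using Z(2) assms by blast
  ultimately show ?thesis unfolding Z(2) by simp
qed

lemma dom_vanishing:
  assumes "f \<in> H1" "\<And>x. x \<in> J - I \<Longrightarrow> f x = 0"
  shows "f \<in> FD"
proof -
  obtain Z where Z: "Z \<subseteq> J - I" "FD = {f \<in> H1. \<forall>x\<in>Z. f x = 0}" by (rule form_domain_repr[OF valid])
  then show ?thesis using assms unfolding Z(2) by blast
qed

text \<open>Multiplying by \<open>1 - (1 - \<rho>)^m\<close> enforces the boundary conditions at no cost in \<open>L\<^sup>2\<close>.\<close>

lemma dom_dense: "L2_on I \<subseteq> closure (c0 ` FD)"
proof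
  fix v assume "v \<in> L2_on I"
  then obtain u where u: "L2_function I u" "v = L2_class I u" by (auto simp: L2_on_def)
  have bc: "continuous_on UNIV bump" by (rule smooth_on_continuous[OF smooth_on_bump])
  show "v \<in> closure (c0 ` FD)"
    unfolding closure_approachable
  proof (intro allI impI)
    fix e :: real assume e: "e > 0"
    then have e3: "e / 3 > 0" by simp
    define \<psi> where "\<psi> n x = bump (x / real (Suc n))" for n x
    have psi: "continuous_on UNIV (\<psi> n)" "0 \<le> \<psi> n x" "\<psi> n x \<le> 1" "\<bar>\<psi> n x\<bar> \<le> 1" for n x
    proof -
      show "continuous_on UNIV (\<psi> n)" unfolding \<psi>_def
        by (rule continuous_on_compose2[OF bc]) (auto intro!: continuous_intros)
      show "0 \<le> \<psi> n x" "\<psi> n x \<le> 1" unfolding \<psi>_def by (rule bump_bounds)+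
      then show "\<bar>\<psi> n x\<bar> \<le> 1" by simp
    qed
    have c1m: "continuous_on UNIV (\<lambda>x. 1 - \<psi> n x)" "\<bar>1 - \<psi> n x\<bar> \<le> 1" for n x
      using psi(1,2,3)[of n] by (auto intro!: continuous_intros)
    have psi_lim: "(\<lambda>n. 1 - \<psi> n x) \<longlonglongrightarrow> 0" for x
    proof -
      have "(\<lambda>n. x * inverse (real (Suc n))) \<longlonglongrightarrow> x * 0" by (intro tendsto_mult_left LIMSEQ_inverse_real_of_nat)
      then have "(\<lambda>n. x / real (Suc n)) \<longlonglongrightarrow> 0" by (simp add: divide_inverse)
      then have "(\<lambda>n. \<psi> n x) \<longlonglongrightarrow> bump 0" unfolding \<psi>_def
        by (rule isCont_tendsto_compose[rotated]) (use bc in \<open>simp add: continuous_on_eq_continuous_at\<close>)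
      then have "(\<lambda>n. 1 - \<psi> n x) \<longlonglongrightarrow> 1 - 1" unfolding bump_at_0 by (intro tendsto_diff tendsto_const)
      then show ?thesis by simp
    qed
    have "(\<lambda>n. norm (L2_class I (\<lambda>x. (1 - \<psi> n x) * u x))) \<longlonglongrightarrow> 0"
    proof (rule pairing_dominated[OF L2_function_mult_bounded[OF u(1) c1m] u(1)])
      show "\<bar>(1 - \<psi> n x) * u x\<bar> \<le> \<bar>u x\<bar>" for n x
        using mult_right_mono[OF c1m(2)[of n x], of "\<bar>u x\<bar>"] by (simp add: abs_mult)
      show "AE x in lebesgue. x \<in> I \<longrightarrow> (\<lambda>n. (1 - \<psi> n x) * u x) \<longlonglongrightarrow> 0"
        by (intro AE_I2 impI tendsto_mult_left_zero psi_lim)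
    qed
    from LIMSEQ_D[OF this e3] obtain n where n: "norm (L2_class I (\<lambda>x. (1 - \<psi> n x) * u x)) < e / 3" by force
    define R where "R = real (Suc n)"
    have R: "R > 0" by (simp add: R_def)
    obtain c d where cd: "c < d" "{c..d} = J \<inter> {-R..R}" "{c<..<d} = I \<inter> {-R<..<R}"
      by (rule interval_box[OF valid R])
    let ?A = "{c<..<d}"
    have sub: "?A \<subseteq> I" using cd by auto
    have z: "\<psi> n x = 0" if "x \<in> I - ?A" for x
    proof -
      have "\<bar>x / R\<bar> \<ge> 1" using that cd(3) R by (auto simp: abs_le_iff pos_le_divide_eq)
      then show ?thesis using bump_zero by (simp add: \<psi>_def R_def del: of_nat_Suc)
    qed
    have uA: "L2_function ?A u" by (rule L2_function_subset(1)[OF u(1) _ sub]) auto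
    obtain p where p: "real_polynomial_function p" "L2_function ?A p"
      "norm (L2_class ?A u - L2_class ?A p) < e / 3"
      using L2_polynomial_approx[OF uA cd(1) e3] by metis
    have Lup: "L2_function ?A (\<lambda>x. u x - p x)" by (rule L2_function_diff[OF uA p(2)])
    have P2: "L2_function I (\<lambda>x. \<psi> n x * (u x - p x))" "norm (L2_class I (\<lambda>x. \<psi> n x * (u x - p x))) < e / 3"
      using L2_function_mult_extend[OF Lup sub psi(1,4) z] p(3) by (auto simp: L2_class_diff[OF uA p(2)])
    have Lp: "L2_function I (\<lambda>x. \<psi> n x * p x)" using L2_function_mult_extend(1)[OF p(2) sub psi(1,4) z] .
    obtain \<rho> where rho: "real_polynomial_function \<rho>" "\<And>x. x \<in> I \<inter> {-R<..<R} \<Longrightarrow> 0 < \<rho> x \<and> \<rho> x \<le> 1"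
      "\<And>x. x \<in> J - I \<Longrightarrow> \<rho> x = 0" using interval_weight[OF valid R] by metis
    define g where "g m x = \<psi> n x * (p x * (1 - (1 - \<rho> x) ^ Suc m))" for m x
    have gC: "g m \<in> C0_infinity I" for m
    proof -
      have "real_polynomial_function (\<lambda>x. p x * (1 - (1 - \<rho> x) ^ Suc m))"
        by (intro real_polynomial_function.intros(4) real_polynomial_function_diff real_polynomial_function_power
            real_polynomial_function.intros(2) p(1) rho(1))
      from bump_polynomial_C0[OF R this] show ?thesis unfolding g_def \<psi>_def R_def .
    qed
    have gH: "g m \<in> H1" for m by (rule C0_infinity_H1V[OF gC])
    have gd: "g m \<in> FD" for m by (rule dom_vanishing[OF gH]) (simp add: g_def rho(3))
    have "(\<lambda>m. norm (L2_class I (\<lambda>x. \<psi> n x * p x - g m x))) \<longlonglongrightarrow> 0"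
    proof (rule pairing_dominated[OF L2_function_diff[OF Lp H1V_D(2)[OF gH]] Lp])
      have eq: "\<psi> n x * p x - g m x = (1 - \<rho> x) ^ Suc m * (\<psi> n x * p x)" for m x
        by (simp add: g_def algebra_simps)
      have b: "0 \<le> 1 - \<rho> x" "1 - \<rho> x < 1" if "x \<in> ?A" for x using rho(2)[of x] that cd(3) by auto
      show "\<bar>\<psi> n x * p x - g m x\<bar> \<le> \<bar>\<psi> n x * p x\<bar>" if x: "x \<in> I" for m x
      proof (cases "x \<in> ?A")
        case True
        have "\<bar>(1 - \<rho> x) ^ Suc m\<bar> \<le> 1" using b[OF True] by (simp add: power_abs[symmetric] power_le_one del: power_Suc)
        then show ?thesis unfolding eq abs_mult[of "_ ^ _"] using mult_right_mono by fastforce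
      qed (use z x in \<open>simp add: g_def\<close>)
      show "AE x in lebesgue. x \<in> I \<longrightarrow> (\<lambda>m. \<psi> n x * p x - g m x) \<longlonglongrightarrow> 0"
      proof (intro AE_I2 impI)
        fix x assume x: "x \<in> I"
        show "(\<lambda>m. \<psi> n x * p x - g m x) \<longlonglongrightarrow> 0"
        proof (cases "x \<in> ?A")
          case True
          have "(\<lambda>m. (1 - \<rho> x) ^ Suc m) \<longlonglongrightarrow> 0"
            by (rule LIMSEQ_Suc[OF LIMSEQ_power_zero]) (use b[OF True] in simp)
          then show ?thesis unfolding eq by (rule tendsto_mult_left_zero)
        qed (use z x in \<open>simp add: g_def\<close>)
      qed
    qed
    from LIMSEQ_D[OF this e3] obtain m where m: "norm (L2_class I (\<lambda>x. \<psi> n x * p x - g m x)) < e / 3" by force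
    have "v = L2_class I (\<lambda>x. (1 - \<psi> n x) * u x + (\<psi> n x * (u x - p x) + \<psi> n x * p x))"
      unfolding u(2) by (simp add: algebra_simps)
    also have "\<dots> = L2_class I (\<lambda>x. (1 - \<psi> n x) * u x) + (L2_class I (\<lambda>x. \<psi> n x * (u x - p x)) + L2_class I (\<lambda>x. \<psi> n x * p x))"
      using L2_class_add[OF L2_function_mult_bounded[OF u(1) c1m] L2_function_add[OF P2(1) Lp]] L2_class_add[OF P2(1) Lp] by simp
    finally have v: "v - c0 (g m) = L2_class I (\<lambda>x. (1 - \<psi> n x) * u x) + (L2_class I (\<lambda>x. \<psi> n x * (u x - p x))
        + L2_class I (\<lambda>x. \<psi> n x * p x - g m x))"
      unfolding c0_def L2_class_diff[OF Lp H1V_D(2)[OF gH]] by simp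
    have "norm (v - c0 (g m)) < e"
      unfolding v using n P2(2) m
        norm_triangle_ineq[of "L2_class I (\<lambda>x. (1 - \<psi> n x) * u x)" "L2_class I (\<lambda>x. \<psi> n x * (u x - p x)) + L2_class I (\<lambda>x. \<psi> n x * p x - g m x)"]
        norm_triangle_ineq[of "L2_class I (\<lambda>x. \<psi> n x * (u x - p x))" "L2_class I (\<lambda>x. \<psi> n x * p x - g m x)"] by linarith
    then show "\<exists>y\<in>c0 ` FD. dist y v < e" using gd[of m] by (auto simp: dist_norm norm_minus_commute)
  qed
qed

text \<open>For the difference of \<open>f\<close> and \<open>g\<close> only \<open>2 * r\<close>
  times the squared norm of the derivative is left of the pointwise bound, and \<open>r\<close> may
  tend to 0. The class in \<open>L2\<close> therefore determines the values on the closure,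
  including those at the boundary.\<close>

lemma c0_eq_imp:
  assumes "f \<in> H1" "g \<in> H1" "c0 f = c0 g" "x \<in> J"
  shows "f x = g x"
proof -
  obtain r0 where r0: "r0 > 0" "\<And>f x r. \<lbrakk>f \<in> H1; x \<in> J; 0 < r; r \<le> r0\<rbrakk> \<Longrightarrow>
    (f x)\<^sup>2 \<le> 2 * r * (norm (c1 f))\<^sup>2 + 2 / r * (norm (c0 f))\<^sup>2"
    using pointwise_le_star by blast
  let ?h = "\<lambda>x. f x - g x"
  have h: "?h \<in> H1" "c0 ?h = 0" using H1V_diff[OF assms(1,2)] assms(3) by auto
  have "(?h x)\<^sup>2 \<le> 0"
  proof (rule field_le_epsilon)
    fix e :: real assume e: "e > 0"
    define N where "N = 2 * (norm (c1 ?h))\<^sup>2 + 1"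
    have N: "N > 0" by (simp add: N_def add_nonneg_pos)
    have "(?h x)\<^sup>2 \<le> 2 * min r0 (e / N) * (norm (c1 ?h))\<^sup>2"
      using r0(2)[OF h(1) assms(4), of "min r0 (e / N)"] r0(1) e N h(2) by simp
    also have "\<dots> \<le> 2 * (e / N) * (norm (c1 ?h))\<^sup>2" by (intro mult_right_mono) auto
    also have "\<dots> \<le> e" using e N by (simp add: N_def field_simps)
    finally show "(?h x)\<^sup>2 \<le> 0 + e" by simp
  qed
  then show ?thesis by simp
qed

lemma c_cong:
  assumes "f \<in> H1" "\<And>x. x \<in> J \<Longrightarrow> f x = g x"
  shows "c1 f = c1 g" "cV f = cV g" "L2_class I (\<lambda>x. h x * f x) = L2_class I (\<lambda>x. h x * g x)"
proof -
  have eq: "f x = g x" if "x \<in> I" for x using assms(2) that I_subset_J by blast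
  have d: "deriv f x = deriv g x" if x: "x \<in> I" for x
  proof (rule deriv_cong_ev[OF _ refl])
    show "\<forall>\<^sub>F y in nhds x. f y = g y"
      using eventually_nhds_in_open[OF open_interval x] by eventually_elim (rule eq)
  qed
  show "c1 f = c1 g" unfolding c1_def L2_class_def
    by (rule arg_cong[where f = abs_L2]) (auto simp: fun_eq_iff indicator_def d)
  show "cV f = cV g" unfolding cV_def L2_class_def
    by (rule arg_cong[where f = abs_L2]) (auto simp: fun_eq_iff indicator_def eq)
  show "L2_class I (\<lambda>x. h x * f x) = L2_class I (\<lambda>x. h x * g x)" unfolding L2_class_def
    by (rule arg_cong[where f = abs_L2]) (auto simp: fun_eq_iff indicator_def eq)
qed

text \<open>Infinitesimal form boundedness of \<open>\<kappa>^2\<close>. A bound on the norm of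
  \<open>\<kappa> f\<close>, rather than on the integral of \<open>\<kappa> f^2\<close>, is what the
  cross term of \<open>f'\<close> with \<open>k f\<close> calls for.\<close>

definition form_small :: "(real \<Rightarrow> real) \<Rightarrow> bool" where
  "form_small \<kappa> \<longleftrightarrow> (\<forall>\<theta>>0. \<exists>C\<ge>0. \<forall>f\<in>H1. L2_function I (\<lambda>x. \<kappa> x * f x) \<and>
     (norm (L2_class I (\<lambda>x. \<kappa> x * f x)))\<^sup>2 \<le> \<theta> * ((norm (c1 f))\<^sup>2 + (norm (cV f))\<^sup>2) + C * (norm (c0 f))\<^sup>2)"

end

text \<open>A path \<open>w\<close> is split as \<open>k + L\<close> with \<open>L\<close> locally Lipschitz and \<open>l = L'\<close>, so that
  \<open>-\<integral>(f\<^sup>2)' w = -2\<integral>f f' k + \<integral>f\<^sup>2 l\<close> up to boundary terms; both \<open>k\<^sup>2\<close> and \<open>l\<^sup>2\<close> are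
  infinitesimally form bounded.\<close>

locale good_path = potential_setting +
  fixes w k l :: "real \<Rightarrow> real"
  assumes small_k: "form_small k" and small_l: "form_small l"
    and xi_eq: "\<And>f. f \<in> C0_infinity (interval s) \<Longrightarrow> xi s w (\<lambda>x. (f x)\<^sup>2) =
      boundary_noise s w (\<lambda>x. (f x)\<^sup>2) - 2 * inner (c1 f) (L2_class (interval s) (\<lambda>x. k x * f x))
      + inner (c0 f) (L2_class (interval s) (\<lambda>x. l x * f x))"
begin

section \<open>The random form for a decomposed path\<close>

definition "mk f = L2_class I (\<lambda>x. k x * f x)"
definition "ml f = L2_class I (\<lambda>x. l x * f x)"

text \<open>The symmetric bilinear form whose diagonal is the right-hand side of
  \<open>xi_eq\<close>; the two terms with \<open>mk\<close> merge there into the factor 2.\<close>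

definition "B f g = boundary_noise s w (\<lambda>x. f x * g x) - inner (c1 f) (mk g) - inner (c1 g) (mk f)
  + inner (c0 f) (ml g)"

text \<open>The random form in concrete terms: \<open>form_hat_eq\<close> identifies it with
  \<open>form_hat\<close> on \<open>H1\<close>.\<close>

definition "qh f g = 1 / 2 * inner (c1 f) (c1 g) + inner (cV f) (cV g) + bdry s f g + B f g"

lemma m_L2: "f \<in> H1 \<Longrightarrow> L2_function I (\<lambda>x. k x * f x)" "f \<in> H1 \<Longrightarrow> L2_function I (\<lambda>x. l x * f x)"
  using small_k small_l zero_less_one unfolding form_small_def by blast+

lemma m_add: "\<lbrakk>f \<in> H1; g \<in> H1\<rbrakk> \<Longrightarrow> mk (\<lambda>x. f x + g x) = mk f + mk g"
  "\<lbrakk>f \<in> H1; g \<in> H1\<rbrakk> \<Longrightarrow> ml (\<lambda>x. f x + g x) = ml f + ml g"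
  unfolding mk_def ml_def distrib_left by (intro L2_class_add m_L2; assumption)+

lemma m_scale: "f \<in> H1 \<Longrightarrow> mk (\<lambda>x. c * f x) = c *\<^sub>R mk f" "f \<in> H1 \<Longrightarrow> ml (\<lambda>x. c * f x) = c *\<^sub>R ml f"
  unfolding mk_def ml_def mult.left_commute[of _ c] by (intro L2_class_scale m_L2; assumption)+

lemma m_sym:
  assumes "f \<in> H1" "g \<in> H1"
  shows "inner (c0 f) (ml g) = inner (c0 g) (ml f)"
proof -
  have "inner (c0 f) (ml g) = pairing I f (\<lambda>x. l x * g x)"
    unfolding c0_def ml_def by (rule pairing_inner[symmetric]) (intro H1V_D m_L2 assms)+
  also have "\<dots> = pairing I g (\<lambda>x. l x * f x)" unfolding pairing_def by (simp add: ac_simps)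
  also have "\<dots> = inner (c0 g) (ml f)"
    unfolding c0_def ml_def by (rule pairing_inner) (intro H1V_D m_L2 assms)+
  finally show ?thesis .
qed

lemma B_sym: "\<lbrakk>f \<in> H1; g \<in> H1\<rbrakk> \<Longrightarrow> B f g = B g f"
  using m_sym by (simp add: B_def mult.commute)

lemma B_add:
  assumes "f \<in> H1" "g \<in> H1" "h \<in> H1"
  shows "B (\<lambda>x. f x + g x) h = B f h + B g h"
proof -
  obtain q \<beta> where r: "\<And>h. boundary_noise s w h = \<beta> * h q" using boundary_noise_repr[OF valid] by metis
  show ?thesis
    by (simp add: B_def r H1V_add[OF assms(1,2)] m_add[OF assms(1,2)] inner_add_left inner_add_right algebra_simps)
qed

lemma B_scale:
  assumes "f \<in> H1" "h \<in> H1"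
  shows "B (\<lambda>x. c * f x) h = c * B f h"
proof -
  obtain q \<beta> where r: "\<And>h. boundary_noise s w h = \<beta> * h q" using boundary_noise_repr[OF valid] by metis
  show ?thesis
    by (simp add: B_def r H1V_scale[OF assms(1)] m_scale[OF assms(1)] algebra_simps)
qed

lemma bdry_sym: "bdry s f g = bdry s g f"
  by (cases s) (simp_all add: mult.assoc mult.commute[of "f _" "g _"])

lemma qh_sym: "\<lbrakk>f \<in> H1; g \<in> H1\<rbrakk> \<Longrightarrow> qh f g = qh g f"
  using B_sym[of f g] bdry_sym[of f g] by (simp add: qh_def inner_commute)

lemma qh_add:
  assumes "f \<in> H1" "g \<in> H1" "h \<in> H1"
  shows "qh (\<lambda>x. f x + g x) h = qh f h + qh g h"
proof -
  obtain p q \<alpha> \<beta> where r: "\<And>f g. bdry s f g = \<alpha> * (f p * g p) + \<beta> * (f q * g q)" using bdry_repr[OF valid] by metis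
  show ?thesis
    by (simp add: qh_def r B_add[OF assms] H1V_add[OF assms(1,2)] inner_add_left algebra_simps)
qed

lemma qh_scale:
  assumes "f \<in> H1" "h \<in> H1"
  shows "qh (\<lambda>x. c * f x) h = c * qh f h"
proof -
  obtain p q \<alpha> \<beta> where r: "\<And>f g. bdry s f g = \<alpha> * (f p * g p) + \<beta> * (f q * g q)" using bdry_repr[OF valid] by metis
  show ?thesis
    by (simp add: qh_def r B_scale[OF assms] H1V_scale[OF assms(1)] algebra_simps)
qed

lemma qh_cong:
  assumes "f \<in> H1" "g \<in> H1" "c0 f = c0 g" "h \<in> H1"
  shows "qh f h = qh g h"
proof -
  have eq: "f x = g x" if "x \<in> J" for x by (rule c0_eq_imp[OF assms(1,2,3) that])
  obtain q \<beta> where r: "q \<in> J" "\<And>h. boundary_noise s w h = \<beta> * h q" using boundary_noise_repr[OF valid] by metis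
  obtain p' q' \<alpha>' \<beta>' where r': "p' \<in> J" "q' \<in> J" "\<And>f g. bdry s f g = \<alpha>' * (f p' * g p') + \<beta>' * (f q' * g q')"
    using bdry_repr[OF valid] by metis
  note cc = c_cong[OF assms(1) eq]
  show ?thesis
    using cc(1,2) cc(3)[of k] assms(3) by (simp add: qh_def B_def r r' eq mk_def)
qed

lemma point_small:
  assumes "p \<in> J" "\<theta> > 0"
  obtains C where "C \<ge> 0" "\<And>f. f \<in> H1 \<Longrightarrow> \<bar>\<alpha> * (f p * f p)\<bar> \<le> \<theta> * ((norm (c1 f))\<^sup>2 + (norm (cV f))\<^sup>2) + C * (norm (c0 f))\<^sup>2"
proof -
  obtain r0 where r0: "r0 > 0" "\<And>f x r. \<lbrakk>f \<in> H1; x \<in> J; 0 < r; r \<le> r0\<rbrakk> \<Longrightarrow>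
    (f x)\<^sup>2 \<le> 2 * r * (norm (c1 f))\<^sup>2 + 2 / r * (norm (c0 f))\<^sup>2"
    using pointwise_le_star by blast
  define r where "r = min r0 (\<theta> / (2 * (\<bar>\<alpha>\<bar> + 1)))"
  have r: "r > 0" "r \<le> r0" using r0(1) assms(2) by (auto simp: r_def)
  have ra: "\<bar>\<alpha>\<bar> * (2 * r) \<le> \<theta>"
  proof -
    have "\<bar>\<alpha>\<bar> * (2 * r) \<le> (\<bar>\<alpha>\<bar> + 1) * (2 * (\<theta> / (2 * (\<bar>\<alpha>\<bar> + 1))))"
      using r(1) by (intro mult_mono) (auto simp: r_def)
    also have "\<dots> = \<theta>" by (simp add: field_simps)
    finally show ?thesis .
  qed
  show thesis
  proof (rule that[of "\<bar>\<alpha>\<bar> * (2 / r)"])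
    show "\<bar>\<alpha>\<bar> * (2 / r) \<ge> 0" using r(1) by simp
    fix f assume f: "f \<in> H1"
    have "\<bar>\<alpha> * (f p * f p)\<bar> = \<bar>\<alpha>\<bar> * (f p)\<^sup>2" by (simp add: abs_mult power2_eq_square)
    also have "\<dots> \<le> \<bar>\<alpha>\<bar> * (2 * r * (norm (c1 f))\<^sup>2 + 2 / r * (norm (c0 f))\<^sup>2)"
      by (rule mult_left_mono[OF r0(2)[OF f assms(1) r]]) simp
    also have "\<dots> = (\<bar>\<alpha>\<bar> * (2 * r)) * (norm (c1 f))\<^sup>2 + \<bar>\<alpha>\<bar> * (2 / r) * (norm (c0 f))\<^sup>2" by (simp add: algebra_simps)
    also have "\<dots> \<le> \<theta> * (norm (c1 f))\<^sup>2 + \<bar>\<alpha>\<bar> * (2 / r) * (norm (c0 f))\<^sup>2"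
      by (intro add_right_mono mult_right_mono[OF ra]) simp
    also have "\<dots> \<le> \<theta> * ((norm (c1 f))\<^sup>2 + (norm (cV f))\<^sup>2) + \<bar>\<alpha>\<bar> * (2 / r) * (norm (c0 f))\<^sup>2"
      using assms(2) by (intro add_right_mono mult_left_mono) auto
    finally show "\<bar>\<alpha> * (f p * f p)\<bar> \<le> \<theta> * ((norm (c1 f))\<^sup>2 + (norm (cV f))\<^sup>2) + \<bar>\<alpha>\<bar> * (2 / r) * (norm (c0 f))\<^sup>2" .
  qed
qed

lemma B_small:
  assumes \<theta>: "\<theta> > 0"
  obtains C where "C \<ge> 0" "\<And>f. f \<in> H1 \<Longrightarrow> \<bar>B f f\<bar> \<le> \<theta> * ((norm (c1 f))\<^sup>2 + (norm (cV f))\<^sup>2) + C * (norm (c0 f))\<^sup>2"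
proof -
  obtain q \<beta> where r: "q \<in> J" "\<And>h. boundary_noise s w h = \<beta> * h q" using boundary_noise_repr[OF valid] by metis
  have t4: "\<theta> / 4 > 0" using \<theta> by simp
  obtain C1 where C1: "C1 \<ge> 0" "\<And>f. f \<in> H1 \<Longrightarrow> \<bar>\<beta> * (f q * f q)\<bar> \<le> \<theta> / 4 * ((norm (c1 f))\<^sup>2 + (norm (cV f))\<^sup>2) + C1 * (norm (c0 f))\<^sup>2"
    using point_small[OF r(1) t4] by blast
  \<comment> \<open>Young's inequality with weight \<open>\<theta> / 4\<close> multiplies this bound
    by \<open>4 / \<theta>\<close>, so the \<open>mk\<close> term takes \<open>\<theta> / 2\<close>
    in all; the boundary term and the \<open>ml\<close> term take \<open>\<theta> / 4\<close>
    each.\<close>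
  have t16: "\<theta> * \<theta> / 16 > 0" using \<theta> by simp
  obtain C2 where C2: "C2 \<ge> 0" "\<And>f. f \<in> H1 \<Longrightarrow> (norm (mk f))\<^sup>2 \<le> \<theta> * \<theta> / 16 * ((norm (c1 f))\<^sup>2 + (norm (cV f))\<^sup>2) + C2 * (norm (c0 f))\<^sup>2"
    using small_k[unfolded form_small_def, rule_format, OF t16] unfolding mk_def by blast
  obtain C3 where C3: "C3 \<ge> 0" "\<And>f. f \<in> H1 \<Longrightarrow> (norm (ml f))\<^sup>2 \<le> \<theta> / 4 * ((norm (c1 f))\<^sup>2 + (norm (cV f))\<^sup>2) + C3 * (norm (c0 f))\<^sup>2"
    using small_l[unfolded form_small_def, rule_format, OF t4] unfolding ml_def by blast
  have young: "\<bar>2 * inner a b\<bar> \<le> \<delta> * (norm a)\<^sup>2 + 1 / \<delta> * (norm b)\<^sup>2" if "\<delta> > 0" for a b :: L2 and \<delta> :: real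
  proof -
    have "2 * (norm a * norm b) \<le> \<delta> * (norm a)\<^sup>2 + 1 / \<delta> * (norm b)\<^sup>2"
    proof -
      have "0 \<le> (\<delta> * norm a - norm b)\<^sup>2 / \<delta>" using that by simp
      also have "\<dots> = \<delta> * (norm a)\<^sup>2 + 1 / \<delta> * (norm b)\<^sup>2 - 2 * (norm a * norm b)"
        using that by (simp add: power2_eq_square field_simps)
      finally show ?thesis by simp
    qed
    then show ?thesis using Cauchy_Schwarz_ineq2[of a b] by simp
  qed
  show thesis
  proof (rule that[of "C1 + 4 / \<theta> * C2 + (1 + C3)"])
    show "C1 + 4 / \<theta> * C2 + (1 + C3) \<ge> 0" using C1(1) C2(1) C3(1) \<theta> by simp
    fix f assume f: "f \<in> H1"
    let ?E = "(norm (c1 f))\<^sup>2 + (norm (cV f))\<^sup>2" and ?n = "(norm (c0 f))\<^sup>2"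
    have "\<bar>2 * inner (c1 f) (mk f)\<bar> \<le> \<theta> / 4 * (norm (c1 f))\<^sup>2 + 1 / (\<theta> / 4) * (norm (mk f))\<^sup>2" by (rule young[OF t4])
    also have "\<dots> \<le> \<theta> / 4 * ?E + 1 / (\<theta> / 4) * (\<theta> * \<theta> / 16 * ?E + C2 * ?n)"
      by (intro add_mono mult_left_mono C2(2)[OF f]) (use \<theta> in auto)
    also have "\<dots> = \<theta> / 2 * ?E + 4 / \<theta> * C2 * ?n" using \<theta> by (simp add: field_simps)
    finally have 2: "\<bar>2 * inner (c1 f) (mk f)\<bar> \<le> \<theta> / 2 * ?E + 4 / \<theta> * C2 * ?n" .
    have "\<bar>2 * inner (c0 f) (ml f)\<bar> \<le> 1 * ?n + 1 / 1 * (norm (ml f))\<^sup>2" by (rule young) simp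
    then have 3: "\<bar>inner (c0 f) (ml f)\<bar> \<le> ?n + (\<theta> / 4 * ?E + C3 * ?n)" using C3(2)[OF f] by simp
    have "B f f = \<beta> * (f q * f q) - 2 * inner (c1 f) (mk f) + inner (c0 f) (ml f)"
      by (simp add: B_def r(2))
    then have "\<bar>B f f\<bar> \<le> (\<theta> / 4 * ?E + C1 * ?n) + (\<theta> / 2 * ?E + 4 / \<theta> * C2 * ?n) + (?n + (\<theta> / 4 * ?E + C3 * ?n))"
      using C1(2)[OF f] 2 3 by linarith
    also have "\<dots> = \<theta> * ?E + (C1 + 4 / \<theta> * C2 + (1 + C3)) * ?n" by (simp add: algebra_simps)
    finally show "\<bar>B f f\<bar> \<le> \<theta> * ?E + (C1 + 4 / \<theta> * C2 + (1 + C3)) * ?n" .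
  qed
qed

lemma bdry_small:
  assumes \<theta>: "\<theta> > 0"
  obtains C where "C \<ge> 0" "\<And>f. f \<in> H1 \<Longrightarrow> \<bar>bdry s f f\<bar> \<le> \<theta> * ((norm (c1 f))\<^sup>2 + (norm (cV f))\<^sup>2) + C * (norm (c0 f))\<^sup>2"
proof -
  obtain p q \<alpha> \<beta> where r: "p \<in> J" "q \<in> J" "\<And>f g. bdry s f g = \<alpha> * (f p * g p) + \<beta> * (f q * g q)"
    using bdry_repr[OF valid] by metis
  have t2: "\<theta> / 2 > 0" using \<theta> by simp
  obtain C1 where C1: "C1 \<ge> 0" "\<And>f. f \<in> H1 \<Longrightarrow> \<bar>\<alpha> * (f p * f p)\<bar> \<le> \<theta> / 2 * ((norm (c1 f))\<^sup>2 + (norm (cV f))\<^sup>2) + C1 * (norm (c0 f))\<^sup>2"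
    using point_small[OF r(1) t2] by blast
  obtain C2 where C2: "C2 \<ge> 0" "\<And>f. f \<in> H1 \<Longrightarrow> \<bar>\<beta> * (f q * f q)\<bar> \<le> \<theta> / 2 * ((norm (c1 f))\<^sup>2 + (norm (cV f))\<^sup>2) + C2 * (norm (c0 f))\<^sup>2"
    using point_small[OF r(2) t2] by blast
  show thesis
  proof (rule that[of "C1 + C2"])
    show "C1 + C2 \<ge> 0" using C1 C2 by simp
    fix f assume f: "f \<in> H1"
    show "\<bar>bdry s f f\<bar> \<le> \<theta> * ((norm (c1 f))\<^sup>2 + (norm (cV f))\<^sup>2) + (C1 + C2) * (norm (c0 f))\<^sup>2"
      using C1(2)[OF f] C2(2)[OF f] unfolding r(3) by (simp add: algebra_simps)
  qed
qed

lemma B_bounded: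
  obtains C where "C \<ge> 0" "\<And>f. f \<in> H1 \<Longrightarrow> \<bar>B f f\<bar> \<le> C * star f"
proof -
  obtain C where C: "C \<ge> 0" "\<And>f. f \<in> H1 \<Longrightarrow> \<bar>B f f\<bar> \<le> 1 * ((norm (c1 f))\<^sup>2 + (norm (cV f))\<^sup>2) + C * (norm (c0 f))\<^sup>2"
    using B_small[OF zero_less_one] by blast
  show thesis
  proof (rule that[of "1 + C"])
    fix f assume f: "f \<in> H1"
    have "1 * ((norm (c1 f))\<^sup>2 + (norm (cV f))\<^sup>2) + C * (norm (c0 f))\<^sup>2
        \<le> (1 + C) * ((norm (c1 f))\<^sup>2 + (norm (cV f))\<^sup>2) + (1 + C) * (norm (c0 f))\<^sup>2"
      using C(1) by (intro add_mono mult_right_mono) auto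
    also have "\<dots> = (1 + C) * star f" by (simp add: star_def distrib_left)
    finally show "\<bar>B f f\<bar> \<le> (1 + C) * star f" using C(2)[OF f] by linarith
  qed (use C(1) in simp)
qed

lemma star_parallelogram:
  assumes "f \<in> H1" "g \<in> H1"
  shows "star (\<lambda>x. f x + g x) + star (\<lambda>x. f x - g x) = 2 * star f + 2 * star g"
  unfolding star_def H1V_add[OF assms] H1V_diff[OF assms]
  by (simp add: power2_norm_eq_inner inner_add_left inner_add_right inner_diff_left inner_diff_right inner_commute)

lemma star_scale: "f \<in> H1 \<Longrightarrow> star (\<lambda>x. c * f x) = c\<^sup>2 * star f"
  by (simp add: star_def H1V_scale power_mult_distrib distrib_left)

lemma B_polar:
  assumes "f \<in> H1" "g \<in> H1"
  shows "4 * B f g = B (\<lambda>x. f x + g x) (\<lambda>x. f x + g x) - B (\<lambda>x. f x - g x) (\<lambda>x. f x - g x)"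
    "B (\<lambda>x. f x + g x) (\<lambda>x. f x + g x) = B f f + 2 * B f g + B g g"
proof -
  have mg: "(\<lambda>x. (-1) * g x) \<in> H1" by (rule H1V_scale(1)[OF assms(2)])
  have ex: "B (\<lambda>x. f x + h x) (\<lambda>x. f x + h x) = B f f + 2 * B f h + B h h" if h: "h \<in> H1" for h
    using B_add[OF assms(1) h H1V_add(1)[OF assms(1) h]] B_add[OF assms(1) h assms(1)] B_add[OF assms(1) h h]
      B_sym[OF assms(1) H1V_add(1)[OF assms(1) h]] B_sym[OF h H1V_add(1)[OF assms(1) h]] B_sym[OF h assms(1)] by simp
  show 1: "B (\<lambda>x. f x + g x) (\<lambda>x. f x + g x) = B f f + 2 * B f g + B g g" by (rule ex[OF assms(2)])
  have "B f (\<lambda>x. (-1) * g x) = - B f g" "B (\<lambda>x. (-1) * g x) (\<lambda>x. (-1) * g x) = B g g"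
    using B_scale[OF assms(2) assms(1), of "-1"] B_scale[OF assms(2) mg, of "-1"] B_scale[OF assms(2) assms(2), of "-1"]
      B_sym[OF assms(1) mg] B_sym[OF assms(1,2)] B_sym[OF assms(2) mg] by simp_all
  then show "4 * B f g = B (\<lambda>x. f x + g x) (\<lambda>x. f x + g x) - B (\<lambda>x. f x - g x) (\<lambda>x. f x - g x)"
    using ex[OF mg] 1 by simp
qed

lemma B_Cauchy_Schwarz:
  obtains C where "C \<ge> 0" "\<And>f g. \<lbrakk>f \<in> H1; g \<in> H1\<rbrakk> \<Longrightarrow> \<bar>B f g\<bar> \<le> C * (sqrt (star f) * sqrt (star g))"
proof -
  obtain C where C: "C \<ge> 0" "\<And>f. f \<in> H1 \<Longrightarrow> \<bar>B f f\<bar> \<le> C * star f" using B_bounded by blast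
  have *: "\<bar>B f g\<bar> \<le> C * (star f + star g) / 2" if f: "f \<in> H1" and g: "g \<in> H1" for f g
  proof -
    have "4 * \<bar>B f g\<bar> \<le> C * star (\<lambda>x. f x + g x) + C * star (\<lambda>x. f x - g x)"
      using B_polar(1)[OF f g] C(2)[OF H1V_add(1)[OF f g]] C(2)[OF H1V_diff(1)[OF f g]] by linarith
    also have "\<dots> = C * (2 * star f + 2 * star g)" unfolding distrib_left[symmetric] star_parallelogram[OF f g] ..
    finally show ?thesis by (simp add: algebra_simps)
  qed
  show thesis
  proof (rule that[OF C(1)])
    fix f g assume f: "f \<in> H1" and g: "g \<in> H1"
    show "\<bar>B f g\<bar> \<le> C * (sqrt (star f) * sqrt (star g))"
    proof (rule field_le_epsilon)
      fix e :: real assume e: "e > 0"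
      \<comment> \<open>The summand with \<open>\<epsilon>\<close> in \<open>a\<close> and
        \<open>b\<close> keeps the scaling factors positive when a norm vanishes; the denominator
        makes the resulting error at most \<open>e\<close>.\<close>
      define \<epsilon> where "\<epsilon> = e / (C * (sqrt (star f) + sqrt (star g) + 1) + 1)"
      define a where "a = sqrt (star f) + min 1 \<epsilon>"
      define b where "b = sqrt (star g) + min 1 \<epsilon>"
      have dn: "C * (sqrt (star f) + sqrt (star g) + 1) + 1 > 0"
        using C(1) star_nonneg by (intro add_nonneg_pos mult_nonneg_nonneg) auto
      have ep: "\<epsilon> > 0" using e dn by (simp add: \<epsilon>_def)
      have ab: "a > 0" "b > 0" using ep star_nonneg by (auto simp: a_def b_def intro!: add_nonneg_pos)
      have sa: "star f \<le> a\<^sup>2" "star g \<le> b\<^sup>2"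
      proof -
        have "(sqrt (star f))\<^sup>2 \<le> a\<^sup>2" "(sqrt (star g))\<^sup>2 \<le> b\<^sup>2"
          by (rule power_mono; use ep star_nonneg in \<open>simp add: a_def b_def\<close>)+
        then show "star f \<le> a\<^sup>2" "star g \<le> b\<^sup>2" using star_nonneg by simp_all
      qed
      have "\<bar>B (\<lambda>x. (1 / a) * f x) (\<lambda>x. (1 / b) * g x)\<bar> \<le> C * (star (\<lambda>x. (1 / a) * f x) + star (\<lambda>x. (1 / b) * g x)) / 2"
        by (rule *[OF H1V_scale(1)[OF f] H1V_scale(1)[OF g]])
      also have "\<dots> \<le> C * (1 + 1) / 2"
      proof (intro divide_right_mono mult_left_mono add_mono)
        show "star (\<lambda>x. (1 / a) * f x) \<le> 1" "star (\<lambda>x. (1 / b) * g x) \<le> 1"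
          unfolding star_scale[OF f, of "1 / a"] star_scale[OF g, of "1 / b"]
          using sa ab by (simp_all add: power_divide)
      qed (use C(1) in auto)
      finally have "\<bar>B (\<lambda>x. (1 / a) * f x) (\<lambda>x. (1 / b) * g x)\<bar> \<le> C" by simp
      moreover have "B (\<lambda>x. (1 / a) * f x) (\<lambda>x. (1 / b) * g x) = (1 / a) * ((1 / b) * B f g)"
        using B_scale[OF f H1V_scale(1)[OF g], of "1 / a" "1 / b"] B_scale[OF g f, of "1 / b"]
          B_sym[OF f H1V_scale(1)[OF g], of "1 / b"] B_sym[OF g f] by simp
      ultimately have "\<bar>B f g\<bar> / (a * b) \<le> C" using ab by (simp add: abs_mult)
      then have "\<bar>B f g\<bar> \<le> C * (a * b)" using ab by (simp add: pos_divide_le_eq)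
      also have "\<dots> \<le> C * (sqrt (star f) * sqrt (star g) + \<epsilon> * (sqrt (star f) + sqrt (star g) + 1))"
      proof (rule mult_left_mono[OF _ C(1)])
        have "a * b = sqrt (star f) * sqrt (star g) + min 1 \<epsilon> * (sqrt (star f) + sqrt (star g) + min 1 \<epsilon>)"
          by (simp add: a_def b_def algebra_simps)
        also have "min 1 \<epsilon> * (sqrt (star f) + sqrt (star g) + min 1 \<epsilon>) \<le> \<epsilon> * (sqrt (star f) + sqrt (star g) + 1)"
          using ep star_nonneg by (intro mult_mono add_mono) auto
        finally show "a * b \<le> sqrt (star f) * sqrt (star g) + \<epsilon> * (sqrt (star f) + sqrt (star g) + 1)" by simp
      qed
      finally have "\<bar>B f g\<bar> \<le> C * (sqrt (star f) * sqrt (star g)) + \<epsilon> * (C * (sqrt (star f) + sqrt (star g) + 1))"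
        by (simp add: algebra_simps)
      also have "\<epsilon> * (C * (sqrt (star f) + sqrt (star g) + 1)) \<le> \<epsilon> * (C * (sqrt (star f) + sqrt (star g) + 1) + 1)"
        using ep by (intro mult_left_mono) auto
      also have "\<dots> = e" using dn by (simp add: \<epsilon>_def)
      finally show "\<bar>B f g\<bar> \<le> C * (sqrt (star f) * sqrt (star g)) + e" by simp
    qed
  qed
qed

lemma B_continuous:
  assumes f: "f \<in> H1" and e: "e > 0"
  obtains \<delta> where "\<delta> > 0" "\<And>g. \<lbrakk>g \<in> H1; sqrt (star (\<lambda>x. g x - f x)) < \<delta>\<rbrakk> \<Longrightarrow> \<bar>B g g - B f f\<bar> < e"
proof -
  obtain C where C: "C \<ge> 0" "\<And>f g. \<lbrakk>f \<in> H1; g \<in> H1\<rbrakk> \<Longrightarrow> \<bar>B f g\<bar> \<le> C * (sqrt (star f) * sqrt (star g))"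
    using B_Cauchy_Schwarz by blast
  define M where "M = C * (2 * sqrt (star f) + 1) + 1"
  have M: "M > 0" using C(1) star_nonneg by (simp add: M_def add_nonneg_pos)
  show thesis
  proof (rule that[of "min 1 (e / M)"])
    show "min 1 (e / M) > 0" using e M by simp
    fix g assume g: "g \<in> H1" and d: "sqrt (star (\<lambda>x. g x - f x)) < min 1 (e / M)"
    let ?h = "\<lambda>x. g x - f x" and ?t = "sqrt (star (\<lambda>x. g x - f x))"
    have h: "?h \<in> H1" by (rule H1V_diff(1)[OF g f])
    have t: "0 \<le> ?t" using star_nonneg by simp
    have "B g g = B f f + 2 * B f ?h + B ?h ?h" using B_polar(2)[OF f h] by simp
    then have "\<bar>B g g - B f f\<bar> \<le> 2 * (C * (sqrt (star f) * ?t)) + C * (?t * ?t)"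
      using C(2)[OF f h] C(2)[OF h h] by linarith
    also have "\<dots> \<le> 2 * (C * (sqrt (star f) * ?t)) + C * (1 * ?t)"
      using C(1) t d by (intro add_left_mono mult_left_mono mult_right_mono) auto
    also have "\<dots> = (M - 1) * ?t" by (simp add: M_def algebra_simps)
    also have "\<dots> \<le> M * ?t" using t by (intro mult_right_mono) auto
    also have "\<dots> < M * (e / M)" using d M by (intro mult_strict_left_mono) auto
    finally show "\<bar>B g g - B f f\<bar> < e" using M by simp
  qed
qed

text \<open>The diagonal of \<open>B\<close> meets the defining conditions by \<open>xi_eq\<close>
  and \<open>B_continuous\<close>. Any other candidate agrees with it on the test functions; these
  are dense and both are continuous at each \<open>f\<close>, so they agree on
  \<open>H1\<close>.\<close>

lemma xi_square_eq: "xi_square s V w = restrict (\<lambda>f. B f f) H1"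
  unfolding xi_square_def
proof (rule the_equality, intro conjI ballI)
  show "restrict (\<lambda>f. B f f) H1 \<in> extensional H1" by simp
  show "quadratic_form_on H1 (restrict (\<lambda>f. B f f) H1)"
    unfolding quadratic_form_on_def
    by (rule exI[of _ B]) (use B_sym B_add B_scale in auto)
  show "star_continuous I V (restrict (\<lambda>f. B f f) H1)"
    unfolding star_continuous_def
  proof (intro ballI allI impI)
    fix f e assume f: "f \<in> H1" and e: "(e::real) > 0"
    obtain d where d: "d > 0" "\<And>g. \<lbrakk>g \<in> H1; sqrt (star (\<lambda>x. g x - f x)) < d\<rbrakk> \<Longrightarrow> \<bar>B g g - B f f\<bar> < e"
      using B_continuous[OF f e] by blast
    show "\<exists>\<delta>>0. \<forall>g\<in>H1. norm_star I V (\<lambda>x. g x - f x) < \<delta> \<longrightarrow>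
        \<bar>restrict (\<lambda>f. B f f) H1 g - restrict (\<lambda>f. B f f) H1 f\<bar> < e"
    proof (intro exI[of _ d] conjI ballI impI d(1))
      fix g assume g: "g \<in> H1" "norm_star I V (\<lambda>x. g x - f x) < d"
      then show "\<bar>restrict (\<lambda>f. B f f) H1 g - restrict (\<lambda>f. B f f) H1 f\<bar> < e"
        using d(2)[OF g(1)] f star_norm[OF H1V_diff(1)[OF g(1) f]] by simp
    qed
  qed
  show "restrict (\<lambda>f. B f f) H1 f = xi s w (\<lambda>x. (f x)\<^sup>2)" if f: "f \<in> C0_infinity I" for f
    using C0_infinity_H1V[OF f] xi_eq[OF f] by (simp add: B_def mk_def ml_def power2_eq_square)
next
  fix Q assume Q: "Q \<in> extensional H1 \<and> quadratic_form_on H1 Q \<and> star_continuous I V Q \<and>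
    (\<forall>f\<in>C0_infinity I. Q f = xi s w (\<lambda>x. (f x)\<^sup>2))"
  have "Q f = B f f" if f: "f \<in> H1" for f
  proof (rule ccontr)
    assume ne: "Q f \<noteq> B f f"
    define e where "e = \<bar>Q f - B f f\<bar> / 2"
    have e: "e > 0" using ne by (simp add: e_def)
    obtain d1 where d1: "d1 > 0" "\<And>g. \<lbrakk>g \<in> H1; sqrt (star (\<lambda>x. g x - f x)) < d1\<rbrakk> \<Longrightarrow> \<bar>B g g - B f f\<bar> < e"
      using B_continuous[OF f e] by blast
    obtain d2 where d2: "d2 > 0" "\<And>g. \<lbrakk>g \<in> H1; norm_star I V (\<lambda>x. g x - f x) < d2\<rbrakk> \<Longrightarrow> \<bar>Q g - Q f\<bar> < e"
      using Q f e unfolding star_continuous_def by blast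
    have "(min d1 d2)\<^sup>2 > 0" using d1(1) d2(1) by simp
    from C0_infinity_dense[OF f this] obtain g where g: "g \<in> C0_infinity I" "star (\<lambda>x. f x - g x) < (min d1 d2)\<^sup>2" by blast
    have gH: "g \<in> H1" by (rule C0_infinity_H1V[OF g(1)])
    have "star (\<lambda>x. g x - f x) = star (\<lambda>x. f x - g x)"
      using H1V_diff[OF f gH] H1V_diff[OF gH f] by (simp add: star_def norm_minus_commute)
    then have "sqrt (star (\<lambda>x. g x - f x)) < min d1 d2"
      using real_sqrt_less_mono[OF g(2)] d1(1) d2(1) by simp
    then have "\<bar>B g g - B f f\<bar> < e" "\<bar>Q g - Q f\<bar> < e"
      using d1(2)[OF gH] d2(2)[OF gH] star_norm[OF H1V_diff(1)[OF gH f]] by auto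
    moreover have "Q g = B g g"
      using Q g(1) xi_eq[OF g(1)] by (simp add: B_def mk_def ml_def power2_eq_square)
    ultimately show False by (simp add: e_def abs_if split: if_splits)
  qed
  then show "Q = restrict (\<lambda>f. B f f) H1" using Q by (auto simp: extensional_def restrict_def fun_eq_iff)
qed

lemma form_hat_eq:
  assumes "f \<in> H1" "g \<in> H1"
  shows "form_hat s V w f g = qh f g"
proof -
  have "xi_product s V w f g = B f g"
    unfolding xi_product_def xi_square_eq using B_polar(1)[OF assms] H1V_add(1)[OF assms] H1V_diff(1)[OF assms] by simp
  then show ?thesis by (simp add: form_hat_def form_E_def qh_def pairing_c[OF assms])
qed

lemma qh_bounds:
  obtains c K where "\<And>f. f \<in> H1 \<Longrightarrow> qh f f + c * (norm (c0 f))\<^sup>2 \<ge> 1 / 4 * ((norm (c1 f))\<^sup>2 + (norm (cV f))\<^sup>2) + (norm (c0 f))\<^sup>2"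
    "\<And>f. f \<in> H1 \<Longrightarrow> qh f f + c * (norm (c0 f))\<^sup>2 \<le> K * star f"
proof -
  \<comment> \<open>Two perturbations of relative size \<open>1 / 8\<close> leave
    \<open>1 / 4\<close> of the \<open>1 / 2\<close> in front of the derivative; the extra 1 in the
    shift leaves the full squared norm of \<open>c0 f\<close> for coercivity.\<close>
  have t: "(1/8::real) > 0" by simp
  obtain C1 where C1: "C1 \<ge> 0" "\<And>f. f \<in> H1 \<Longrightarrow> \<bar>B f f\<bar> \<le> 1/8 * ((norm (c1 f))\<^sup>2 + (norm (cV f))\<^sup>2) + C1 * (norm (c0 f))\<^sup>2"
    using B_small[OF t] by blast
  obtain C2 where C2: "C2 \<ge> 0" "\<And>f. f \<in> H1 \<Longrightarrow> \<bar>bdry s f f\<bar> \<le> 1/8 * ((norm (c1 f))\<^sup>2 + (norm (cV f))\<^sup>2) + C2 * (norm (c0 f))\<^sup>2"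
    using bdry_small[OF t] by blast
  show thesis
  proof (rule that[of "C1 + C2 + 1" "2 * (C1 + C2) + 2"])
    fix f assume f: "f \<in> H1"
    have q: "qh f f = 1 / 2 * (norm (c1 f))\<^sup>2 + (norm (cV f))\<^sup>2 + bdry s f f + B f f"
      by (simp add: qh_def power2_norm_eq_inner)
    have ex: "(C1 + C2 + 1) * (norm (c0 f))\<^sup>2 = C1 * (norm (c0 f))\<^sup>2 + C2 * (norm (c0 f))\<^sup>2 + (norm (c0 f))\<^sup>2"
      "(2 * (C1 + C2) + 1) * (norm (c0 f))\<^sup>2 = 2 * (C1 * (norm (c0 f))\<^sup>2) + 2 * (C2 * (norm (c0 f))\<^sup>2) + (norm (c0 f))\<^sup>2"
      by (simp_all add: algebra_simps)
    have nn: "(norm (c1 f))\<^sup>2 \<ge> 0" "(norm (cV f))\<^sup>2 \<ge> 0" "(norm (c0 f))\<^sup>2 \<ge> 0" by simp_all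
    show "1 / 4 * ((norm (c1 f))\<^sup>2 + (norm (cV f))\<^sup>2) + (norm (c0 f))\<^sup>2 \<le> qh f f + (C1 + C2 + 1) * (norm (c0 f))\<^sup>2"
    proof -
      have "1 / 4 * (a + b) + n \<le> 1 / 2 * a + b + y + x + (u + v + n)"
        if "\<bar>x\<bar> \<le> 1/8 * (a + b) + u" "\<bar>y\<bar> \<le> 1/8 * (a + b) + v" "a \<ge> 0" "b \<ge> 0" for a b n u v x y :: real
        using that unfolding abs_le_iff distrib_left by linarith
      from this[OF C1(2)[OF f] C2(2)[OF f] nn(1,2)] show ?thesis unfolding q ex(1) .
    qed
    have "qh f f + (C1 + C2 + 1) * (norm (c0 f))\<^sup>2 \<le> 2 * ((norm (c1 f))\<^sup>2 + (norm (cV f))\<^sup>2) + (2 * (C1 + C2) + 1) * (norm (c0 f))\<^sup>2"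
    proof -
      have "1 / 2 * a + b + y + x + (u + v + n) \<le> 2 * (a + b) + (2 * u + 2 * v + n)"
        if "\<bar>x\<bar> \<le> 1/8 * (a + b) + u" "\<bar>y\<bar> \<le> 1/8 * (a + b) + v" "a \<ge> 0" "b \<ge> 0" for a b n u v x y :: real
        using that unfolding abs_le_iff distrib_left by linarith
      from this[OF C1(2)[OF f] C2(2)[OF f] nn(1,2)] show ?thesis unfolding q ex .
    qed
    also have "\<dots> \<le> (2 * (C1 + C2) + 2) * ((norm (c1 f))\<^sup>2 + (norm (cV f))\<^sup>2) + (2 * (C1 + C2) + 2) * (norm (c0 f))\<^sup>2"
      using C1(1) C2(1) by (intro add_mono mult_right_mono) auto
    also have "\<dots> = (2 * (C1 + C2) + 2) * star f" by (simp add: star_def distrib_left)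
    finally show "qh f f + (C1 + C2 + 1) * (norm (c0 f))\<^sup>2 \<le> (2 * (C1 + C2) + 2) * star f" .
  qed
qed

section \<open>Passage to classes and the operator of a good path\<close>

text \<open>The operator acts on classes, whereas the form reads derivatives and point values of
  functions. Representatives of a class in the form domain differ only outside the closure of the
  interval, so by \<open>qh_cong\<close> the choice does not affect the form.\<close>

definition "rep u = (SOME f. f \<in> FD \<and> c0 f = u)"
definition "qL u v = qh (rep u) (rep v)"

lemma rep: "u \<in> c0 ` FD \<Longrightarrow> rep u \<in> FD \<and> c0 (rep u) = u"
proof -
  assume "u \<in> c0 ` FD"
  then have "\<exists>f. f \<in> FD \<and> c0 f = u" by blast
  then show ?thesis unfolding rep_def by (rule someI_ex)
qed

lemma qL_c0:
  assumes "f \<in> FD" "g \<in> FD"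
  shows "qL (c0 f) (c0 g) = qh f g"
proof -
  have f: "rep (c0 f) \<in> H1" "c0 (rep (c0 f)) = c0 f" "f \<in> H1" using rep[of "c0 f"] assms dom_H1 by auto
  have g: "rep (c0 g) \<in> H1" "c0 (rep (c0 g)) = c0 g" "g \<in> H1" using rep[of "c0 g"] assms dom_H1 by auto
  have "qL (c0 f) (c0 g) = qh f (rep (c0 g))" unfolding qL_def by (rule qh_cong[OF f(1,3,2) g(1)])
  also have "\<dots> = qh (rep (c0 g)) f" by (rule qh_sym[OF f(3) g(1)])
  also have "\<dots> = qh g f" by (rule qh_cong[OF g(1,3,2) f(3)])
  also have "\<dots> = qh f g" by (rule qh_sym[OF g(3) f(3)])
  finally show ?thesis .
qed

text \<open>By \<open>qh_bounds\<close> the shifted form is equivalent to \<open>star\<close> in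
  both directions, so closedness comes from \<open>H1V_complete\<close> and compactness from
  \<open>H1V_compact\<close>; \<open>dom_closed\<close> keeps the boundary conditions in the
  limit.\<close>

lemma compact_form_qL:
  obtains c where "compact_form (c0 ` FD) qL c (L2_on I)"
proof -
  obtain c K where c: "\<And>f. f \<in> H1 \<Longrightarrow> qh f f + c * (norm (c0 f))\<^sup>2 \<ge> 1 / 4 * ((norm (c1 f))\<^sup>2 + (norm (cV f))\<^sup>2) + (norm (c0 f))\<^sup>2"
    "\<And>f. f \<in> H1 \<Longrightarrow> qh f f + c * (norm (c0 f))\<^sup>2 \<le> K * star f"
    using qh_bounds by metis
  have c4: "star f \<le> 4 * (qh f f + c * (norm (c0 f))\<^sup>2)" if "f \<in> H1" for f
  proof -
    have "a + b + n \<le> 4 * y" if "1 / 4 * (a + b) + n \<le> y" "0 \<le> n" for a b n y :: real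
      using that unfolding distrib_left by linarith
    from this[OF c(1)[OF that]] show ?thesis unfolding star_def by simp
  qed
  have D: "subspace (c0 ` FD)"
  proof (rule subspaceI)
    have "(\<lambda>x. 0) \<in> FD" by (rule dom_vanishing[OF H1V_zero]) simp
    moreover have "c0 (\<lambda>x. 0) = 0" using H1V_scale(2)[OF H1V_zero, of 0] by simp
    ultimately show "0 \<in> c0 ` FD" by force
    show "x + y \<in> c0 ` FD" if xy: "x \<in> c0 ` FD" "y \<in> c0 ` FD" for x y
    proof -
      obtain f g where fg: "f \<in> FD" "g \<in> FD" "x = c0 f" "y = c0 g" using xy by blast
      have "x + y = c0 (\<lambda>x. f x + g x)" unfolding fg(3,4) by (rule H1V_add(2)[OF dom_H1 dom_H1, OF fg(1,2), symmetric])
      then show ?thesis using dom_add[OF fg(1,2)] by (rule image_eqI)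
    qed
    show "a *\<^sub>R x \<in> c0 ` FD" if x: "x \<in> c0 ` FD" for a x
    proof -
      obtain f where f: "f \<in> FD" "x = c0 f" using x by blast
      have "a *\<^sub>R x = c0 (\<lambda>x. a * f x)" unfolding f(2) by (rule H1V_scale(2)[OF dom_H1[OF f(1)], symmetric])
      then show ?thesis using dom_scale[OF f(1)] by (rule image_eqI)
    qed
  qed
  have q_add: "qL (u + v) z = qL u z + qL v z" if uvz: "u \<in> c0 ` FD" "v \<in> c0 ` FD" "z \<in> c0 ` FD" for u v z
  proof -
    obtain f g h where fgh: "f \<in> FD" "g \<in> FD" "h \<in> FD" "u = c0 f" "v = c0 g" "z = c0 h" using uvz by blast
    then have H: "f \<in> H1" "g \<in> H1" "h \<in> H1" using dom_H1 by auto
    have "u + v = c0 (\<lambda>x. f x + g x)" using H1V_add(2)[OF H(1,2)] fgh by simp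
    then show ?thesis using qL_c0[OF dom_add[OF fgh(1,2)] fgh(3)] qL_c0 fgh qh_add[OF H] by simp
  qed
  have q_scale: "qL (a *\<^sub>R u) z = a * qL u z" if uz: "u \<in> c0 ` FD" "z \<in> c0 ` FD" for a u z
  proof -
    obtain f h where fh: "f \<in> FD" "h \<in> FD" "u = c0 f" "z = c0 h" using uz by blast
    then have H: "f \<in> H1" "h \<in> H1" using dom_H1 by auto
    have "a *\<^sub>R u = c0 (\<lambda>x. a * f x)" using H1V_scale(2)[OF H(1)] fh by simp
    then show ?thesis using qL_c0[OF dom_scale[OF fh(1)] fh(2)] qL_c0 fh qh_scale[OF H] by simp
  qed
  have q_sym: "qL u v = qL v u" if uv: "u \<in> c0 ` FD" "v \<in> c0 ` FD" for u v
  proof -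
    obtain f h where fh: "f \<in> FD" "h \<in> FD" "u = c0 f" "v = c0 h" using uv by blast
    then show ?thesis using qL_c0 qh_sym[of f h] dom_H1 by simp
  qed
  have pc0: "qL (c0 f) (c0 f) + c * inner (c0 f) (c0 f) = qh f f + c * (norm (c0 f))\<^sup>2" if "f \<in> FD" for f
    using qL_c0[OF that that] by (simp add: power2_norm_eq_inner)
  have "compact_form (c0 ` FD) qL c (L2_on I)"
  proof
    show "subspace (c0 ` FD)" by (rule D)
    show "subspace (L2_on I)" by (rule subspace_L2_on)
    show "L2_on I \<subseteq> closure (c0 ` FD)" by (rule dom_dense)
    show "c0 ` FD \<subseteq> L2_on I" using dom_H1 H1V_D(2) by (auto simp: c0_def L2_on_def)
    show "qL u v + c * inner u v = qL v u + c * inner v u" if "u \<in> c0 ` FD" "v \<in> c0 ` FD" for u v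
      using q_sym[OF that] by (simp add: inner_commute)
    show "qL (u + v) z + c * inner (u + v) z = qL u z + c * inner u z + (qL v z + c * inner v z)"
      if "u \<in> c0 ` FD" "v \<in> c0 ` FD" "z \<in> c0 ` FD" for u v z
      using q_add[OF that] by (simp add: inner_add_left algebra_simps)
    show "qL (a *\<^sub>R u) v + c * inner (a *\<^sub>R u) v = a * (qL u v + c * inner u v)"
      if "u \<in> c0 ` FD" "v \<in> c0 ` FD" for a u v
      using q_scale[OF that] by (simp add: algebra_simps)
    show "inner u u \<le> qL u u + c * inner u u" if u: "u \<in> c0 ` FD" for u
    proof -
      obtain f where f: "f \<in> FD" "u = c0 f" using u by blast
      have "1 / 4 * ((norm (c1 f))\<^sup>2 + (norm (cV f))\<^sup>2) \<ge> 0" by simp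
      then have "(norm (c0 f))\<^sup>2 \<le> qh f f + c * (norm (c0 f))\<^sup>2" using c(1)[OF dom_H1[OF f(1)]] by linarith
      then show ?thesis using pc0[OF f(1)] unfolding f(2) power2_norm_eq_inner by argo
    qed
    show "\<exists>u\<in>c0 ` FD. (\<lambda>n. qL (U n - u) (U n - u) + c * inner (U n - u) (U n - u)) \<longlonglongrightarrow> 0"
      if U: "\<And>n. U n \<in> c0 ` FD" and
        C: "\<And>e. e > 0 \<Longrightarrow> \<exists>N. \<forall>m\<ge>N. \<forall>n\<ge>N. qL (U m - U n) (U m - U n) + c * inner (U m - U n) (U m - U n) < e" for U
    proof -
      obtain F where F: "\<And>n. F n \<in> FD" "\<And>n. U n = c0 (F n)" using U unfolding image_iff by metis
      have FH: "F n \<in> H1" for n using F(1) dom_H1 by blast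
      have sub: "(\<lambda>x. f x - g x) \<in> FD" "c0 (\<lambda>x. f x - g x) = c0 f - c0 g" if "f \<in> FD" "g \<in> FD" for f g
        using dom_add[OF that(1) dom_scale[OF that(2)], of "-1"] H1V_diff(2)[OF dom_H1 dom_H1, OF that] by simp_all
      have pd: "qL (c0 f - c0 g) (c0 f - c0 g) + c * inner (c0 f - c0 g) (c0 f - c0 g)
          = qh (\<lambda>x. f x - g x) (\<lambda>x. f x - g x) + c * (norm (c0 (\<lambda>x. f x - g x)))\<^sup>2" if "f \<in> FD" "g \<in> FD" for f g
        using pc0[OF sub(1)[OF that]] sub(2)[OF that] by simp
      have "\<exists>N. \<forall>m\<ge>N. \<forall>n\<ge>N. star (\<lambda>x. F m x - F n x) < e" if e: "e > 0" for e
      proof -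
        have "e / 4 > 0" using e by simp
        from C[OF this] obtain N where N: "\<And>m n. \<lbrakk>m \<ge> N; n \<ge> N\<rbrakk> \<Longrightarrow> qL (U m - U n) (U m - U n) + c * inner (U m - U n) (U m - U n) < e / 4" by blast
        show ?thesis
        proof (intro exI[of _ N] allI impI)
          fix m n assume "m \<ge> N" "n \<ge> N"
          then have "qh (\<lambda>x. F m x - F n x) (\<lambda>x. F m x - F n x) + c * (norm (c0 (\<lambda>x. F m x - F n x)))\<^sup>2 < e / 4"
            using N[of m n] pd[OF F(1) F(1), of m n] F(2) by simp
          then show "star (\<lambda>x. F m x - F n x) < e" using order.strict_trans1[OF c4[OF H1V_diff(1)[OF FH FH]]] by simp
        qed
      qed
      from H1V_complete[OF FH this] obtain f where f: "f \<in> H1" "(\<lambda>n. star (\<lambda>x. F n x - f x)) \<longlonglongrightarrow> 0"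
        "\<And>x. x \<in> J \<Longrightarrow> (\<lambda>n. F n x) \<longlonglongrightarrow> f x" by metis
      have fd: "f \<in> FD" by (rule dom_closed[OF F(1) f(1,3)])
      have "(\<lambda>n. qL (U n - c0 f) (U n - c0 f) + c * inner (U n - c0 f) (U n - c0 f)) \<longlonglongrightarrow> 0"
      proof (rule Lim_null_comparison)
        show "(\<lambda>n. K * star (\<lambda>x. F n x - f x)) \<longlonglongrightarrow> 0" using tendsto_mult_right_zero[OF f(2)] .
        show "\<forall>\<^sub>F n in sequentially. norm (qL (U n - c0 f) (U n - c0 f) + c * inner (U n - c0 f) (U n - c0 f)) \<le> K * star (\<lambda>x. F n x - f x)"
        proof (intro always_eventually allI)
          fix n
          have H: "(\<lambda>x. F n x - f x) \<in> H1" by (rule H1V_diff(1)[OF FH f(1)])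
          have "0 \<le> qh (\<lambda>x. F n x - f x) (\<lambda>x. F n x - f x) + c * (norm (c0 (\<lambda>x. F n x - f x)))\<^sup>2"
            using order_trans[OF star_nonneg c4[OF H]] by simp
          then show "norm (qL (U n - c0 f) (U n - c0 f) + c * inner (U n - c0 f) (U n - c0 f)) \<le> K * star (\<lambda>x. F n x - f x)"
            using c(2)[OF H] pd[OF F(1) fd, of n] F(2) by simp
        qed
      qed
      then show ?thesis using fd by blast
    qed
    show "\<exists>l r. strict_mono (r :: nat \<Rightarrow> nat) \<and> (U \<circ> r) \<longlonglongrightarrow> l"
      if U: "\<And>n. U n \<in> c0 ` FD" "\<And>n. qL (U n) (U n) + c * inner (U n) (U n) \<le> 1" for U
    proof -
      obtain F where F: "\<And>n. F n \<in> FD" "\<And>n. U n = c0 (F n)" using U(1) unfolding image_iff by metis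
      have FH: "F n \<in> H1" for n using F(1) dom_H1 by blast
      have F4: "star (F n) \<le> 4" for n
        using c4[OF FH, of n] pc0[OF F(1), of n] U(2)[of n] F(2)[of n] by simp
      show ?thesis
      proof (rule H1V_compact[OF FH F4])
        fix r f assume r: "strict_mono (r :: nat \<Rightarrow> nat)" and l: "(\<lambda>n. c0 (F (r n))) \<longlonglongrightarrow> L2_class I f"
        have eq: "U \<circ> r = (\<lambda>n. c0 (F (r n)))" using F(2) by (simp add: fun_eq_iff)
        have "(U \<circ> r) \<longlonglongrightarrow> L2_class I f" unfolding eq by (rule l)
        with r show ?thesis by blast
      qed
    qed
  qed
  then show thesis by (rule that)
qed

theorem ex1_operator:
  "\<exists>!H. self_adjoint_in (L2_on I) H \<and> Domain H \<subseteq> L2_class I ` FD \<and> represents_form s V w H \<and>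
     compact_resolvent_in (L2_on I) H"
proof -
  obtain c where "compact_form (c0 ` FD) qL c (L2_on I)" by (rule compact_form_qL)
  then interpret F: compact_form "c0 ` FD" qL c "L2_on I" .
  have c0L: "L2_class I = c0" by (rule ext) (simp add: c0_def)
  show ?thesis
  proof (rule ex1I, intro conjI)
    show "self_adjoint_in (L2_on I) F.H" by (rule F.self_adjoint_H)
    show "compact_resolvent_in (L2_on I) F.H" by (rule F.compact_resolvent_H)
    show "Domain F.H \<subseteq> L2_class I ` FD" unfolding c0L by (auto simp: form_operator_def)
    show "represents_form s V w F.H"
      unfolding represents_form_def c0L
    proof (intro ballI allI impI)
      fix f g u assume fg: "f \<in> FD" "g \<in> FD" and u: "(c0 g, u) \<in> F.H"
      have "inner (c0 f) u = qL (c0 f) (c0 g)" using u fg(1) by (auto simp: form_operator_def)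
      then show "inner (c0 f) u = form_hat s V w f g"
        using qL_c0[OF fg] form_hat_eq[OF dom_H1 dom_H1, OF fg] by simp
    qed
  next
    fix H' assume H': "self_adjoint_in (L2_on I) H' \<and> Domain H' \<subseteq> L2_class I ` FD \<and> represents_form s V w H' \<and>
      compact_resolvent_in (L2_on I) H'"
    \<comment> \<open>\<open>represents_form\<close> tests against every function of the form
      domain, so each pair in \<open>H'\<close> satisfies the defining relation of
      \<open>F.H\<close>.\<close>
    have "H' \<subseteq> F.H"
    proof
      fix a assume a: "a \<in> H'"
      obtain x u where xu: "a = (x, u)" by (cases a)
      have "x \<in> c0 ` FD" using H' a xu c0L by force
      then obtain g where g: "g \<in> FD" "x = c0 g" by blast
      have uX: "u \<in> L2_on I" using H' a xu unfolding self_adjoint_in_def operator_in_def by blast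
      have "inner (c0 f) u = qL (c0 f) (c0 g)" if f: "f \<in> FD" for f
      proof -
        have "inner (c0 f) u = form_hat s V w f g"
          using H' a xu g f unfolding represents_form_def c0L by blast
        then show ?thesis using qL_c0[OF f g(1)] form_hat_eq[OF dom_H1 dom_H1, OF f g(1)] by simp
      qed
      then show "a \<in> F.H" using g uX by (auto simp: xu form_operator_def)
    qed
    then show "H' = F.H" using self_adjoint_in_maximal[OF F.self_adjoint_H] H' by blast
  qed
qed

end

section \<open>Form boundedness from exponential integrability\<close>

text \<open>Convex duality between \<open>s * ln s - s\<close> and \<open>exp\<close>: multiply
  \<open>1 + x \<le> exp x\<close> at \<open>x = t - ln s\<close> by \<open>s\<close>. The term
  \<open>- s\<close> is dropped.\<close>

lemma Young_entropy:
  fixes s t :: real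
  assumes "s > 0"
  shows "s * t \<le> s * ln s + exp t"
proof -
  have "1 + (t - ln s) \<le> exp (t - ln s)" by (rule exp_ge_add_one_self)
  then have "s * (1 + (t - ln s)) \<le> s * exp (t - ln s)" using assms by (intro mult_left_mono) auto
  also have "s * exp (t - ln s) = exp t" using assms by (simp add: exp_diff)
  finally show ?thesis using assms by (simp add: algebra_simps)
qed

context potential_setting
begin

lemma form_smallI:
  assumes m: "\<kappa> \<in> borel_measurable borel"
    and b: "\<And>\<theta>. \<theta> > 0 \<Longrightarrow> \<exists>C\<ge>0. \<forall>f\<in>H1. (\<integral>\<^sup>+x. ennreal ((indicator I x * (\<kappa> x * f x))\<^sup>2) \<partial>lebesgue)
      \<le> ennreal (\<theta> * ((norm (c1 f))\<^sup>2 + (norm (cV f))\<^sup>2) + C * (norm (c0 f))\<^sup>2)"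
  shows "form_small \<kappa>"
  unfolding form_small_def
proof (intro allI impI)
  fix \<theta> :: real assume \<theta>: "\<theta> > 0"
  obtain C where C: "C \<ge> 0" "\<And>f. f \<in> H1 \<Longrightarrow> (\<integral>\<^sup>+x. ennreal ((indicator I x * (\<kappa> x * f x))\<^sup>2) \<partial>lebesgue)
      \<le> ennreal (\<theta> * ((norm (c1 f))\<^sup>2 + (norm (cV f))\<^sup>2) + C * (norm (c0 f))\<^sup>2)"
    using b[OF \<theta>] by blast
  show "\<exists>C\<ge>0. \<forall>f\<in>H1. L2_function I (\<lambda>x. \<kappa> x * f x) \<and>
     (norm (L2_class I (\<lambda>x. \<kappa> x * f x)))\<^sup>2 \<le> \<theta> * ((norm (c1 f))\<^sup>2 + (norm (cV f))\<^sup>2) + C * (norm (c0 f))\<^sup>2"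
  proof (intro exI[of _ C] conjI C(1) ballI)
    fix f assume f: "f \<in> H1"
    let ?K = "\<theta> * ((norm (c1 f))\<^sup>2 + (norm (cV f))\<^sup>2) + C * (norm (c0 f))\<^sup>2"
    have K: "?K \<ge> 0" using \<theta> C(1) by simp
    have "\<kappa> \<in> borel_measurable lebesgue" using m by (simp add: measurable_completion)
    then have "(\<lambda>x. \<kappa> x * (indicator I x * f x)) \<in> borel_measurable lebesgue"
      using L2_function_measurable[OF H1V_D(2)[OF f]] by (rule borel_measurable_times)
    then have "(\<lambda>x. indicator I x * (\<kappa> x * f x)) \<in> borel_measurable lebesgue" by (simp add: mult.left_commute)
    with C(2)[OF f] have *: "L2_function I (\<lambda>x. \<kappa> x * f x) \<and> pairing I (\<lambda>x. \<kappa> x * f x) (\<lambda>x. \<kappa> x * f x) \<le> ?K"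
      using L2_bound_iff[OF K] by blast
    then show "L2_function I (\<lambda>x. \<kappa> x * f x)" ..
    then show "(norm (L2_class I (\<lambda>x. \<kappa> x * f x)))\<^sup>2 \<le> ?K" using * pairing_norm by metis
  qed
qed

text \<open>With \<open>t = a \<kappa>\<^sup>2 - ln (1 + x\<^sup>2)\<close> and \<open>A = \<integral> f\<^sup>2\<close>, Young's inequality gives
  \<open>f\<^sup>2 t \<le> f\<^sup>2 ln (f\<^sup>2 / A) + A e\<^sup>t\<close>, and the supremum of \<open>f\<^sup>2 / A\<close> is at most
  \<open>2 / r (1 + r\<^sup>2 B / A)\<close> with \<open>B = \<integral> f'\<^sup>2\<close>.\<close>

lemma form_small_exp:
  assumes \<kappa>: "continuous_on UNIV \<kappa>" and a: "a > 0"
    and fin: "(\<integral>\<^sup>+x\<in>I. ennreal (exp (a * (\<kappa> x)\<^sup>2) / (1 + x\<^sup>2)) \<partial>lborel) < \<infinity>"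
  shows "form_small \<kappa>"
proof (rule form_smallI)
  show km: "\<kappa> \<in> borel_measurable borel" using \<kappa> by (rule borel_measurable_continuous_onI)
  define e where "e x = indicator I x * (exp (a * (\<kappa> x)\<^sup>2) / (1 + x\<^sup>2))" for x :: real
  have e0: "e x \<ge> 0" for x by (simp add: e_def)
  have em: "e \<in> borel_measurable borel" unfolding e_def using km by measurable
  define E where "E = enn2real (\<integral>\<^sup>+x. ennreal (e x) \<partial>lborel)"
  have "(\<integral>\<^sup>+x. ennreal (e x) \<partial>lborel) < \<infinity>"
  proof -
    have "(\<integral>\<^sup>+x. ennreal (e x) \<partial>lborel) = (\<integral>\<^sup>+x\<in>I. ennreal (exp (a * (\<kappa> x)\<^sup>2) / (1 + x\<^sup>2)) \<partial>lborel)"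
      by (rule nn_integral_cong) (simp add: e_def indicator_def)
    then show ?thesis using fin by simp
  qed
  then have E: "(\<integral>\<^sup>+x. ennreal (e x) \<partial>lebesgue) = ennreal E" "E \<ge> 0"
    using em by (simp_all add: E_def nn_integral_completion)
  fix \<theta> :: real assume \<theta>: "\<theta> > 0"
  obtain r0 where r0: "r0 > 0" "\<And>f x r. \<lbrakk>f \<in> H1; x \<in> J; 0 < r; r \<le> r0\<rbrakk> \<Longrightarrow>
    (f x)\<^sup>2 \<le> 2 * r * (norm (c1 f))\<^sup>2 + 2 / r * (norm (c0 f))\<^sup>2"
    using pointwise_le_star by blast
  \<comment> \<open>The derivative ends up with the coefficient \<open>r^2 / a\<close>;
    \<open>r \<le> 1\<close> and \<open>r \<le> a * \<theta>\<close> bring it below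
    \<open>\<theta>\<close>.\<close>
  define r where "r = min (min r0 1) (a * \<theta>)"
  have r: "r > 0" "r \<le> r0" "r \<le> 1" using r0(1) \<theta> a by (auto simp: r_def)
  have r2: "r\<^sup>2 / a \<le> \<theta>"
  proof -
    have "r * r \<le> 1 * (a * \<theta>)" using r by (intro mult_mono) (auto simp: r_def)
    then show ?thesis using a by (simp add: power2_eq_square field_simps)
  qed
  \<comment> \<open>Halved because \<open>ln (1 + x^2)\<close> is estimated by twice
    \<open>ln (2 + \<bar>x\<bar>)\<close>.\<close>
  have "a * \<theta> / 2 > 0" using a \<theta> by simp
  then obtain C' where C': "C' \<ge> 0" "\<And>x. x \<in> I \<Longrightarrow> ln (2 + \<bar>x\<bar>) \<le> a * \<theta> / 2 * V x + C'"
    using log_le_V by blast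
  define P where "P = (2 * C' + ln (2 / r)) / a"
  have P: "P \<ge> 0" using C'(1) r a by (auto simp: P_def intro!: divide_nonneg_pos add_nonneg_nonneg)
  have log1: "ln (1 + x\<^sup>2) \<le> a * \<theta> * V x + 2 * C'" if x: "x \<in> I" for x
  proof -
    have "1 + x\<^sup>2 \<le> (2 + \<bar>x\<bar>)\<^sup>2" by (simp add: power2_sum)
    then have "ln (1 + x\<^sup>2) \<le> ln ((2 + \<bar>x\<bar>)\<^sup>2)" by (subst ln_le_cancel_iff) (auto simp: add_pos_nonneg)
    also have "\<dots> = 2 * ln (2 + \<bar>x\<bar>)" by (simp add: ln_realpow)
    also have "\<dots> \<le> 2 * (a * \<theta> / 2 * V x + C')" using C'(2)[OF x] by simp
    finally show ?thesis by (simp add: algebra_simps)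
  qed
  show "\<exists>C\<ge>0. \<forall>f\<in>H1. (\<integral>\<^sup>+x. ennreal ((indicator I x * (\<kappa> x * f x))\<^sup>2) \<partial>lebesgue)
      \<le> ennreal (\<theta> * ((norm (c1 f))\<^sup>2 + (norm (cV f))\<^sup>2) + C * (norm (c0 f))\<^sup>2)"
  proof (intro exI[of _ "P + E / a"] conjI ballI)
    show "P + E / a \<ge> 0" using P E a by simp
    fix f assume f: "f \<in> H1"
    define A where "A = (norm (c0 f))\<^sup>2"
    define B where "B = (norm (c1 f))\<^sup>2"
    define W where "W = (norm (cV f))\<^sup>2"
    have nn: "A \<ge> 0" "B \<ge> 0" "W \<ge> 0" by (simp_all add: A_def B_def W_def)
    have "(\<integral>\<^sup>+x. ennreal ((indicator I x * (\<kappa> x * f x))\<^sup>2) \<partial>lebesgue) \<le> ennreal (\<theta> * (B + W) + (P + E / a) * A)"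
    \<comment> \<open>The entropy argument divides by \<open>A\<close>; when \<open>A = 0\<close>,
      \<open>f\<close> vanishes on \<open>I\<close>.\<close>
    proof (cases "A = 0")
      case True
      then have "c0 f = c0 (\<lambda>x. 0)" using H1V_scale(2)[OF H1V_zero, of 0] by (simp add: A_def)
      then have "f x = 0" if "x \<in> I" for x using c0_eq_imp[OF f H1V_zero] that I_subset_J by blast
      then have zero: "(indicator I x * (\<kappa> x * f x))\<^sup>2 = 0" for x by (simp add: indicator_def)
      show ?thesis unfolding zero by simp
    next
      case False
      with nn have A: "A > 0" by simp
      \<comment> \<open>The coefficient of \<open>f^2\<close> still contains the ratio
        \<open>B / A\<close>; after integration, where \<open>f^2\<close> contributes
        \<open>A\<close>, this becomes the harmless \<open>r^2 * B / a\<close>.\<close>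
      define Q where "Q = P + r\<^sup>2 * B / (A * a)"
      have Q: "Q \<ge> 0" using P A a nn by (simp add: Q_def)
      define g0 where "g0 x = (indicator I x * f x)\<^sup>2" for x :: real
      define g1 where "g1 x = (indicator I x * (sqrt (V x) * f x))\<^sup>2" for x :: real
      have gm: "g0 \<in> borel_measurable lebesgue" "g1 \<in> borel_measurable lebesgue" "e \<in> borel_measurable lebesgue"
        unfolding g0_def g1_def using L2_function_measurable[OF H1V_D(2)[OF f]] L2_function_measurable[OF H1V_D(4)[OF f]] em
        by (auto simp: measurable_completion)
      have g_nn: "g0 x \<ge> 0" "g1 x \<ge> 0" for x by (simp_all add: g0_def g1_def)
      have gi: "(\<integral>\<^sup>+x. ennreal (g0 x) \<partial>lebesgue) = ennreal A" "(\<integral>\<^sup>+x. ennreal (g1 x) \<partial>lebesgue) = ennreal W"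
        unfolding g0_def g1_def A_def W_def c0_def cV_def
        using pairing_nn[OF H1V_D(2)[OF f]] pairing_nn[OF H1V_D(4)[OF f]] pairing_norm[OF H1V_D(2)[OF f]] pairing_norm[OF H1V_D(4)[OF f]]
        by simp_all
      have pw: "(indicator I x * (\<kappa> x * f x))\<^sup>2 \<le> \<theta> * g1 x + (Q * g0 x + A / a * e x)" for x
      proof (cases "x \<in> I \<and> f x \<noteq> 0")
        case False
        then show ?thesis using g_nn[of x] e0[of x] \<theta> Q A a by (auto simp: indicator_def)
      next
        case True
        define s where "s = (f x)\<^sup>2 / A"
        define t where "t = a * (\<kappa> x)\<^sup>2 - ln (1 + x\<^sup>2)"
        have s: "s > 0" using True A by (simp add: s_def)
        have "s \<le> (2 * r * B + 2 / r * A) / A"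
          using r0(2)[OF f _ r(1,2), of x] True I_subset_J A by (auto simp: s_def A_def B_def intro!: divide_right_mono)
        also have "\<dots> = 2 / r * (1 + r\<^sup>2 * B / A)" using r A by (simp add: field_simps power2_eq_square)
        finally have "ln s \<le> ln (2 / r * (1 + r\<^sup>2 * B / A))" using s by (subst ln_le_cancel_iff) auto
        also have "\<dots> = ln (2 / r) + ln (1 + r\<^sup>2 * B / A)"
          using r A nn by (intro ln_mult_pos) (auto simp: add_pos_nonneg)
        also have "\<dots> \<le> ln (2 / r) + r\<^sup>2 * B / A" using A nn by (intro add_left_mono ln_add_one_self_le_self) auto
        finally have ls: "ln s \<le> ln (2 / r) + r\<^sup>2 * B / A" .
        have "s * t \<le> s * ln s + exp t" by (rule Young_entropy[OF s])
        also have "\<dots> \<le> s * (ln (2 / r) + r\<^sup>2 * B / A) + exp t" using s ls by (intro add_right_mono mult_left_mono) auto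
        finally have "A * (s * t) \<le> A * (s * (ln (2 / r) + r\<^sup>2 * B / A) + exp t)" using A by (intro mult_left_mono) auto
        moreover have As: "A * s = (f x)\<^sup>2" using A by (simp add: s_def)
        moreover have "exp t = e x" using True by (simp add: t_def e_def exp_diff add_pos_nonneg)
        ultimately have "(f x)\<^sup>2 * t \<le> (f x)\<^sup>2 * (ln (2 / r) + r\<^sup>2 * B / A) + A * e x"
          by (simp add: distrib_left mult.assoc[symmetric])
        moreover have "(f x)\<^sup>2 * ln (1 + x\<^sup>2) \<le> (f x)\<^sup>2 * (a * \<theta> * V x + 2 * C')"
          using log1 True by (intro mult_left_mono) auto
        moreover have "(f x)\<^sup>2 * (a * (\<kappa> x)\<^sup>2) = (f x)\<^sup>2 * t + (f x)\<^sup>2 * ln (1 + x\<^sup>2)"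
          by (simp add: t_def algebra_simps)
        ultimately have "(f x)\<^sup>2 * (a * (\<kappa> x)\<^sup>2) \<le>
            (f x)\<^sup>2 * (ln (2 / r) + r\<^sup>2 * B / A) + A * e x + (f x)\<^sup>2 * (a * \<theta> * V x + 2 * C')" by linarith
        also have "\<dots> = a * (\<theta> * (V x * (f x)\<^sup>2) + (Q * (f x)\<^sup>2 + A / a * e x))"
          using a A by (simp add: Q_def P_def field_simps)
        finally have "a * ((\<kappa> x)\<^sup>2 * (f x)\<^sup>2) \<le> a * (\<theta> * (V x * (f x)\<^sup>2) + (Q * (f x)\<^sup>2 + A / a * e x))"
          by (simp add: ac_simps)
        then have "(\<kappa> x)\<^sup>2 * (f x)\<^sup>2 \<le> \<theta> * (V x * (f x)\<^sup>2) + (Q * (f x)\<^sup>2 + A / a * e x)" using a by simp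
        then show ?thesis using True V_nonneg[of x] by (simp add: g0_def g1_def power_mult_distrib)
      qed
      have "(\<integral>\<^sup>+x. ennreal ((indicator I x * (\<kappa> x * f x))\<^sup>2) \<partial>lebesgue)
          \<le> (\<integral>\<^sup>+x. ennreal \<theta> * ennreal (g1 x) + (ennreal Q * ennreal (g0 x) + ennreal (A / a) * ennreal (e x)) \<partial>lebesgue)"
      proof (rule nn_integral_mono)
        fix x
        have "ennreal ((indicator I x * (\<kappa> x * f x))\<^sup>2) \<le> ennreal (\<theta> * g1 x + (Q * g0 x + A / a * e x))"
          by (rule ennreal_leI[OF pw])
        also have "\<dots> = ennreal \<theta> * ennreal (g1 x) + (ennreal Q * ennreal (g0 x) + ennreal (A / a) * ennreal (e x))"
          using g_nn[of x] e0[of x] \<theta> Q A a by (simp add: ennreal_plus[symmetric] ennreal_mult'[symmetric] del: ennreal_plus)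
        finally show "ennreal ((indicator I x * (\<kappa> x * f x))\<^sup>2)
          \<le> ennreal \<theta> * ennreal (g1 x) + (ennreal Q * ennreal (g0 x) + ennreal (A / a) * ennreal (e x))" .
      qed
      also have "\<dots> = ennreal \<theta> * ennreal W + (ennreal Q * ennreal A + ennreal (A / a) * ennreal E)"
        using gm by (simp add: nn_integral_add nn_integral_cmult gi E(1))
      also have "\<dots> = ennreal (\<theta> * W + (Q * A + A / a * E))"
        using nn E(2) \<theta> Q A a by (simp add: ennreal_plus[symmetric] ennreal_mult'[symmetric] del: ennreal_plus)
      also have "\<dots> \<le> ennreal (\<theta> * (B + W) + (P + E / a) * A)"
      proof (rule ennreal_leI)
        have "Q * A = P * A + r\<^sup>2 / a * B" using A a by (simp add: Q_def field_simps)
        also have "\<dots> \<le> P * A + \<theta> * B" using nn r2 by (intro add_left_mono mult_right_mono) auto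
        finally show "\<theta> * W + (Q * A + A / a * E) \<le> \<theta> * (B + W) + (P + E / a) * A" by (simp add: algebra_simps)
      qed
      finally show ?thesis .
    qed
    then show "(\<integral>\<^sup>+x. ennreal ((indicator I x * (\<kappa> x * f x))\<^sup>2) \<partial>lebesgue)
      \<le> ennreal (\<theta> * ((norm (c1 f))\<^sup>2 + (norm (cV f))\<^sup>2) + (P + E / a) * (norm (c0 f))\<^sup>2)"
      unfolding A_def B_def W_def .
  qed
qed

text \<open>A continuous weight is bounded on a bounded interval, so the exponential is integrable
  already for \<open>a = 1\<close>.\<close>

lemma form_small_bounded_interval:
  assumes \<kappa>: "continuous_on UNIV \<kappa>" and I: "I = {0<..<b}"
  shows "form_small \<kappa>"
proof (rule form_small_exp[OF \<kappa> zero_less_one])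
  let ?e = "\<lambda>x. exp (1 * (\<kappa> x)\<^sup>2) / (1 + x\<^sup>2)"
  have "continuous_on {0..b} ?e"
    by (intro continuous_intros continuous_on_subset[OF \<kappa>]) (auto simp: add_nonneg_eq_0_iff)
  then have "compact (?e ` {0..b})" by (rule compact_continuous_image) simp
  then have "bounded (?e ` {0..b})" by (rule compact_imp_bounded)
  then obtain M where "\<forall>y\<in>?e ` {0..b}. norm y \<le> M" unfolding bounded_iff by blast
  then have M: "\<bar>?e x\<bar> \<le> M" if "x \<in> {0..b}" for x using that by auto
  have "(\<integral>\<^sup>+x\<in>I. ennreal (?e x) \<partial>lborel) \<le> (\<integral>\<^sup>+x. ennreal M * indicator {0<..<b} x \<partial>lborel)"
    unfolding I using M by (intro nn_integral_mono) (fastforce split: split_indicator intro!: ennreal_leI)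
  also have "\<dots> = ennreal M * emeasure lborel {0<..<b}" by (rule nn_integral_cmult_indicator) simp
  also have "\<dots> < \<infinity>" using emeasure_bounded_finite[of "{0<..<b}"] by (simp add: ennreal_mult_less_top)
  finally show "(\<integral>\<^sup>+x\<in>I. ennreal (?e x) \<partial>lborel) < \<infinity>" .
qed

section \<open>Decomposition of a path on bounded and unbounded intervals\<close>

lemma pairing_deriv_square:
  assumes f: "f \<in> C0_infinity I" and h: "L2_function I (\<lambda>x. h x * f x)"
  shows "pairing I (deriv (\<lambda>x. (f x)\<^sup>2)) h = 2 * inner (c1 f) (L2_class I (\<lambda>x. h x * f x))"
proof -
  have H: "f \<in> H1" by (rule C0_infinity_H1V[OF f])
  obtain f' where f': "\<And>x. x \<in> I \<Longrightarrow> deriv f x = f' x" "\<And>x. x \<in> I \<Longrightarrow> (f has_real_derivative f' x) (at x)"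
    using C0_infinity_D[OF f] by metis
  have d: "deriv (\<lambda>x. (f x)\<^sup>2) x = 2 * f x * deriv f x" if x: "x \<in> I" for x
    using f'[OF x] by (intro DERIV_imp_deriv) (auto intro!: derivative_eq_intros)
  have "pairing I (deriv (\<lambda>x. (f x)\<^sup>2)) h = set_lebesgue_integral lebesgue I (\<lambda>x. 2 * (deriv f x * (h x * f x)))"
    unfolding pairing_def by (rule set_lebesgue_integral_cong) (auto simp: d)
  also have "\<dots> = 2 * pairing I (deriv f) (\<lambda>x. h x * f x)" unfolding pairing_def by simp
  finally show ?thesis unfolding pairing_inner[OF H1V_D(3)[OF H] h] c1_def .
qed

text \<open>There is no growth to remove, so \<open>k = w\<close> and \<open>l = 0\<close>;
  \<open>xi_eq\<close> is then the definition of \<open>xi\<close> with the square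
  differentiated.\<close>

lemma good_path_bounded:
  assumes w: "continuous_on UNIV w" and I: "I = {0<..<b}"
  shows "good_path s V w w (\<lambda>x. 0)"
proof (unfold_locales)
  show k: "form_small w" by (rule form_small_bounded_interval[OF w I])
  show "form_small (\<lambda>x. 0)" by (rule form_small_bounded_interval[OF _ I]) simp
  fix f assume f: "f \<in> C0_infinity I"
  have "L2_function I (\<lambda>x. w x * f x)"
    using k C0_infinity_H1V[OF f] zero_less_one unfolding form_small_def by blast
  moreover have "L2_class I (\<lambda>x. 0 * f x) = 0"
    using L2_class_scale[OF H1V_D(2)[OF C0_infinity_H1V[OF f]], of 0] by simp
  ultimately show "xi s w (\<lambda>x. (f x)\<^sup>2) = boundary_noise s w (\<lambda>x. (f x)\<^sup>2)
      - 2 * inner (c1 f) (L2_class I (\<lambda>x. w x * f x)) + inner (c0 f) (L2_class I (\<lambda>x. 0 * f x))"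
    unfolding xi_def using pairing_deriv_square[OF f] by simp
qed

text \<open>Here \<open>k\<close> differs by a constant from \<open>w\<close> minus its average over \<open>{x..x + 1}\<close>; the constant makes
  \<open>w - k\<close> vanish at the boundary point \<open>0\<close>.\<close>

lemma good_path_unbounded:
  assumes w: "continuous_on UNIV w" and I: "I = UNIV \<or> I = {0<..}"
    and W: "\<And>x. (W has_real_derivative w x) (at x)" and a: "a > 0"
    and fk: "(\<integral>\<^sup>+x. ennreal (exp (a * (w x - (W (x + 1) - W x))\<^sup>2) / (1 + x\<^sup>2)) \<partial>lborel) < \<infinity>"
    and fl: "(\<integral>\<^sup>+x. ennreal (exp (a * (w (x + 1) - w x)\<^sup>2) / (1 + x\<^sup>2)) \<partial>lborel) < \<infinity>"
  shows "good_path s V w (\<lambda>x. w x - (W (x + 1) - W x) + (W 1 - W 0)) (\<lambda>x. w (x + 1) - w x)"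
proof -
  define k0 where "k0 x = w x - (W (x + 1) - W x)" for x
  define k where "k x = k0 x + (W 1 - W 0)" for x
  define l where "l x = w (x + 1) - w x" for x
  define \<Lambda> where "\<Lambda> x = (W (x + 1) - W x) - (W 1 - W 0)" for x
  have wk: "w x = k x + \<Lambda> x" for x by (simp add: k_def k0_def \<Lambda>_def)
  have Wc: "continuous_on UNIV W" using W by (intro continuous_at_imp_continuous_on ballI DERIV_isCont)
  have w1: "continuous_on UNIV (\<lambda>x. w (x + 1))" "continuous_on UNIV (\<lambda>x. W (x + 1))"
    by (rule continuous_on_compose2[OF w] continuous_on_compose2[OF Wc]; auto intro!: continuous_intros)+
  have kc: "continuous_on UNIV k0" "continuous_on UNIV k" "continuous_on UNIV l" "continuous_on UNIV \<Lambda>"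
    unfolding k0_def k_def l_def \<Lambda>_def using w Wc w1 by (auto intro!: continuous_intros)
  have W1: "((\<lambda>x. W (x + 1)) has_real_derivative w (x + 1)) (at x)" for x
    using W[of "x + 1"] by (simp add: DERIV_shift)
  have dL: "(\<Lambda> has_real_derivative l x) (at x)" for x
    unfolding \<Lambda>_def l_def by (auto intro!: derivative_eq_intros W W1)
  have on_I: "(\<integral>\<^sup>+x\<in>I. F x \<partial>lborel) \<le> (\<integral>\<^sup>+x. F x \<partial>lborel)" for F :: "real \<Rightarrow> ennreal"
    by (intro nn_integral_mono) (auto simp: indicator_def)
  have "(\<integral>\<^sup>+x. ennreal (exp (a / 2 * (k x)\<^sup>2) / (1 + x\<^sup>2)) \<partial>lborel)
      \<le> (\<integral>\<^sup>+x. ennreal (exp (a * (W 1 - W 0)\<^sup>2)) * ennreal (exp (a * (k0 x)\<^sup>2) / (1 + x\<^sup>2)) \<partial>lborel)"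
  \<comment> \<open>The constant that distinguishes \<open>k\<close> from \<open>k0\<close> is paid
    for by halving \<open>a\<close>, through \<open>(x + y)^2 \<le> 2 x^2 + 2 y^2\<close>.\<close>
  proof (rule nn_integral_mono)
    fix x
    have "(k x)\<^sup>2 \<le> 2 * (k0 x)\<^sup>2 + 2 * (W 1 - W 0)\<^sup>2"
      using sum_squares_bound[of "k0 x" "W 1 - W 0"] by (simp add: k_def power2_sum)
    then have "a / 2 * (k x)\<^sup>2 \<le> a / 2 * (2 * (k0 x)\<^sup>2 + 2 * (W 1 - W 0)\<^sup>2)" using a by (intro mult_left_mono) auto
    also have "\<dots> = a * (W 1 - W 0)\<^sup>2 + a * (k0 x)\<^sup>2" by (simp add: algebra_simps)
    finally have "exp (a / 2 * (k x)\<^sup>2) / (1 + x\<^sup>2) \<le> exp (a * (W 1 - W 0)\<^sup>2 + a * (k0 x)\<^sup>2) / (1 + x\<^sup>2)"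
      by (intro divide_right_mono) auto
    then show "ennreal (exp (a / 2 * (k x)\<^sup>2) / (1 + x\<^sup>2))
        \<le> ennreal (exp (a * (W 1 - W 0)\<^sup>2)) * ennreal (exp (a * (k0 x)\<^sup>2) / (1 + x\<^sup>2))"
      by (simp add: exp_add ennreal_mult'[symmetric] ennreal_leI)
  qed
  also have "\<dots> = ennreal (exp (a * (W 1 - W 0)\<^sup>2)) * (\<integral>\<^sup>+x. ennreal (exp (a * (k0 x)\<^sup>2) / (1 + x\<^sup>2)) \<partial>lborel)"
  proof (rule nn_integral_cmult)
    have "(\<lambda>x. ennreal (exp (a * (k0 x)\<^sup>2) / (1 + x\<^sup>2))) \<in> borel_measurable borel"
      using borel_measurable_continuous_onI[OF kc(1)] by measurable
    then show "(\<lambda>x. ennreal (exp (a * (k0 x)\<^sup>2) / (1 + x\<^sup>2))) \<in> borel_measurable lborel" by simp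
  qed
  also have "\<dots> < \<infinity>" using fk by (simp add: k0_def ennreal_mult_less_top)
  finally have "form_small k"
    using a by (intro form_small_exp[OF kc(2), of "a / 2"] le_less_trans[OF on_I]) auto
  moreover have "form_small l"
    using a fl by (intro form_small_exp[OF kc(3), of a] le_less_trans[OF on_I]) (auto simp: l_def)
  moreover have "xi s w (\<lambda>x. (f x)\<^sup>2) = boundary_noise s w (\<lambda>x. (f x)\<^sup>2)
      - 2 * inner (c1 f) (L2_class I (\<lambda>x. k x * f x)) + inner (c0 f) (L2_class I (\<lambda>x. l x * f x))"
    if sk: "form_small k" and sl: "form_small l" and f: "f \<in> C0_infinity I" for f
  proof -
    have H: "f \<in> H1" by (rule C0_infinity_H1V[OF f])
    have L2: "L2_function I (\<lambda>x. k x * f x)" "L2_function I (\<lambda>x. l x * f x)"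
      using sk sl H zero_less_one unfolding form_small_def by blast+
    show ?thesis
    proof (rule C0_infinity_D[OF f])
      fix f' c d B
      assume f': "\<And>x. x \<in> J \<Longrightarrow> (f has_real_derivative f' x) (at x within J)"
        "\<And>x. x \<in> I \<Longrightarrow> deriv f x = f' x" "\<And>x. x \<in> I \<Longrightarrow> (f has_real_derivative f' x) (at x)"
        "continuous_on J f" "continuous_on J f'" and cd: "c < d" "{c..d} \<subseteq> J" "{c<..<d} \<subseteq> I"
        and z: "\<And>x. x \<in> I - {c<..<d} \<Longrightarrow> f x = 0" "\<And>x. x \<in> I - {c<..<d} \<Longrightarrow> f' x = 0"
      have JI: "J = UNIV \<or> J = {0..}"
        using I
      proof
        assume "I = UNIV"
        then show ?thesis by simp
      next
        assume "I = {0<..}"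
        then show ?thesis by simp
      qed
      define G where "G x = 2 * f x * f' x * \<Lambda> x + (f x)\<^sup>2 * l x" for x
      have dG: "((\<lambda>x. (f x)\<^sup>2 * \<Lambda> x) has_vector_derivative G x) (at x within {c..d})" if x: "c \<le> x" "x \<le> d" for x
      proof -
        have "x \<in> J" using x cd(2) by auto
        then have "(f has_real_derivative f' x) (at x within {c..d})" using DERIV_subset[OF f'(1) cd(2)] by blast
        moreover have "(\<Lambda> has_real_derivative l x) (at x within {c..d})" by (rule has_field_derivative_at_within[OF dL])
        ultimately show ?thesis
          unfolding G_def has_real_derivative_iff_has_vector_derivative[symmetric]
          by (auto intro!: derivative_eq_intros)
      qed
      have Gc: "continuous_on {c..d} G"
        unfolding G_def
        by (intro continuous_intros continuous_on_subset[OF f'(4) cd(2)] continuous_on_subset[OF f'(5) cd(2)]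
            continuous_on_subset[OF kc(4)] continuous_on_subset[OF kc(3)]) auto
      \<comment> \<open>\<open>f\<close> vanishes at \<open>c\<close> and \<open>d\<close>, unless
        \<open>c\<close> is the boundary point 0, where \<open>\<Lambda>\<close> is normalized to
        vanish. Hence the derivative \<open>G\<close> of \<open>f^2 \<Lambda>\<close> has integral
        0.\<close>
      have e0: "(f c)\<^sup>2 * \<Lambda> c = 0" "(f d)\<^sup>2 * \<Lambda> d = 0"
      proof -
        have "c \<in> J" using cd by auto
        then have "c \<in> I \<or> c = 0" using I JI by auto
        then show "(f c)\<^sup>2 * \<Lambda> c = 0" using z(1)[of c] by (auto simp: \<Lambda>_def)
        have "d \<in> I" using I JI cd by force
        then show "(f d)\<^sup>2 * \<Lambda> d = 0" using z(1)[of d] by simp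
      qed
      have "has_bochner_integral lborel (\<lambda>x. indicator {c..d} x *\<^sub>R G x) ((f d)\<^sup>2 * \<Lambda> d - (f c)\<^sup>2 * \<Lambda> c)"
        by (rule has_bochner_integral_FTC_Icc[OF _ dG Gc]) (use cd in auto)
      then have hb: "has_bochner_integral lborel (\<lambda>x. indicator {c..d} x *\<^sub>R G x) 0" using e0 by simp
      have Gi: "integrable lebesgue (\<lambda>x. indicator {c..d} x *\<^sub>R G x)"
        "(LINT x|lebesgue. indicator {c..d} x *\<^sub>R G x) = 0"
        using hb by (auto simp: has_bochner_integral_iff integrable_completion integral_completion
            dest: borel_measurable_integrable)
      have eqG: "indicator {c..d} x *\<^sub>R G x = indicator I x * G x" if x: "x \<noteq> c" "x \<noteq> d" for x
      proof (cases "x \<in> {c<..<d}")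
        case True
        then show ?thesis using cd(3) by (simp add: subset_iff)
      next
        case False
        then have "x \<notin> {c..d}" using x by auto
        moreover have "indicator I x * G x = 0" using False z(1)[of x] by (cases "x \<in> I") (auto simp: G_def)
        ultimately show ?thesis by simp
      qed
      have ae: "AE x in lebesgue. indicator {c..d} x *\<^sub>R G x = indicator I x * G x"
      proof (rule AE_mp[OF AE_I'])
        show "{c, d} \<in> null_sets lebesgue" by (simp add: negligible_iff_null_sets[symmetric])
        show "{x \<in> space lebesgue. \<not> (x \<noteq> c \<and> x \<noteq> d)} \<subseteq> {c, d}" by auto
      qed (use eqG in auto)
      have GI: "integrable lebesgue (\<lambda>x. indicator I x * G x)" "(LINT x|lebesgue. indicator I x * G x) = 0"
      proof -
        have m: "(\<lambda>x. indicator I x * G x) \<in> borel_measurable lebesgue"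
          using borel_measurable_AE[OF borel_measurable_integrable[OF Gi(1)] ae] .
        show "integrable lebesgue (\<lambda>x. indicator I x * G x)"
          using integrable_cong_AE[OF borel_measurable_integrable[OF Gi(1)] m ae] Gi(1) by blast
        show "(LINT x|lebesgue. indicator I x * G x) = 0"
          using integral_cong_AE[OF borel_measurable_integrable[OF Gi(1)] m ae] Gi(2) by simp
      qed
      have d2: "deriv (\<lambda>x. (f x)\<^sup>2) x = 2 * f x * f' x" if x: "x \<in> I" for x
        using f'(3)[OF x] by (intro DERIV_imp_deriv) (auto intro!: derivative_eq_intros)
      \<comment> \<open>Integration by parts in pointwise form: \<open>(f^2)' \<Lambda>\<close> is
        replaced by \<open>G - f^2 l\<close>.\<close>
      have pt: "deriv (\<lambda>x. (f x)\<^sup>2) x * w x = 2 * (deriv f x * (k x * f x)) + (G x - f x * (l x * f x))" if x: "x \<in> I" for x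
        unfolding d2[OF x] f'(2)[OF x] wk G_def by (simp add: power2_eq_square algebra_simps)
      have P: "integrable lebesgue (\<lambda>x. indicator I x * (deriv f x * (k x * f x)))"
        "integrable lebesgue (\<lambda>x. indicator I x * (f x * (l x * f x)))"
        by (rule pairing_integrable[OF H1V_D(3)[OF H] L2(1)] pairing_integrable[OF H1V_D(2)[OF H] L2(2)])+
      have "pairing I (deriv (\<lambda>x. (f x)\<^sup>2)) w = (LINT x|lebesgue. 2 * (indicator I x * (deriv f x * (k x * f x)))
          + (indicator I x * G x - indicator I x * (f x * (l x * f x))))"
        unfolding pairing_def set_lebesgue_integral_def
        by (rule Bochner_Integration.integral_cong)
          (auto simp: indicator_def pt)
      also have "\<dots> = 2 * (LINT x|lebesgue. indicator I x * (deriv f x * (k x * f x)))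
          - (LINT x|lebesgue. indicator I x * (f x * (l x * f x)))"
        using P GI by simp
      also have "\<dots> = 2 * pairing I (deriv f) (\<lambda>x. k x * f x) - pairing I f (\<lambda>x. l x * f x)"
        unfolding pairing_def set_lebesgue_integral_def by simp
      also have "\<dots> = 2 * inner (c1 f) (L2_class I (\<lambda>x. k x * f x)) - inner (c0 f) (L2_class I (\<lambda>x. l x * f x))"
        unfolding pairing_inner[OF H1V_D(3)[OF H] L2(1)] pairing_inner[OF H1V_D(2)[OF H] L2(2)] c0_def c1_def ..
      finally show ?thesis unfolding xi_def by simp
    qed
  qed
  ultimately show ?thesis
    unfolding k_def[unfolded k0_def, symmetric] l_def[symmetric] by unfold_locales
qed

end

section \<open>Exponential moments of the noise\<close>

text \<open>The product of the density with \<open>exp (a * x^2)\<close> is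
  \<open>1 / sqrt v\<close> times the normal density of variance \<open>\<sigma>^2 / v\<close>,
  where \<open>v = 1 - 2 * a * \<sigma>^2\<close>. The hypothesis makes
  \<open>v \<ge> 1 / 2\<close>, so the factor is at most 2.\<close>

lemma nn_integral_exp_normal:
  assumes \<sigma>: "\<sigma> > 0" and a: "2 * a * \<sigma>\<^sup>2 \<le> 1 / 2"
  shows "(\<integral>\<^sup>+x. ennreal (normal_density 0 \<sigma> x) * ennreal (exp (a * x\<^sup>2)) \<partial>lborel) \<le> 2"
proof -
  define v where "v = 1 - 2 * a * \<sigma>\<^sup>2"
  have v: "v \<ge> 1 / 2" using a by (simp add: v_def)
  define \<tau> where "\<tau> = \<sigma> / sqrt v"
  have \<tau>: "\<tau> > 0" "\<tau>\<^sup>2 = \<sigma>\<^sup>2 / v" using \<sigma> v by (simp_all add: \<tau>_def power_divide)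
  have eq: "normal_density 0 \<sigma> x * exp (a * x\<^sup>2) = (1 / sqrt v) * normal_density 0 \<tau> x" for x
  proof -
    have "exp (- (x - 0)\<^sup>2 / (2 * \<sigma>\<^sup>2)) * exp (a * x\<^sup>2) = exp (- (x - 0)\<^sup>2 / (2 * \<tau>\<^sup>2))"
      using \<sigma> v by (simp add: exp_add[symmetric] \<tau>(2) v_def field_simps)
    moreover have "1 / sqrt (2 * pi * \<sigma>\<^sup>2) = (1 / sqrt v) * (1 / sqrt (2 * pi * \<tau>\<^sup>2))"
      using \<sigma> v by (simp add: \<tau>(2) real_sqrt_mult real_sqrt_divide)
    ultimately show ?thesis unfolding normal_density_def by simp
  qed
  have "(\<integral>\<^sup>+x. ennreal (normal_density 0 \<sigma> x) * ennreal (exp (a * x\<^sup>2)) \<partial>lborel)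
      = (\<integral>\<^sup>+x. ennreal (1 / sqrt v) * ennreal (normal_density 0 \<tau> x) \<partial>lborel)"
    using v by (simp add: ennreal_mult'[symmetric] eq)
  also have "\<dots> = ennreal (1 / sqrt v) * (\<integral>\<^sup>+x. ennreal (normal_density 0 \<tau> x) \<partial>lborel)"
    by (rule nn_integral_cmult) simp
  also have "(\<integral>\<^sup>+x. ennreal (normal_density 0 \<tau> x) \<partial>lborel) = 1"
    using prob_space.emeasure_space_1[OF prob_space_normal_density[OF \<tau>(1), of 0]] by (simp add: emeasure_density)
  also have "ennreal (1 / sqrt v) * 1 \<le> ennreal 2"
  proof -
    have "1 / 2 \<le> sqrt v" using v by (intro real_le_rsqrt) (simp add: power2_eq_square)
    then have "1 / sqrt v \<le> 2" using v by (simp add: field_simps)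
    then have "ennreal (1 / sqrt v) \<le> ennreal 2" by (rule ennreal_leI)
    then show ?thesis by simp
  qed
  finally show ?thesis by simp
qed

text \<open>The density is at most \<open>1 / \<sigma>\<close>, so the ball has mass at most
  \<open>2 * m / \<sigma>\<close>. A lower bound on the probability of a ball thus bounds the
  standard deviation.\<close>

lemma normal_small_ball:
  assumes \<sigma>: "\<sigma> > 0" and m: "m > 0" and "ennreal (1 / 2) \<le> (\<integral>\<^sup>+x\<in>{-m..m}. ennreal (normal_density 0 \<sigma> x) \<partial>lborel)"
  shows "\<sigma> \<le> 4 * m"
proof -
  have "normal_density 0 \<sigma> x \<le> 1 / \<sigma>" for x
  proof -
    have "\<sigma> \<le> sqrt (2 * pi * \<sigma>\<^sup>2)"
    proof (rule real_le_rsqrt)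
      have "1 \<le> 2 * pi" using pi_gt3 by simp
      then show "\<sigma>\<^sup>2 \<le> 2 * pi * \<sigma>\<^sup>2" by (intro mult_le_cancel_right1[THEN iffD2]) auto
    qed
    then have "1 / sqrt (2 * pi * \<sigma>\<^sup>2) \<le> 1 / \<sigma>" using \<sigma> by (intro divide_left_mono) auto
    moreover have "exp (- (x - 0)\<^sup>2 / (2 * \<sigma>\<^sup>2)) \<le> 1" using \<sigma> by simp
    ultimately have "1 / sqrt (2 * pi * \<sigma>\<^sup>2) * exp (- (x - 0)\<^sup>2 / (2 * \<sigma>\<^sup>2)) \<le> 1 / \<sigma> * 1"
      using \<sigma> by (intro mult_mono) auto
    then show ?thesis unfolding normal_density_def by simp
  qed
  then have "(\<integral>\<^sup>+x\<in>{-m..m}. ennreal (normal_density 0 \<sigma> x) \<partial>lborel) \<le> (\<integral>\<^sup>+x. ennreal (1 / \<sigma>) * indicator {-m..m} x \<partial>lborel)"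
    by (intro nn_integral_mono mult_right_mono ennreal_leI) auto
  also have "\<dots> = ennreal (1 / \<sigma>) * emeasure lborel {-m..m}" by (rule nn_integral_cmult_indicator) simp
  also have "\<dots> = ennreal (1 / \<sigma> * (2 * m))" using m \<sigma> by (simp add: ennreal_mult'[symmetric])
  finally have "ennreal (1 / 2) \<le> ennreal (1 / \<sigma> * (2 * m))" using assms(3) by (rule order_trans[rotated])
  then have "1 / 2 \<le> 1 / \<sigma> * (2 * m)" using m \<sigma> by (subst (asm) ennreal_le_iff) auto
  then show ?thesis using \<sigma> by (simp add: field_simps)
qed

lemma nn_integral_Cauchy_weight: "(\<integral>\<^sup>+x. ennreal (1 / (1 + x\<^sup>2)) \<partial>lborel) < \<infinity>"
proof -
  have "set_integrable lborel (einterval (-\<infinity>) \<infinity>) (\<lambda>x. inverse (1 + x^2))" by (rule integrable_inverse_1_plus_square)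
  then have "integrable lborel (\<lambda>x::real. 1 / (1 + x\<^sup>2))"
    by (simp add: set_integrable_def einterval_def inverse_eq_divide)
  then show ?thesis unfolding integrable_iff_bounded by simp
qed

text \<open>Convexity of \<open>t \<mapsto> exp (a t\<^sup>2)\<close>: integrate its tangent line at the mean over the unit interval.\<close>

lemma Jensen_exp_square:
  fixes u :: "real \<Rightarrow> real"
  assumes u: "continuous_on UNIV u" and a: "a > 0"
  shows "ennreal (exp (a * (LINT t:{0..1}|lborel. u t)\<^sup>2)) \<le> (\<integral>\<^sup>+t\<in>{0..1}. ennreal (exp (a * (u t)\<^sup>2)) \<partial>lborel)"
proof -
  define k where "k = (LINT t:{0..1}|lborel. u t)"
  have ui: "integrable lborel (\<lambda>t. indicator {0..1} t *\<^sub>R u t)" "integrable lborel (\<lambda>t::real. indicator {0..1} t *\<^sub>R exp (a * (u t)\<^sup>2))"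
    by (rule borel_integrable_compact; auto intro!: continuous_intros continuous_on_subset[OF u])+
  have ci: "integrable lborel (\<lambda>t::real. indicator {0..1} t * C)" for C :: real by simp
  have tangent: "exp (a * k\<^sup>2) + exp (a * k\<^sup>2) * (2 * a * k) * (x - k) \<le> exp (a * x\<^sup>2)" for x
  proof -
    have "a * (2 * k * (x - k)) \<le> a * (x\<^sup>2 - k\<^sup>2)"
    proof (rule mult_left_mono)
      have "0 \<le> (x - k)\<^sup>2" by simp
      then show "2 * k * (x - k) \<le> x\<^sup>2 - k\<^sup>2" by (simp add: power2_eq_square algebra_simps)
    qed (use a in simp)
    also have "1 + a * (x\<^sup>2 - k\<^sup>2) \<le> exp (a * (x\<^sup>2 - k\<^sup>2))" by (rule exp_ge_add_one_self)
    finally have "exp (a * k\<^sup>2) * (1 + a * (2 * k * (x - k))) \<le> exp (a * k\<^sup>2) * exp (a * (x\<^sup>2 - k\<^sup>2))"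
      by (intro mult_left_mono) auto
    then show ?thesis by (simp add: exp_add[symmetric] algebra_simps)
  qed
  have "exp (a * k\<^sup>2) = (LINT t|lborel. indicator {0..1} t * (exp (a * k\<^sup>2) - exp (a * k\<^sup>2) * (2 * a * k) * k)
      + exp (a * k\<^sup>2) * (2 * a * k) * (indicator {0..1} t *\<^sub>R u t))"
  proof -
    have "(LINT t::real|lborel. indicator {0..1} t * (C - c * k) + c * (indicator {0..1} t *\<^sub>R u t)) = C" for c C :: real
    proof -
      have "(LINT t|lborel. indicator {0..1} t * (C - c * k) + c * (indicator {0..1} t *\<^sub>R u t))
          = (LINT t::real|lborel. indicator {0..1} t * (C - c * k)) + (LINT t|lborel. c * (indicator {0..1} t *\<^sub>R u t))"
        using ci ui(1) by (intro Bochner_Integration.integral_add) auto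
      also have "(LINT t|lborel. c * (indicator {0..1} t *\<^sub>R u t)) = c * k"
        unfolding k_def set_lebesgue_integral_def by (rule integral_mult_right_zero)
      finally show ?thesis by simp
    qed
    from this[symmetric] show ?thesis .
  qed
  also have "\<dots> \<le> (LINT t|lborel. indicator {0..1} t *\<^sub>R exp (a * (u t)\<^sup>2))"
  proof (rule integral_mono)
    fix t :: real
    show "indicator {0..1} t * (exp (a * k\<^sup>2) - exp (a * k\<^sup>2) * (2 * a * k) * k) + exp (a * k\<^sup>2) * (2 * a * k) * (indicator {0..1} t *\<^sub>R u t)
        \<le> indicator {0..1} t *\<^sub>R exp (a * (u t)\<^sup>2)"
      using tangent[of "u t"] by (simp add: indicator_def algebra_simps)
  qed (use ui in auto)
  finally have "ennreal (exp (a * k\<^sup>2)) \<le> ennreal (LINT t|lborel. indicator {0..1} t *\<^sub>R exp (a * (u t)\<^sup>2))" by (rule ennreal_leI)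
  also have "\<dots> = (\<integral>\<^sup>+t. ennreal (indicator {0..1} t *\<^sub>R exp (a * (u t)\<^sup>2)) \<partial>lborel)"
    by (rule nn_integral_eq_integral[symmetric, OF ui(2)]) auto
  also have "\<dots> = (\<integral>\<^sup>+t\<in>{0..1}. ennreal (exp (a * (u t)\<^sup>2)) \<partial>lborel)"
    by (rule nn_integral_cong) (simp add: indicator_def)
  finally show ?thesis unfolding k_def .
qed

text \<open>By Tonelli's theorem the weighted integral has expectation at most twice the integral of
  \<open>1 / (1 + x^2)\<close>, and a nonnegative variable with finite expectation is almost surely
  finite.\<close>

lemma (in prob_space) weighted_integral_finite:
  assumes F: "case_prod F \<in> borel_measurable (lborel \<Otimes>\<^sub>M M)" and le: "\<And>x. (\<integral>\<^sup>+\<omega>. F x \<omega> \<partial>M) \<le> 2"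
  shows "AE \<omega> in M. (\<integral>\<^sup>+x. ennreal (1 / (1 + x\<^sup>2)) * F x \<omega> \<partial>lborel) < \<infinity>"
proof -
  interpret pair_sigma_finite lborel M ..
  have m: "(\<lambda>(x, \<omega>). ennreal (1 / (1 + x\<^sup>2)) * F x \<omega>) \<in> borel_measurable (lborel \<Otimes>\<^sub>M M)" using F by measurable
  have "(\<integral>\<^sup>+\<omega>. (\<integral>\<^sup>+x. ennreal (1 / (1 + x\<^sup>2)) * F x \<omega> \<partial>lborel) \<partial>M)
      = (\<integral>\<^sup>+x. (\<integral>\<^sup>+\<omega>. ennreal (1 / (1 + x\<^sup>2)) * F x \<omega> \<partial>M) \<partial>lborel)"
    using Fubini'[OF m] by simp
  also have "\<dots> = (\<integral>\<^sup>+x. ennreal (1 / (1 + x\<^sup>2)) * (\<integral>\<^sup>+\<omega>. F x \<omega> \<partial>M) \<partial>lborel)"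
    using F by (intro nn_integral_cong nn_integral_cmult) simp
  also have "\<dots> \<le> (\<integral>\<^sup>+x. ennreal (1 / (1 + x\<^sup>2)) * 2 \<partial>lborel)" by (intro nn_integral_mono mult_left_mono le) simp
  also have "\<dots> = (\<integral>\<^sup>+x. ennreal (1 / (1 + x\<^sup>2)) \<partial>lborel) * 2" by (rule nn_integral_multc) simp
  also have "\<dots> < \<infinity>" using nn_integral_Cauchy_weight by (simp add: ennreal_mult_less_top)
  finally have "(\<integral>\<^sup>+\<omega>. (\<integral>\<^sup>+x. ennreal (1 / (1 + x\<^sup>2)) * F x \<omega> \<partial>lborel) \<partial>M) \<noteq> \<infinity>" by simp
  moreover have "(\<lambda>\<omega>. \<integral>\<^sup>+x. ennreal (1 / (1 + x\<^sup>2)) * F x \<omega> \<partial>lborel) \<in> borel_measurable M"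
    using m by measurable
  ultimately show ?thesis
    using nn_integral_PInf_AE[of "\<lambda>\<omega>. \<integral>\<^sup>+x. ennreal (1 / (1 + x\<^sup>2)) * F x \<omega> \<partial>lborel" M] by (auto simp: top.not_eq_extremum elim: eventually_mono)
qed

lemma floor_approx_tendsto: "(\<lambda>n. real_of_int \<lfloor>x * real (Suc n)\<rfloor> / real (Suc n)) \<longlonglongrightarrow> x"
proof (rule LIM_zero_cancel, rule Lim_null_comparison)
  show "(\<lambda>n. inverse (real (Suc n))) \<longlonglongrightarrow> 0" by (rule LIMSEQ_inverse_real_of_nat)
  show "\<forall>\<^sub>F n in sequentially. norm (real_of_int \<lfloor>x * real (Suc n)\<rfloor> / real (Suc n) - x) \<le> inverse (real (Suc n))"
  proof (intro always_eventually allI)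
    fix n
    have "real_of_int \<lfloor>x * real (Suc n)\<rfloor> / real (Suc n) - x = (real_of_int \<lfloor>x * real (Suc n)\<rfloor> - x * real (Suc n)) / real (Suc n)"
      by (simp add: field_simps del: of_nat_Suc)
    moreover have "\<bar>real_of_int \<lfloor>x * real (Suc n)\<rfloor> - x * real (Suc n)\<bar> \<le> 1" by linarith
    ultimately show "norm (real_of_int \<lfloor>x * real (Suc n)\<rfloor> / real (Suc n) - x) \<le> inverse (real (Suc n))"
      by (simp add: divide_right_mono inverse_eq_divide del: of_nat_Suc)
  qed
qed

section \<open>Gaussian increments, uniformly in time, and their paths\<close>

context prob_space
begin

text \<open>The small ball estimate gives \<open>\<sigma> \<le> 4 * m\<close>, and then
  \<open>2 * \<sigma>^2 / (64 * m^2) \<le> 1 / 2\<close>, the threshold of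
  \<open>nn_integral_exp_normal\<close>. This is the origin of the constant 64.\<close>

lemma gaussian_exp_moment:
  assumes X: "centered_gaussian M X" and m: "m > 0" and p: "prob {\<omega> \<in> space M. \<bar>X \<omega>\<bar> \<le> m} \<ge> 1 / 2"
  shows "(\<integral>\<^sup>+\<omega>. ennreal (exp (1 / (64 * m\<^sup>2) * (X \<omega>)\<^sup>2)) \<partial>M) \<le> 2"
  using X unfolding centered_gaussian_def
proof (elim conjE disjE exE)
  assume "AE \<omega> in M. X \<omega> = 0"
  then have "(\<integral>\<^sup>+\<omega>. ennreal (exp (1 / (64 * m\<^sup>2) * (X \<omega>)\<^sup>2)) \<partial>M) = (\<integral>\<^sup>+\<omega>. 1 \<partial>M)"
    by (intro nn_integral_cong_AE) auto
  then show ?thesis by (simp add: emeasure_space_1)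
next
  fix \<sigma> :: real assume \<sigma>: "0 < \<sigma>" and D: "distributed M lborel X (\<lambda>x. ennreal (normal_density 0 \<sigma> x))"
    and Xm: "X \<in> borel_measurable M"
  have "(\<integral>\<^sup>+x\<in>{-m..m}. ennreal (normal_density 0 \<sigma> x) \<partial>lborel) = (\<integral>\<^sup>+\<omega>. indicator {-m..m} (X \<omega>) \<partial>M)"
    by (rule distributed_nn_integral[OF D]) simp
  also have "\<dots> = (\<integral>\<^sup>+\<omega>. indicator {\<omega> \<in> space M. \<bar>X \<omega>\<bar> \<le> m} \<omega> \<partial>M)"
    by (rule nn_integral_cong) (auto simp: indicator_def)
  also have "\<dots> = ennreal (prob {\<omega> \<in> space M. \<bar>X \<omega>\<bar> \<le> m})" using Xm by (simp add: emeasure_eq_measure)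
  finally have "ennreal (1 / 2) \<le> (\<integral>\<^sup>+x\<in>{-m..m}. ennreal (normal_density 0 \<sigma> x) \<partial>lborel)"
    using ennreal_leI[OF p] by (simp only:)
  then have "\<sigma> \<le> 4 * m" by (rule normal_small_ball[OF \<sigma> m])
  then have "\<sigma>\<^sup>2 \<le> (4 * m)\<^sup>2" using \<sigma> by (intro power_mono) auto
  then have "2 * (1 / (64 * m\<^sup>2)) * \<sigma>\<^sup>2 \<le> 1 / 2" using m by (simp add: field_simps power2_eq_square)
  from nn_integral_exp_normal[OF \<sigma> this]
  show ?thesis by (subst (asm) distributed_nn_integral[OF D]) simp_all
qed

text \<open>Stationarity is used for families of a single increment; projecting to the only
  component turns equality of laws on the product space into equality on the line.\<close>

lemma noise_process_increment:
  assumes "noise_process M \<Xi>"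
  shows "\<Xi> x \<in> borel_measurable M" "centered_gaussian M (\<Xi> x)"
    "distr M borel (\<lambda>\<omega>. \<Xi> (y + h) \<omega> - \<Xi> (z + h) \<omega>) = distr M borel (\<lambda>\<omega>. \<Xi> y \<omega> - \<Xi> z \<omega>)"
proof -
  have g: "centered_gaussian M (\<lambda>\<omega>. \<Sum>x\<in>F. c x * \<Xi> x \<omega>)" if "finite F" for F c
    using assms that unfolding noise_process_def centered_gaussian_process_def by blast
  show G: "centered_gaussian M (\<Xi> x)" for x using g[of "{x}" "\<lambda>_. 1"] by simp
  then show m: "\<Xi> x \<in> borel_measurable M" for x unfolding centered_gaussian_def by blast
  let ?P = "\<Pi>\<^sub>M i\<in>{..<1::nat}. (borel :: real measure)"
  have st: "distr M ?P (\<lambda>\<omega>. \<lambda>i\<in>{..<1}. \<Xi> (y + h) \<omega> - \<Xi> (z + h) \<omega>) = distr M ?P (\<lambda>\<omega>. \<lambda>i\<in>{..<1}. \<Xi> y \<omega> - \<Xi> z \<omega>)"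
  proof -
    have "stationary_increments M \<Xi>" using assms by (simp add: noise_process_def)
    then show ?thesis
      unfolding stationary_increments_def
      by (elim allE[of _ 1] allE[of _ "\<lambda>_::nat. z"] allE[of _ "\<lambda>_::nat. y"] allE[of _ h])
  qed
  have c: "distr (distr M ?P (\<lambda>\<omega>. \<lambda>i\<in>{..<1}. U \<omega>)) borel (\<lambda>f. f 0) = distr M borel U" if U: "U \<in> borel_measurable M" for U
  proof -
    have "(\<lambda>\<omega>. \<lambda>i\<in>{..<1}. U \<omega>) \<in> measurable M ?P" using U by (intro measurable_restrict) auto
    moreover have "(\<lambda>f. f (0::nat)) \<in> measurable ?P borel" by (rule measurable_component_singleton) simp
    ultimately have "distr (distr M ?P (\<lambda>\<omega>. \<lambda>i\<in>{..<1}. U \<omega>)) borel (\<lambda>f. f 0) = distr M borel ((\<lambda>f. f 0) \<circ> (\<lambda>\<omega>. \<lambda>i\<in>{..<1::nat}. U \<omega>))"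
      by (intro distr_distr)
    also have "((\<lambda>f. f 0) \<circ> (\<lambda>\<omega>. \<lambda>i\<in>{..<1::nat}. U \<omega>)) = U" by auto
    finally show ?thesis .
  qed
  show "distr M borel (\<lambda>\<omega>. \<Xi> (y + h) \<omega> - \<Xi> (z + h) \<omega>) = distr M borel (\<lambda>\<omega>. \<Xi> y \<omega> - \<Xi> z \<omega>)"
    using arg_cong[OF st, of "\<lambda>N. distr N borel (\<lambda>f. f 0)"] m by (subst (asm) (1 2) c) auto
qed

text \<open>Continuous paths are bounded on the unit interval, so the events \<open>A n\<close>
  increase to probability one. They run over rational times to be measurable, and continuity carries
  the bound to every \<open>t\<close>. One level \<open>m\<close> serves all these times, which
  bounds their variances uniformly without computing a covariance.\<close>

lemma noise_process_bounded:
  assumes N: "noise_process M \<Xi>"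
  obtains m where "m > 0" "\<And>t. t \<in> {0..1} \<Longrightarrow> prob {\<omega> \<in> space M. \<bar>\<Xi> t \<omega>\<bar> \<le> m} \<ge> 1 / 2"
proof -
  have cont: "AE \<omega> in M. continuous_on UNIV (\<lambda>x. \<Xi> x \<omega>)" using N by (auto simp: noise_process_def)
  define A where "A n = {\<omega> \<in> space M. \<forall>q::rat. of_rat q \<in> {0..1::real} \<longrightarrow> \<bar>\<Xi> (of_rat q) \<omega>\<bar> \<le> real n}" for n :: nat
  have meas: "{\<omega> \<in> space M. \<bar>\<Xi> t \<omega>\<bar> \<le> c} \<in> sets M" for t c
    using noise_process_increment(1)[OF N, of t] by measurable
  have Am: "A n \<in> sets M" for n
    unfolding A_def
  proof (rule sets.sets_Collect_countable_All)
    fix q :: rat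
    show "{\<omega> \<in> space M. of_rat q \<in> {0..1::real} \<longrightarrow> \<bar>\<Xi> (of_rat q) \<omega>\<bar> \<le> real n} \<in> sets M"
      using meas[of "of_rat q" "real n"] by (cases "of_rat q \<in> {0..1::real}") simp_all
  qed
  have "(\<lambda>n. prob (A n)) \<longlonglongrightarrow> prob (\<Union>n. A n)"
    by (rule finite_Lim_measure_incseq) (use Am in \<open>auto simp: incseq_def A_def intro: order_trans\<close>)
  moreover have "prob (\<Union>n. A n) = 1"
  proof (subst prob_eq_1)
    show "AE \<omega> in M. \<omega> \<in> (\<Union>n. A n)"
      using cont AE_space
    proof eventually_elim
      case (elim \<omega>)
      have "compact ((\<lambda>x. \<Xi> x \<omega>) ` {0..1})"
        by (intro compact_continuous_image continuous_on_subset[OF elim(1)]) auto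
      then have "bounded ((\<lambda>x. \<Xi> x \<omega>) ` {0..1})" by (rule compact_imp_bounded)
      then obtain B where "\<forall>y\<in>(\<lambda>x. \<Xi> x \<omega>) ` {0..1}. norm y \<le> B" unfolding bounded_iff by blast
      then have B: "\<bar>\<Xi> t \<omega>\<bar> \<le> B" if "t \<in> {0..1}" for t using that by auto
      obtain n :: nat where n: "B \<le> real n" using real_arch_simple by blast
      have "\<bar>\<Xi> (of_rat q) \<omega>\<bar> \<le> real n" if "of_rat q \<in> {0..1::real}" for q
        using order_trans[OF B[OF that] n] .
      then have "\<omega> \<in> A n" using elim(2) unfolding A_def by blast
      then show ?case by blast
    qed
  qed (use Am in auto)
  ultimately have "(\<lambda>n. prob (A n)) \<longlonglongrightarrow> 1" by simp
  then have "\<forall>\<^sub>F n in sequentially. 1 / 2 < prob (A n)" by (rule order_tendstoD) simp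
  then obtain n where n: "1 / 2 < prob (A n)" by (auto simp: eventually_sequentially)
  show thesis
  \<comment> \<open>The added 1 makes the level positive also when \<open>n = 0\<close>.\<close>
  proof (rule that[of "real n + 1"])
    fix t :: real assume t: "t \<in> {0..1}"
    have "prob (A n) \<le> prob {\<omega> \<in> space M. \<bar>\<Xi> t \<omega>\<bar> \<le> real n + 1}"
    proof (rule finite_measure_mono_AE[OF _ meas])
      show "AE \<omega> in M. \<omega> \<in> A n \<longrightarrow> \<omega> \<in> {\<omega> \<in> space M. \<bar>\<Xi> t \<omega>\<bar> \<le> real n + 1}"
        using cont
      proof (rule AE_mp, intro AE_I2 impI)
        fix \<omega> assume elim: "continuous_on UNIV (\<lambda>x. \<Xi> x \<omega>)" "\<omega> \<in> A n"
        let ?t = "\<lambda>k. real_of_int \<lfloor>t * real (Suc k)\<rfloor> / real (Suc k)"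
        have "?t k \<in> {0..1} \<inter> \<rat>" for k
        proof -
          have "real_of_int \<lfloor>t * real (Suc k)\<rfloor> \<le> t * real (Suc k)" by (rule of_int_floor_le)
          also have "\<dots> \<le> 1 * real (Suc k)" using t by (intro mult_right_mono) auto
          finally have "?t k \<le> 1" by (simp add: divide_le_eq_1 del: of_nat_Suc)
          moreover have "0 \<le> ?t k" using t by (intro divide_nonneg_nonneg) (auto simp del: of_nat_Suc)
          ultimately show ?thesis by (simp del: of_nat_Suc)
        qed
        then have "\<bar>\<Xi> (?t k) \<omega>\<bar> \<le> real n" for k
          using elim(2) unfolding A_def by (metis (mono_tags, lifting) IntE Rats_cases mem_Collect_eq)
        moreover have "(\<lambda>k. \<bar>\<Xi> (?t k) \<omega>\<bar>) \<longlonglongrightarrow> \<bar>\<Xi> t \<omega>\<bar>"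
          using elim(1) by (intro tendsto_rabs isCont_tendsto_compose[OF _ floor_approx_tendsto])
            (simp add: continuous_on_eq_continuous_at)
        ultimately have "\<bar>\<Xi> t \<omega>\<bar> \<le> real n" by (intro LIMSEQ_le_const2) auto
        then show "\<omega> \<in> {\<omega> \<in> space M. \<bar>\<Xi> t \<omega>\<bar> \<le> real n + 1}" using elim(2) by (auto simp: A_def)
      qed
    qed
    then show "prob {\<omega> \<in> space M. \<bar>\<Xi> t \<omega>\<bar> \<le> real n + 1} \<ge> 1 / 2" using n by simp
  qed simp
qed

text \<open>Stationarity moves the increment to the starting time 0, where the noise vanishes. Only
  the laws of the noise at times in the unit interval remain, so one \<open>a\<close> serves every
  \<open>x\<close>.\<close>

lemma noise_process_exp_moment:
  assumes N: "noise_process M \<Xi>"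
  obtains a where "a > 0"
    "\<And>x t. t \<in> {0..1} \<Longrightarrow> (\<integral>\<^sup>+\<omega>. ennreal (exp (a * (\<Xi> (x + t) \<omega> - \<Xi> x \<omega>)\<^sup>2)) \<partial>M) \<le> 2"
proof -
  obtain m where m: "m > 0" "\<And>t. t \<in> {0..1} \<Longrightarrow> prob {\<omega> \<in> space M. \<bar>\<Xi> t \<omega>\<bar> \<le> m} \<ge> 1 / 2"
    using noise_process_bounded[OF N] by blast
  have zero: "AE \<omega> in M. \<Xi> 0 \<omega> = 0" using N by (auto simp: noise_process_def)
  note [measurable] = noise_process_increment(1)[OF N]
  show thesis
  proof (rule that[of "1 / (64 * m\<^sup>2)"])
    show "1 / (64 * m\<^sup>2) > 0" using m by simp
    fix x t :: real assume t: "t \<in> {0..1}"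
    let ?g = "\<lambda>u. ennreal (exp (1 / (64 * m\<^sup>2) * u\<^sup>2))"
    have "(\<integral>\<^sup>+\<omega>. ?g (\<Xi> (x + t) \<omega> - \<Xi> x \<omega>) \<partial>M) = (\<integral>\<^sup>+u. ?g u \<partial>distr M borel (\<lambda>\<omega>. \<Xi> (t + x) \<omega> - \<Xi> (0 + x) \<omega>))"
      by (subst nn_integral_distr) (auto simp: add.commute)
    also have "\<dots> = (\<integral>\<^sup>+u. ?g u \<partial>distr M borel (\<lambda>\<omega>. \<Xi> t \<omega> - \<Xi> 0 \<omega>))"
      unfolding noise_process_increment(3)[OF N] ..
    also have "\<dots> = (\<integral>\<^sup>+\<omega>. ?g (\<Xi> t \<omega> - \<Xi> 0 \<omega>) \<partial>M)" by (subst nn_integral_distr) auto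
    also have "\<dots> = (\<integral>\<^sup>+\<omega>. ?g (\<Xi> t \<omega>) \<partial>M)"
    proof (rule nn_integral_cong_AE)
      show "AE \<omega> in M. ?g (\<Xi> t \<omega> - \<Xi> 0 \<omega>) = ?g (\<Xi> t \<omega>)" using zero by eventually_elim simp
    qed
    also have "\<dots> \<le> 2" by (rule gaussian_exp_moment[OF noise_process_increment(2)[OF N] m(1) m(2)[OF t]])
    finally show "(\<integral>\<^sup>+\<omega>. ?g (\<Xi> (x + t) \<omega> - \<Xi> x \<omega>) \<partial>M) \<le> 2" .
  qed
qed

text \<open>Evaluation at the next mesh point to the left involves countably many times and is
  jointly measurable; by continuity of the paths these step processes converge. Tonelli's theorem
  relies on this joint measurability.\<close>

lemma continuous_process_measurable:
  fixes X :: "real \<Rightarrow> 'a \<Rightarrow> real"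
  assumes X: "\<And>x. X x \<in> borel_measurable M" and c: "\<And>\<omega>. continuous_on UNIV (\<lambda>x. X x \<omega>)"
  shows "(\<lambda>(x, \<omega>). X x \<omega>) \<in> borel_measurable (borel \<Otimes>\<^sub>M M)"
proof (rule borel_measurable_LIMSEQ_real)
  fix n
  have "(\<lambda>p. X (real_of_int \<lfloor>fst p * real (Suc n)\<rfloor> / real (Suc n)) (snd p)) \<in> borel_measurable (borel \<Otimes>\<^sub>M M)"
    by (rule measurable_compose_countable[where f = "\<lambda>i p. X (real_of_int i / real (Suc n)) (snd p)"])
      (auto intro!: measurable_compose[OF measurable_snd X])
  then show "(\<lambda>(x, \<omega>). X (real_of_int \<lfloor>x * real (Suc n)\<rfloor> / real (Suc n)) \<omega>) \<in> borel_measurable (borel \<Otimes>\<^sub>M M)"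
    by (simp add: case_prod_beta')
next
  fix p :: "real \<times> 'a"
  show "(\<lambda>n. case p of (x, \<omega>) \<Rightarrow> X (real_of_int \<lfloor>x * real (Suc n)\<rfloor> / real (Suc n)) \<omega>) \<longlonglongrightarrow> (case p of (x, \<omega>) \<Rightarrow> X x \<omega>)"
    using c by (cases p) (auto intro!: isCont_tendsto_compose[OF _ floor_approx_tendsto] simp: continuous_on_eq_continuous_at simp del: of_nat_Suc)
qed

text \<open>Tonelli's theorem turns moments of single increments into almost sure integrability
  along the path. The deviation of the path from its average over the following unit interval is an
  average of increments, so Jensen's inequality reduces it to the moments with \<open>t\<close> in
  the unit interval.\<close>

theorem noise_process_paths:
  assumes N: "noise_process M \<Xi>"
  obtains a where "a > 0" "AE \<omega> in M. continuous_on UNIV (\<lambda>x. \<Xi> x \<omega>) \<and>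
    (\<integral>\<^sup>+x. ennreal (exp (a * (\<Xi> (x + 1) \<omega> - \<Xi> x \<omega>)\<^sup>2) / (1 + x\<^sup>2)) \<partial>lborel) < \<infinity> \<and>
    (\<forall>W. (\<forall>x. (W has_real_derivative \<Xi> x \<omega>) (at x)) \<longrightarrow>
      (\<integral>\<^sup>+x. ennreal (exp (a * (\<Xi> x \<omega> - (W (x + 1) - W x))\<^sup>2) / (1 + x\<^sup>2)) \<partial>lborel) < \<infinity>)"
proof -
  obtain a where a: "a > 0"
    "\<And>x t. t \<in> {0..1} \<Longrightarrow> (\<integral>\<^sup>+\<omega>. ennreal (exp (a * (\<Xi> (x + t) \<omega> - \<Xi> x \<omega>)\<^sup>2)) \<partial>M) \<le> 2"
    using noise_process_exp_moment[OF N] by blast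
  have "AE \<omega> in M. continuous_on UNIV (\<lambda>x. \<Xi> x \<omega>)" using N by (auto simp: noise_process_def)
  then obtain Z where Z: "{\<omega> \<in> space M. \<not> continuous_on UNIV (\<lambda>x. \<Xi> x \<omega>)} \<subseteq> Z" "emeasure M Z = 0" "Z \<in> sets M"
    by (rule AE_E)
  \<comment> \<open>A version with all paths continuous, as
    \<open>continuous_process_measurable\<close> requires; it agrees with the noise off the null set
    \<open>Z\<close>.\<close>
  define X where "X x \<omega> = (if \<omega> \<in> space M - Z then \<Xi> x \<omega> else 0)" for x \<omega>
  have Xm: "X x \<in> borel_measurable M" for x
    unfolding X_def using noise_process_increment(1)[OF N] Z(3) by (intro measurable_If_set) auto
  have Xc: "continuous_on UNIV (\<lambda>x. X x \<omega>)" for \<omega>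
    using Z(1) by (cases "\<omega> \<in> space M - Z") (auto simp: X_def)
  have good: "AE \<omega> in M. \<omega> \<in> space M - Z"
    using AE_not_in[of Z M] Z(2,3) AE_space by (auto simp: null_sets_def)
  note XM [measurable] = continuous_process_measurable[OF Xm Xc]
  have moment: "(\<integral>\<^sup>+\<omega>. ennreal (exp (a * (X (x + t) \<omega> - X x \<omega>)\<^sup>2)) \<partial>M) \<le> 2" if t: "t \<in> {0..1}" for x t
  proof -
    have "(\<integral>\<^sup>+\<omega>. ennreal (exp (a * (X (x + t) \<omega> - X x \<omega>)\<^sup>2)) \<partial>M)
        = (\<integral>\<^sup>+\<omega>. ennreal (exp (a * (\<Xi> (x + t) \<omega> - \<Xi> x \<omega>)\<^sup>2)) \<partial>M)"
    proof (rule nn_integral_cong_AE)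
      show "AE \<omega> in M. ennreal (exp (a * (X (x + t) \<omega> - X x \<omega>)\<^sup>2)) = ennreal (exp (a * (\<Xi> (x + t) \<omega> - \<Xi> x \<omega>)\<^sup>2))"
        using good by eventually_elim (simp add: X_def)
    qed
    then show ?thesis using a(2)[OF t, of x] by simp
  qed
  \<comment> \<open>\<open>F\<close> treats the increment over distance 1, and \<open>G\<close>,
    averaged over all distances up to 1, dominates the exponential of the squared deviation from the
    average.\<close>
  define F where "F x \<omega> = ennreal (exp (a * (X (x + 1) \<omega> - X x \<omega>)\<^sup>2))" for x \<omega>
  define G where "G x \<omega> = (\<integral>\<^sup>+t\<in>{0..1}. ennreal (exp (a * (X (x + t) \<omega> - X x \<omega>)\<^sup>2)) \<partial>lborel)" for x \<omega>
  have Xt: "(\<lambda>q. X (fst q + t) (snd q)) \<in> borel_measurable (borel \<Otimes>\<^sub>M M)" for t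
    using measurable_compose[OF _ XM, of "\<lambda>q. (fst q + t, snd q)"] by simp
  have Xt2: "(\<lambda>q. X (fst (fst q) + snd q) (snd (fst q))) \<in> borel_measurable ((borel \<Otimes>\<^sub>M M) \<Otimes>\<^sub>M borel)"
    "(\<lambda>q. X (fst (fst q)) (snd (fst q))) \<in> borel_measurable ((borel \<Otimes>\<^sub>M M) \<Otimes>\<^sub>M borel)"
    using measurable_compose[OF _ XM, of "\<lambda>q. (fst (fst q) + snd q, snd (fst q))" "(borel \<Otimes>\<^sub>M M) \<Otimes>\<^sub>M borel"]
      measurable_compose[OF _ XM, of "\<lambda>q. (fst (fst q), snd (fst q))" "(borel \<Otimes>\<^sub>M M) \<Otimes>\<^sub>M borel"] by simp_all
  have FM: "case_prod F \<in> borel_measurable (lborel \<Otimes>\<^sub>M M)"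
    unfolding F_def case_prod_beta' using Xt[of 1] Xt[of 0] by simp
  have FM2: "(\<integral>\<^sup>+\<omega>. F x \<omega> \<partial>M) \<le> 2" for x unfolding F_def using moment[of 1] by simp
  have GM': "(\<lambda>q. ennreal (exp (a * (X (fst (fst q) + snd q) (snd (fst q)) - X (fst (fst q)) (snd (fst q)))\<^sup>2)) * indicator {0..1} (snd q))
      \<in> borel_measurable ((borel \<Otimes>\<^sub>M M) \<Otimes>\<^sub>M lborel)"
    using Xt2 by measurable
  have GM: "case_prod G \<in> borel_measurable (lborel \<Otimes>\<^sub>M M)"
    using sigma_finite_measure.borel_measurable_nn_integral_fst[OF sigma_finite_lborel GM'] by (simp add: G_def case_prod_beta')
  have GM2: "(\<integral>\<^sup>+\<omega>. G x \<omega> \<partial>M) \<le> 2" for x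
  proof -
    interpret pair_sigma_finite lborel M ..
    have m: "(\<lambda>(t, \<omega>). ennreal (exp (a * (X (x + t) \<omega> - X x \<omega>)\<^sup>2)) * indicator {0..1} t) \<in> borel_measurable (lborel \<Otimes>\<^sub>M M)"
    proof -
      have "(\<lambda>q. X (x + fst q) (snd q)) \<in> borel_measurable (borel \<Otimes>\<^sub>M M)" using Xt by (simp add: add.commute)
      moreover have "(\<lambda>q. X x (snd q)) \<in> borel_measurable (borel \<Otimes>\<^sub>M M)" using Xm by (rule measurable_compose[OF measurable_snd])
      ultimately show ?thesis unfolding case_prod_beta' by measurable
    qed
    have "(\<integral>\<^sup>+\<omega>. G x \<omega> \<partial>M) = (\<integral>\<^sup>+t. (\<integral>\<^sup>+\<omega>. ennreal (exp (a * (X (x + t) \<omega> - X x \<omega>)\<^sup>2)) * indicator {0..1} t \<partial>M) \<partial>lborel)"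
      using Fubini'[OF m] by (simp add: G_def)
    also have "\<dots> \<le> (\<integral>\<^sup>+t. 2 * indicator {0..1::real} t \<partial>lborel)"
    proof (rule nn_integral_mono)
      fix t :: real
      show "(\<integral>\<^sup>+\<omega>. ennreal (exp (a * (X (x + t) \<omega> - X x \<omega>)\<^sup>2)) * indicator {0..1} t \<partial>M) \<le> 2 * indicator {0..1} t"
        using moment[of t x] by (cases "t \<in> {0..1}") auto
    qed
    also have "\<dots> = 2" by (simp add: nn_integral_cmult_indicator)
    finally show ?thesis .
  qed
  show thesis
  proof (rule that[OF a(1)])
    show "AE \<omega> in M. continuous_on UNIV (\<lambda>x. \<Xi> x \<omega>) \<and>
      (\<integral>\<^sup>+x. ennreal (exp (a * (\<Xi> (x + 1) \<omega> - \<Xi> x \<omega>)\<^sup>2) / (1 + x\<^sup>2)) \<partial>lborel) < \<infinity> \<and>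
      (\<forall>W. (\<forall>x. (W has_real_derivative \<Xi> x \<omega>) (at x)) \<longrightarrow>
        (\<integral>\<^sup>+x. ennreal (exp (a * (\<Xi> x \<omega> - (W (x + 1) - W x))\<^sup>2) / (1 + x\<^sup>2)) \<partial>lborel) < \<infinity>)"
      using good weighted_integral_finite[OF FM FM2] weighted_integral_finite[OF GM GM2]
    proof eventually_elim
      case (elim \<omega>)
      have eq: "\<Xi> x \<omega> = X x \<omega>" for x using elim(1) by (simp add: X_def)
      have 1: "(\<integral>\<^sup>+x. ennreal (exp (a * (X (x + 1) \<omega> - X x \<omega>)\<^sup>2) / (1 + x\<^sup>2)) \<partial>lborel) < \<infinity>"
        using elim(2) unfolding F_def by (simp add: ennreal_mult'[symmetric])
      have 2: "(\<integral>\<^sup>+x. ennreal (exp (a * (X x \<omega> - (W (x + 1) - W x))\<^sup>2) / (1 + x\<^sup>2)) \<partial>lborel) < \<infinity>"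
        if W: "\<And>x. (W has_real_derivative X x \<omega>) (at x)" for W
      proof -
        have "ennreal (exp (a * (X x \<omega> - (W (x + 1) - W x))\<^sup>2) / (1 + x\<^sup>2)) \<le> ennreal (1 / (1 + x\<^sup>2)) * G x \<omega>" for x
        proof -
          define u where "u t = X (x + t) \<omega> - X x \<omega>" for t
          have uc: "continuous_on UNIV u" unfolding u_def
            by (intro continuous_on_diff continuous_on_const continuous_on_compose2[OF Xc]) (auto intro!: continuous_intros)
          have "((\<lambda>t. W (x + t) - t * X x \<omega>) has_real_derivative u t) (at t)" for t
          proof -
            have "((\<lambda>t. W (t + x)) has_real_derivative X (t + x) \<omega>) (at t)"
              using W[of "t + x"] by (simp add: DERIV_shift)
            then have "((\<lambda>t. W (x + t)) has_real_derivative X (x + t) \<omega>) (at t)" by (simp add: add.commute)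
            then show ?thesis unfolding u_def by (auto intro!: derivative_eq_intros)
          qed
          then have "(LINT t|lborel. indicator {0..1} t *\<^sub>R u t) = (W (x + 1) - 1 * X x \<omega>) - (W (x + 0) - 0 * X x \<omega>)"
            by (intro integral_FTC_Icc continuous_on_subset[OF uc])
              (auto simp: has_real_derivative_iff_has_vector_derivative[symmetric] intro: has_field_derivative_at_within)
          then have "(LINT t:{0..1}|lborel. u t) = - (X x \<omega> - (W (x + 1) - W x))"
            unfolding set_lebesgue_integral_def by simp
          then have "(LINT t:{0..1}|lborel. u t)\<^sup>2 = (X x \<omega> - (W (x + 1) - W x))\<^sup>2" by (simp only: power2_minus)
          then have "ennreal (exp (a * (X x \<omega> - (W (x + 1) - W x))\<^sup>2)) \<le> G x \<omega>"
            using Jensen_exp_square[OF uc a(1)] unfolding G_def u_def by simp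
          then have "ennreal (1 / (1 + x\<^sup>2)) * ennreal (exp (a * (X x \<omega> - (W (x + 1) - W x))\<^sup>2)) \<le> ennreal (1 / (1 + x\<^sup>2)) * G x \<omega>"
            by (intro mult_left_mono) auto
          then show ?thesis by (simp add: ennreal_mult'[symmetric])
        qed
        then have "(\<integral>\<^sup>+x. ennreal (exp (a * (X x \<omega> - (W (x + 1) - W x))\<^sup>2) / (1 + x\<^sup>2)) \<partial>lborel)
            \<le> (\<integral>\<^sup>+x. ennreal (1 / (1 + x\<^sup>2)) * G x \<omega> \<partial>lborel)"
          by (intro nn_integral_mono)
        also note elim(3)
        finally show ?thesis .
      qed
      show ?case unfolding eq by (intro conjI allI impI Xc 1 2) blast
    qed
  qed
qed

end

section \<open>The almost sure statement\<close>

lemma continuous_antiderivative: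
  fixes w :: "real \<Rightarrow> real"
  assumes "continuous_on UNIV w"
  obtains W where "\<And>x. (W has_real_derivative w x) (at x)"
proof -
  have "\<exists>F. \<forall>x::real. -\<infinity> < ereal x \<longrightarrow> ereal x < \<infinity> \<longrightarrow> (F has_vector_derivative w x) (at x)"
    by (rule einterval_antiderivative) (use assms in \<open>auto simp: continuous_on_eq_continuous_at\<close>)
  then show thesis using that by (auto simp: has_real_derivative_iff_has_vector_derivative)
qed

theorem proposition2p10:
  fixes M :: "'w measure" and \<Xi> :: "real \<Rightarrow> 'w \<Rightarrow> real"
    and s :: setting and V :: "real \<Rightarrow> real"
  assumes "prob_space M"
    and "valid_setting s"
    and "admissible_potential (interval s) V"
    and "noise_process M \<Xi>"
  shows "AE \<omega> in M. \<exists>!H :: (L2 \<times> L2) set.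
           self_adjoint_in (L2_on (interval s)) H \<and>
           Domain H \<subseteq> L2_class (interval s) ` form_domain s V \<and>
           represents_form s V (\<lambda>x. \<Xi> x \<omega>) H \<and>
           compact_resolvent_in (L2_on (interval s)) H"
proof -
  interpret prob_space M by (rule assms(1))
  interpret potential_setting s V using assms(2,3) by unfold_locales
  obtain a where a: "a > 0" and ae: "AE \<omega> in M. continuous_on UNIV (\<lambda>x. \<Xi> x \<omega>) \<and>
    (\<integral>\<^sup>+x. ennreal (exp (a * (\<Xi> (x + 1) \<omega> - \<Xi> x \<omega>)\<^sup>2) / (1 + x\<^sup>2)) \<partial>lborel) < \<infinity> \<and>
    (\<forall>W. (\<forall>x. (W has_real_derivative \<Xi> x \<omega>) (at x)) \<longrightarrow>
      (\<integral>\<^sup>+x. ennreal (exp (a * (\<Xi> x \<omega> - (W (x + 1) - W x))\<^sup>2) / (1 + x\<^sup>2)) \<partial>lborel) < \<infinity>)"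
    by (rule noise_process_paths[OF assms(4)])
  show ?thesis
    using ae
  proof eventually_elim
    case (elim \<omega>)
    then have w: "continuous_on UNIV (\<lambda>x. \<Xi> x \<omega>)" by blast
    \<comment> \<open>The antiderivative is chosen only after the path; the almost sure bound above
      covers all antiderivatives at once.\<close>
    obtain W where W: "\<And>x. (W has_real_derivative \<Xi> x \<omega>) (at x)" using continuous_antiderivative[OF w] by blast
    have fin: "(\<integral>\<^sup>+x. ennreal (exp (a * (\<Xi> x \<omega> - (W (x + 1) - W x))\<^sup>2) / (1 + x\<^sup>2)) \<partial>lborel) < \<infinity>"
      "(\<integral>\<^sup>+x. ennreal (exp (a * (\<Xi> (x + 1) \<omega> - \<Xi> x \<omega>)\<^sup>2) / (1 + x\<^sup>2)) \<partial>lborel) < \<infinity>"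
      using elim W by blast+
    have "\<exists>k l. good_path s V (\<lambda>x. \<Xi> x \<omega>) k l"
      using assms(2)
    proof (cases rule: interval_cases)
      case 1
      then have "I = UNIV \<or> I = {0<..}" by simp
      from good_path_unbounded[OF w this W a fin] show ?thesis by blast
    next
      case 2
      then have "I = UNIV \<or> I = {0<..}" by simp
      from good_path_unbounded[OF w this W a fin] show ?thesis by blast
    next
      case (3 b)
      from good_path_bounded[OF w 3(2)] show ?thesis by blast
    qed
    then obtain k l where "good_path s V (\<lambda>x. \<Xi> x \<omega>) k l" by blast
    then show ?case by (rule good_path.ex1_operator)
  qed
qed

end
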